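(* For every slant angle $0^\circ\le\sigma<10^\circ$, the shape $\mathcal{H}(\sigma)$ is a covering for sets of unit diameter; that is, every point set of diameter $1$ in the Euclidean plane is congruent to a subset of $\mathcal{H}(\sigma)$.
   Context: Conventions. The diameter of a bounded point set is the supremum of the distances between pairs of its points. Congruent means isometric (translations, rotations and reflections allowed). A covering for a collection of point sets is a set containing a subset congruent to each point set in the collection. The shape $\mathcal{P}(\sigma)$. Let $\mathrm{Hex}$ be the closed regular hexagon with centre $O$ and unit distance between opposite sides, with corners $A,B,C,D,E,F$ in clockwise order (also written $A_1,\dots,F_1$). Let $0\le\sigma<30^\circ$. For each corner $V$ let $n_V$ be the unit vector in direction $\overrightarrow{OV}$ rotated counterclockwise by $\sigma$. The line $\{x:(x-O)\cdot n_V=1/2\}$ (the six such lines contain the sides of the hexagon rotated counterclockwise by $30^\circ+\sigma$ about $O$) cuts off from $\mathrm{Hex}$ the closed triangular corner region $V=\{x\in\mathrm{Hex}:(x-O)\cdot n_V\ge 1/2\}$ with vertices $V_1,V_2,V_3$, where $V_3$ lies on the side joining $V_1$ to the corner preceding it in clockwise order and $V_2$ lies on the side joining $V_1$ to the following corner (e.g. $C_3\in BC$, $C_2\in CD$). The slanted Pál covering is $\mathcal{P}(\sigma)=\{x\in\mathrm{Hex}:(x-O)\cdot n_C\le 1/2,\ (x-O)\cdot n_E\le 1/2\}$, i.e. the hexagon with the corner regions $C$ and $E$ cut off (boundary kept). The shape $\mathcal{S}(\sigma)$. The arc of radius one centred on $F_3$ touches segment $C_3C_2$ at $K$ and cuts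 segment $D_3C_2$ at $G$; $C_S$ is the closed region bounded by the arc $KG$ and the segments $GC_2$, $C_2K$. The arc of radius one centred on $B_3$ touches segment $E_3E_2$ at $I$; the arc of radius one centred on $C_3$ touches segment $E_2F_3$ at $H$; these arcs intersect (near $E_2$) at $J$; $E_S$ is the closed region $IJHE_2$ bounded by the arcs $IJ$, $JH$ and the segments $HE_2$, $E_2I$. The arc of radius one centred on $G$ touches $F_1A_1$ at $P$; the arc of radius one centred on $E_3$ touches $A_1B_1$ at $Q$; these arcs intersect (near $A$) at $X$; $A_S$ is the closed region $QXPA_1$ bounded by the arcs $QX$, $XP$ and the segments $PA_1$, $A_1Q$. Then $\mathcal{S}(\sigma)$ is the closure of $\mathcal{P}(\sigma)\setminus(C_S\cup E_S\cup A_S)$. The region $A_H$. Let $\theta\ge 0$ be the angle that the unit segment $F_3G$ makes with side $ED$. For $-\theta\le s\le\theta$ let $L(s)$ be the point on side $DC$ that is an endpoint of a unit-length segment whose other endpoint is on side $EF$ and which makes signed angle $s$ with side $ED$, the sign being such that $L(-\theta)=G$ (so $s<0$ when the endpoint on $DC$ is farther from line $ED$ than the endpoint on $EF$). Let $M$ be the midpoint of $DE$; for $-\tau\le t\le\tau$ let $N(t)$ be the point of $DE$ at signed distance $t$ from $M$, positive towards $E$, where $\tau$ is such that $N(\tau)=E_3$. Let $X(s,t)$ be the intersection point near $A$ of the circles of radius one centred on $L(s)$ and $N(t)$, and $\mathcal{R}=\{X(s,t):-\theta\le s\le\theta,\ -\tau\le t\le\tau\}$; one has $X(-\theta,-\tau)=P$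 and $X(-\theta,\tau)=X$. Take the shortest continuous path from $X(\theta,\tau)$ to $X(0,0)$ staying within $\mathcal{R}$, and join to it the curve from $X(0,0)$ to $P=X(-\theta,-\tau)$ formed by the image points $X(-s,-t)$ of the points $X(s,t)$ of the path. $A_H\subset\mathcal{R}$ is the closed region bounded by this combined curve from $X(\theta,\tau)$ to $P$, the arc from $P$ to $X$ (centred on $G$) and the arc from $X$ to $X(\theta,\tau)$ (centred on $E_3$). The region $E_H$ ($\sigma<10^\circ$). Let $R$ be the intersection of segment $F_2F_3$ with line $F_1C_1$. The circle of radius one centred on $R$ cuts the edge $CB$ at a point $S$ (lying outside the corner region $C$). The arc of radius one centred on $S$ intersects the arc $JI$ at a point $T$. The line $\{x:(x-O)\cdot\overrightarrow{OE}/|OE|=1/2\}$ (the line that would cut off corner $E$ at slant angle zero, an edge line of a regular dodecagon) cuts the arc $HJ$ at a point $U$. Consider the convex hull of the point $U$ together with the arc of the unit circle centred on $S$ that runs from $T$ towards side $EF$ (ending where it touches $EF$); let the curve $TU$ be the part of the boundary of this convex hull from $T$ to $U$ facing $J$ (it follows the arc from $T$, possibly trivially, and then a straight segment to $U$). $E_H$ is the closed region $TUJ$ bounded by the curve $TU$ and the arcs $UJ$ and $JT$. If the arc centred on $S$ does not meet the arc $JI$ (which happens only for degenerate, very small $\sigma$), $E_H$ is taken to be empty. The shape $\mathcal{H}(\sigma)$. For $\sigma<10^\circ$, $\mathcal{H}(\sigma)$ is $\mathcal{S}(\sigma)$ with $A_H$ and $E_H$ removed, i.e. the closure of $\mathcal{S}(\sigma)\setminus(A_H\cup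 E_H)$. *)

theory Defs
  imports "HOL-Analysis.Analysis"
begin

text \<open>The Euclidean plane is the type \<^typ>\<open>complex\<close>, with \<open>x \<bullet> y\<close> its real inner product;
  multiplication by \<open>cis \<phi>\<close> is the counterclockwise rotation by \<open>\<phi>\<close>. Angles are in radians.\<close>

subsection \<open>Coverings\<close>

definition congruent_sets :: "complex set \<Rightarrow> complex set \<Rightarrow> bool" where
  "congruent_sets S T \<longleftrightarrow>
     (\<exists>f :: complex \<Rightarrow> complex. (\<forall>x y. dist (f x) (f y) = dist x y) \<and> f ` S = T)"

definition is_covering :: "complex set \<Rightarrow> complex set set \<Rightarrow> bool" where
  "is_covering K \<C> \<longleftrightarrow> (\<forall>S\<in>\<C>. \<exists>T. T \<subseteq> K \<and> congruent_sets S T)"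

text \<open>Boundedness is explicit because \<^const>\<open>diameter\<close> has no meaningful value on unbounded sets.\<close>

definition unit_diameter_sets :: "complex set set" where
  "unit_diameter_sets = {S. bounded S \<and> diameter S = 1}"

subsection \<open>Arcs, bounded regions, shortest paths\<close>

text \<open>The minor arc from \<open>p\<close> to \<open>q\<close> of the unit circle centred on \<open>c\<close> (for \<open>p\<close>, \<open>q\<close> on that
  circle): the part of the circle in the cone with apex \<open>c\<close> spanned by \<open>p\<close> and \<open>q\<close>.\<close>

definition unit_arc :: "complex \<Rightarrow> complex \<Rightarrow> complex \<Rightarrow> complex set" where
  "unit_arc c p q =
     {x. dist c x = 1 \<and> (\<exists>a\<ge>0. \<exists>b\<ge>0. x - c = a *\<^sub>R (p - c) + b *\<^sub>R (q - c))}"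

text \<open>Where the unit circle centred on \<open>c\<close> touches or cuts the segment from \<open>a\<close> to \<open>b\<close>; used
  only where there is exactly one such point.\<close>

definition arc_meets :: "complex \<Rightarrow> complex \<Rightarrow> complex \<Rightarrow> complex" where
  "arc_meets c a b = (THE x. x \<in> closed_segment a b \<and> dist c x = 1)"

text \<open>The intersection point near \<open>v\<close> of the unit circles centred on \<open>c\<close> and \<open>d\<close>: of the (at
  most two) intersection points, the one closest to \<open>v\<close>.\<close>

definition arcs_meet_near :: "complex \<Rightarrow> complex \<Rightarrow> complex \<Rightarrow> complex" where
  "arcs_meet_near v c d =
     (THE x. dist c x = 1 \<and> dist d x = 1 \<and>
        (\<forall>y. dist c y = 1 \<and> dist d y = 1 \<longrightarrow> dist v x \<le> dist v y))"

text \<open>The closed region bounded by a closed curve, given by its point set \<open>\<Gamma>\<close>. For a curve that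
  degenerates to an arc or a point, this is that arc or point.\<close>

definition bounded_region :: "complex set \<Rightarrow> complex set" where
  "bounded_region \<Gamma> = \<Gamma> \<union> inside \<Gamma>"

definition curve_length :: "(real \<Rightarrow> complex) \<Rightarrow> ennreal" where
  "curve_length g =
     (SUP ts \<in> {ts. sorted ts \<and> set ts \<subseteq> {0..1}}.
        ennreal (\<Sum>i<length ts - 1. dist (g (ts ! i)) (g (ts ! Suc i))))"

definition path_within :: "complex set \<Rightarrow> complex \<Rightarrow> complex \<Rightarrow> (real \<Rightarrow> complex) \<Rightarrow> bool" where
  "path_within T a b g \<longleftrightarrow>
     path g \<and> path_image g \<subseteq> T \<and> pathstart g = a \<and> pathfinish g = b"

definition shortest_path :: "complex set \<Rightarrow> complex \<Rightarrow> complex \<Rightarrow> (real \<Rightarrow> complex) \<Rightarrow> bool" where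
  "shortest_path T a b g \<longleftrightarrow>
     path_within T a b g \<and> (\<forall>h. path_within T a b h \<longrightarrow> curve_length g \<le> curve_length h)"

subsection \<open>The hexagon and the slanted Pal covering\<close>

text \<open>The centre is \<open>0\<close>; the corners \<open>A, B, C, D, E, F\<close>, in clockwise order, have the indices
  \<open>0, \<dots>, 5\<close> (read modulo \<open>6\<close>). Opposite sides have distance \<open>1\<close>, so the circumradius is
  \<open>1 / sqrt 3\<close>. The placement makes \<open>AB\<close> the top and \<open>ED\<close> the bottom side.\<close>

definition hex_corner :: "int \<Rightarrow> complex" where
  "hex_corner k = (1 / sqrt 3) *\<^sub>R cis (2 * pi / 3 - of_int k * (pi / 3))"

abbreviation "corner_A \<equiv> hex_corner 0"
abbreviation "corner_B \<equiv> hex_corner 1"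
abbreviation "corner_C \<equiv> hex_corner 2"
abbreviation "corner_D \<equiv> hex_corner 3"
abbreviation "corner_E \<equiv> hex_corner 4"
abbreviation "corner_F \<equiv> hex_corner 5"

definition Hex :: "complex set" where
  "Hex = convex hull (hex_corner ` {0..5})"

definition cut_normal :: "real \<Rightarrow> int \<Rightarrow> complex" where
  "cut_normal \<sigma> k = cis \<sigma> * sgn (hex_corner k)"

text \<open>The vertices \<open>V\<^sub>2\<close> (towards the next corner in clockwise order) and \<open>V\<^sub>3\<close> (towards the
  preceding one) of the corner region \<open>V\<close> with index \<open>k\<close>.\<close>

definition cut2 :: "real \<Rightarrow> int \<Rightarrow> complex" where
  "cut2 \<sigma> k = (THE x. x \<in> closed_segment (hex_corner k) (hex_corner (k + 1)) \<and>
                      x \<bullet> cut_normal \<sigma> k = 1/2)"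

definition cut3 :: "real \<Rightarrow> int \<Rightarrow> complex" where
  "cut3 \<sigma> k = (THE x. x \<in> closed_segment (hex_corner k) (hex_corner (k - 1)) \<and>
                      x \<bullet> cut_normal \<sigma> k = 1/2)"

abbreviation "pt_B3 \<sigma> \<equiv> cut3 \<sigma> 1"
abbreviation "pt_C2 \<sigma> \<equiv> cut2 \<sigma> 2"
abbreviation "pt_C3 \<sigma> \<equiv> cut3 \<sigma> 2"
abbreviation "pt_D3 \<sigma> \<equiv> cut3 \<sigma> 3"
abbreviation "pt_E2 \<sigma> \<equiv> cut2 \<sigma> 4"
abbreviation "pt_E3 \<sigma> \<equiv> cut3 \<sigma> 4"
abbreviation "pt_F2 \<sigma> \<equiv> cut2 \<sigma> 5"
abbreviation "pt_F3 \<sigma> \<equiv> cut3 \<sigma> 5"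

definition slanted_Pal :: "real \<Rightarrow> complex set" where
  "slanted_Pal \<sigma> = {x \<in> Hex. x \<bullet> cut_normal \<sigma> 2 \<le> 1/2 \<and> x \<bullet> cut_normal \<sigma> 4 \<le> 1/2}"

subsection \<open>The shape \<open>\<S>(\<sigma>)\<close>\<close>

definition pt_K :: "real \<Rightarrow> complex" where
  "pt_K \<sigma> = arc_meets (pt_F3 \<sigma>) (pt_C3 \<sigma>) (pt_C2 \<sigma>)"

definition pt_G :: "real \<Rightarrow> complex" where
  "pt_G \<sigma> = arc_meets (pt_F3 \<sigma>) (pt_D3 \<sigma>) (pt_C2 \<sigma>)"

definition region_C_S :: "real \<Rightarrow> complex set" where
  "region_C_S \<sigma> = bounded_region
     (unit_arc (pt_F3 \<sigma>) (pt_K \<sigma>) (pt_G \<sigma>) \<union>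
      closed_segment (pt_G \<sigma>) (pt_C2 \<sigma>) \<union> closed_segment (pt_C2 \<sigma>) (pt_K \<sigma>))"

definition pt_I :: "real \<Rightarrow> complex" where
  "pt_I \<sigma> = arc_meets (pt_B3 \<sigma>) (pt_E3 \<sigma>) (pt_E2 \<sigma>)"

definition pt_H :: "real \<Rightarrow> complex" where
  "pt_H \<sigma> = arc_meets (pt_C3 \<sigma>) (pt_E2 \<sigma>) (pt_F3 \<sigma>)"

definition pt_J :: "real \<Rightarrow> complex" where
  "pt_J \<sigma> = arcs_meet_near (pt_E2 \<sigma>) (pt_B3 \<sigma>) (pt_C3 \<sigma>)"

definition region_E_S :: "real \<Rightarrow> complex set" where
  "region_E_S \<sigma> = bounded_region
     (unit_arc (pt_B3 \<sigma>) (pt_I \<sigma>) (pt_J \<sigma>) \<union> unit_arc (pt_C3 \<sigma>) (pt_J \<sigma>) (pt_H \<sigma>) \<union>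
      closed_segment (pt_H \<sigma>) (pt_E2 \<sigma>) \<union> closed_segment (pt_E2 \<sigma>) (pt_I \<sigma>))"

definition pt_P :: "real \<Rightarrow> complex" where
  "pt_P \<sigma> = arc_meets (pt_G \<sigma>) corner_F corner_A"

definition pt_Q :: "real \<Rightarrow> complex" where
  "pt_Q \<sigma> = arc_meets (pt_E3 \<sigma>) corner_A corner_B"

definition pt_X :: "real \<Rightarrow> complex" where
  "pt_X \<sigma> = arcs_meet_near corner_A (pt_G \<sigma>) (pt_E3 \<sigma>)"

definition region_A_S :: "real \<Rightarrow> complex set" where
  "region_A_S \<sigma> = bounded_region
     (unit_arc (pt_E3 \<sigma>) (pt_Q \<sigma>) (pt_X \<sigma>) \<union> unit_arc (pt_G \<sigma>) (pt_X \<sigma>) (pt_P \<sigma>) \<union>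
      closed_segment (pt_P \<sigma>) corner_A \<union> closed_segment corner_A (pt_Q \<sigma>))"

definition shape_S :: "real \<Rightarrow> complex set" where
  "shape_S \<sigma> = closure (slanted_Pal \<sigma> - (region_C_S \<sigma> \<union> region_E_S \<sigma> \<union> region_A_S \<sigma>))"

subsection \<open>The region \<open>A\<^sub>H\<close>\<close>

text \<open>The point \<open>G\<close> is at least as far from line \<open>ED\<close> as \<open>F\<^sub>3\<close>, so this signed angle from the
  direction of \<open>ED\<close> to that of \<open>F\<^sub>3G\<close> is the nonnegative angle between the two segments.\<close>

definition ang_theta :: "real \<Rightarrow> real" where
  "ang_theta \<sigma> = Arg ((pt_G \<sigma> - pt_F3 \<sigma>) / (corner_D - corner_E))"

text \<open>The unit segment runs from the point \<open>p - cis (- s) * sgn (corner_D - corner_E)\<close> on \<open>EF\<close>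
  to \<open>p\<close> on \<open>DC\<close>; for \<open>s < 0\<close> it rises towards \<open>DC\<close>.\<close>

definition pt_L :: "real \<Rightarrow> complex" where
  "pt_L s = (THE p. p \<in> closed_segment corner_D corner_C \<and>
                    p - cis (- s) * sgn (corner_D - corner_E) \<in> closed_segment corner_E corner_F)"

definition pt_N :: "real \<Rightarrow> complex" where
  "pt_N t = midpoint corner_D corner_E + t *\<^sub>R sgn (corner_E - corner_D)"

definition len_tau :: "real \<Rightarrow> real" where
  "len_tau \<sigma> = (pt_E3 \<sigma> - midpoint corner_D corner_E) \<bullet> sgn (corner_E - corner_D)"

definition X_map :: "real \<Rightarrow> real \<Rightarrow> complex" where
  "X_map s t = arcs_meet_near corner_A (pt_L s) (pt_N t)"

definition param_box :: "real \<Rightarrow> (real \<times> real) set" where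
  "param_box \<sigma> = {- ang_theta \<sigma>..ang_theta \<sigma>} \<times> {- len_tau \<sigma>..len_tau \<sigma>}"

definition region_R :: "real \<Rightarrow> complex set" where
  "region_R \<sigma> = {X_map s t | s t. (s, t) \<in> param_box \<sigma>}"

definition A_path :: "real \<Rightarrow> complex set" where
  "A_path \<sigma> = path_image (SOME g.
     shortest_path (region_R \<sigma>) (X_map (ang_theta \<sigma>) (len_tau \<sigma>)) (X_map 0 0) g)"

definition A_path_mirror :: "real \<Rightarrow> complex set" where
  "A_path_mirror \<sigma> = {X_map (- s) (- t) | s t. (s, t) \<in> param_box \<sigma> \<and> X_map s t \<in> A_path \<sigma>}"

definition region_A_H :: "real \<Rightarrow> complex set" where
  "region_A_H \<sigma> = bounded_region
     (A_path \<sigma> \<union> A_path_mirror \<sigma> \<union> unit_arc (pt_G \<sigma>) (pt_P \<sigma>) (pt_X \<sigma>) \<union>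
      unit_arc (pt_E3 \<sigma>) (pt_X \<sigma>) (X_map (ang_theta \<sigma>) (len_tau \<sigma>)))"

subsection \<open>The region \<open>E\<^sub>H\<close>\<close>

definition pt_R :: "real \<Rightarrow> complex" where
  "pt_R \<sigma> = (THE x. x \<in> closed_segment (pt_F2 \<sigma>) (pt_F3 \<sigma>) \<and> x \<in> affine hull {corner_F, corner_C})"

definition pt_S :: "real \<Rightarrow> complex" where
  "pt_S \<sigma> = arc_meets (pt_R \<sigma>) corner_C corner_B"

definition pt_T :: "real \<Rightarrow> complex" where
  "pt_T \<sigma> = (THE x. x \<in> unit_arc (pt_B3 \<sigma>) (pt_J \<sigma>) (pt_I \<sigma>) \<and> dist (pt_S \<sigma>) x = 1)"

definition pt_U :: "real \<Rightarrow> complex" where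
  "pt_U \<sigma> = (THE x. x \<in> unit_arc (pt_C3 \<sigma>) (pt_H \<sigma>) (pt_J \<sigma>) \<and> x \<bullet> sgn corner_E = 1/2)"

text \<open>\<open>same_side a b p\<close> is the closed half-plane bounded by the line through \<open>a\<close> and \<open>b\<close> that
  contains \<open>p\<close>. (\<open>Im (cnj z * w)\<close> is the determinant of the pair \<open>z, w\<close>.)\<close>

definition same_side :: "complex \<Rightarrow> complex \<Rightarrow> complex \<Rightarrow> complex set" where
  "same_side a b p = {x. Im (cnj (b - a) * (x - a)) * Im (cnj (b - a) * (p - a)) \<ge> 0}"

text \<open>The points \<open>T\<close> and \<open>U\<close> split the boundary of the convex hull into two curves, on
  different sides of the line through \<open>T\<close> and \<open>U\<close>; the curve facing \<open>J\<close> is the one on the side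
  of \<open>J\<close>. It may be the segment from \<open>T\<close> to \<open>U\<close> itself. The arc from \<open>T\<close> ends where it
  touches \<open>EF\<close>.\<close>

definition curve_TU :: "real \<Rightarrow> complex set" where
  "curve_TU \<sigma> =
     frontier (convex hull (insert (pt_U \<sigma>)
       (unit_arc (pt_S \<sigma>) (pt_T \<sigma>) (arc_meets (pt_S \<sigma>) corner_E corner_F))))
     \<inter> same_side (pt_T \<sigma>) (pt_U \<sigma>) (pt_J \<sigma>)"

definition region_E_H :: "real \<Rightarrow> complex set" where
  "region_E_H \<sigma> =
     (if sphere (pt_S \<sigma>) 1 \<inter> unit_arc (pt_B3 \<sigma>) (pt_J \<sigma>) (pt_I \<sigma>) = {} then {}
      else bounded_region
        (curve_TU \<sigma> \<union> unit_arc (pt_C3 \<sigma>) (pt_U \<sigma>) (pt_J \<sigma>) \<union>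
         unit_arc (pt_B3 \<sigma>) (pt_J \<sigma>) (pt_T \<sigma>)))"

subsection \<open>The shape \<open>\<H>(\<sigma>)\<close>\<close>

definition shape_H :: "real \<Rightarrow> complex set" where
  "shape_H \<sigma> = closure (shape_S \<sigma> - (region_A_H \<sigma> \<union> region_E_H \<sigma>))"

end

theory Submission imports Defs
begin

text \<open>A set of diameter one is contained in a set \<open>K\<close> of constant width one
  (\<open>constant_width_superset\<close>), and \<open>K\<close> has a circumscribed regular hexagon
  (\<open>constant_width_circumscribed_hexagon\<close>). For each pair of opposite corners, width one keeps \<open>K\<close>
  out of at least one of the two corner regions, so that a rotation of the hexagon frees the corner
  regions \<open>C\<close> and \<open>E\<close>. A set in this position is called \<open>placed\<close>. It touches every side of the
  hexagon, and it reaches beyond the cutting lines at the opposite corners \<open>F\<close> and \<open>B\<close>.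

  Since \<open>K\<close> is the closure of its interior, it remains to see that the interior misses the
  removed regions. Each of them is bounded by a curve that lies in a half-plane, while \<open>K\<close> has an
  interior point outside this half-plane; as the interior is convex, it meets the region only if it
  meets the curve (\<open>convex_disjoint_bounded_region\<close>). The straight parts of the curves lie on lines
  that bound \<open>K\<close>. For an arc about \<open>c\<close> it suffices to find a point of \<open>K\<close> that lies in the polar cone at \<open>c\<close>
  of the sector of the arc: it has distance at least one from all points of the arc
  (\<open>interior_disjoint_unit_arc\<close>). The points of \<open>K\<close> on the sides and in the corners \<open>F\<close> and \<open>B\<close>
  serve this purpose. So every placed set fits into \<open>\<S>(\<sigma>)\<close>.

  Not every placed set avoids \<open>A\<^sub>H\<close> and \<open>E\<^sub>H\<close>, but some reflection of it does. For \<open>A\<^sub>H\<close> there are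
  three cases. If \<open>K\<close> avoids the corner region at \<open>C\<close> or at \<open>A\<close> for the slant \<open>- \<sigma>\<close>, then the
  interior of \<open>K\<close> misses \<open>\<R>\<close> (\<open>disjoint_A_H_if_below_C\<close>, \<open>disjoint_A_H_if_below_A\<close>). Otherwise the
  reflection of \<open>K\<close> in the vertical axis is placed as well, and one of the two misses \<open>A\<^sub>H\<close>
  (\<open>disjoint_A_H_or_mirror\<close>): the parameters of the points of \<open>\<R>\<close> in the interior of \<open>K\<close> lie in a
  quadrant, with \<open>s\<close> bounded below and \<open>t\<close> bounded above, and those of the points in the interior of the
  reflection are taken by \<open>(s, t) \<mapsto> (- s, - t)\<close> into the opposite quadrant with the same corner. The
  boundary curve of \<open>A\<^sub>H\<close> is invariant under this map, and \<open>s\<close> and \<open>t\<close> grow together along it, so it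
  cannot meet both quadrants. This monotonicity (\<open>chain_A_path\<close>) is where the shortest path
  matters: it is a segment or consists of an arc about \<open>L(\<theta>)\<close> and a tangent of this arc.

  The region \<open>E\<^sub>H\<close> is avoided if \<open>K\<close> touches \<open>BC\<close> between \<open>B\<close> and \<open>S\<close>, or if \<open>K\<close> avoids the corner
  region at \<open>E\<close> for the slant \<open>0\<close> or \<open>- \<sigma>\<close> (\<open>disjoint_E_H\<close>). The first condition holds if \<open>K\<close>
  reaches beyond the cut at \<open>F\<close> in a point below the line \<open>FC\<close>, by the choice of \<open>R\<close> and \<open>S\<close>
  (\<open>BC_touch_beyond_S\<close>). If none of these conditions holds, a
  reflection moves \<open>K\<close> into the position of an earlier case (\<open>placed_fits\<close>).\<close>

section \<open>Sets of constant width one\<close>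

text \<open>Width at most one is the bound on the distances; width at least one is stated as a chord of
  length one in every direction.\<close>

definition constant_width :: "complex set \<Rightarrow> bool" where
  "constant_width K \<longleftrightarrow> compact K \<and> convex K \<and> (\<forall>x\<in>K. \<forall>y\<in>K. dist x y \<le> 1) \<and>
     (\<forall>u. norm u = 1 \<longrightarrow> (\<exists>x\<in>K. x - u \<in> K))"

text \<open>The union of a chain of sets of diameter at most one has diameter at most one, so Zorn's lemma
  applies.\<close>

lemma maximal_unit_diameter_superset:
  fixes S :: "complex set"
  assumes S: "\<And>x y. x \<in> S \<Longrightarrow> y \<in> S \<Longrightarrow> dist x y \<le> 1"
  obtains K where "S \<subseteq> K" "\<And>x y. x \<in> K \<Longrightarrow> y \<in> K \<Longrightarrow> dist x y \<le> 1"
    "\<And>y. (\<And>x. x \<in> K \<Longrightarrow> dist x y \<le> 1) \<Longrightarrow> y \<in> K"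
proof -
  let ?A = "{T. S \<subseteq> T \<and> (\<forall>x\<in>T. \<forall>y\<in>T. dist x y \<le> 1)}"
  have "\<exists>M\<in>?A. \<forall>X\<in>?A. M \<subseteq> X \<longrightarrow> X = M"
  proof (rule subset_Zorn_nonempty)
    show "?A \<noteq> {}" using S by blast
    fix \<C> assume C: "\<C> \<noteq> {}" "subset.chain ?A \<C>"
    have "dist x y \<le> 1" if xy: "x \<in> \<Union>\<C>" "y \<in> \<Union>\<C>" for x y
    proof -
      obtain T U where "T \<in> \<C>" "x \<in> T" "U \<in> \<C>" "y \<in> U" using xy by blast
      moreover from this have "T \<subseteq> U \<or> U \<subseteq> T" using C(2) by (auto simp: subset_chain_def)
      moreover have "\<And>T. T \<in> \<C> \<Longrightarrow> T \<in> ?A" using C(2) by (auto simp: subset_chain_def)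
      ultimately show ?thesis by (metis (mono_tags, lifting) mem_Collect_eq subsetD)
    qed
    moreover obtain T where "T \<in> \<C>" "S \<subseteq> T" using C by (force simp: subset_chain_def)
    ultimately show "\<Union>\<C> \<in> ?A" by blast
  qed
  then obtain M where MA: "M \<in> ?A" and max: "\<forall>X\<in>?A. M \<subseteq> X \<longrightarrow> X = M" by (rule bexE)
  from MA have M: "S \<subseteq> M" "\<forall>x\<in>M. \<forall>y\<in>M. dist x y \<le> 1" by simp_all
  have "y \<in> M" if y: "\<And>x. x \<in> M \<Longrightarrow> dist x y \<le> 1" for y
  proof -
    have "insert y M \<in> ?A" using M y by (auto simp: dist_commute)
    with max have "insert y M = M" by (meson subset_insertI)
    then show ?thesis by (metis insertI1)
  qed
  with that M show ?thesis by metis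
qed

text \<open>A maximal set of diameter one has width one in every direction. Let \<open>p\<close> be extreme in the
  direction \<open>u\<close> and suppose that some \<open>y\<close> keeps \<open>p - u\<close> out of the set. All contact directions
  \<open>n\<close> (those with \<open>p - n\<close> in the set) are then separated from \<open>u\<close> by a vector \<open>v\<close> obtained by
  tilting \<open>y - p\<close> towards \<open>u\<close>; but the points of the set that exclude \<open>p + \<epsilon> v\<close> accumulate at a
  contact direction on the side of \<open>u\<close>.\<close>

lemma maximal_unit_diameter_imp_width:
  fixes K :: "complex set"
  assumes "K \<noteq> {}" and diam: "\<And>x y. x \<in> K \<Longrightarrow> y \<in> K \<Longrightarrow> dist x y \<le> 1"
    and max: "\<And>y. (\<And>x. x \<in> K \<Longrightarrow> dist x y \<le> 1) \<Longrightarrow> y \<in> K"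
    and K: "compact K" and u: "norm u = 1"
  shows "\<exists>x\<in>K. x - u \<in> K"
proof -
  have "continuous_on K (\<lambda>x. x \<bullet> u)" by (intro continuous_intros)
  then obtain p where p: "p \<in> K" "\<And>x. x \<in> K \<Longrightarrow> x \<bullet> u \<le> p \<bullet> u"
    using continuous_attains_sup[OF K \<open>K \<noteq> {}\<close>] by blast
  have "p - u \<in> K"
  proof (rule ccontr)
    assume "p - u \<notin> K"
    then obtain y where y: "y \<in> K" "dist y (p - u) > 1" using max by force
    define w where "w = y - p"
    have yw: "norm (w + u) > 1" using y(2) by (simp add: w_def dist_norm algebra_simps)
    have exp: "(norm (a + b))\<^sup>2 = (norm a)\<^sup>2 + 2 * (a \<bullet> b) + (norm b)\<^sup>2" for a b :: complex
      by (simp add: power2_norm_eq_inner inner_add_left inner_add_right inner_commute)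
    have "(norm (w + u))\<^sup>2 > 1" using yw by (simp add: one_less_power)
    then have wu: "2 * (w \<bullet> u) > - (norm w)\<^sup>2" using exp[of w u] u by simp
    have "norm w > 0" using yw u by auto
    then have w2: "(norm w)\<^sup>2 > 0" by simp
    then have "max 0 (- (w \<bullet> u)) < (norm w)\<^sup>2 / 2" unfolding max_less_iff_conj using wu by linarith
    then obtain \<kappa> where "max 0 (- (w \<bullet> u)) < \<kappa>" "\<kappa> < (norm w)\<^sup>2 / 2"
      using dense by blast
    then have \<kappa>: "\<kappa> \<ge> 0" "w \<bullet> u + \<kappa> > 0" "\<kappa> < (norm w)\<^sup>2 / 2" by linarith+
    \<comment> \<open>a direction that points towards \<open>u\<close> and away from all \<open>n\<close> with \<open>p - n\<close> in \<open>K\<close>\<close>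
    define v where "v = w + \<kappa> *\<^sub>R u"
    have vu: "v \<bullet> u > 0" using \<kappa> u by (simp add: v_def inner_add_left power2_norm_eq_inner[symmetric])
    have vn: "v \<bullet> n < 0" if n: "norm n = 1" "p - n \<in> K" for n
    proof -
      have "norm (w + n) \<le> 1" using diam[OF y(1) n(2)] by (simp add: w_def dist_norm algebra_simps)
      then have "(norm (w + n))\<^sup>2 \<le> 1" by (simp add: power_le_one)
      then have 1: "2 * (w \<bullet> n) \<le> - (norm w)\<^sup>2" using exp[of w n] n by simp
      have "u \<bullet> n \<le> 1" using norm_cauchy_schwarz[of u n] u n by simp
      then have "\<kappa> * (u \<bullet> n) \<le> \<kappa>" using \<kappa>(1) by (simp add: mult_left_le)
      then show ?thesis using 1 \<kappa> by (simp add: v_def inner_add_left)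
    qed
    define e where "e n = 1 / real (Suc n)" for n
    have "\<exists>x\<in>K. norm (p - x + e n *\<^sub>R v) > 1" for n
    proof -
      have "(p + e n *\<^sub>R v) \<bullet> u > p \<bullet> u" using vu by (simp add: inner_add_left e_def)
      then have "p + e n *\<^sub>R v \<notin> K" using p(2) by force
      then obtain x where "x \<in> K" "\<not> dist x (p + e n *\<^sub>R v) \<le> 1" using max by blast
      then show ?thesis by (intro bexI[of _ x]) (auto simp: dist_norm norm_minus_commute algebra_simps)
    qed
    then obtain X where X: "\<And>n. X n \<in> K" "\<And>n. norm (p - X n + e n *\<^sub>R v) > 1" by metis
    obtain x r where xr: "x \<in> K" "strict_mono r" "(X \<circ> r) \<longlonglongrightarrow> x"
      using K X(1) unfolding compact_def by blast
    have e0: "(e \<circ> r) \<longlonglongrightarrow> 0"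
      unfolding e_def using LIMSEQ_subseq_LIMSEQ[OF LIMSEQ_inverse_real_of_nat xr(2)]
      by (simp add: o_def inverse_eq_divide)
    have "(\<lambda>n. norm (p - (X \<circ> r) n + (e \<circ> r) n *\<^sub>R v)) \<longlonglongrightarrow> norm (p - x + 0 *\<^sub>R v)"
      by (intro tendsto_intros xr e0)
    then have "norm (p - x + 0 *\<^sub>R v) \<ge> 1"
      by (rule LIMSEQ_le_const) (use X(2) in \<open>auto intro: less_imp_le\<close>)
    then have n1: "norm (p - x) = 1" using diam[OF p(1) xr(1)] by (simp add: dist_norm)
    have "v \<bullet> (p - X n) \<ge> - (e n / 2) * (norm v)\<^sup>2" for n
    proof -
      have "(norm (p - X n))\<^sup>2 \<le> 1"
        using diam[OF p(1) X(1)[of n]] by (simp add: dist_norm power_le_one)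
      moreover have "(norm (p - X n + e n *\<^sub>R v))\<^sup>2 > 1" using X(2)[of n] by (simp add: one_less_power)
      ultimately have "0 < 2 * (e n * ((p - X n) \<bullet> v)) + (e n)\<^sup>2 * (norm v)\<^sup>2"
        by (simp only: exp inner_scaleR_right norm_scaleR power_mult_distrib power2_abs)
      then have "0 < e n * (2 * ((p - X n) \<bullet> v) + e n * (norm v)\<^sup>2)" by (simp add: algebra_simps power2_eq_square)
      moreover have "e n > 0" by (simp add: e_def)
      ultimately have "0 < 2 * ((p - X n) \<bullet> v) + e n * (norm v)\<^sup>2"
        by (rule zero_less_mult_pos)
      then show ?thesis by (simp add: inner_commute)
    qed
    then have "\<And>n. v \<bullet> (p - (X \<circ> r) n) \<ge> - ((e \<circ> r) n / 2) * (norm v)\<^sup>2" by simp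
    moreover have "(\<lambda>n. v \<bullet> (p - (X \<circ> r) n)) \<longlonglongrightarrow> v \<bullet> (p - x)" by (intro tendsto_intros xr)
    moreover have "(\<lambda>n. - ((e \<circ> r) n / 2) * (norm v)\<^sup>2) \<longlonglongrightarrow> - (0 / 2) * (norm v)\<^sup>2"
      by (intro tendsto_intros e0) auto
    ultimately have "v \<bullet> (p - x) \<ge> - (0/2) * (norm v)\<^sup>2"
      by (intro LIMSEQ_le) auto
    then show False using vn[OF n1] xr(1) by simp
  qed
  then show ?thesis using p by blast
qed

text \<open>A maximal set of diameter one is the intersection of the unit discs about its points, hence
  compact and convex.\<close>

lemma constant_width_superset:
  fixes S :: "complex set"
  assumes S: "\<And>x y. x \<in> S \<Longrightarrow> y \<in> S \<Longrightarrow> dist x y \<le> 1"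
  obtains K where "S \<subseteq> K" "constant_width K"
proof -
  have "\<exists>S'. S \<subseteq> S' \<and> S' \<noteq> {} \<and> (\<forall>x\<in>S'. \<forall>y\<in>S'. dist x y \<le> 1)"
    using S by (intro exI[of _ "if S = {} then {0} else S"]) auto
  then obtain S' where S': "S \<subseteq> S'" "S' \<noteq> {}" "\<And>x y. x \<in> S' \<Longrightarrow> y \<in> S' \<Longrightarrow> dist x y \<le> 1" by blast
  obtain K where K: "S' \<subseteq> K" "\<And>x y. x \<in> K \<Longrightarrow> y \<in> K \<Longrightarrow> dist x y \<le> 1"
    "\<And>y. (\<And>x. x \<in> K \<Longrightarrow> dist x y \<le> 1) \<Longrightarrow> y \<in> K"
    using maximal_unit_diameter_superset[OF S'(3)] by blast
  have Keq: "K = (\<Inter>x\<in>K. cball x 1)" using K(2,3) by auto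
  have ne: "K \<noteq> {}" using K S' by blast
  have "closed (\<Inter>x\<in>K. cball x (1::real))" "convex (\<Inter>x\<in>K. cball x (1::real))"
    by (auto intro!: closed_INT convex_INT)
  then have cl: "closed K" "convex K" using Keq by simp_all
  obtain x where "x \<in> K" using ne by blast
  then have "K \<subseteq> cball x 1" using K(2) by auto
  then have "compact K" using cl(1) by (metis bounded_cball bounded_subset compact_eq_bounded_closed)
  then have "constant_width K" unfolding constant_width_def
    using cl K maximal_unit_diameter_imp_width[OF ne K(2,3)] by blast
  then show ?thesis using that K S' by blast
qed

text \<open>A convex set without interior points lies on a line and so has width zero in the direction of
  the normal.\<close>

lemma constant_width_closure_interior:
  assumes "constant_width K" shows "interior K \<noteq> {}" "closure (interior K) = K"
proof -
  have cv: "convex K" and co: "compact K" using assms by (auto simp: constant_width_def)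
  show ne: "interior K \<noteq> {}"
  proof
    assume "interior K = {}"
    then obtain a b where ab: "a \<noteq> 0" "K \<subseteq> {x. a \<bullet> x = b}"
      using empty_interior_subset_hyperplane[OF cv] by metis
    define u where "u = sgn a"
    have "norm u = 1" using ab by (simp add: u_def norm_sgn)
    then obtain x where "x \<in> K" "x - u \<in> K" using assms unfolding constant_width_def by blast
    then have "a \<bullet> x = b" "a \<bullet> (x - u) = b" using ab(2) by auto
    then have "a \<bullet> u = 0" by (simp add: inner_diff_right)
    then show False using ab(1) by (simp add: u_def sgn_div_norm)
  qed
  show "closure (interior K) = K"
    using convex_closure_interior[OF cv ne] compact_imp_closed[OF co] by simp
qed

section \<open>The circumscribed hexagon\<close>

lemma constant_width_image:
  fixes h :: "complex \<Rightarrow> complex"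
  assumes K: "constant_width K" and h: "linear h" "\<And>z. norm (h z) = norm z" "\<And>u. \<exists>v. h v = u"
  shows "constant_width ((\<lambda>z. h z + d) ` K)"
  unfolding constant_width_def
proof (intro conjI allI ballI impI)
  have eq: "(\<lambda>z. h z + d) ` K = (\<lambda>z. d + z) ` (h ` K)" by (auto simp: image_image add.commute)
  have "compact (h ` K)"
    using K h(1) unfolding constant_width_def
    by (intro compact_continuous_image linear_continuous_on) (auto simp: linear_conv_bounded_linear)
  then show "compact ((\<lambda>z. h z + d) ` K)" unfolding eq by (rule compact_translation)
  have "convex (h ` K)" using K h(1) convex_linear_image unfolding constant_width_def by blast
  then show "convex ((\<lambda>z. h z + d) ` K)" unfolding eq by (rule convex_translation)
next
  fix x y assume "x \<in> (\<lambda>z. h z + d) ` K" "y \<in> (\<lambda>z. h z + d) ` K"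
  then show "dist x y \<le> 1" using K h(2)
    by (auto simp: constant_width_def dist_norm linear_diff[OF h(1), symmetric])
next
  fix u :: complex assume u: "norm u = 1"
  obtain v where v: "h v = u" using h(3) by blast
  then have "norm v = 1" using h(2) u by metis
  then obtain x where x: "x \<in> K" "x - v \<in> K" using K unfolding constant_width_def by blast
  have "h (x - v) + d = (h x + d) - u" using v by (simp add: linear_diff[OF h(1)])
  then show "\<exists>x\<in>(\<lambda>z. h z + d) ` K. x - u \<in> (\<lambda>z. h z + d) ` K"
    using x by (metis imageI)
qed

text \<open>For the normals \<open>cis \<psi>\<close> of the cuts this says that the cut removes no interior point of \<open>K\<close>.\<close>

definition below :: "complex set \<Rightarrow> real \<Rightarrow> bool" where
  "below K \<psi> \<longleftrightarrow> (\<forall>x\<in>K. x \<bullet> cis \<psi> \<le> 1/2)"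

text \<open>The six half-planes are those whose intersection is the hexagon.\<close>

definition inscribed :: "complex set \<Rightarrow> bool" where
  "inscribed K \<longleftrightarrow> constant_width K \<and> (\<forall>j::int. below K (pi/6 + of_int j * (pi/3)))"

lemma inner_cis_mult_left: "(cis \<alpha> * z) \<bullet> w = z \<bullet> (cis (-\<alpha>) * w)"
  by (simp add: inner_complex_def algebra_simps)

lemma inner_cis_cnj_left: "(cis \<alpha> * cnj z) \<bullet> w = z \<bullet> (cis \<alpha> * cnj w)"
  by (simp add: inner_complex_def algebra_simps)

lemma below_rotation: "below ((\<lambda>z. cis \<alpha> * z) ` K) \<psi> \<longleftrightarrow> below K (\<psi> - \<alpha>)"
  by (simp add: below_def inner_cis_mult_left cis_mult)

lemma below_reflection: "below ((\<lambda>z. cis \<alpha> * cnj z) ` K) \<psi> \<longleftrightarrow> below K (\<alpha> - \<psi>)"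
  by (simp add: below_def inner_cis_cnj_left cis_mult cis_cnj)

lemma below_cong: "cis \<psi> = cis \<phi> \<Longrightarrow> below K \<psi> \<longleftrightarrow> below K \<phi>"
  by (simp add: below_def)

lemma cis_add_multiple: "\<phi> = \<psi> + of_int k * (2 * pi) \<Longrightarrow> cis \<phi> = cis \<psi>"
  using cis_multiple_2pi[of "of_int k"] by (simp add: cis_mult[symmetric] mult.commute mult.left_commute)

lemma cis_plus_pi: "cis (t + pi) = - cis t"
  by (simp add: complex_eq_iff)

text \<open>\<open>K\<close> lies in a strip of width one perpendicular to \<open>cis \<psi>\<close>; only one of its two lines can have
  distance more than \<open>1/2\<close> from the origin.\<close>

lemma constant_width_below_or_opposite:
  assumes "constant_width K"
  shows "below K \<psi> \<or> below K (\<psi> + pi)"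
proof -
  obtain x where x: "x \<in> K" "x - cis \<psi> \<in> K"
    using assms unfolding constant_width_def by (meson norm_cis)
  have d: "norm (y - z) \<le> 1" if "y \<in> K" "z \<in> K" for y z
    using assms that by (auto simp: constant_width_def dist_norm)
  have cc: "cis \<psi> \<bullet> cis \<psi> = 1" by (simp flip: power2_norm_eq_inner)
  have up: "y \<bullet> cis \<psi> \<le> x \<bullet> cis \<psi>" if "y \<in> K" for y
  proof -
    have "(y - (x - cis \<psi>)) \<bullet> cis \<psi> \<le> norm (y - (x - cis \<psi>)) * norm (cis \<psi>)"
      by (rule norm_cauchy_schwarz)
    then show ?thesis using d[OF that x(2)] cc by (simp add: inner_diff_left)
  qed
  have lo: "x \<bullet> cis \<psi> - 1 \<le> y \<bullet> cis \<psi>" if "y \<in> K" for y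
  proof -
    have "(x - y) \<bullet> cis \<psi> \<le> norm (x - y) * norm (cis \<psi>)"
      by (rule norm_cauchy_schwarz)
    then show ?thesis using d[OF x(1) that] cc by (simp add: inner_diff_left)
  qed
  have neg: "cis (\<psi> + pi) = - cis \<psi>" by (rule cis_plus_pi)
  show ?thesis
  proof (cases "x \<bullet> cis \<psi> \<le> 1/2")
    case True then show ?thesis using up by (force simp: below_def)
  next
    case False then show ?thesis using lo by (force simp: below_def neg)
  qed
qed

text \<open>The point sought is the other end of a chord of length one that ends below the line.\<close>

lemma below_imp_reaches_opposite:
  assumes "constant_width K" "below K \<psi>"
  obtains f where "f \<in> K" "f \<bullet> cis \<psi> \<le> - 1/2"
proof -
  obtain x where x: "x \<in> K" "x - cis \<psi> \<in> K"
    using assms unfolding constant_width_def by (meson norm_cis)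
  have cc: "cis \<psi> \<bullet> cis \<psi> = 1" by (simp flip: power2_norm_eq_inner)
  have "(x - cis \<psi>) \<bullet> cis \<psi> \<le> - 1/2" using assms(2) x cc by (force simp: below_def inner_diff_left)
  then show ?thesis using that x by blast
qed

lemma interior_dist_less:
  fixes K :: "complex set"
  assumes "\<And>x y. x \<in> K \<Longrightarrow> y \<in> K \<Longrightarrow> dist x y \<le> 1" "x \<in> interior K" "f \<in> K"
  shows "dist x f < 1"
proof -
  have "open (interior K)" by simp
  have "interior K \<subseteq> cball f 1" using assms(1,3) interior_subset[of K] by (force simp: dist_commute)
  then have "interior K \<subseteq> ball f 1"
    using interior_maximal[OF _ open_interior, of K "cball f 1"] by simp
  then show ?thesis using assms(2) by (auto simp: dist_commute)
qed

lemma interior_below_less: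
  assumes "below K \<psi>" "x \<in> interior K"
  shows "x \<bullet> cis \<psi> < 1/2"
proof -
  have "interior K \<subseteq> {y. cis \<psi> \<bullet> y \<le> 1/2}"
    using assms(1) interior_subset[of K] by (force simp: below_def inner_commute)
  then have "interior K \<subseteq> interior {y. cis \<psi> \<bullet> y \<le> 1/2}" by (simp add: interior_maximal)
  then have "x \<in> {y. cis \<psi> \<bullet> y < 1/2}"
    using assms(2) interior_halfspace_le[of "cis \<psi>" "1/2"] by auto
  then show ?thesis by (simp add: inner_commute)
qed

lemma inscribed_touches_side:
  assumes "inscribed K"
  obtains f where "f \<in> K" "f \<bullet> cis (pi/6 + of_int j * (pi/3)) = 1/2"
proof -
  have "below K (pi/6 + of_int (j + 3) * (pi/3))" using assms unfolding inscribed_def by blast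
  moreover have e: "cis (pi/6 + of_int (j + 3) * (pi/3)) = - cis (pi/6 + of_int j * (pi/3))"
    unfolding cis_plus_pi[symmetric] by (rule arg_cong[of _ _ cis]) (simp add: field_simps)
  moreover have "constant_width K" using assms by (simp add: inscribed_def)
  ultimately obtain f where f: "f \<in> K" "f \<bullet> cis (pi/6 + of_int (j + 3) * (pi/3)) \<le> - 1/2"
    using below_imp_reaches_opposite by blast
  then have "f \<bullet> cis (pi/6 + of_int j * (pi/3)) \<ge> 1/2" unfolding e by simp
  moreover have "f \<bullet> cis (pi/6 + of_int j * (pi/3)) \<le> 1/2"
    using assms f by (auto simp: inscribed_def below_def)
  ultimately show ?thesis using that f by fastforce
qed

lemma constant_width_rotation:
  "constant_width K \<Longrightarrow> constant_width ((\<lambda>z. cis \<alpha> * z + d) ` K)"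
proof (rule constant_width_image)
  show "linear (\<lambda>z. cis \<alpha> * z)" by (simp add: bounded_linear.linear bounded_linear_mult_right)
  show "norm (cis \<alpha> * z) = norm z" for z by (simp add: norm_mult)
  show "\<exists>v. cis \<alpha> * v = u" for u by (rule exI[of _ "u / cis \<alpha>"]) simp
qed

lemma constant_width_reflection:
  "constant_width K \<Longrightarrow> constant_width ((\<lambda>z. cis \<alpha> * cnj z) ` K)"
proof -
  assume "constant_width K"
  then have "constant_width ((\<lambda>z. cis \<alpha> * cnj z + 0) ` K)"
  proof (rule constant_width_image)
    show "linear (\<lambda>z. cis \<alpha> * cnj z)"
      by (auto intro!: linearI simp: algebra_simps scaleR_conv_of_real)
    show "norm (cis \<alpha> * cnj z) = norm z" for z by (simp add: norm_mult)
    show "\<exists>v. cis \<alpha> * cnj v = u" for u by (rule exI[of _ "cnj (u / cis \<alpha>)"]) simp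
  qed
  then show ?thesis by simp
qed

lemma inscribed_rotation:
  assumes "inscribed K" shows "inscribed ((\<lambda>z. cis (of_int m * (pi/3)) * z) ` K)"
  unfolding inscribed_def
proof (intro conjI allI)
  show "constant_width ((\<lambda>z. cis (of_int m * (pi/3)) * z) ` K)"
    using constant_width_rotation[of K _ 0] assms by (simp add: inscribed_def)
  have "pi/6 + of_int j * (pi/3) - of_int m * (pi/3) = pi/6 + of_int (j - m) * (pi/3)" for j :: int
    by (simp add: field_simps)
  then show "below ((\<lambda>z. cis (of_int m * (pi/3)) * z) ` K) (pi/6 + of_int j * (pi/3))" for j :: int
    using assms unfolding below_rotation inscribed_def by metis
qed

lemma inscribed_reflection:
  assumes "inscribed K" shows "inscribed ((\<lambda>z. cis (of_int m * (pi/3)) * cnj z) ` K)"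
  unfolding inscribed_def
proof (intro conjI allI)
  show "constant_width ((\<lambda>z. cis (of_int m * (pi/3)) * cnj z) ` K)"
    using constant_width_reflection assms by (simp add: inscribed_def)
  have "of_int m * (pi/3) - (pi/6 + of_int j * (pi/3)) = pi/6 + of_int (m - j - 1) * (pi/3)" for j :: int
    by (simp add: field_simps)
  then show "below ((\<lambda>z. cis (of_int m * (pi/3)) * cnj z) ` K) (pi/6 + of_int j * (pi/3))" for j :: int
    using assms unfolding below_reflection inscribed_def by metis
qed

text \<open>Of three corners in alternating position and their three opposites, two in alternating
  position can be avoided; a rotation turns them into \<open>C\<close> and \<open>E\<close>.\<close>

lemma inscribed_rotate_to_avoid_C_E:
  assumes "inscribed K"
  obtains m :: int where "below ((\<lambda>z. cis (of_int m * (pi/3)) * z) ` K) \<sigma>"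
    "below ((\<lambda>z. cis (of_int m * (pi/3)) * z) ` K) (\<sigma> - 2*pi/3)"
proof -
  define a where "a j = below K (\<sigma> + of_int j * (pi/3))" for j :: int
  have opp: "a j \<or> a (j + 3)" for j
  proof -
    have "\<sigma> + of_int j * (pi/3) + pi = \<sigma> + of_int (j+3) * (pi/3)" by (simp add: field_simps)
    moreover have "constant_width K" using assms by (simp add: inscribed_def)
    ultimately show ?thesis using constant_width_below_or_opposite unfolding a_def by metis
  qed
  have per: "a (j + 6) = a j" for j
    unfolding a_def by (rule below_cong, rule cis_add_multiple[where k=1]) (simp add: algebra_simps)
  have "\<exists>j. a j \<and> a (j - 2)"
  proof (rule ccontr)
    assume "\<not> ?thesis"
    then have n: "\<And>j. \<not> (a j \<and> a (j - 2))" by blast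
    show False using opp[of 0] opp[of 2] opp[of "-2"] n[of 0] n[of 2] n[of 3] n[of 1] n[of 5] n[of 4]
      per[of "-2"] per[of "-1"] per[of "1"] per[of 0] by auto
  qed
  then obtain j where j: "a j" "a (j - 2)" by blast
  have e: "\<sigma> - of_int (-j) * (pi/3) = \<sigma> + of_int j * (pi/3)"
    "\<sigma> - 2*pi/3 - of_int (-j) * (pi/3) = \<sigma> + of_int (j-2) * (pi/3)" by (simp_all add: field_simps)
  show ?thesis
    by (rule that[of "-j"]; unfold below_rotation e) (use j in \<open>simp_all add: a_def\<close>)
qed

text \<open>The six support lines of a set of constant width one with normals at multiples of
  \<open>60\<close> degrees form a regular hexagon if the three mid-lines are concurrent. The defect of
  concurrency changes sign when the hexagon is rotated by \<open>60\<close> degrees.\<close>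

lemma constant_width_circumscribed_hexagon:
  assumes K: "constant_width K"
  obtains \<alpha> d where "inscribed ((\<lambda>z. cis \<alpha> * z + d) ` K)"
proof -
  have ex: "\<exists>x. x \<in> K \<and> x - cis \<psi> \<in> K" for \<psi>
    using K unfolding constant_width_def by (meson norm_cis)
  then obtain p where p: "\<And>\<psi>. p \<psi> \<in> K" "\<And>\<psi>. p \<psi> - cis \<psi> \<in> K" by metis
  have d: "norm (y - z) \<le> 1" if "y \<in> K" "z \<in> K" for y z
    using K that by (auto simp: constant_width_def dist_norm)
  have cc: "cis \<psi> \<bullet> cis \<psi> = 1" for \<psi> by (simp flip: power2_norm_eq_inner)
  define h where "h \<psi> = p \<psi> \<bullet> cis \<psi>" for \<psi>
  have up: "y \<bullet> cis \<psi> \<le> h \<psi>" if "y \<in> K" for y \<psi>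
  proof -
    have "(y - (p \<psi> - cis \<psi>)) \<bullet> cis \<psi> \<le> norm (y - (p \<psi> - cis \<psi>)) * norm (cis \<psi>)"
      by (rule norm_cauchy_schwarz)
    then show ?thesis using d[OF that p(2)[of \<psi>]] cc[of \<psi>] by (simp add: inner_diff_left h_def)
  qed
  have hopp: "h (\<psi> + pi) = 1 - h \<psi>" for \<psi>
  proof (rule antisym)
    have neg: "cis (\<psi> + pi) = - cis \<psi>" by (rule cis_plus_pi)
    have "(p \<psi> - p (\<psi> + pi)) \<bullet> cis \<psi> \<le> norm (p \<psi> - p (\<psi> + pi)) * norm (cis \<psi>)"
      by (rule norm_cauchy_schwarz)
    then show "h (\<psi> + pi) \<le> 1 - h \<psi>" using d[OF p(1) p(1), of \<psi> "\<psi> + pi"]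
      by (simp add: h_def neg inner_diff_left)
    show "1 - h \<psi> \<le> h (\<psi> + pi)"
      using up[OF p(2)[of \<psi>], of "\<psi> + pi"] cc[of \<psi>] by (simp add: h_def neg inner_diff_left)
  qed
  obtain B where B: "\<And>x. x \<in> K \<Longrightarrow> norm x \<le> B"
    using K compact_imp_bounded[of K] unfolding constant_width_def bounded_iff by metis
  have "B \<ge> 0" using B[OF p(1)[of 0]] by (meson norm_ge_zero order_trans)
  have one: "h \<psi> - h \<phi> \<le> B * dist (cis \<psi>) (cis \<phi>)" for \<psi> \<phi>
  proof -
    have "h \<psi> - h \<phi> \<le> p \<psi> \<bullet> (cis \<psi> - cis \<phi>)"
      using up[OF p(1)[of \<psi>], of \<phi>] by (simp add: h_def inner_diff_right)
    also have "\<dots> \<le> norm (p \<psi>) * norm (cis \<psi> - cis \<phi>)" by (rule norm_cauchy_schwarz)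
    also have "\<dots> \<le> B * norm (cis \<psi> - cis \<phi>)" by (rule mult_right_mono[OF B[OF p(1)]]) simp
    finally show ?thesis by (simp add: dist_norm)
  qed
  have hcont: "continuous (at \<phi>) h" for \<phi>
  proof -
    have "((\<lambda>\<psi>. B * dist (cis \<psi>) (cis \<phi>)) \<longlongrightarrow> B * dist (cis \<phi>) (cis \<phi>)) (at \<phi>)"
      by (intro tendsto_intros isCont_tendsto_compose[OF _ tendsto_ident_at] continuous_intros)
    then have t: "((\<lambda>\<psi>. B * dist (cis \<psi>) (cis \<phi>)) \<longlongrightarrow> 0) (at \<phi>)" by simp
    have "((\<lambda>\<psi>. h \<psi> - h \<phi>) \<longlongrightarrow> 0) (at \<phi>)"
    proof (rule Lim_null_comparison[OF _ t])
      have "norm (h \<psi> - h \<phi>) \<le> B * dist (cis \<psi>) (cis \<phi>)" for \<psi>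
        using one[of \<psi> \<phi>] one[of \<phi> \<psi>] by (simp add: dist_commute abs_le_iff)
      then show "\<forall>\<^sub>F \<psi> in at \<phi>. norm (h \<psi> - h \<phi>) \<le> B * dist (cis \<psi>) (cis \<phi>)" by simp
    qed
    then show ?thesis by (simp add: continuous_at LIM_zero_iff)
  qed
  \<comment> \<open>vanishes if and only if the three mid-lines have a common point\<close>
  define F where "F \<psi> = h \<psi> - h (\<psi> + pi/3) + h (\<psi> + 2*pi/3) - 1/2" for \<psi>
  have F1: "F (pi/3) = - F 0"
  proof -
    have e: "h (pi/3 + 2*pi/3) = h (0 + pi)" "h (pi/3 + pi/3) = h (0 + 2*pi/3)" "h (0 + pi/3) = h (pi/3)"
      by (rule arg_cong[of _ _ h], simp)+
    have alg: "a - b + (1 - c) - 1/2 = - (c - a + b - 1/2)" for a b c :: real by simp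
    show ?thesis unfolding F_def e hopp by (rule alg)
  qed
  have hs: "isCont (\<lambda>\<psi>. h (\<psi> + t)) \<phi>" for t \<phi>
    by (rule isCont_o2[where f="\<lambda>\<psi>. \<psi> + t" and g=h, OF _ hcont]) simp
  have Fc: "\<forall>\<psi>. 0 \<le> \<psi> \<and> \<psi> \<le> pi/3 \<longrightarrow> isCont F \<psi>" unfolding F_def
    by (intro allI impI continuous_intros hs hcont)
  have pi3: "(0::real) \<le> pi/3" by simp
  have "\<exists>\<psi>. F \<psi> = 0"
  proof (cases "F 0 \<le> 0")
    case True
    then show ?thesis using IVT[of F 0 0 "pi/3"] F1 Fc pi3 by (metis neg_0_le_iff_le)
  next
    case False
    then have "F (pi/3) \<le> 0" "0 \<le> F 0" using F1 by auto
    then show ?thesis using IVT2[of F "pi/3" 0 0] Fc pi3 by metis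
  qed
  then obtain \<psi> where F0: "F \<psi> = 0" by blast
  \<comment> \<open>\<open>c\<close> is the common point of the mid-lines, in coordinates rotated by \<open>\<psi>\<close>\<close>
  define a b where "a = h \<psi> - 1/2" and "b = (h (\<psi> + pi/3) - 1/2 - a / 2) * 2 / sqrt 3"
  define c where "c = cis \<psi> * Complex a b"
  have ci: "c \<bullet> cis (\<psi> + t) = a * cos t + b * sin t" for t
  proof -
    have "c \<bullet> cis (\<psi> + t) = Complex a b \<bullet> (cis (-\<psi>) * cis (\<psi> + t))"
      unfolding c_def by (rule inner_cis_mult_left)
    then show ?thesis by (simp add: cis_mult inner_complex_def)
  qed
  have c0: "c \<bullet> cis \<psi> = h \<psi> - 1/2" using ci[of 0] by (simp add: a_def)
  have hb: "b * sqrt 3 = (h (\<psi> + pi/3) - 1/2 - a/2) * 2" by (simp add: b_def)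
  have c1: "c \<bullet> cis (\<psi> + pi/3) = h (\<psi> + pi/3) - 1/2"
    using ci[of "pi/3"] hb by (simp add: cos_60 sin_60 field_simps)
  have "2*pi/3 = pi - pi/3" by simp
  then have "cos (2*pi/3) = -1/2" "sin (2*pi/3) = sqrt 3 / 2"
    by (simp_all only: cos_diff sin_diff) (simp_all add: cos_60 sin_60)
  then have c2: "c \<bullet> cis (\<psi> + 2*pi/3) = h (\<psi> + 2*pi/3) - 1/2"
    using ci[of "2*pi/3"] F0 hb by (simp add: F_def a_def field_simps)
  have k: "h (\<psi> + of_int j * (pi/3)) - c \<bullet> cis (\<psi> + of_int j * (pi/3)) = 1/2" if "j \<in> {0,1,2}" for j :: int
    using that c0 c1 c2 by auto
  have k': "h (\<psi> + of_int j * (pi/3)) - c \<bullet> cis (\<psi> + of_int j * (pi/3)) = 1/2" for j :: int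
  proof -
    have per: "h (\<phi> + 2*pi) = h \<phi>" for \<phi> using hopp[of "\<phi> + pi"] hopp[of \<phi>] by (simp add: add.assoc)
    define m where "m = j mod 6"
    have hm: "h (\<phi> + of_int n * (2*pi)) = h \<phi>" for \<phi> and n :: int
    proof (induction n rule: int_induct[of _ 0])
      case (step1 i) then show ?case using per[of "\<phi> + of_int i * (2*pi)"] by (simp add: algebra_simps)
    next
      case (step2 i) then show ?case using per[of "\<phi> + of_int (i-1) * (2*pi)"] by (simp add: algebra_simps)
    qed simp
    have j: "\<psi> + of_int j * (pi/3) = \<psi> + of_int m * (pi/3) + of_int (j div 6) * (2*pi)"
    proof -
      have "j = m + 6 * (j div 6)" by (simp add: m_def)
      then have "real_of_int j = of_int m + 6 * of_int (j div 6)" by (metis of_int_add of_int_mult of_int_numeral)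
      then show ?thesis by (simp add: algebra_simps)
    qed
    have "m \<in> {0..<6}" by (simp add: m_def)
    then have "m \<in> {0,1,2} \<or> m - 3 \<in> {0,1,2}" by auto
    moreover have "h (\<psi> + of_int m * (pi/3)) - c \<bullet> cis (\<psi> + of_int m * (pi/3)) = 1/2" if m3: "m - 3 \<in> {0,1,2}"
    proof -
      have e: "\<psi> + of_int m * (pi/3) = (\<psi> + of_int (m-3) * (pi/3)) + pi" by (simp add: field_simps)
      have "cis ((\<psi> + of_int (m-3) * (pi/3)) + pi) = - cis (\<psi> + of_int (m-3) * (pi/3))"
        by (rule cis_plus_pi)
      then show ?thesis unfolding e hopp using k[OF m3] by simp
    qed
    ultimately have "h (\<psi> + of_int m * (pi/3)) - c \<bullet> cis (\<psi> + of_int m * (pi/3)) = 1/2" using k by blast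
    then show ?thesis unfolding j hm using cis_add_multiple[OF refl, of "\<psi> + of_int m * (pi/3)" "j div 6"] by simp
  qed
  define \<alpha> where "\<alpha> = pi/6 - \<psi>"
  have "inscribed ((\<lambda>z. cis \<alpha> * z + (- cis \<alpha> * c)) ` K)"
    unfolding inscribed_def below_def
  proof (intro conjI allI ballI constant_width_rotation K)
    fix j :: int and x assume "x \<in> (\<lambda>z. cis \<alpha> * z + (- cis \<alpha> * c)) ` K"
    then obtain y where y: "y \<in> K" "x = cis \<alpha> * (y - c)" by (auto simp: algebra_simps)
    have "x \<bullet> cis (pi/6 + of_int j * (pi/3)) = (y - c) \<bullet> (cis (-\<alpha>) * cis (pi/6 + of_int j * (pi/3)))"
      unfolding y by (rule inner_cis_mult_left)
    also have "\<dots> = (y - c) \<bullet> cis (\<psi> + of_int j * (pi/3))" by (simp add: cis_mult \<alpha>_def algebra_simps)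
    also have "\<dots> \<le> 1/2" using up[OF y(1)] k'[of j] by (simp add: inner_diff_left) (smt (verit))
    finally show "x \<bullet> cis (pi/6 + of_int j * (pi/3)) \<le> 1/2" .
  qed
  then show ?thesis using that by blast
qed

text \<open>A curve that a convex set \<open>V\<close> does not meet, and that lies on one side of a line of which
  \<open>V\<close> has a point on the other side, cannot enclose any point of \<open>V\<close>: together with the open
  half-plane, \<open>V\<close> is a connected unbounded set in the complement of the curve.\<close>

lemma convex_disjoint_bounded_region:
  fixes V :: "complex set"
  assumes V: "convex V" "V \<inter> \<Gamma> = {}" and \<Gamma>: "\<And>x. x \<in> \<Gamma> \<Longrightarrow> x \<bullet> a \<ge> t"
    and v: "v \<in> V" "v \<bullet> a < t" and "a \<noteq> 0"
  shows "V \<inter> bounded_region \<Gamma> = {}"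
proof -
  let ?H = "{x. a \<bullet> x < t}"
  have co: "connected (V \<union> ?H)"
    using V v by (intro connected_Un convex_connected convex_halfspace_lt) (auto simp: inner_commute)
  have dis: "(V \<union> ?H) \<inter> \<Gamma> = {}" using V \<Gamma> by (force simp: inner_commute)
  have unb: "\<not> bounded (V \<union> ?H)"
  proof
    assume "bounded (V \<union> ?H)"
    then obtain B where B: "\<And>x. x \<in> ?H \<Longrightarrow> norm x \<le> B" by (auto simp: bounded_iff)
    define s where "s = (\<bar>t\<bar> + 1) / (a \<bullet> a) + (B + 1) / norm a"
    have na: "norm a > 0" "a \<bullet> a > 0" using \<open>a \<noteq> 0\<close> by auto
    have "v \<in> ?H" using v by (simp add: inner_commute)
    then have "B \<ge> 0" using B[of v] norm_ge_zero[of v] by linarith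
    then have s: "s \<ge> (\<bar>t\<bar> + 1) / (a \<bullet> a)" "s \<ge> (B + 1) / norm a" using na by (simp_all add: s_def)
    have "s * (a \<bullet> a) \<ge> \<bar>t\<bar> + 1" using s(1) na(2) by (simp add: pos_divide_le_eq)
    then have "- s *\<^sub>R a \<in> ?H" by simp
    then have "norm (- s *\<^sub>R a) \<le> B" by (rule B)
    moreover have "s * norm a \<ge> B + 1" using s(2) na(1) by (simp add: pos_divide_le_eq)
    moreover have "norm (- s *\<^sub>R a) = \<bar>s\<bar> * norm a" by simp
    moreover have "s * norm a \<le> \<bar>s\<bar> * norm a" by (rule mult_right_mono) auto
    ultimately show False by linarith
  qed
  have "V \<inter> inside \<Gamma> = {}"
  proof (rule ccontr)
    assume "V \<inter> inside \<Gamma> \<noteq> {}"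
    then obtain x where x: "x \<in> V" "x \<in> inside \<Gamma>" by blast
    have "V \<union> ?H \<subseteq> connected_component_set (- \<Gamma>) x"
      using co dis x(1) by (intro connected_component_maximal) auto
    moreover have "bounded (connected_component_set (- \<Gamma>) x)" using x(2) by (simp add: inside_def)
    ultimately show False using unb bounded_subset by blast
  qed
  then show ?thesis using V by (auto simp: bounded_region_def)
qed

section \<open>Coordinates of the hexagon and of the cuts\<close>

lemma less_tan: fixes x :: real assumes "0 < x" "x < pi/2" shows "x < tan x"
proof -
  have "\<exists>z. 0 < z \<and> z < x \<and> tan x - tan 0 = (x - 0) * inverse ((cos z)\<^sup>2)"
  proof (rule MVT2[OF assms(1)])
    fix z assume "0 \<le> z" "z \<le> x"
    then have "cos z \<noteq> 0" using assms cos_gt_zero_pi[of z] by force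
    then show "(tan has_real_derivative inverse ((cos z)\<^sup>2)) (at z)" by (rule DERIV_tan)
  qed
  then obtain z where z: "0 < z" "z < x" "tan x = x * inverse ((cos z)\<^sup>2)" by auto
  have c: "0 < cos z" using z assms by (intro cos_gt_zero_pi) auto
  have "cos z < cos 0" using z assms by (intro cos_monotone_0_pi) auto
  then have "(cos z)\<^sup>2 < 1" using c by (simp add: power_less_one_iff abs_square_less_1)
  then have "1 < inverse ((cos z)\<^sup>2)" using c by (simp add: one_less_inverse)
  then show ?thesis using z(3) assms(1) by simp
qed

lemma cis_60s:
  "cis (pi/3) = Complex (1/2) (sqrt 3/2)" "cis (2*pi/3) = Complex (-1/2) (sqrt 3/2)"
  "cis (pi/6) = Complex (sqrt 3/2) (1/2)" "cis (5*pi/6) = Complex (- sqrt 3/2) (1/2)"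
  "cis (-(pi/3)) = Complex (1/2) (- sqrt 3/2)" "cis (-(2*pi/3)) = Complex (-1/2) (- sqrt 3/2)"
  "cis (-(pi/6)) = Complex (sqrt 3/2) (-1/2)" "cis (-(5*pi/6)) = Complex (- sqrt 3/2) (-1/2)"
proof -
  have "2*pi/3 = pi - pi/3" "5*pi/6 = pi - pi/6" by simp_all
  then have 1: "cos (2*pi/3) = -1/2" "sin (2*pi/3) = sqrt 3 / 2"
    "cos (5*pi/6) = - sqrt 3/2" "sin (5*pi/6) = 1/2"
    by (simp_all only: cos_diff sin_diff) (simp_all add: cos_60 sin_60 cos_30 sin_30)
  then show "cis (pi/3) = Complex (1/2) (sqrt 3/2)" "cis (2*pi/3) = Complex (-1/2) (sqrt 3/2)"
    "cis (pi/6) = Complex (sqrt 3/2) (1/2)" "cis (5*pi/6) = Complex (- sqrt 3/2) (1/2)"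
    "cis (-(pi/3)) = Complex (1/2) (- sqrt 3/2)" "cis (-(2*pi/3)) = Complex (-1/2) (- sqrt 3/2)"
    "cis (-(pi/6)) = Complex (sqrt 3/2) (-1/2)" "cis (-(5*pi/6)) = Complex (- sqrt 3/2) (-1/2)"
    by (simp_all add: complex_eq_iff cos_60 sin_60 cos_30 sin_30)
qed

lemma hex_corner_cis: "2*pi/3 - of_int k * (pi/3) = \<phi> \<Longrightarrow> hex_corner k = Complex (sqrt 3/3) 0 * cis \<phi>"
  by (auto simp: hex_corner_def complex_eq_iff real_div_sqrt field_simps)

lemma hex_corners:
  "corner_A = Complex (- sqrt 3/6) (1/2)" "corner_B = Complex (sqrt 3/6) (1/2)"
  "corner_C = Complex (sqrt 3/3) 0" "corner_D = Complex (sqrt 3/6) (-1/2)"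
  "corner_E = Complex (- sqrt 3/6) (-1/2)" "corner_F = Complex (- sqrt 3/3) 0"
proof -
  show "corner_A = Complex (- sqrt 3/6) (1/2)" by (subst hex_corner_cis[of _ "2*pi/3"]) (simp_all add: cis_60s complex_eq_iff)
  show "corner_B = Complex (sqrt 3/6) (1/2)" by (subst hex_corner_cis[of _ "pi/3"]) (simp_all add: cis_60s complex_eq_iff)
  show "corner_C = Complex (sqrt 3/3) 0" by (subst hex_corner_cis[of _ "0"]) (simp_all add: complex_eq_iff)
  show "corner_D = Complex (sqrt 3/6) (-1/2)" by (subst hex_corner_cis[of _ "-(pi/3)"]) (simp_all add: cis_60s complex_eq_iff)
  show "corner_E = Complex (- sqrt 3/6) (-1/2)" by (subst hex_corner_cis[of _ "-(2*pi/3)"]) (simp_all add: cis_60s complex_eq_iff)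
  show "corner_F = Complex (- sqrt 3/3) 0" by (subst hex_corner_cis[of _ "-pi"]) (simp_all add: complex_eq_iff)
qed

lemma sqrt3_bounds: "1732/1000 < sqrt (3::real)" "sqrt (3::real) < 17321/10000"
  by (rule real_less_rsqrt, simp add: power2_eq_square) (rule real_less_lsqrt, simp_all add: power2_eq_square)

lemma sqrt3_sq: "sqrt 3 * sqrt (3::real) = 3" "(sqrt (3::real))\<^sup>2 = 3"
  "sqrt 3 * (sqrt 3 * x) = 3 * (x::real)"
  by (simp_all add: mult.assoc[symmetric])

lemma segment_point_eq:
  fixes a b n :: complex
  assumes "a \<bullet> n \<noteq> b \<bullet> n" "x \<in> closed_segment a b" "x \<bullet> n = t"
  shows "(THE x. x \<in> closed_segment a b \<and> x \<bullet> n = t) = x"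
proof (rule the_equality)
  show "x \<in> closed_segment a b \<and> x \<bullet> n = t" using assms by simp
  fix y assume y: "y \<in> closed_segment a b \<and> y \<bullet> n = t"
  obtain u v where u: "x = (1-u) *\<^sub>R a + u *\<^sub>R b" and v: "y = (1-v) *\<^sub>R a + v *\<^sub>R b"
    using assms(2) y by (auto simp: in_segment)
  have "(u - v) * (b \<bullet> n - a \<bullet> n) = x \<bullet> n - y \<bullet> n"
    unfolding u v by (simp add: inner_add_left algebra_simps)
  then have "u = v" using assms y by simp
  then show "y = x" using u v by simp
qed

lemma dist_eq_1_iff: "dist c x = 1 \<longleftrightarrow> (x - c) \<bullet> (x - c) = (1::real)" for x c :: complex
  by (simp add: dist_norm norm_minus_commute[of c x] norm_eq_1)

lemma dist_le_1_iff: "dist c x \<le> 1 \<longleftrightarrow> (x - c) \<bullet> (x - c) \<le> (1::real)" for x c :: complex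
  by (simp add: dist_norm norm_minus_commute[of c x] norm_le_square)

lemma dist_less_1_iff: "dist c x < 1 \<longleftrightarrow> (x - c) \<bullet> (x - c) < (1::real)" for x c :: complex
  by (simp add: dist_norm norm_minus_commute[of c x] norm_lt_square)

lemma in_segment_from:
  "x \<in> closed_segment a b \<longleftrightarrow> (\<exists>u. 0 \<le> u \<and> u \<le> 1 \<and> x = a + u *\<^sub>R (b - a))"
  for a b x :: complex
  by (auto simp: in_segment algebra_simps)

lemma in_closed_segmentI: "x = a + u *\<^sub>R (b - a) \<Longrightarrow> 0 \<le> u \<Longrightarrow> u \<le> 1 \<Longrightarrow> x \<in> closed_segment a b"
  for a b x :: complex
  by (auto simp: in_segment_from)

lemma arc_meets_tangent:
  assumes "x \<in> closed_segment a b" "dist c x = 1" "(x - c) \<bullet> (b - a) = 0"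
  shows "arc_meets c a b = x"
  unfolding arc_meets_def
proof (rule the_equality)
  show "x \<in> closed_segment a b \<and> dist c x = 1" using assms by simp
  fix y assume y: "y \<in> closed_segment a b \<and> dist c y = 1"
  obtain u v where u: "x = a + u *\<^sub>R (b - a)" and v: "y = a + v *\<^sub>R (b - a)"
    using assms(1) y unfolding in_segment_from by metis
  have e: "y - c = (x - c) + (v - u) *\<^sub>R (b - a)" unfolding u v by (simp add: algebra_simps)
  have "(y - c) \<bullet> (y - c) = (x - c) \<bullet> (x - c) + (v - u)\<^sup>2 * ((b - a) \<bullet> (b - a))"
    unfolding e using assms(3)
    by (simp add: inner_add_left inner_add_right inner_commute[of "b - a" "x - c"] power2_eq_square)
  then have "(v - u)\<^sup>2 * ((b - a) \<bullet> (b - a)) = 0" using assms(2) y by (simp add: dist_eq_1_iff)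
  then have "v = u \<or> b = a" by simp
  then show "y = x" using u v by auto
qed

lemma dist_less_between:
  fixes x y a c :: complex
  assumes "dist c a < 1" "dist c y \<le> 1" "x = a + u *\<^sub>R (y - a)" "0 \<le> u" "u < 1"
  shows "dist c x < 1"
proof -
  have "c - x = (1 - u) *\<^sub>R (c - a) + u *\<^sub>R (c - y)" unfolding assms(3) by (simp add: algebra_simps)
  then have "dist c x \<le> (1 - u) * dist c a + u * dist c y"
    using norm_triangle_ineq[of "(1 - u) *\<^sub>R (c - a)" "u *\<^sub>R (c - y)"] assms(4,5) by (simp add: dist_norm)
  moreover have "(1 - u) * dist c a < (1 - u) * 1" using assms by (intro mult_strict_left_mono) auto
  moreover have "u * dist c y \<le> u * 1" using assms by (intro mult_left_mono) auto
  ultimately show ?thesis by simp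
qed

lemma arc_meets_crossing:
  assumes "x \<in> closed_segment a b" "dist c x = 1" "dist c a < 1"
  shows "arc_meets c a b = x"
  unfolding arc_meets_def
proof (rule the_equality)
  show "x \<in> closed_segment a b \<and> dist c x = 1" using assms by simp
  fix y assume y: "y \<in> closed_segment a b \<and> dist c y = 1"
  obtain u v where u: "x = a + u *\<^sub>R (b - a)" "0 \<le> u" and v: "y = a + v *\<^sub>R (b - a)" "0 \<le> v"
    using assms(1) y unfolding in_segment_from by metis
  have nz: "u \<noteq> 0" "v \<noteq> 0" using u v assms y by auto
  have "\<not> u < v"
  proof
    assume l: "u < v"
    have "x = a + (u / v) *\<^sub>R (y - a)" using u v nz by simp
    then have "dist c x < 1" using assms(3) y u(2) l by (intro dist_less_between[of c a y x "u/v"]) auto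
    then show False using assms(2) by simp
  qed
  moreover have "\<not> v < u"
  proof
    assume l: "v < u"
    have "y = a + (v / u) *\<^sub>R (x - a)" using u v nz by simp
    then have "dist c y < 1" using assms(2,3) v(2) l by (intro dist_less_between[of c a x y "v/u"]) auto
    then show False using y by simp
  qed
  ultimately show "y = x" using u v by simp
qed

locale slant =
  fixes \<sigma> :: real
  assumes slant_nonneg: "0 \<le> \<sigma>" and slant_less: "\<sigma> < pi/18"
begin

text \<open>The lines of the sides and of the cuts are tangents of the circle of radius \<open>1/2\<close> about the
  centre. On each side, \<open>p\<close> and \<open>q\<close> are the distances from the midpoint, where the side touches
  this circle, to the cut vertices with the indices \<open>3\<close> and \<open>2\<close>.\<close>

definition p :: real where "p = tan (pi/12 - \<sigma>/2) / 2"
definition q :: real where "q = tan (pi/12 + \<sigma>/2) / 2"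

lemma angles: "0 < pi/12 - \<sigma>/2" "\<sigma> < pi/12 - \<sigma>/2" "pi/18 < pi/12 - \<sigma>/2" "pi/12 - \<sigma>/2 \<le> pi/12 + \<sigma>/2"
  "pi/12 + \<sigma>/2 < pi/2" "pi/12 - \<sigma>/2 < pi/2"
  using slant_nonneg slant_less pi_gt_zero by linarith+

lemma cos_slant_pos: "0 < cos \<sigma>"
  using angles slant_nonneg by (intro cos_gt_zero_pi) auto

lemma sin_slant_nonneg: "0 \<le> sin \<sigma>"
  using angles slant_nonneg by (intro sin_ge_zero) auto

lemma sin_slant_pos: "0 < \<sigma> \<Longrightarrow> 0 < sin \<sigma>"
  using angles by (intro sin_gt_zero) auto

lemma cos_sin_sq: "cos \<sigma> * cos \<sigma> + sin \<sigma> * sin \<sigma> = 1"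
  by (simp flip: power2_eq_square)

text \<open>The two tangents from \<open>C\<^sub>3\<close> to the circle of radius \<open>1/2\<close> have the same length. So \<open>p\<close>
  describes \<open>C\<^sub>3\<close> relative to the side \<open>BC\<close> (left-hand sides) and relative to the line of the cut
  (right-hand sides). The equations for \<open>q\<close> do the same for \<open>C\<^sub>2\<close> and the side \<open>CD\<close>.\<close>

lemma p_eqs: "sqrt 3/4 + p/2 = cos \<sigma>/2 - p * sin \<sigma>" "1/4 - sqrt 3 * p/2 = sin \<sigma>/2 + p * cos \<sigma>"
proof -
  define a where "a = pi/12 - \<sigma>/2"
  have c: "cos a \<noteq> 0" using cos_gt_zero[of a] angles by (auto simp: a_def)
  have p1: "Complex (2 * cos a) 0 * Complex (1/2) (-p) = cis (- a)"
    "Complex (2 * cos a) 0 * Complex (1/2) p = cis a"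
    using c by (simp_all add: complex_eq_iff p_def a_def[symmetric] tan_def)
  have "Complex (2 * cos a) 0 * (Complex (1/2) (-p) * cis (pi/6)) = cis (- a + pi/6)"
    using p1(1) by (simp add: cis_mult mult.assoc[symmetric])
  also have "- a + pi/6 = a + \<sigma>" by (simp add: a_def field_simps)
  also have "cis (a + \<sigma>) = Complex (2 * cos a) 0 * (Complex (1/2) p * cis \<sigma>)"
    using p1(2) by (simp add: cis_mult mult.assoc[symmetric])
  finally have "Complex (2 * cos a) 0 * (Complex (1/2) (-p) * cis (pi/6)) = Complex (2 * cos a) 0 * (Complex (1/2) p * cis \<sigma>)" .
  moreover have "Complex (2 * cos a) 0 \<noteq> 0" using c by (simp add: complex_eq_iff)
  ultimately have "Complex (1/2) (-p) * cis (pi/6) = Complex (1/2) p * cis \<sigma>" by (metis mult_left_cancel)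
  then show "sqrt 3/4 + p/2 = cos \<sigma>/2 - p * sin \<sigma>" "1/4 - sqrt 3 * p/2 = sin \<sigma>/2 + p * cos \<sigma>"
    by (simp_all add: complex_eq_iff cis_60s algebra_simps)
qed

lemma q_eqs: "sqrt 3/4 + q/2 = cos \<sigma>/2 + q * sin \<sigma>" "- 1/4 + sqrt 3 * q/2 = sin \<sigma>/2 - q * cos \<sigma>"
proof -
  define a where "a = pi/12 + \<sigma>/2"
  have c: "cos a \<noteq> 0" using cos_gt_zero[of a] angles by (auto simp: a_def)
  have p1: "Complex (2 * cos a) 0 * Complex (1/2) (-q) = cis (- a)"
    "Complex (2 * cos a) 0 * Complex (1/2) q = cis a"
    using c by (simp_all add: complex_eq_iff q_def a_def[symmetric] tan_def)
  have "Complex (2 * cos a) 0 * (Complex (1/2) q * cis (-(pi/6))) = cis (a - pi/6)"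
    using p1(2) by (simp add: cis_mult mult.assoc[symmetric])
  also have "a - pi/6 = - a + \<sigma>" by (simp add: a_def field_simps)
  also have "cis (- a + \<sigma>) = Complex (2 * cos a) 0 * (Complex (1/2) (-q) * cis \<sigma>)"
    using p1(1) by (simp add: cis_mult mult.assoc[symmetric])
  finally have "Complex (2 * cos a) 0 * (Complex (1/2) q * cis (-(pi/6))) = Complex (2 * cos a) 0 * (Complex (1/2) (-q) * cis \<sigma>)" .
  moreover have "Complex (2 * cos a) 0 \<noteq> 0" using c by (simp add: complex_eq_iff)
  ultimately have "Complex (1/2) q * cis (-(pi/6)) = Complex (1/2) (-q) * cis \<sigma>" by (metis mult_left_cancel)
  then show "sqrt 3/4 + q/2 = cos \<sigma>/2 + q * sin \<sigma>" "- 1/4 + sqrt 3 * q/2 = sin \<sigma>/2 - q * cos \<sigma>"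
    by (simp_all add: complex_eq_iff cis_60s algebra_simps)
qed

text \<open>The bound of \<open>10\<close> degrees on the slant is exactly \<open>\<sigma> < 15 - \<sigma>/2\<close> degrees.\<close>

lemma p_gt: "sin \<sigma> < 2 * p * cos \<sigma>"
proof -
  have "tan \<sigma> < tan (pi/12 - \<sigma>/2)"
    using angles slant_nonneg by (intro tan_monotone) auto
  then have "tan \<sigma> < 2 * p" by (simp add: p_def)
  then show ?thesis using cos_slant_pos by (simp add: tan_def pos_divide_less_eq)
qed

lemma p_less_q: "0 < \<sigma> \<Longrightarrow> p < q"
  unfolding p_def q_def using angles tan_monotone[of "pi/12 - \<sigma>/2" "pi/12 + \<sigma>/2"] by auto

lemma p_le_q: "p \<le> q"
proof (cases "\<sigma> = 0")
  case True
  then have "p = q" unfolding p_def q_def by simp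
  then show ?thesis by simp
qed (use p_less_q slant_nonneg in auto)

text \<open>The angles that belong to the tangents of length \<open>p\<close> and \<open>q\<close> add up to \<open>30\<close> degrees.\<close>

lemma p_q: "2 * sqrt 3 * (p + q) + 4 * p * q = 1"
proof -
  let ?a = "pi/12 - \<sigma>/2" and ?b = "pi/12 + \<sigma>/2"
  have c: "cos ?a \<noteq> 0" "cos ?b \<noteq> 0" using cos_gt_zero[of ?a] cos_gt_zero[of ?b] angles by auto
  have e: "?a + ?b = pi/6" by simp
  have "cos (?a + ?b) \<noteq> 0" unfolding e by (simp add: cos_30)
  then have "tan (?a + ?b) = (tan ?a + tan ?b) / (1 - tan ?a * tan ?b)" "1 - tan ?a * tan ?b \<noteq> 0"
    using c tan_add[of ?a ?b] lemma_tan_add1[of ?a ?b] by auto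
  moreover have "tan (?a + ?b) = 1 / sqrt 3" unfolding e by (rule tan_30)
  ultimately have "1 - tan ?a * tan ?b = sqrt 3 * (tan ?a + tan ?b)" by (simp add: field_simps)
  then show ?thesis by (simp add: p_def q_def algebra_simps)
qed

text \<open>Both tangents have length \<open>1 - sqrt 3/2\<close> at slant zero, and \<open>p\<close> decreases while \<open>q\<close> increases.
  The numerical bounds hold up to the slant of \<open>10\<close> degrees.\<close>

lemma p_bounds: "87/1000 < p" "p \<le> 1 - sqrt 3/2" "p < 135/1000" "0 < p"
  and q_bounds: "1 - sqrt 3/2 \<le> q" "130/1000 < q" "q < 1842/10000"
proof -
  have "pi/18 < tan (pi/12 - \<sigma>/2)" using less_tan[of "pi/12 - \<sigma>/2"] angles by linarith
  then show p: "87/1000 < p" using pi_approx by (simp add: p_def)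
  then show "0 < p" by simp
  have s: "1732/1000 < sqrt (3::real)" "sqrt (3::real) < 17321/10000" using sqrt3_bounds by auto
  show pu: "p \<le> 1 - sqrt 3/2"
  proof (rule ccontr)
    assume "\<not> p \<le> 1 - sqrt 3/2"
    then have gt: "p > 1 - sqrt 3/2" "q > 1 - sqrt 3/2" using p_le_q by auto
    have "(1 - sqrt 3/2) * (1 - sqrt 3/2) < p * q" using gt s by (intro mult_strict_mono) auto
    moreover have "2 * sqrt 3 * (2 * (1 - sqrt 3/2)) < 2 * sqrt 3 * (p + q)" using gt by simp
    ultimately have "2 * sqrt 3 * (2 * (1 - sqrt 3/2)) + 4 * ((1 - sqrt 3/2) * (1 - sqrt 3/2)) < 1" using p_q by linarith
    then show False by (simp add: algebra_simps)
  qed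
  then show "p < 135/1000" using s by simp
  show q: "1 - sqrt 3/2 \<le> q"
  proof (rule ccontr)
    assume "\<not> 1 - sqrt 3/2 \<le> q"
    then have gt: "p < 1 - sqrt 3/2" "q < 1 - sqrt 3/2" using p_le_q by auto
    have "p * q < (1 - sqrt 3/2) * (1 - sqrt 3/2)" using gt s p p_le_q by (intro mult_strict_mono) auto
    moreover have "2 * sqrt 3 * (p + q) < 2 * sqrt 3 * (2 * (1 - sqrt 3/2))" using gt by simp
    ultimately have "2 * sqrt 3 * (2 * (1 - sqrt 3/2)) + 4 * ((1 - sqrt 3/2) * (1 - sqrt 3/2)) > 1" using p_q by linarith
    then show False by (simp add: algebra_simps)
  qed
  then show "130/1000 < q" using s by simp
  define x y where "x = sqrt 3 * (p + q)" and "y = p * q"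
  have "87/1000 * q \<le> y" unfolding y_def using p q s by (intro mult_right_mono) auto
  moreover have "1732/1000 * (p + q) \<le> x" unfolding x_def using p q s by (intro mult_right_mono) auto
  then have "1732 * p + 1732 * q \<le> 1000 * x" by (simp add: field_simps)
  moreover have "2 * x + 4 * y = 1" using p_q by (simp add: x_def y_def algebra_simps)
  ultimately show "q < 1842/10000" using p by linarith
qed

lemma sin_slant_less: "sin \<sigma> < 27/100 * cos \<sigma>"
proof -
  have "p * cos \<sigma> \<le> 135/1000 * cos \<sigma>" using p_bounds cos_slant_pos by (intro mult_right_mono) auto
  moreover have "sin \<sigma> < 2 * (p * cos \<sigma>)" using p_gt by simp
  ultimately show ?thesis by linarith
qed

lemma cut3_eq: "cut3 \<sigma> k = cis (2*pi/3 - of_int k * (pi/3)) * Complex (sqrt 3/4 + p/2) (1/4 - sqrt 3*p/2)"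
proof -
  let ?v = "2*pi/3 - of_int k * (pi/3)"
  have c: "hex_corner k = cis ?v * Complex (sqrt 3/3) 0"
    "hex_corner (k - 1) = cis ?v * Complex (sqrt 3/6) (1/2)"
  proof -
    show "hex_corner k = cis ?v * Complex (sqrt 3/3) 0" using hex_corner_cis[OF refl, of k] by (simp add: mult.commute)
    have "hex_corner (k - 1) = Complex (sqrt 3/3) 0 * cis (?v + pi/3)" by (rule hex_corner_cis) (simp add: field_simps)
    then show "hex_corner (k - 1) = cis ?v * Complex (sqrt 3/6) (1/2)"
      unfolding cis_mult[of ?v "pi/3", symmetric] cis_60s by (simp add: complex_eq_iff algebra_simps sqrt3_sq)
  qed
  have n: "cut_normal \<sigma> k = cis ?v * cis \<sigma>"
    unfolding cut_normal_def hex_corner_def by (simp add: sgn_scaleR sgn_div_norm mult.commute)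
  have inn: "(cis ?v * z) \<bullet> (cis ?v * w) = z \<bullet> w" for z w
    unfolding inner_cis_mult_left by (simp add: mult.assoc[symmetric] cis_mult)
  show ?thesis unfolding cut3_def
  proof (rule segment_point_eq)
    define x where "x = sqrt 3 * cos \<sigma>"
    have x: "1732/1000 * cos \<sigma> \<le> x" unfolding x_def using sqrt3_bounds cos_slant_pos
      by (intro mult_right_mono) auto
    have "hex_corner k \<bullet> cut_normal \<sigma> k - hex_corner (k - 1) \<bullet> cut_normal \<sigma> k = x / 6 - sin \<sigma> / 2"
      unfolding n c inn by (simp add: inner_complex_def x_def algebra_simps)
    then show "hex_corner k \<bullet> cut_normal \<sigma> k \<noteq> hex_corner (k - 1) \<bullet> cut_normal \<sigma> k"
      using x sin_slant_less sin_slant_nonneg cos_slant_pos by linarith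
    show "cis ?v * Complex (sqrt 3/4 + p/2) (1/4 - sqrt 3*p/2) \<in> closed_segment (hex_corner k) (hex_corner (k - 1))"
    proof (rule in_closed_segmentI)
      show "cis ?v * Complex (sqrt 3/4 + p/2) (1/4 - sqrt 3*p/2) =
        hex_corner k + (1/2 - sqrt 3 * p) *\<^sub>R (hex_corner (k - 1) - hex_corner k)"
        unfolding c by (simp add: complex_eq_iff algebra_simps sqrt3_sq)
      show "0 \<le> 1/2 - sqrt 3 * p" using p_bounds sqrt3_bounds mult_mono[of "sqrt 3" "17321/10000" p "135/1000"] by auto
      have "0 \<le> sqrt 3 * p" using p_bounds p_le_q by simp
      then show "1/2 - sqrt 3 * p \<le> 1" by linarith
    qed
    have "Complex (sqrt 3/4 + p/2) (1/4 - sqrt 3*p/2) \<bullet> cis \<sigma> = 1/2 * (cos \<sigma> * cos \<sigma> + sin \<sigma> * sin \<sigma>)"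
      unfolding p_eqs by (simp add: inner_complex_def algebra_simps)
    then show "(cis ?v * Complex (sqrt 3/4 + p/2) (1/4 - sqrt 3*p/2)) \<bullet> cut_normal \<sigma> k = 1/2"
      unfolding n inn cos_sin_sq by simp
  qed
qed

lemma cut2_eq: "cut2 \<sigma> k = cis (2*pi/3 - of_int k * (pi/3)) * Complex (sqrt 3/4 + q/2) (- 1/4 + sqrt 3*q/2)"
proof -
  let ?v = "2*pi/3 - of_int k * (pi/3)"
  have c: "hex_corner k = cis ?v * Complex (sqrt 3/3) 0"
    "hex_corner (k + 1) = cis ?v * Complex (sqrt 3/6) (-1/2)"
  proof -
    show "hex_corner k = cis ?v * Complex (sqrt 3/3) 0" using hex_corner_cis[OF refl, of k] by (simp add: mult.commute)
    have "hex_corner (k + 1) = Complex (sqrt 3/3) 0 * cis (?v + -(pi/3))" by (rule hex_corner_cis) (simp add: field_simps)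
    then show "hex_corner (k + 1) = cis ?v * Complex (sqrt 3/6) (-1/2)"
      unfolding cis_mult[of ?v "-(pi/3)", symmetric] cis_60s by (simp add: complex_eq_iff algebra_simps sqrt3_sq)
  qed
  have n: "cut_normal \<sigma> k = cis ?v * cis \<sigma>"
    unfolding cut_normal_def hex_corner_def by (simp add: sgn_scaleR sgn_div_norm mult.commute)
  have inn: "(cis ?v * z) \<bullet> (cis ?v * w) = z \<bullet> w" for z w
    unfolding inner_cis_mult_left by (simp add: mult.assoc[symmetric] cis_mult)
  show ?thesis unfolding cut2_def
  proof (rule segment_point_eq)
    define x where "x = sqrt 3 * cos \<sigma>"
    have x: "1732/1000 * cos \<sigma> \<le> x" unfolding x_def using sqrt3_bounds cos_slant_pos
      by (intro mult_right_mono) auto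
    have "hex_corner k \<bullet> cut_normal \<sigma> k - hex_corner (k + 1) \<bullet> cut_normal \<sigma> k = x / 6 + sin \<sigma> / 2"
      unfolding n c inn by (simp add: inner_complex_def x_def algebra_simps)
    then show "hex_corner k \<bullet> cut_normal \<sigma> k \<noteq> hex_corner (k + 1) \<bullet> cut_normal \<sigma> k"
      using x sin_slant_less sin_slant_nonneg cos_slant_pos by linarith
    show "cis ?v * Complex (sqrt 3/4 + q/2) (-1/4 + sqrt 3*q/2) \<in> closed_segment (hex_corner k) (hex_corner (k + 1))"
    proof (rule in_closed_segmentI)
      show "cis ?v * Complex (sqrt 3/4 + q/2) (-1/4 + sqrt 3*q/2) =
        hex_corner k + (1/2 - sqrt 3 * q) *\<^sub>R (hex_corner (k + 1) - hex_corner k)"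
        unfolding c by (simp add: complex_eq_iff algebra_simps sqrt3_sq)
      show "0 \<le> 1/2 - sqrt 3 * q" using q_bounds sqrt3_bounds mult_mono[of "sqrt 3" "17321/10000" q "1842/10000"] by auto
      have "0 \<le> sqrt 3 * q" using p_bounds p_le_q by simp
      then show "1/2 - sqrt 3 * q \<le> 1" by linarith
    qed
    have "Complex (sqrt 3/4 + q/2) (-1/4 + sqrt 3*q/2) \<bullet> cis \<sigma> = 1/2 * (cos \<sigma> * cos \<sigma> + sin \<sigma> * sin \<sigma>)"
      unfolding q_eqs by (simp add: inner_complex_def algebra_simps)
    then show "(cis ?v * Complex (sqrt 3/4 + q/2) (-1/4 + sqrt 3*q/2)) \<bullet> cut_normal \<sigma> k = 1/2"
      unfolding n inn cos_sin_sq by simp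
  qed
qed

lemma cut_points:
  "pt_B3 \<sigma> = Complex p (1/2)" "pt_C2 \<sigma> = Complex (sqrt 3/4 + q/2) (- 1/4 + sqrt 3*q/2)"
  "pt_C3 \<sigma> = Complex (sqrt 3/4 + p/2) (1/4 - sqrt 3*p/2)"
  "pt_D3 \<sigma> = Complex (sqrt 3/4 - p/2) (- 1/4 - sqrt 3*p/2)"
  "pt_E2 \<sigma> = Complex (- sqrt 3/4 + q/2) (- 1/4 - sqrt 3*q/2)" "pt_E3 \<sigma> = Complex (-p) (-1/2)"
  "pt_F2 \<sigma> = Complex (- sqrt 3/4 - q/2) (1/4 - sqrt 3*q/2)"
  "pt_F3 \<sigma> = Complex (- sqrt 3/4 - p/2) (- 1/4 + sqrt 3*p/2)"
proof -
  have a: "2*pi/3 - of_int 1 * (pi/3) = pi/3" "2*pi/3 - of_int 2 * (pi/3) = 0" "2*pi/3 - of_int 3 * (pi/3) = -(pi/3)"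
    "2*pi/3 - of_int 4 * (pi/3) = -(2*pi/3)" "2*pi/3 - of_int 5 * (pi/3) = -pi" by simp_all
  show "pt_B3 \<sigma> = Complex p (1/2)" "pt_C2 \<sigma> = Complex (sqrt 3/4 + q/2) (- 1/4 + sqrt 3*q/2)"
  "pt_C3 \<sigma> = Complex (sqrt 3/4 + p/2) (1/4 - sqrt 3*p/2)"
  "pt_D3 \<sigma> = Complex (sqrt 3/4 - p/2) (- 1/4 - sqrt 3*p/2)"
  "pt_E2 \<sigma> = Complex (- sqrt 3/4 + q/2) (- 1/4 - sqrt 3*q/2)" "pt_E3 \<sigma> = Complex (-p) (-1/2)"
  "pt_F2 \<sigma> = Complex (- sqrt 3/4 - q/2) (1/4 - sqrt 3*q/2)"
  "pt_F3 \<sigma> = Complex (- sqrt 3/4 - p/2) (- 1/4 + sqrt 3*p/2)"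
    unfolding cut2_eq cut3_eq a cis_60s by (simp_all add: complex_eq_iff algebra_simps sqrt3_sq)
qed

end

section \<open>Arcs, cones and distances\<close>

definition det2 :: "complex \<Rightarrow> complex \<Rightarrow> real" where
  "det2 z w = Re z * Im w - Im z * Re w"

text \<open>By Cramer's rule \<open>n\<close> is a nonnegative combination of \<open>a\<close> and \<open>b\<close>.\<close>

lemma cone_inner_nonpos:
  assumes "0 < det2 a b" "0 \<le> det2 a n" "0 \<le> det2 n b" "a \<bullet> g \<le> 0" "b \<bullet> g \<le> 0"
  shows "n \<bullet> g \<le> 0"
proof -
  have "det2 a b * (n \<bullet> g) = det2 n b * (a \<bullet> g) + det2 a n * (b \<bullet> g)"
    by (simp add: det2_def inner_complex_def algebra_simps)
  also have "\<dots> \<le> 0" using assms by (intro add_nonpos_nonpos mult_nonneg_nonpos)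
  finally show ?thesis using assms(1) by (simp add: mult_le_0_iff)
qed

text \<open>In the triangle with the corners \<open>x\<close>, \<open>c\<close>, \<open>f\<close> the side opposite to \<open>c\<close> is at least as long as \<open>cx\<close>.\<close>

lemma dist_ge_1_if_obtuse:
  fixes x c f :: complex
  assumes "dist c x \<ge> 1" "(x - c) \<bullet> (f - c) \<le> 0"
  shows "dist f x \<ge> 1"
proof -
  have "(x - f) \<bullet> (x - f) = (x - c) \<bullet> (x - c) - 2 * ((x - c) \<bullet> (f - c)) + (f - c) \<bullet> (f - c)"
    by (simp add: inner_diff_left inner_diff_right inner_commute)
  moreover have "(x - c) \<bullet> (x - c) \<ge> 1" using assms(1) dist_less_1_iff[of c x] by linarith
  ultimately have "\<not> (x - f) \<bullet> (x - f) < 1" using assms(2) inner_ge_zero[of "f - c"] by linarith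
  then show ?thesis using dist_less_1_iff[of f x] by linarith
qed

lemma unit_arc_far:
  assumes "x \<in> unit_arc c u v" "(u - c) \<bullet> (f - c) \<le> 0" "(v - c) \<bullet> (f - c) \<le> 0"
  shows "dist f x \<ge> 1"
proof -
  obtain a b where ab: "dist c x = 1" "a \<ge> 0" "b \<ge> 0" "x - c = a *\<^sub>R (u - c) + b *\<^sub>R (v - c)"
    using assms(1) by (auto simp: unit_arc_def)
  have "(x - c) \<bullet> (f - c) \<le> 0" unfolding ab(4) using ab assms
    by (simp add: inner_add_left add_nonpos_nonpos mult_nonneg_nonpos)
  then show ?thesis using ab(1) dist_ge_1_if_obtuse[of c x f] by simp
qed

text \<open>The chord of the arc is where the coefficients have sum one; the arc lies beyond it.\<close>

lemma unit_arc_coefficients: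
  assumes "x \<in> unit_arc c u v" "dist c u = 1" "dist c v = 1"
  obtains a b where "a \<ge> 0" "b \<ge> 0" "a + b \<ge> 1" "x - c = a *\<^sub>R (u - c) + b *\<^sub>R (v - c)"
proof -
  obtain a b where ab: "dist c x = 1" "a \<ge> 0" "b \<ge> 0" "x - c = a *\<^sub>R (u - c) + b *\<^sub>R (v - c)"
    using assms(1) by (auto simp: unit_arc_def)
  have "1 = norm (x - c)" using ab(1) by (simp add: dist_norm norm_minus_commute)
  also have "\<dots> \<le> norm (a *\<^sub>R (u - c)) + norm (b *\<^sub>R (v - c))" unfolding ab(4) by (rule norm_triangle_ineq)
  also have "\<dots> = a + b" using ab assms by (simp add: dist_norm norm_minus_commute)
  finally show ?thesis using that ab by blast
qed

lemma unit_arc_halfplane: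
  assumes x: "x \<in> unit_arc c u v" "dist c u = 1" "dist c v = 1"
    and "u \<bullet> a \<ge> t" "v \<bullet> a \<ge> t" "c \<bullet> a \<le> t"
  shows "x \<bullet> a \<ge> t"
proof -
  obtain \<alpha> \<beta> where ab: "\<alpha> \<ge> 0" "\<beta> \<ge> 0" "\<alpha> + \<beta> \<ge> 1" "x - c = \<alpha> *\<^sub>R (u - c) + \<beta> *\<^sub>R (v - c)"
    using unit_arc_coefficients[OF x] by blast
  have "(x - c) \<bullet> a = \<alpha> * ((u - c) \<bullet> a) + \<beta> * ((v - c) \<bullet> a)" unfolding ab(4) by (simp add: inner_add_left)
  also have "\<dots> \<ge> \<alpha> * (t - c \<bullet> a) + \<beta> * (t - c \<bullet> a)"
    using ab assms by (intro add_mono mult_left_mono) (auto simp: inner_diff_left)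
  also have "\<alpha> * (t - c \<bullet> a) + \<beta> * (t - c \<bullet> a) = (\<alpha> + \<beta>) * (t - c \<bullet> a)" by (simp add: algebra_simps)
  also have "\<dots> \<ge> 1 * (t - c \<bullet> a)" using ab assms by (intro mult_right_mono) auto
  finally show ?thesis by (simp add: inner_diff_left)
qed

lemma segment_halfplane:
  fixes u v a x :: complex
  assumes "x \<in> closed_segment u v" "u \<bullet> a \<ge> t" "v \<bullet> a \<ge> t"
  shows "x \<bullet> a \<ge> t"
proof -
  have "closed_segment u v \<subseteq> {x. a \<bullet> x \<ge> t}"
    using assms convex_halfspace_ge[of t a] by (intro closed_segment_subset) (auto simp: inner_commute)
  then show ?thesis using assms(1) by (auto simp: inner_commute)
qed

text \<open>Both intersection points lie on the perpendicular bisector of \<open>cd\<close>, at the same distance from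
  the midpoint.\<close>

lemma unit_circles_meet:
  fixes c d x y :: complex
  assumes "c \<noteq> d" "dist c x = 1" "dist d x = 1" "dist c y = 1" "dist d y = 1"
  shows "y = x \<or> y = c + d - x"
proof -
  define e where "e = d - c"
  define w where "w z = 2 *\<^sub>R z - (c + d)" for z
  have e0: "e \<bullet> e > 0" using assms(1) by (simp add: e_def)
  have perp: "w z \<bullet> e = 0" "(w z \<bullet> w z) = 4 - e \<bullet> e" if "dist c z = 1" "dist d z = 1" for z
  proof -
    have z: "(z - c) \<bullet> (z - c) = 1" "(z - d) \<bullet> (z - d) = 1" using that by (simp_all add: dist_eq_1_iff)
    have "w z \<bullet> e = (z - c) \<bullet> (z - c) - (z - d) \<bullet> (z - d)"
      by (simp add: w_def e_def inner_complex_def algebra_simps)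
    then show "w z \<bullet> e = 0" using z by simp
    have "w z \<bullet> w z = 2 * ((z - c) \<bullet> (z - c)) + 2 * ((z - d) \<bullet> (z - d)) - e \<bullet> e"
      by (simp add: w_def e_def inner_complex_def algebra_simps)
    then show "w z \<bullet> w z = 4 - e \<bullet> e" using z by simp
  qed
  have repr: "(e \<bullet> e) *\<^sub>R v = det2 e v *\<^sub>R (\<i> * e)" "(det2 e v)\<^sup>2 = (e \<bullet> e) * (v \<bullet> v)" if "v \<bullet> e = 0" for v
  proof -
    have o: "Re v * Re e + Im v * Im e = 0" using that by (simp add: inner_complex_def)
    have "Re e * (Re v * Re e + Im v * Im e) = 0" "Im e * (Re v * Re e + Im v * Im e) = 0" by (simp_all add: o)
    then show "(e \<bullet> e) *\<^sub>R v = det2 e v *\<^sub>R (\<i> * e)"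
      by (simp add: complex_eq_iff det2_def inner_complex_def algebra_simps)
    have "(e \<bullet> e) * (v \<bullet> v) = (det2 e v)\<^sup>2 + (Re v * Re e + Im v * Im e)\<^sup>2"
      by (simp add: det2_def inner_complex_def power2_eq_square algebra_simps)
    then show "(det2 e v)\<^sup>2 = (e \<bullet> e) * (v \<bullet> v)" by (simp add: o)
  qed
  have "(det2 e (w y))\<^sup>2 = (det2 e (w x))\<^sup>2" using repr(2) perp assms by simp
  then have "det2 e (w y) = det2 e (w x) \<or> det2 e (w y) = - det2 e (w x)" by (simp add: power2_eq_iff)
  then have "(e \<bullet> e) *\<^sub>R w y = (e \<bullet> e) *\<^sub>R w x \<or> (e \<bullet> e) *\<^sub>R w y = (e \<bullet> e) *\<^sub>R (- w x)"
    using repr(1)[OF perp(1)] assms by auto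
  then have "w y = w x \<or> w y = - w x" using e0 by (metis less_irrefl scaleR_left_imp_eq)
  then show ?thesis by (auto simp: w_def complex_eq_iff)
qed

lemma arcs_meet_near_eq:
  assumes "c \<noteq> d" "dist c x = 1" "dist d x = 1" "dist v x < dist v (c + d - x)"
  shows "arcs_meet_near v c d = x"
  unfolding arcs_meet_near_def
proof (rule the_equality)
  show "dist c x = 1 \<and> dist d x = 1 \<and> (\<forall>y. dist c y = 1 \<and> dist d y = 1 \<longrightarrow> dist v x \<le> dist v y)"
    using unit_circles_meet[OF assms(1-3)] assms by fastforce
  fix y assume y: "dist c y = 1 \<and> dist d y = 1 \<and> (\<forall>z. dist c z = 1 \<and> dist d z = 1 \<longrightarrow> dist v y \<le> dist v z)"
  then have "dist v y \<le> dist v x" using assms by blast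
  then show "y = x" using unit_circles_meet[OF assms(1-3), of y] y assms(4) by auto
qed

lemma constant_width_interior_point:
  assumes "constant_width K" "f \<in> K" "f \<bullet> a < t"
  obtains v where "v \<in> interior K" "v \<bullet> a < t"
proof -
  have "f \<in> closure (interior K)" using assms constant_width_closure_interior by auto
  moreover have "open {x. x \<bullet> a < t}" using open_halfspace_lt[of a t] by (simp add: inner_commute)
  ultimately have "interior K \<inter> {x. x \<bullet> a < t} \<noteq> {}"
    using assms(3) open_Int_closure_eq_empty[of "{x. x \<bullet> a < t}" "interior K"] by blast
  then show ?thesis using that by blast
qed

text \<open>The hexagon as an intersection of half-planes, which is how membership is obtained for
  inscribed sets.\<close>

definition inHex :: "complex \<Rightarrow> bool" where
  "inHex x \<longleftrightarrow> \<bar>Im x\<bar> \<le> 1/2 \<and> \<bar>sqrt 3 * Re x + Im x\<bar> \<le> 1 \<and> \<bar>sqrt 3 * Re x - Im x\<bar> \<le> 1"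

lemma cis_sides:
  "cis (pi/6 + of_int 0 * (pi/3)) = Complex (sqrt 3/2) (1/2)"
  "cis (pi/6 + of_int 1 * (pi/3)) = Complex 0 1"
  "cis (pi/6 + of_int 2 * (pi/3)) = Complex (- sqrt 3/2) (1/2)"
  "cis (pi/6 + of_int (-1) * (pi/3)) = Complex (sqrt 3/2) (-1/2)"
  "cis (pi/6 + of_int (-2) * (pi/3)) = Complex 0 (-1)"
  "cis (pi/6 + of_int (-3) * (pi/3)) = Complex (- sqrt 3/2) (-1/2)"
proof -
  have "pi/6 + of_int 1 * (pi/3) = pi/2" "pi/6 + of_int 2 * (pi/3) = 5*pi/6"
    "pi/6 + of_int (-1) * (pi/3) = -(pi/6)" "pi/6 + of_int (-2) * (pi/3) = -(pi/2)"
    "pi/6 + of_int (-3) * (pi/3) = -(5*pi/6)" by simp_all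
  note e = this
  show "cis (pi/6 + of_int 0 * (pi/3)) = Complex (sqrt 3/2) (1/2)" using cis_60s by simp
  show "cis (pi/6 + of_int 1 * (pi/3)) = Complex 0 1" "cis (pi/6 + of_int 2 * (pi/3)) = Complex (- sqrt 3/2) (1/2)"
    "cis (pi/6 + of_int (-1) * (pi/3)) = Complex (sqrt 3/2) (-1/2)"
    "cis (pi/6 + of_int (-2) * (pi/3)) = Complex 0 (-1)"
    "cis (pi/6 + of_int (-3) * (pi/3)) = Complex (- sqrt 3/2) (-1/2)"
    unfolding e cis_60s by (simp_all add: complex_eq_iff)
qed

lemma inscribed_inHex:
  assumes "inscribed K" "x \<in> K" shows "inHex x"
proof -
  have "x \<bullet> cis (pi/6 + of_int j * (pi/3)) \<le> 1/2" for j :: int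
    using assms by (auto simp: inscribed_def below_def)
  from this[of 0] this[of 1] this[of 2] this[of "-1"] this[of "-2"] this[of "-3"]
  show ?thesis unfolding cis_sides by (simp add: inHex_def inner_complex_def abs_le_iff algebra_simps)
qed

lemma inscribed_interior:
  assumes "inscribed K" "x \<in> interior K"
  shows "x \<bullet> Complex (sqrt 3/2) (1/2) < 1/2" "Im x < 1/2" "x \<bullet> Complex (- sqrt 3/2) (1/2) < 1/2"
    "x \<bullet> Complex (sqrt 3/2) (-1/2) < 1/2" "- 1/2 < Im x" "x \<bullet> Complex (- sqrt 3/2) (-1/2) < 1/2"
proof -
  have i: "x \<bullet> cis (pi/6 + of_int j * (pi/3)) < 1/2" for j :: int
    using assms interior_below_less by (auto simp: inscribed_def)
  show "x \<bullet> Complex (sqrt 3/2) (1/2) < 1/2" using i[of 0] unfolding cis_sides .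
  show "Im x < 1/2" using i[of 1] unfolding cis_sides by (simp add: inner_complex_def)
  show "x \<bullet> Complex (- sqrt 3/2) (1/2) < 1/2" using i[of 2] unfolding cis_sides .
  show "x \<bullet> Complex (sqrt 3/2) (-1/2) < 1/2" using i[of "-1"] unfolding cis_sides .
  show "- 1/2 < Im x" using i[of "-2"] unfolding cis_sides by (simp add: inner_complex_def)
  show "x \<bullet> Complex (- sqrt 3/2) (-1/2) < 1/2" using i[of "-3"] unfolding cis_sides .
qed

lemma inHex_subset_Hex: "inHex x \<Longrightarrow> x \<in> Hex"
proof (rule ccontr)
  assume x: "inHex x" and "x \<notin> Hex"
  have "{0..5::int} = {0,1,2,3,4,5}" by auto
  then have H: "Hex = convex hull {corner_A, corner_B, corner_C, corner_D, corner_E, corner_F}"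
    by (simp add: Hex_def)
  have "compact Hex" unfolding H by (rule finite_imp_compact_convex_hull) simp
  then have "closed Hex" by (rule compact_imp_closed)
  moreover have "convex Hex" by (simp add: Hex_def)
  ultimately obtain a b where ab: "a \<bullet> x < b" "\<forall>y\<in>Hex. b < a \<bullet> y"
    using separating_hyperplane_closed_point[of Hex x] \<open>x \<notin> Hex\<close> by auto
  have m: "corner_A \<in> Hex" "corner_B \<in> Hex" "corner_C \<in> Hex" "corner_D \<in> Hex" "corner_E \<in> Hex" "corner_F \<in> Hex"
    unfolding H by (auto intro: hull_inc)
  have c: "a \<bullet> x < a \<bullet> corner_A" "a \<bullet> x < a \<bullet> corner_B" "a \<bullet> x < a \<bullet> corner_C"
    "a \<bullet> x < a \<bullet> corner_D" "a \<bullet> x < a \<bullet> corner_E" "a \<bullet> x < a \<bullet> corner_F"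
    using m ab by force+
  define r s where "r = Re a" and "s = Im a"
  have s3: "sqrt 3 > (0::real)" by simp
  define X where "X = sqrt 3 * Re x"
  have X: "Re x = X * sqrt 3 / 3" by (simp add: X_def)
  define k where "k = r * sqrt 3"
  have ax: "3 * (a \<bullet> x) = k * X + 3 * s * Im x" by (simp add: inner_complex_def X k_def r_def s_def)
  have cc: "6 * (a \<bullet> corner_A) = - k + 3 * s" "6 * (a \<bullet> corner_B) = k + 3 * s" "6 * (a \<bullet> corner_C) = 2 * k"
     "6 * (a \<bullet> corner_D) = k - 3 * s" "6 * (a \<bullet> corner_E) = - k - 3 * s" "6 * (a \<bullet> corner_F) = - 2 * k"
    by (simp_all add: hex_corners inner_complex_def k_def r_def s_def algebra_simps)
  have h: "\<bar>Im x\<bar> \<le> 1/2" "\<bar>X + Im x\<bar> \<le> 1" "\<bar>X - Im x\<bar> \<le> 1" using x by (auto simp: inHex_def X_def)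
  have b1: "- k + 3 * s > 2 * k * X + 6 * s * Im x" "k + 3 * s > 2 * k * X + 6 * s * Im x"
     "2 * k > 2 * k * X + 6 * s * Im x" "k - 3 * s > 2 * k * X + 6 * s * Im x"
     "- k - 3 * s > 2 * k * X + 6 * s * Im x" "- 2 * k > 2 * k * X + 6 * s * Im x"
    using c cc ax by (simp_all add: algebra_simps)
  text \<open>The functional is a nonnegative combination of two adjacent side normals, up to sign.\<close>
  consider "\<bar>3 * s\<bar> \<le> \<bar>k\<bar>" | "\<bar>3 * s\<bar> > \<bar>k\<bar>" by linarith
  then show False
  proof cases
    case 1
    have "2 * k * X + 6 * s * Im x = (k + 3 * s) * (X + Im x) + (k - 3 * s) * (X - Im x)"
      by (simp add: algebra_simps)
    moreover have "\<bar>(k + 3 * s) * (X + Im x)\<bar> \<le> \<bar>k + 3 * s\<bar>" "\<bar>(k - 3 * s) * (X - Im x)\<bar> \<le> \<bar>k - 3 * s\<bar>"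
      unfolding abs_mult using h by (simp_all add: mult_left_le)
    moreover have "\<bar>k + 3 * s\<bar> + \<bar>k - 3 * s\<bar> = 2 * \<bar>k\<bar>" using 1 by linarith
    ultimately have "2 * k * X + 6 * s * Im x \<ge> - 2 * \<bar>k\<bar>" by linarith
    then show False using b1(3,6) by linarith
  next
    case 2
    have e: "2 * k * X + 6 * s * Im x = 2 * k * (X + Im x) + 2 * (3 * s - k) * Im x"
       "2 * k * X + 6 * s * Im x = 2 * k * (X - Im x) + 2 * (3 * s + k) * Im x"
      by (simp_all add: algebra_simps)
    have f: "\<bar>2 * k * (X + Im x)\<bar> \<le> \<bar>2 * k\<bar>" "\<bar>2 * k * (X - Im x)\<bar> \<le> \<bar>2 * k\<bar>"
      unfolding abs_mult using h by (simp_all add: mult_left_le)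
    have g: "\<bar>2 * (3 * s - k) * Im x\<bar> \<le> \<bar>3 * s - k\<bar>" "\<bar>2 * (3 * s + k) * Im x\<bar> \<le> \<bar>3 * s + k\<bar>"
      unfolding abs_mult using h(1) mult_left_mono[of "\<bar>Im x\<bar>" "1/2" "2 * \<bar>3 * s - k\<bar>"]
        mult_left_mono[of "\<bar>Im x\<bar>" "1/2" "2 * \<bar>3 * s + k\<bar>"] by simp_all
    have "2 * k * X + 6 * s * Im x \<ge> - \<bar>k\<bar> - \<bar>3 * s\<bar>"
    proof (cases "(0 \<le> k) = (0 \<le> s)")
      case True then show ?thesis using 2 e(1) f(1) g(1) by linarith
    next
      case False then show ?thesis using 2 e(2) f(2) g(2) by linarith
    qed
    then show False using b1 by linarith
  qed
qed

section \<open>The points that bound the corner regions\<close>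

lemma in_closed_segment_ratioI:
  fixes a b x :: complex
  assumes "0 \<le> m" "m \<le> k" "0 < k" "k * (Re x - Re a) = m * (Re b - Re a)" "k * (Im x - Im a) = m * (Im b - Im a)"
  shows "x \<in> closed_segment a b"
proof (rule in_closed_segmentI[where u="m/k"])
  have "Re x - Re a = m / k * (Re b - Re a)" "Im x - Im a = m / k * (Im b - Im a)"
    using assms(3-5) by (simp_all add: eq_divide_eq mult.commute)
  then show "x = a + (m / k) *\<^sub>R (b - a)" by (simp add: complex_eq_iff)
  show "0 \<le> m/k" "m/k \<le> 1" using assms by auto
qed
lemma sqrt3_mult: "0 \<le> x \<Longrightarrow> 1732/1000 * x \<le> sqrt 3 * x" "0 \<le> x \<Longrightarrow> sqrt 3 * x \<le> 17321/10000 * x" for x :: real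
  by (rule mult_right_mono; use sqrt3_bounds in simp)+

context slant begin

abbreviation "cs \<equiv> cos \<sigma>"
abbreviation "sn \<equiv> sin \<sigma>"

text \<open>The coordinates of the normal of the cut at corner \<open>E\<close>.\<close>

definition ex :: real where "ex = - cs/2 + sqrt 3/2 * sn"
definition ey :: real where "ey = - sqrt 3/2 * cs - sn/2"

lemma cis_cut_E: "cis (\<sigma> - 2*pi/3) = Complex ex ey"
proof -
  have "cis (\<sigma> - 2*pi/3) = cis \<sigma> * cis (-(2*pi/3))" by (simp add: cis_mult)
  then show ?thesis unfolding cis_60s by (simp add: ex_def ey_def complex_eq_iff algebra_simps)
qed

lemma ex_ey_sq: "ex * ex + ey * ey = 1"
proof -
  have "cmod (cis (\<sigma> - 2*pi/3)) ^ 2 = 1" by simp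
  then show ?thesis unfolding cis_cut_E cmod_power2 by (simp add: power2_eq_square)
qed

lemma cs_gt: "965/1000 < cs"
proof (rule ccontr)
  assume "\<not> 965/1000 < cs"
  then have le: "cs \<le> 965/1000" by simp
  have "sn * sn \<le> (27/100 * cs) * (27/100 * cs)" using sin_slant_less sin_slant_nonneg cos_slant_pos by (intro mult_mono) auto
  moreover have "cs * cs \<le> 965/1000 * (965/1000)" using le cos_slant_pos by (intro mult_mono) auto
  ultimately show False using cos_sin_sq by simp
qed

lemma sn_less: "sn < 27/100"
  using sin_slant_less cos_le_one[of \<sigma>] by linarith

lemma C3_alt: "pt_C3 \<sigma> = Complex (cs/2 - p* sn) (sn/2 + p* cs)"
  unfolding cut_points p_eqs ..

lemma F3_alt: "pt_F3 \<sigma> = Complex (- cs/2 + p* sn) (- sn/2 - p* cs)"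
  using p_eqs unfolding cut_points by (simp add: complex_eq_iff)

lemma C2_alt: "pt_C2 \<sigma> = Complex (cs/2 + q* sn) (sn/2 - q* cs)"
  unfolding cut_points q_eqs ..

text \<open>The equations for \<open>p\<close>, \<open>q\<close>, \<open>ex\<close> and \<open>ey\<close> with integral coefficients: further identities
  among these numbers follow from them as elements of the ideal that they generate.\<close>

lemma integral_eqs:
  "sqrt 3 + 2 * p = 2 * cs - 4 * p * sn" "1 - 2 * sqrt 3 * p = 2 * sn + 4 * p * cs"
  "sqrt 3 + 2 * q = 2 * cs + 4 * q * sn" "- 1 + 2 * sqrt 3 * q = 2 * sn - 4 * q * cs"
  "2 * ex = - cs + sqrt 3 * sn" "2 * ey = - sqrt 3 * cs - sn"
  using p_eqs q_eqs by (simp_all add: ex_def ey_def field_simps)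

lemma E3_alt: "- p = ex/2 - p * ey" "-1/2 = ey/2 + p * ex"
  by (simp_all add: field_simps) (use integral_eqs sqrt3_sq(1) in algebra)+

lemma E2_alt: "- sqrt 3/4 + q/2 = ex/2 + q * ey" "- 1/4 - sqrt 3*q/2 = ey/2 - q * ex"
  by (simp_all add: field_simps) (use integral_eqs sqrt3_sq(1) in algebra)+

lemma E_integral: "- 2 * p = ex - 2 * p * ey" "- 1 = ey + 2 * p * ex"
  "- sqrt 3 + 2 * q = 2 * ex + 4 * q * ey" "- 1 - 2 * sqrt 3 * q = 2 * ey - 4 * q * ex"
proof -
  show "- 2 * p = ex - 2 * p * ey" "- 1 = ey + 2 * p * ex" "- sqrt 3 + 2 * q = 2 * ex + 4 * q * ey"
    using E3_alt E2_alt by linarith+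
  have "4 * (- 1/4 - sqrt 3*q/2) = 4 * (ey/2 - q * ex)" by (simp only: E2_alt(2))
  then show "- 1 - 2 * sqrt 3 * q = 2 * ey - 4 * q * ex" by (simp add: algebra_simps)
qed

lemma C_cut_slope: "0 < cs + sqrt 3 * sn" "0 < cs - sqrt 3 * sn"
proof -
  have "sqrt 3 * sn \<le> 17321/10000 * sn" using sqrt3_bounds sin_slant_nonneg by (intro mult_right_mono) auto
  moreover have "0 \<le> sqrt 3 * sn" using sin_slant_nonneg by simp
  ultimately show "0 < cs + sqrt 3 * sn" "0 < cs - sqrt 3 * sn"
    using sin_slant_less cos_slant_pos sin_slant_nonneg by linarith+
qed

text \<open>The position of \<open>K\<close> in which the corner regions \<open>C\<close> and \<open>E\<close> can be removed.\<close>

definition placed :: "complex set \<Rightarrow> bool" where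
  "placed K \<longleftrightarrow> inscribed K \<and> below K \<sigma> \<and> below K (\<sigma> - 2*pi/3)"

text \<open>The equation says that the points of \<open>EF\<close> and \<open>CD\<close> at distance \<open>p\<close> and \<open>x\<close> from the
  midpoints of these sides have distance one. So \<open>g\<close> is the coordinate of \<open>G\<close> on \<open>CD\<close>.\<close>

definition g :: real where
  "g = (SOME x. p \<le> x \<and> x \<le> q \<and> x\<^sup>2 - x * p + p\<^sup>2 + sqrt 3/2 * (x + p) = 1/4)"

text \<open>The point with coordinate \<open>p\<close> on \<open>CD\<close> is at the same height as \<open>F\<^sub>3\<close> and within distance
  one, while the tangent from \<open>C\<^sub>2\<close> to the unit circle about \<open>F\<^sub>3\<close> has length \<open>q - p\<close>.\<close>

lemma g: "p \<le> g" "g \<le> q" "g\<^sup>2 - g * p + p\<^sup>2 + sqrt 3/2 * (g + p) = 1/4"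
proof -
  let ?f = "\<lambda>x. x\<^sup>2 - x * p + p\<^sup>2 + sqrt 3/2 * (x + p)"
  have "(p + sqrt 3/2)\<^sup>2 \<le> 1\<^sup>2" using p_bounds sqrt3_bounds by (intro power_mono) auto
  then have "?f p \<le> 1/4" by (simp add: power2_eq_square algebra_simps)
  moreover have "1/4 \<le> ?f q"
  proof -
    have "norm (Complex (cs + (q - p) * sn) (sn - (q - p) * cs)) ^ 2 = (cs * cs + sn * sn) * (1 + (q - p)\<^sup>2)"
      unfolding cmod_power2 complex.sel by algebra
    moreover have "Complex (cs + (q - p) * sn) (sn - (q - p) * cs) = Complex (sqrt 3/2 + (q+p)/2) (sqrt 3/2 * (q - p))"
      by (simp add: complex_eq_iff field_simps) (use integral_eqs in algebra)
    moreover have "norm (Complex (sqrt 3/2 + (q+p)/2) (sqrt 3/2 * (q - p))) ^ 2 = ?f q + 3/4"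
      unfolding cmod_power2 by (simp add: power2_eq_square field_simps)
    ultimately have "?f q + 3/4 = 1 + (q - p)\<^sup>2" by (simp add: cos_sin_sq)
    then show ?thesis using zero_le_power2[of "q - p"] by linarith
  qed
  moreover have "\<forall>x. p \<le> x \<and> x \<le> q \<longrightarrow> isCont ?f x" by (intro allI impI continuous_intros)
  ultimately have "\<exists>x. p \<le> x \<and> x \<le> q \<and> ?f x = 1/4" using IVT[of ?f p "1/4" q] p_le_q by blast
  from someI_ex[OF this] show "p \<le> g" "g \<le> q" "?f g = 1/4" unfolding g_def by blast+
qed

lemma g_bounds: "g < 1842/10000" "87/1000 < g" using g p_bounds q_bounds by linarith+

abbreviation "F3G \<equiv> Complex (sqrt 3/2 + (g+p)/2) (sqrt 3/2 * (g - p))"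

lemma norm_F3G: "F3G \<bullet> F3G = 1"
proof -
  have "4 * g * g - 4 * g * p + 4 * p * p + 2 * sqrt 3 * (g + p) = 1"
    using g(3) by (simp add: power2_eq_square field_simps)
  then show ?thesis
    by (simp add: inner_complex_def field_simps)
qed

lemma pt_G_eq: "pt_G \<sigma> = Complex (sqrt 3/4 + g/2) (- 1/4 + sqrt 3*g/2)"
  unfolding pt_G_def
proof (rule arc_meets_crossing)
  show "Complex (sqrt 3/4 + g/2) (- 1/4 + sqrt 3*g/2) \<in> closed_segment (pt_D3 \<sigma>) (pt_C2 \<sigma>)"
  proof (rule in_closed_segment_ratioI[of "g + p" "p + q"])
    show "0 \<le> g + p" "g + p \<le> p + q" "0 < p + q" using g p_bounds p_le_q by linarith+
  qed (simp_all add: cut_points field_simps)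
  have "Complex (sqrt 3/4 + g/2) (- 1/4 + sqrt 3*g/2) - pt_F3 \<sigma> = F3G"
    unfolding cut_points by (simp add: complex_eq_iff algebra_simps)
  then show "dist (pt_F3 \<sigma>) (Complex (sqrt 3/4 + g/2) (- 1/4 + sqrt 3*g/2)) = 1"
    unfolding dist_eq_1_iff using norm_F3G by simp
  have "(pt_D3 \<sigma> - pt_F3 \<sigma>) \<bullet> (pt_D3 \<sigma> - pt_F3 \<sigma>) = 3/4 + 3 * (p * p)"
    unfolding cut_points by (simp add: inner_complex_def algebra_simps)
  moreover have "p * p \<le> 135/1000 * (135/1000)" using p_bounds by (intro mult_mono) auto
  ultimately show "dist (pt_F3 \<sigma>) (pt_D3 \<sigma>) < 1" unfolding dist_less_1_iff by simp
qed

lemma pt_K_eq: "pt_K \<sigma> = Complex (cs/2 + p* sn) (sn/2 - p* cs)"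
  unfolding pt_K_def
proof (rule arc_meets_tangent)
  show "Complex (cs/2 + p* sn) (sn/2 - p* cs) \<in> closed_segment (pt_C3 \<sigma>) (pt_C2 \<sigma>)"
  proof (rule in_closed_segment_ratioI[of "2 * p" "p + q"])
    show "0 \<le> 2 * p" "2 * p \<le> p + q" "0 < p + q" using p_bounds p_le_q by linarith+
  qed (simp_all add: C3_alt C2_alt algebra_simps)
  have "Complex (cs/2 + p* sn) (sn/2 - p* cs) - pt_F3 \<sigma> = Complex cs sn"
    unfolding F3_alt by (simp add: complex_eq_iff)
  then show "dist (pt_F3 \<sigma>) (Complex (cs/2 + p* sn) (sn/2 - p* cs)) = 1"
    "(Complex (cs/2 + p* sn) (sn/2 - p* cs) - pt_F3 \<sigma>) \<bullet> (pt_C2 \<sigma> - pt_C3 \<sigma>) = 0"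
    unfolding dist_eq_1_iff C3_alt C2_alt using cos_sin_sq by (simp_all add: inner_complex_def algebra_simps)
qed

lemma pt_I_eq: "pt_I \<sigma> = Complex (ex/2 + p*ey) (ey/2 - p*ex)"
  unfolding pt_I_def
proof (rule arc_meets_tangent)
  have E3: "pt_E3 \<sigma> = Complex (ex/2 - p*ey) (ey/2 + p*ex)"
    unfolding cut_points using E3_alt by (simp add: complex_eq_iff)
  have B3: "pt_B3 \<sigma> = Complex (- (ex/2 - p*ey)) (- (ey/2 + p*ex))"
    unfolding cut_points using E3_alt by (simp add: complex_eq_iff)
  have E2: "pt_E2 \<sigma> = Complex (ex/2 + q*ey) (ey/2 - q*ex)"
    unfolding cut_points using E2_alt by (simp add: complex_eq_iff)
  show "Complex (ex/2 + p*ey) (ey/2 - p*ex) \<in> closed_segment (pt_E3 \<sigma>) (pt_E2 \<sigma>)"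
  proof (rule in_closed_segment_ratioI[of "2 * p" "p + q"])
    show "0 \<le> 2 * p" "2 * p \<le> p + q" "0 < p + q" using p_bounds p_le_q by linarith+
  qed (simp_all add: E3 E2 algebra_simps)
  have "Complex (ex/2 + p*ey) (ey/2 - p*ex) - pt_B3 \<sigma> = Complex ex ey"
    unfolding B3 by (simp add: complex_eq_iff)
  then show "dist (pt_B3 \<sigma>) (Complex (ex/2 + p*ey) (ey/2 - p*ex)) = 1"
    "(Complex (ex/2 + p*ey) (ey/2 - p*ex) - pt_B3 \<sigma>) \<bullet> (pt_E2 \<sigma> - pt_E3 \<sigma>) = 0"
    unfolding dist_eq_1_iff E3 E2 using ex_ey_sq by (simp_all add: inner_complex_def algebra_simps)
qed

lemma I_minus_B3: "pt_I \<sigma> - pt_B3 \<sigma> = Complex ex ey"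
  unfolding pt_I_eq cut_points using E3_alt by (simp add: complex_eq_iff)

lemma pt_H_eq: "pt_H \<sigma> = Complex (- sqrt 3/4 + p/2) (- 1/4 - sqrt 3*p/2)"
  unfolding pt_H_def
proof (rule arc_meets_tangent)
  let ?H = "Complex (- sqrt 3/4 + p/2) (- 1/4 - sqrt 3*p/2)"
  show "?H \<in> closed_segment (pt_E2 \<sigma>) (pt_F3 \<sigma>)"
  proof (rule in_closed_segment_ratioI[of "q - p" "p + q"])
    show "0 \<le> q - p" "q - p \<le> p + q" "0 < p + q" using p_bounds p_le_q by linarith+
  qed (simp_all add: cut_points field_simps)
  show "dist (pt_C3 \<sigma>) ?H = 1" "(?H - pt_C3 \<sigma>) \<bullet> (pt_F3 \<sigma> - pt_E2 \<sigma>) = 0"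
    unfolding dist_eq_1_iff cut_points by (simp_all add: inner_complex_def algebra_simps)
qed

lemma pt_P_eq: "pt_P \<sigma> = Complex (- sqrt 3/4 + g/2) (1/4 + sqrt 3*g/2)"
  unfolding pt_P_def
proof (rule arc_meets_tangent)
  let ?P = "Complex (- sqrt 3/4 + g/2) (1/4 + sqrt 3*g/2)"
  have "0 \<le> sqrt 3 * g" "sqrt 3 * g \<le> 1/2"
    using g_bounds sqrt3_mult[of g] by linarith+
  then show "?P \<in> closed_segment corner_F corner_A"
    unfolding hex_corners
    by (intro in_closed_segmentI[where u="1/2 + sqrt 3 * g"]) (simp_all add: complex_eq_iff algebra_simps)
  show "dist (pt_G \<sigma>) ?P = 1" "(?P - pt_G \<sigma>) \<bullet> (corner_A - corner_F) = 0"
    unfolding dist_eq_1_iff pt_G_eq hex_corners by (simp_all add: inner_complex_def algebra_simps)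
qed

lemma pt_Q_eq: "pt_Q \<sigma> = Complex (-p) (1/2)"
  unfolding pt_Q_def
proof (rule arc_meets_tangent)
  have "0 \<le> sqrt 3 * p" "sqrt 3 * p \<le> 1/2"
    using p_bounds sqrt3_mult[of p] by linarith+
  then show "Complex (-p) (1/2) \<in> closed_segment corner_A corner_B"
    unfolding hex_corners
    by (intro in_closed_segmentI[where u="1/2 - sqrt 3 * p"]) (simp_all add: complex_eq_iff algebra_simps)
  show "dist (pt_E3 \<sigma>) (Complex (-p) (1/2)) = 1" "(Complex (-p) (1/2) - pt_E3 \<sigma>) \<bullet> (corner_B - corner_A) = 0"
    unfolding dist_eq_1_iff cut_points hex_corners by (simp_all add: inner_complex_def)
qed

text \<open>The point \<open>E\<^sub>2\<close> is at the same distance from \<open>B\<^sub>3\<close> and \<open>C\<^sub>3\<close>: its tangents to both unit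
  circles have length \<open>q - p\<close>. So \<open>J\<close> lies on the segment from \<open>E\<^sub>2\<close> to the midpoint of
  \<open>B\<^sub>3C\<^sub>3\<close>, within distance of order \<open>(q - p)\<^sup>2\<close> of \<open>E\<^sub>2\<close>.\<close>

lemma pt_J_facts:
  "dist (pt_B3 \<sigma>) (pt_J \<sigma>) = 1" "dist (pt_C3 \<sigma>) (pt_J \<sigma>) = 1" "norm (pt_E2 \<sigma> - pt_J \<sigma>) \<le> (q - p) / 5"
proof -
  define Mid where "Mid = (1/2) *\<^sub>R (pt_B3 \<sigma> + pt_C3 \<sigma>)"
  define D where "D = pt_E2 \<sigma> - Mid"
  define h where "h = (1/2) *\<^sub>R (pt_C3 \<sigma> - pt_B3 \<sigma>)"
  have B: "pt_B3 \<sigma> = Mid - h" "pt_C3 \<sigma> = Mid + h"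
    unfolding h_def Mid_def complex_eq_iff by (simp_all add: field_simps)
  have hh: "h \<bullet> h = 1/16 + p\<^sup>2/4"
    by (simp add: h_def cut_points inner_complex_def power2_eq_square field_simps)
  have nz: "h \<noteq> 0" using hh zero_le_power2[of p] by (metis add_pos_nonneg divide_nonneg_pos inner_zero_left less_irrefl zero_less_divide_1_iff zero_less_numeral)
  have s: "(pt_E2 \<sigma> - pt_B3 \<sigma>) \<bullet> (pt_E2 \<sigma> - pt_B3 \<sigma>) = 1 + (q - p)\<^sup>2"
  proof -
    have "pt_E2 \<sigma> - pt_B3 \<sigma> = Complex (ex + (q - p) * ey) (ey - (q - p) * ex)"
      unfolding cut_points using E2_alt E3_alt by (simp add: complex_eq_iff algebra_simps)
    moreover have "Complex (ex + (q - p) * ey) (ey - (q - p) * ex) \<bullet> Complex (ex + (q - p) * ey) (ey - (q - p) * ex)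
      = (ex * ex + ey * ey) * (1 + (q - p)\<^sup>2)" by (simp add: inner_complex_def power2_eq_square algebra_simps)
    ultimately show ?thesis by (simp add: ex_ey_sq)
  qed
  have t: "(pt_E2 \<sigma> - pt_C3 \<sigma>) \<bullet> (pt_E2 \<sigma> - pt_C3 \<sigma>) = 1 + (q - p)\<^sup>2"
    unfolding cut_points by (simp add: inner_complex_def power2_eq_square algebra_simps)
  have "(D + h) \<bullet> (D + h) = 1 + (q - p)\<^sup>2" "(D - h) \<bullet> (D - h) = 1 + (q - p)\<^sup>2"
    using s t unfolding B D_def by (simp_all add: algebra_simps)
  then have Dh: "D \<bullet> h = 0" and DD: "D \<bullet> D = 1 + (q - p)\<^sup>2 - h \<bullet> h"
    by (simp_all add: inner_add_left inner_add_right inner_diff_left inner_diff_right inner_commute)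
  have p2: "p\<^sup>2 \<le> (135/1000)\<^sup>2" using p_bounds by (intro power_mono) auto
  have DD9: "D \<bullet> D \<ge> 9/10"
  proof -
    have "(135/1000)\<^sup>2 \<le> (1/10::real)" by (simp add: power2_eq_square)
    then show ?thesis using DD hh p2 zero_le_power2[of "q - p"] by linarith
  qed
  define \<rho> where "\<rho> = sqrt ((1 - h \<bullet> h) / (D \<bullet> D))"
  have q0: "0 < 1 - h \<bullet> h" using hh p2 by (simp add: power2_eq_square)
  have DDp: "D \<bullet> D > 0" using DD9 by linarith
  then have pos: "(1 - h \<bullet> h) / (D \<bullet> D) > 0" using q0 by (rule_tac divide_pos_pos)
  have "\<rho>\<^sup>2 = (1 - h \<bullet> h) / (D \<bullet> D)" unfolding \<rho>_def using pos by (intro real_sqrt_pow2) linarith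
  then have r2: "\<rho>\<^sup>2 * (D \<bullet> D) = 1 - h \<bullet> h" using DDp by (metis nonzero_eq_divide_eq less_irrefl)
  have r0: "\<rho> > 0" unfolding \<rho>_def using pos by (rule real_sqrt_gt_zero)
  have "(1 - h \<bullet> h) / (D \<bullet> D) \<le> 1" using DD zero_le_power2[of "q - p"] by (subst pos_divide_le_eq[OF DDp]) linarith
  then have r1: "\<rho> \<le> 1" by (simp add: \<rho>_def)
  define J where "J = Mid + \<rho> *\<^sub>R D"
  have d1: "dist (pt_B3 \<sigma>) J = 1" "dist (pt_C3 \<sigma>) J = 1"
    unfolding dist_eq_1_iff B J_def using r2 Dh
    by (simp_all add: inner_add_left inner_add_right inner_diff_left inner_diff_right inner_commute power2_eq_square)
  have J: "pt_J \<sigma> = J" unfolding pt_J_def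
  proof (rule arcs_meet_near_eq[OF _ d1])
    show "pt_B3 \<sigma> \<noteq> pt_C3 \<sigma>" unfolding B using nz by (simp add: complex_eq_iff)
    have "pt_E2 \<sigma> - J = (1 - \<rho>) *\<^sub>R D" "pt_E2 \<sigma> - (pt_B3 \<sigma> + pt_C3 \<sigma> - J) = (1 + \<rho>) *\<^sub>R D"
      unfolding B J_def D_def by (simp_all add: algebra_simps)
    moreover have "norm D > 0" using DDp by auto
    then have "\<bar>1 - \<rho>\<bar> * norm D < \<bar>1 + \<rho>\<bar> * norm D" using r0 r1 by (intro mult_strict_right_mono) auto
    ultimately show "dist (pt_E2 \<sigma>) J < dist (pt_E2 \<sigma>) (pt_B3 \<sigma> + pt_C3 \<sigma> - J)"
      by (simp add: dist_norm)
  qed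
  show "dist (pt_B3 \<sigma>) (pt_J \<sigma>) = 1" "dist (pt_C3 \<sigma>) (pt_J \<sigma>) = 1" using d1 J by simp_all
  have nD: "norm D \<ge> 9/10"
  proof (rule ccontr)
    assume "\<not> norm D \<ge> 9/10"
    then have "(norm D)\<^sup>2 < (9/10)\<^sup>2" by (intro power_strict_mono) auto
    moreover have "(norm D)\<^sup>2 = D \<bullet> D" by (rule power2_norm_eq_inner)
    moreover have "(9/10)\<^sup>2 = (81/100::real)" by (simp add: power2_eq_square)
    ultimately show False using DD9 by linarith
  qed
  have "pt_E2 \<sigma> - J = (1 - \<rho>) *\<^sub>R D" by (simp add: J_def D_def algebra_simps)
  then have "norm (pt_E2 \<sigma> - pt_J \<sigma>) = (1 - \<rho>) * norm D" using r1 J by simp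
  also have "\<dots> \<le> (1 - \<rho>) * (1 + \<rho>) * norm D" using r0 r1 by (intro mult_right_mono) (auto simp: mult_le_cancel_left1)
  also have "\<dots> = ((1 - \<rho>\<^sup>2) * (D \<bullet> D)) / norm D"
  proof -
    have "norm D \<noteq> 0" "D \<bullet> D = norm D * norm D" using nD by (auto simp: power2_norm_eq_inner[symmetric] power2_eq_square)
    then show ?thesis by (simp add: power2_eq_square field_simps)
  qed
  also have "(1 - \<rho>\<^sup>2) * (D \<bullet> D) = (q - p)\<^sup>2" using r2 DD by algebra
  also have "(q - p)\<^sup>2 / norm D \<le> (q - p)\<^sup>2 / (9/10)" using nD by (intro divide_left_mono) auto
  also have "(q - p)\<^sup>2 / (9/10) \<le> (q - p) * (18/100) / (9/10)" unfolding power2_eq_square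
    using p_le_q p_bounds q_bounds by (intro divide_right_mono mult_left_mono) auto
  finally show "norm (pt_E2 \<sigma> - pt_J \<sigma>) \<le> (q - p) / 5" by simp
qed

lemma pt_J_inner:
  assumes "norm u = 1"
  shows "5 * (pt_J \<sigma> \<bullet> u) - 5 * (pt_E2 \<sigma> \<bullet> u) \<le> q - p" "5 * (pt_E2 \<sigma> \<bullet> u) - 5 * (pt_J \<sigma> \<bullet> u) \<le> q - p"
proof -
  have "\<bar>pt_J \<sigma> \<bullet> u - pt_E2 \<sigma> \<bullet> u\<bar> * 5 \<le> q - p"
    using Cauchy_Schwarz_ineq2[of "pt_J \<sigma> - pt_E2 \<sigma>" u] pt_J_facts(3) assms
    by (simp add: norm_minus_commute inner_diff_left)
  then show "5 * (pt_J \<sigma> \<bullet> u) - 5 * (pt_E2 \<sigma> \<bullet> u) \<le> q - p" "5 * (pt_E2 \<sigma> \<bullet> u) - 5 * (pt_J \<sigma> \<bullet> u) \<le> q - p"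
    by (smt (verit))+
qed

text \<open>For \<open>E\<^sub>2\<close> instead of \<open>J\<close> the first two inner products are \<open>q - p\<close> and \<open>- (q - p)\<close>, and \<open>J\<close> is
  within a fifth of \<open>q - p\<close> of \<open>E\<^sub>2\<close>.\<close>

lemma pt_J_position:
  "(pt_J \<sigma> - pt_B3 \<sigma>) \<bullet> Complex ey (-ex) \<ge> 0" "(pt_J \<sigma> - pt_C3 \<sigma>) \<bullet> Complex (-1/2) (sqrt 3/2) \<le> 0"
  "Re (pt_J \<sigma>) < -3/10" "Im (pt_J \<sigma>) < - 3/10"
proof -
  have pq: "0 \<le> q - p" using p_le_q by simp
  have n: "norm (Complex ey (-ex)) = 1" "norm (Complex (-1/2) (sqrt 3/2)) = 1"
    using ex_ey_sq by (simp_all add: cmod_def power2_eq_square algebra_simps)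
  have "(pt_E2 \<sigma> - pt_B3 \<sigma>) \<bullet> Complex ey (-ex) = (q - p) * (ex * ex + ey * ey)"
    unfolding cut_points by (simp add: inner_complex_def field_simps) (use E_integral in algebra)
  then show "(pt_J \<sigma> - pt_B3 \<sigma>) \<bullet> Complex ey (-ex) \<ge> 0"
    using pt_J_inner[OF n(1)] pq unfolding ex_ey_sq inner_diff_left by (smt (verit))
  have "(pt_E2 \<sigma> - pt_C3 \<sigma>) \<bullet> Complex (-1/2) (sqrt 3/2) = - (q - p)"
    unfolding cut_points by (simp add: inner_complex_def algebra_simps)
  then show "(pt_J \<sigma> - pt_C3 \<sigma>) \<bullet> Complex (-1/2) (sqrt 3/2) \<le> 0"
    using pt_J_inner[OF n(2)] pq unfolding inner_diff_left by (smt (verit))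
  have "1732/1000 * q \<le> sqrt 3 * q" using q_bounds sqrt3_mult[of q] by linarith
  then have "Re (pt_E2 \<sigma>) \<le> - 33/100" "Im (pt_E2 \<sigma>) \<le> - 36/100"
    using q_bounds sqrt3_bounds unfolding cut_points complex.sel by linarith+
  moreover have "5 * Re (pt_J \<sigma>) - 5 * Re (pt_E2 \<sigma>) \<le> q - p" "5 * Im (pt_J \<sigma>) - 5 * Im (pt_E2 \<sigma>) \<le> q - p"
    using pt_J_inner(1)[of 1] pt_J_inner(1)[of \<i>] by (simp_all add: inner_complex_def)
  ultimately show "Re (pt_J \<sigma>) < -3/10" "Im (pt_J \<sigma>) < - 3/10"
    using p_bounds q_bounds by linarith+
qed

end

section \<open>The regions removed at the corners C and E\<close>

text \<open>Points on the lines of the sides, at a signed distance from the midpoint of the side; the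
  positive direction leads to \<open>E\<close>, \<open>C\<close>, \<open>F\<close> and \<open>C\<close>, respectively.\<close>

definition DEpt :: "real \<Rightarrow> complex" where "DEpt t = Complex (-t) (-1/2)"
definition CDpt :: "real \<Rightarrow> complex" where "CDpt l = Complex (sqrt 3/4 + l/2) (- 1/4 + sqrt 3*l/2)"
definition EFpt :: "real \<Rightarrow> complex" where "EFpt l = Complex (- sqrt 3/4 - l/2) (- 1/4 + sqrt 3*l/2)"
definition BCpt :: "real \<Rightarrow> complex" where "BCpt l = Complex (sqrt 3/4 + l/2) (1/4 - sqrt 3*l/2)"

lemma CDptE: assumes "sqrt 3 * Re x - Im x = 1" obtains l where "x = CDpt l"
proof
  show "x = CDpt (2 * Re x - sqrt 3/2)"
    using assms by (simp add: CDpt_def complex_eq_iff diff_divide_distrib algebra_simps sqrt3_sq)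
qed

lemma EFptE: assumes "sqrt 3 * Re x + Im x = - 1" obtains l where "x = EFpt l"
proof
  show "x = EFpt (- 2 * Re x - sqrt 3/2)"
    using assms by (simp add: EFpt_def complex_eq_iff diff_divide_distrib algebra_simps sqrt3_sq)
qed

lemma BCptE: assumes "sqrt 3 * Re x + Im x = 1" obtains l where "x = BCpt l"
proof
  show "x = BCpt (2 * Re x - sqrt 3/2)"
    using assms by (simp add: BCpt_def complex_eq_iff diff_divide_distrib algebra_simps sqrt3_sq)
qed

lemma inscribed_touches:
  assumes "inscribed K"
  shows "\<exists>l. CDpt l \<in> K" "\<exists>l. EFpt l \<in> K" "\<exists>l. BCpt l \<in> K" "\<exists>t. DEpt t \<in> K"
proof -
  obtain f where f: "f \<in> K" "f \<bullet> cis (pi/6 + of_int (-1) * (pi/3)) = 1/2"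
    by (rule inscribed_touches_side[OF assms])
  then have "sqrt 3 * Re f - Im f = 1" unfolding cis_sides by (simp add: inner_complex_def algebra_simps)
  then show "\<exists>l. CDpt l \<in> K" using f CDptE by metis
  obtain f where f: "f \<in> K" "f \<bullet> cis (pi/6 + of_int (-3) * (pi/3)) = 1/2"
    by (rule inscribed_touches_side[OF assms])
  then have "sqrt 3 * Re f + Im f = - 1" unfolding cis_sides by (simp add: inner_complex_def algebra_simps)
  then show "\<exists>l. EFpt l \<in> K" using f EFptE by metis
  obtain f where f: "f \<in> K" "f \<bullet> cis (pi/6 + of_int 0 * (pi/3)) = 1/2"
    by (rule inscribed_touches_side[OF assms])
  then have "sqrt 3 * Re f + Im f = 1" unfolding cis_sides by (simp add: inner_complex_def algebra_simps)
  then show "\<exists>l. BCpt l \<in> K" using f BCptE by metis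
  obtain f where f: "f \<in> K" "f \<bullet> cis (pi/6 + of_int (-2) * (pi/3)) = 1/2"
    by (rule inscribed_touches_side[OF assms])
  then have "f = DEpt (- Re f)" unfolding cis_sides by (simp add: inner_complex_def DEpt_def complex_eq_iff)
  then show "\<exists>t. DEpt t \<in> K" using f by metis
qed

lemma CDpt_diff: "CDpt l - CDpt m = (l - m) *\<^sub>R Complex (1/2) (sqrt 3/2)"
  by (simp add: CDpt_def complex_eq_iff field_simps)

lemma segment_disjoint_halfplane:
  fixes u v n :: complex
  assumes "\<And>x. x \<in> V \<Longrightarrow> x \<bullet> n < t" "u \<bullet> n \<ge> t" "v \<bullet> n \<ge> t"
  shows "V \<inter> closed_segment u v = {}"
  using segment_halfplane[of _ u v t n] assms by force

lemma inscribed_diam: "inscribed K \<Longrightarrow> x \<in> K \<Longrightarrow> y \<in> K \<Longrightarrow> dist x y \<le> 1"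
  by (auto simp: inscribed_def constant_width_def)

lemma interior_disjoint_unit_arc:
  assumes "inscribed K" "f \<in> K" "(u - c) \<bullet> (f - c) \<le> 0" "(v - c) \<bullet> (f - c) \<le> 0"
  shows "interior K \<inter> unit_arc c u v = {}"
proof (rule ccontr)
  assume "\<not> ?thesis"
  then obtain x where x: "x \<in> interior K" "x \<in> unit_arc c u v" by blast
  have "dist x f < 1" by (rule interior_dist_less[OF _ x(1) assms(2)]) (rule inscribed_diam[OF assms(1)])
  then show False using unit_arc_far[OF x(2) assms(3,4)] by (simp add: dist_commute)
qed

context slant begin

lemma pt_C3_BC: "pt_C3 \<sigma> = BCpt p" and pt_F3_EF: "pt_F3 \<sigma> = EFpt p" and pt_G_CD: "pt_G \<sigma> = CDpt g"
  and pt_E3_DE: "pt_E3 \<sigma> = DEpt p"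
  unfolding cut_points pt_G_eq BCpt_def EFpt_def CDpt_def DEpt_def by simp_all

lemma placedD:
  assumes "placed K" shows "inscribed K" "constant_width K" "\<And>x. x \<in> K \<Longrightarrow> inHex x"
    "\<And>x. x \<in> K \<Longrightarrow> x \<bullet> Complex cs sn \<le> 1/2" "\<And>x. x \<in> K \<Longrightarrow> x \<bullet> Complex ex ey \<le> 1/2"
  using assms inscribed_inHex cis_cut_E
  by (auto simp: placed_def inscribed_def below_def cis.ctr)

lemma placed_interior:
  assumes "placed K" "x \<in> interior K" shows "x \<bullet> Complex cs sn < 1/2" "x \<bullet> Complex ex ey < 1/2"
  using assms interior_below_less[of K \<sigma> x] interior_below_less[of K "\<sigma> - 2*pi/3" x] cis_cut_E
  by (auto simp: placed_def cis.ctr)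

text \<open>On a side next to a cut corner, the half-plane of the cut bounds the coordinate by that of the
  vertex at which the cut meets the side.\<close>

lemma placed_CD_le_q: "placed K \<Longrightarrow> CDpt l \<in> K \<Longrightarrow> l \<le> q"
proof -
  assume K: "placed K" "CDpt l \<in> K"
  have "CDpt q = pt_C2 \<sigma>" by (simp add: CDpt_def cut_points)
  then have "CDpt q \<bullet> Complex cs sn = 1/2 * (cs * cs + sn * sn)"
    unfolding C2_alt by (simp add: inner_complex_def algebra_simps)
  then have 1: "CDpt q \<bullet> Complex cs sn = 1/2" by (simp add: cos_sin_sq)
  have "CDpt l \<bullet> Complex cs sn \<le> 1/2" using placedD[OF K(1)] K(2) by blast
  then have "(CDpt l - CDpt q) \<bullet> Complex cs sn \<le> 0" using 1 by (simp add: inner_diff_left)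
  then have "(l - q) * (cs + sqrt 3 * sn) \<le> 0" unfolding CDpt_diff by (simp add: inner_complex_def algebra_simps)
  then show ?thesis using C_cut_slope by (simp add: mult_le_0_iff)
qed

lemma placed_BC_le_p: "placed K \<Longrightarrow> BCpt l \<in> K \<Longrightarrow> l \<le> p"
proof -
  assume K: "placed K" "BCpt l \<in> K"
  have "BCpt p = pt_C3 \<sigma>" by (simp add: BCpt_def cut_points)
  then have "BCpt p \<bullet> Complex cs sn = 1/2 * (cs * cs + sn * sn)"
    unfolding C3_alt by (simp add: inner_complex_def algebra_simps)
  then have 1: "BCpt p \<bullet> Complex cs sn = 1/2" by (simp add: cos_sin_sq)
  have "BCpt l \<bullet> Complex cs sn \<le> 1/2" using placedD[OF K(1)] K(2) by blast
  then have "(BCpt l - BCpt p) \<bullet> Complex cs sn \<le> 0" using 1 by (simp add: inner_diff_left)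
  then have "(l - p) * (cs - sqrt 3 * sn) \<le> 0" by (simp add: BCpt_def inner_complex_def algebra_simps)
  then show ?thesis using C_cut_slope by (simp add: mult_le_0_iff)
qed

lemma placed_DE_le_p: "placed K \<Longrightarrow> DEpt t \<in> K \<Longrightarrow> t \<le> p"
proof -
  assume K: "placed K" "DEpt t \<in> K"
  have "DEpt p \<bullet> Complex ex ey = 1/2 * (ex * ex + ey * ey)"
    by (simp add: DEpt_def inner_complex_def field_simps) (use E_integral in algebra)
  then have 1: "DEpt p \<bullet> Complex ex ey = 1/2" by (simp add: ex_ey_sq)
  have "DEpt t \<bullet> Complex ex ey \<le> 1/2" using placedD[OF K(1)] K(2) by blast
  then have "(DEpt t - DEpt p) \<bullet> Complex ex ey \<le> 0" using 1 by (simp add: inner_diff_left)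
  then have "(t - p) * (- 2 * ex) \<le> 0" by (simp add: DEpt_def inner_complex_def algebra_simps)
  moreover have "0 < - 2 * ex" using integral_eqs(5) C_cut_slope by linarith
  ultimately show ?thesis using mult_pos_pos[of "t - p" "- 2 * ex"] by linarith
qed

lemma placed_reaches_F:
  assumes "placed K"
  obtains f where "f \<in> K" "f \<bullet> Complex cs sn \<le> -1/2" "inHex f"
  using assms below_imp_reaches_opposite[of K \<sigma>] placedD[OF assms] by (auto simp: placed_def cis.ctr)

lemma placed_reaches_B:
  assumes "placed K"
  obtains f where "f \<in> K" "f \<bullet> Complex ex ey \<le> -1/2" "inHex f"
  using assms below_imp_reaches_opposite[of K "\<sigma> - 2*pi/3"] placedD[OF assms]
  by (auto simp: placed_def cis_cut_E)

lemma F3_inner: "pt_F3 \<sigma> \<bullet> Complex cs sn = -1/2"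
proof -
  have "pt_F3 \<sigma> \<bullet> Complex cs sn = -1/2 * (cs * cs + sn * sn)"
    unfolding F3_alt by (simp add: inner_complex_def algebra_simps)
  then show ?thesis by (simp add: cos_sin_sq)
qed

text \<open>At \<open>F\<^sub>3\<close> the hexagon beyond the cut of corner \<open>F\<close> spans a cone, bounded by the side \<open>EF\<close> and by the
  line of the cut. The polar cone is spanned by the normal of \<open>EF\<close> and by \<open>cis \<sigma>\<close>; it contains the
  direction of \<open>K\<close> and those of the points of \<open>CD\<close> up to \<open>C\<^sub>2\<close>.\<close>

lemma F_corner_polar:
  assumes "f \<bullet> Complex cs sn \<le> -1/2" "inHex f"
  shows "Complex cs sn \<bullet> (f - pt_F3 \<sigma>) \<le> 0"
    "p \<le> l \<Longrightarrow> l \<le> q \<Longrightarrow> Complex (sqrt 3/2 + (l+p)/2) (sqrt 3/2 * (l - p)) \<bullet> (f - pt_F3 \<sigma>) \<le> 0"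
proof -
  show 1: "Complex cs sn \<bullet> (f - pt_F3 \<sigma>) \<le> 0"
    using assms(1) F3_inner by (simp add: inner_diff_right inner_commute)
  have 2: "Complex (- sqrt 3/2) (-1/2) \<bullet> (f - pt_F3 \<sigma>) \<le> 0"
    using assms(2) unfolding cut_points by (simp add: inHex_def inner_complex_def abs_le_iff field_simps)
  assume l: "p \<le> l" "l \<le> q"
  then have gp: "0 \<le> l - p" "0 \<le> q - p" "0 \<le> q - l" by auto
  show "Complex (sqrt 3/2 + (l+p)/2) (sqrt 3/2 * (l - p)) \<bullet> (f - pt_F3 \<sigma>) \<le> 0"
  proof (rule cone_inner_nonpos[OF _ _ _ 2 1])
    show "0 < det2 (Complex (- sqrt 3/2) (-1/2)) (Complex cs sn)"
      using C_cut_slope(2) by (simp add: det2_def field_simps)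
    have "det2 (Complex (- sqrt 3/2) (-1/2)) (Complex (sqrt 3/2 + (l+p)/2) (sqrt 3/2 * (l - p))) = (sqrt 3 + 4 * p - 2 * l) / 4"
      by (simp add: det2_def field_simps)
    moreover have "0 \<le> (sqrt 3 + 4 * p - 2 * l) / 4" using l q_bounds p_bounds sqrt3_bounds by simp
    ultimately show "0 \<le> det2 (Complex (- sqrt 3/2) (-1/2)) (Complex (sqrt 3/2 + (l+p)/2) (sqrt 3/2 * (l - p)))" by simp
    have "det2 (Complex (sqrt 3/2 + (l+p)/2) (sqrt 3/2 * (l - p))) (Complex cs sn) = (q - p) + (q - l) * (sqrt 3 * cs - sn) / 2"
      by (simp add: det2_def field_simps) (use integral_eqs cos_sin_sq sqrt3_sq(1) in algebra)
    moreover have "0 \<le> sqrt 3 * cs - sn" using sqrt3_mult[of cs] cos_slant_pos sin_slant_less by linarith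
    then have "0 \<le> (q - p) + (q - l) * (sqrt 3 * cs - sn) / 2" using gp
      by (intro add_nonneg_nonneg divide_nonneg_nonneg mult_nonneg_nonneg) auto
    ultimately show "0 \<le> det2 (Complex (sqrt 3/2 + (l+p)/2) (sqrt 3/2 * (l - p))) (Complex cs sn)" by (simp only:)
  qed
qed

text \<open>The arc is far from a point of \<open>K\<close> in corner \<open>F\<close>; the segments lie on the lines of \<open>CD\<close> and of
  the cut.\<close>

lemma placed_disjoint_C_S:
  assumes K: "placed K" shows "interior K \<inter> region_C_S \<sigma> = {}"
  unfolding region_C_S_def
proof -
  obtain f where f: "f \<in> K" "f \<bullet> Complex cs sn \<le> -1/2" "inHex f" using placed_reaches_F[OF K] .
  note ins = placedD(1)[OF K]
  let ?\<Gamma> = "unit_arc (pt_F3 \<sigma>) (pt_K \<sigma>) (pt_G \<sigma>) \<union> closed_segment (pt_G \<sigma>) (pt_C2 \<sigma>) \<union> closed_segment (pt_C2 \<sigma>) (pt_K \<sigma>)"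
  have KF: "pt_K \<sigma> - pt_F3 \<sigma> = Complex cs sn" unfolding pt_K_eq F3_alt by (simp add: complex_eq_iff)
  have GF: "pt_G \<sigma> - pt_F3 \<sigma> = F3G" unfolding pt_G_eq cut_points by (simp add: complex_eq_iff field_simps)
  have pn: "0 \<le> p * sn" "0 \<le> q * sn" using p_bounds p_le_q sin_slant_nonneg by auto
  obtain v where v: "v \<in> interior K" "v \<bullet> 1 < 0"
  proof -
    obtain l where l: "EFpt l \<in> K" using inscribed_touches[OF ins] by blast
    have "inHex (EFpt l)" using placedD[OF K] l by blast
    then have "\<bar>sqrt 3 * l\<bar> \<le> 1/2" by (auto simp: inHex_def EFpt_def field_simps abs_le_iff)
    then have "sqrt 3 * (- l) \<le> 1/2" by (simp add: abs_le_iff)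
    have "EFpt l \<bullet> 1 < 0"
    proof (rule ccontr)
      assume "\<not> EFpt l \<bullet> 1 < 0"
      then have "- l \<ge> sqrt 3/2" by (simp add: EFpt_def inner_complex_def)
      then have "sqrt 3 * (- l) \<ge> sqrt 3 * (sqrt 3/2)" by (intro mult_left_mono) auto
      then show False using \<open>sqrt 3 * (- l) \<le> 1/2\<close> by simp
    qed
    then show ?thesis using constant_width_interior_point[OF placedD(2)[OF K] l] that by blast
  qed
  show "interior K \<inter> bounded_region ?\<Gamma> = {}"
  proof (rule convex_disjoint_bounded_region[OF _ _ _ v])
    show "convex (interior K)" using placedD(2)[OF K] by (simp add: constant_width_def)
    have "interior K \<inter> unit_arc (pt_F3 \<sigma>) (pt_K \<sigma>) (pt_G \<sigma>) = {}"
      by (rule interior_disjoint_unit_arc[OF ins f(1)], unfold KF GF)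
        (rule F_corner_polar(1)[OF f(2,3)], rule F_corner_polar(2)[OF f(2,3) g(1,2)])
    moreover have "interior K \<inter> closed_segment (pt_G \<sigma>) (pt_C2 \<sigma>) = {}"
      by (rule segment_disjoint_halfplane[where n="Complex (sqrt 3/2) (-1/2)" and t="1/2"])
        (use inscribed_interior(4)[OF ins] in \<open>auto simp: pt_G_eq cut_points inner_complex_def field_simps\<close>)
    moreover have "interior K \<inter> closed_segment (pt_C2 \<sigma>) (pt_K \<sigma>) = {}"
    proof (rule segment_disjoint_halfplane[where n="Complex cs sn" and t="1/2"])
      have "pt_C2 \<sigma> \<bullet> Complex cs sn = 1/2 * (cs * cs + sn * sn)" "pt_K \<sigma> \<bullet> Complex cs sn = 1/2 * (cs * cs + sn * sn)"
        unfolding pt_K_eq C2_alt by (simp_all add: inner_complex_def algebra_simps)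
      then show "pt_C2 \<sigma> \<bullet> Complex cs sn \<ge> 1/2" "pt_K \<sigma> \<bullet> Complex cs sn \<ge> 1/2" by (simp_all add: cos_sin_sq)
    qed (rule placed_interior[OF K])
    ultimately show "interior K \<inter> ?\<Gamma> = {}" by blast
    have h: "pt_K \<sigma> \<bullet> 1 \<ge> 0" "pt_G \<sigma> \<bullet> 1 \<ge> 0" "pt_C2 \<sigma> \<bullet> 1 \<ge> 0" "pt_F3 \<sigma> \<bullet> 1 \<le> 0"
      using pn cos_slant_pos p_bounds g_bounds sqrt3_bounds unfolding pt_K_eq C2_alt pt_G_eq cut_points
      by (simp_all add: inner_complex_def)
    have d: "dist (pt_F3 \<sigma>) (pt_K \<sigma>) = 1" "dist (pt_F3 \<sigma>) (pt_G \<sigma>) = 1"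
      unfolding dist_eq_1_iff KF GF using norm_F3G cos_sin_sq by (simp_all add: inner_complex_def)
    show "x \<bullet> 1 \<ge> 0" if "x \<in> ?\<Gamma>" for x
    proof -
      from that consider "x \<in> unit_arc (pt_F3 \<sigma>) (pt_K \<sigma>) (pt_G \<sigma>)"
        | "x \<in> closed_segment (pt_G \<sigma>) (pt_C2 \<sigma>)" | "x \<in> closed_segment (pt_C2 \<sigma>) (pt_K \<sigma>)" by blast
      then show ?thesis
      proof cases
        case 1 show ?thesis by (rule unit_arc_halfplane[OF 1 d h(1,2,4)])
      next
        case 2 show ?thesis by (rule segment_halfplane[OF 2 h(2,3)])
      next
        case 3 show ?thesis by (rule segment_halfplane[OF 3 h(3,1)])
      qed
    qed
  qed simp
qed

text \<open>The cone at \<open>B\<^sub>3\<close> of the part of the hexagon beyond the cut of corner \<open>B\<close> is treated like the one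
  at \<open>F\<^sub>3\<close>.\<close>

lemma J_arc_polar:
  assumes "f \<bullet> Complex ex ey \<le> -1/2" "inHex f"
  shows "(pt_I \<sigma> - pt_B3 \<sigma>) \<bullet> (f - pt_B3 \<sigma>) \<le> 0" "(pt_J \<sigma> - pt_B3 \<sigma>) \<bullet> (f - pt_B3 \<sigma>) \<le> 0"
proof -
  have "pt_B3 \<sigma> \<bullet> Complex ex ey = -1/2 * (ex * ex + ey * ey)"
    unfolding cut_points by (simp add: inner_complex_def field_simps) (use E_integral in algebra)
  then have B: "pt_B3 \<sigma> \<bullet> Complex ex ey = -1/2" by (simp add: ex_ey_sq)
  show 1: "(pt_I \<sigma> - pt_B3 \<sigma>) \<bullet> (f - pt_B3 \<sigma>) \<le> 0"
    unfolding I_minus_B3 using assms(1) B by (simp add: inner_diff_right inner_commute)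
  have "Im f \<le> 1/2" using assms(2) abs_ge_self[of "Im f"] unfolding inHex_def by linarith
  then have 2: "\<i> \<bullet> (f - pt_B3 \<sigma>) \<le> 0" unfolding cut_points by (simp add: inner_complex_def)
  have exn: "ex < 0" using integral_eqs(5) C_cut_slope by linarith
  show "(pt_J \<sigma> - pt_B3 \<sigma>) \<bullet> (f - pt_B3 \<sigma>) \<le> 0"
  proof (rule cone_inner_nonpos[OF _ _ _ 2 1])
    show "0 < det2 \<i> (pt_I \<sigma> - pt_B3 \<sigma>)" unfolding I_minus_B3 using exn by (simp add: det2_def)
    show "0 \<le> det2 \<i> (pt_J \<sigma> - pt_B3 \<sigma>)" using pt_J_position(3) p_bounds unfolding cut_points by (simp add: det2_def)
    show "0 \<le> det2 (pt_J \<sigma> - pt_B3 \<sigma>) (pt_I \<sigma> - pt_B3 \<sigma>)"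
      unfolding I_minus_B3 using pt_J_position(1) by (simp add: det2_def inner_complex_def algebra_simps)
  qed
qed

text \<open>The arc about \<open>B\<^sub>3\<close> is far from a point of \<open>K\<close> in corner \<open>B\<close>. The arc about \<open>C\<^sub>3\<close> is far from
  the point where \<open>K\<close> touches \<open>BC\<close>, because this point lies on the side of \<open>C\<^sub>3\<close> towards \<open>B\<close>.\<close>

lemma placed_disjoint_E_arcs:
  assumes K: "placed K"
  shows "interior K \<inter> unit_arc (pt_B3 \<sigma>) (pt_I \<sigma>) (pt_J \<sigma>) = {}"
    "interior K \<inter> unit_arc (pt_C3 \<sigma>) (pt_J \<sigma>) (pt_H \<sigma>) = {}"
proof -
  note ins = placedD(1)[OF K]
  obtain f where f: "f \<in> K" "f \<bullet> Complex ex ey \<le> -1/2" "inHex f" using placed_reaches_B[OF K] .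
  show "interior K \<inter> unit_arc (pt_B3 \<sigma>) (pt_I \<sigma>) (pt_J \<sigma>) = {}"
    by (rule interior_disjoint_unit_arc[OF ins f(1)]) (rule J_arc_polar[OF f(2,3)])+
  obtain l where l: "BCpt l \<in> K" using inscribed_touches[OF ins] by blast
  have lp: "l \<le> p" using placed_BC_le_p[OF K l] .
  have e: "BCpt l - pt_C3 \<sigma> = (p - l) *\<^sub>R Complex (-1/2) (sqrt 3/2)"
    unfolding pt_C3_BC BCpt_def by (simp add: complex_eq_iff field_simps)
  show "interior K \<inter> unit_arc (pt_C3 \<sigma>) (pt_J \<sigma>) (pt_H \<sigma>) = {}"
  proof (rule interior_disjoint_unit_arc[OF ins l], unfold e)
    show "(pt_J \<sigma> - pt_C3 \<sigma>) \<bullet> (p - l) *\<^sub>R Complex (- 1 / 2) (sqrt 3 / 2) \<le> 0"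
      using pt_J_position(2) lp by (simp add: mult_nonneg_nonpos)
    show "(pt_H \<sigma> - pt_C3 \<sigma>) \<bullet> (p - l) *\<^sub>R Complex (- 1 / 2) (sqrt 3 / 2) \<le> 0"
      unfolding pt_H_eq cut_points by (simp add: inner_complex_def field_simps)
  qed
qed

lemma placed_disjoint_E_S:
  assumes K: "placed K" shows "interior K \<inter> region_E_S \<sigma> = {}"
  unfolding region_E_S_def
proof -
  note ins = placedD(1)[OF K]
  let ?\<Gamma> = "unit_arc (pt_B3 \<sigma>) (pt_I \<sigma>) (pt_J \<sigma>) \<union> unit_arc (pt_C3 \<sigma>) (pt_J \<sigma>) (pt_H \<sigma>) \<union>
      closed_segment (pt_H \<sigma>) (pt_E2 \<sigma>) \<union> closed_segment (pt_E2 \<sigma>) (pt_I \<sigma>)"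
  let ?e = "Complex (-1/2) (- sqrt 3/2)"
  obtain v where v: "v \<in> interior K" "v \<bullet> ?e < 0"
  proof -
    obtain l where l: "BCpt l \<in> K" using inscribed_touches[OF ins] by blast
    have "l \<le> p" using placed_BC_le_p[OF K l] .
    then have "BCpt l \<bullet> ?e < 0" using p_bounds sqrt3_bounds by (simp add: BCpt_def inner_complex_def field_simps)
    then show ?thesis using constant_width_interior_point[OF placedD(2)[OF K] l] that by blast
  qed
  have Ie: "pt_I \<sigma> \<bullet> ?e \<ge> 0"
  proof -
    have "2 * (pt_I \<sigma> \<bullet> ?e) = 2 * (pt_B3 \<sigma> \<bullet> ?e) - ex - sqrt 3 * ey"
      using I_minus_B3 by (simp add: complex_eq_iff inner_complex_def algebra_simps)
    moreover have "- ex - sqrt 3 * ey = 2 * cs" using integral_eqs(5,6) sqrt3_sq(1) by algebra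
    moreover have "2 * (pt_B3 \<sigma> \<bullet> ?e) = - p - sqrt 3/2" unfolding cut_points by (simp add: inner_complex_def)
    ultimately show ?thesis using cs_gt p_bounds sqrt3_bounds by linarith
  qed
  show "interior K \<inter> bounded_region ?\<Gamma> = {}"
  proof (rule convex_disjoint_bounded_region[OF _ _ _ v])
    show "convex (interior K)" using placedD(2)[OF K] by (simp add: constant_width_def)
    have "interior K \<inter> closed_segment (pt_H \<sigma>) (pt_E2 \<sigma>) = {}"
      by (rule segment_disjoint_halfplane[where n="Complex (-sqrt 3/2) (-1/2)" and t="1/2"])
        (use inscribed_interior(6)[OF ins] in \<open>auto simp: pt_H_eq cut_points inner_complex_def field_simps\<close>)
    moreover have "interior K \<inter> closed_segment (pt_E2 \<sigma>) (pt_I \<sigma>) = {}"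
    proof (rule segment_disjoint_halfplane[where n="Complex ex ey" and t="1/2"])
      have "pt_E2 \<sigma> = Complex (ex/2 + q * ey) (ey/2 - q * ex)" unfolding cut_points E2_alt ..
      then have "pt_E2 \<sigma> \<bullet> Complex ex ey = 1/2 * (ex * ex + ey * ey)" "pt_I \<sigma> \<bullet> Complex ex ey = 1/2 * (ex * ex + ey * ey)"
        unfolding pt_I_eq by (simp_all add: inner_complex_def algebra_simps)
      then show "pt_E2 \<sigma> \<bullet> Complex ex ey \<ge> 1/2" "pt_I \<sigma> \<bullet> Complex ex ey \<ge> 1/2" by (simp_all add: ex_ey_sq)
    qed (rule placed_interior[OF K])
    ultimately show "interior K \<inter> ?\<Gamma> = {}" using placed_disjoint_E_arcs[OF K] by blast
    have "0 \<le> sqrt 3 * q" "0 \<le> sqrt 3 * p" using p_bounds q_bounds by auto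
    moreover have "sqrt 3 * Im (pt_J \<sigma>) \<le> 0" using pt_J_position(4) by (simp add: mult_le_0_iff)
    ultimately have h: "pt_I \<sigma> \<bullet> ?e \<ge> 0" "pt_J \<sigma> \<bullet> ?e \<ge> 0" "pt_H \<sigma> \<bullet> ?e \<ge> 0" "pt_E2 \<sigma> \<bullet> ?e \<ge> 0"
      "pt_B3 \<sigma> \<bullet> ?e \<le> 0" "pt_C3 \<sigma> \<bullet> ?e \<le> 0"
      using Ie pt_J_position(3) p_bounds q_bounds sqrt3_bounds unfolding pt_H_eq cut_points
      by (simp_all add: inner_complex_def field_simps)
    have d: "dist (pt_B3 \<sigma>) (pt_I \<sigma>) = 1" "dist (pt_C3 \<sigma>) (pt_H \<sigma>) = 1"
      unfolding dist_eq_1_iff I_minus_B3 using ex_ey_sq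
      by (simp_all add: pt_H_eq cut_points inner_complex_def field_simps)
    show "x \<bullet> ?e \<ge> 0" if "x \<in> ?\<Gamma>" for x
    proof -
      from that consider "x \<in> unit_arc (pt_B3 \<sigma>) (pt_I \<sigma>) (pt_J \<sigma>)"
        | "x \<in> unit_arc (pt_C3 \<sigma>) (pt_J \<sigma>) (pt_H \<sigma>)"
        | "x \<in> closed_segment (pt_H \<sigma>) (pt_E2 \<sigma>)" | "x \<in> closed_segment (pt_E2 \<sigma>) (pt_I \<sigma>)" by blast
      then show ?thesis
      proof cases
        case 1 show ?thesis by (rule unit_arc_halfplane[OF 1 d(1) pt_J_facts(1) h(1,2,5)])
      next
        case 2 show ?thesis by (rule unit_arc_halfplane[OF 2 pt_J_facts(2) d(2) h(2,3,6)])
      next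
        case 3 show ?thesis by (rule segment_halfplane[OF 3 h(3,4)])
      next
        case 4 show ?thesis by (rule segment_halfplane[OF 4 h(4,1)])
      qed
    qed
  qed (simp add: complex_eq_iff)
qed

end

section \<open>The parametrised region at corner A\<close>

lemma dist_less_iff_sq: "dist a x < dist b y \<longleftrightarrow> (x - a) \<bullet> (x - a) < (y - b) \<bullet> (y - b)" for a b x y :: complex
  by (simp add: dist_norm norm_minus_commute[of _ x] norm_minus_commute[of _ y] norm_lt)

text \<open>The coordinate on \<open>CD\<close> of the point \<open>L(s)\<close>; the other end of the unit segment has the
  coordinate \<open>lam (- s)\<close> on \<open>EF\<close>.\<close>

definition lam :: "real \<Rightarrow> real" where
  "lam s = cos s - sqrt 3/2 - sqrt 3/3 * sin s"

lemma lam_less: assumes "- (pi/6) \<le> a" "a < b" "b \<le> pi/6" shows "lam b < lam a"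
proof -
  have e: "lam s = 2 * sqrt 3/3 * cos (s + pi/6) - sqrt 3/2" for s
    unfolding cos_add lam_def cos_30 sin_30 by (simp add: field_simps)
  have "cos (b + pi/6) < cos (a + pi/6)" using assms by (intro cos_monotone_0_pi) auto
  then show ?thesis unfolding e by simp
qed

lemma sqrt3_mult_le_half: assumes "\<bar>l\<bar> \<le> sqrt 3/6" shows "sqrt 3 * l \<le> 1/2" "- 1/2 \<le> sqrt 3 * l"
proof -
  have "sqrt 3 * l \<le> sqrt 3 * (sqrt 3/6)" "sqrt 3 * (- l) \<le> sqrt 3 * (sqrt 3/6)"
    using assms by (intro mult_left_mono; simp add: abs_le_iff)+
  then show "sqrt 3 * l \<le> 1/2" "- 1/2 \<le> sqrt 3 * l" by simp_all
qed

lemma CDpt_in_segment: "CDpt l \<in> closed_segment corner_D corner_C \<longleftrightarrow> \<bar>l\<bar> \<le> sqrt 3/6"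
proof
  assume "\<bar>l\<bar> \<le> sqrt 3/6"
  from sqrt3_mult_le_half[OF this] show "CDpt l \<in> closed_segment corner_D corner_C" unfolding hex_corners
    by (intro in_closed_segmentI[where u="1/2 + sqrt 3 * l"])
      (simp_all add: CDpt_def complex_eq_iff field_simps sqrt3_sq)
next
  assume "CDpt l \<in> closed_segment corner_D corner_C"
  then obtain u where "0 \<le> u" "u \<le> 1" "CDpt l = corner_D + u *\<^sub>R (corner_C - corner_D)"
    unfolding in_segment_from by blast
  then have "u * sqrt 3 / 6 = sqrt 3/4 + l/2 - sqrt 3/6" "0 \<le> u * sqrt 3" "u * sqrt 3 \<le> 1 * sqrt 3"
    unfolding hex_corners by (auto simp: CDpt_def complex_eq_iff intro!: mult_right_mono)
  then show "\<bar>l\<bar> \<le> sqrt 3/6" by (simp add: abs_le_iff)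
qed

lemma EFpt_in_segment: "\<bar>l\<bar> \<le> sqrt 3/6 \<Longrightarrow> EFpt l \<in> closed_segment corner_E corner_F"
proof -
  assume l: "\<bar>l\<bar> \<le> sqrt 3/6"
  from sqrt3_mult_le_half[OF this] show ?thesis unfolding hex_corners
    by (intro in_closed_segmentI[where u="1/2 + sqrt 3 * l"])
      (simp_all add: EFpt_def complex_eq_iff field_simps sqrt3_sq)
qed

lemma pt_L_eq: assumes "\<bar>lam s\<bar> \<le> sqrt 3/6" "\<bar>lam (-s)\<bar> \<le> sqrt 3/6" shows "pt_L s = CDpt (lam s)"
  unfolding pt_L_def
proof (rule the_equality)
  have sg: "sgn (corner_D - corner_E) = 1"
    unfolding hex_corners by (simp add: complex_eq_iff sgn_div_norm cmod_def)
  have "CDpt (lam s) - cis (- s) * sgn (corner_D - corner_E) = EFpt (lam (-s))"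
    unfolding sg by (simp add: CDpt_def EFpt_def lam_def complex_eq_iff algebra_simps sqrt3_sq)
      (simp add: field_simps)?
  then show "CDpt (lam s) \<in> closed_segment corner_D corner_C \<and>
    CDpt (lam s) - cis (- s) * sgn (corner_D - corner_E) \<in> closed_segment corner_E corner_F"
    using assms CDpt_in_segment EFpt_in_segment by simp
  fix x assume x: "x \<in> closed_segment corner_D corner_C \<and>
    x - cis (- s) * sgn (corner_D - corner_E) \<in> closed_segment corner_E corner_F"
  obtain u where u: "x = corner_D + u *\<^sub>R (corner_C - corner_D)" using x unfolding in_segment_from by blast
  have 1: "sqrt 3 * Re x - Im x = 1" unfolding u hex_corners by (simp add: algebra_simps sqrt3_sq)
  obtain v where v: "x - cis (- s) = corner_E + v *\<^sub>R (corner_F - corner_E)" using x unfolding sg in_segment_from by auto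
  have 2: "sqrt 3 * Re (x - cis (-s)) + Im (x - cis (-s)) = -1" unfolding v hex_corners
    by (simp add: algebra_simps sqrt3_sq)
  have "2 * sqrt 3 * Re x = sqrt 3 * cos s - sin s" using 1 2 by (simp add: algebra_simps)
  then have "sqrt 3 * (2 * sqrt 3 * Re x) = sqrt 3 * (sqrt 3 * cos s - sin s)" by simp
  then have "6 * Re x = 3 * cos s - sqrt 3 * sin s" by (simp add: algebra_simps sqrt3_sq)
  then have R: "Re x = sqrt 3/4 + lam s/2" by (simp add: lam_def field_simps)
  moreover have "Im x = sqrt 3 * Re x - 1" using 1 by simp
  ultimately show "x = CDpt (lam s)" by (simp add: CDpt_def complex_eq_iff algebra_simps)
qed

lemma pt_N_eq: "pt_N t = DEpt t"
proof -
  have "sgn (corner_E - corner_D) = -1"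
    unfolding hex_corners by (simp add: complex_eq_iff sgn_div_norm cmod_def)
  then show ?thesis unfolding pt_N_def hex_corners by (simp add: DEpt_def midpoint_def complex_eq_iff)
qed

text \<open>Two unit circles meet in a pair of points symmetric about the midpoint of their centres;
  with centres on \<open>DC\<close> and \<open>ED\<close>, the point in the second quadrant is the one closest to \<open>A\<close>.\<close>

lemma arcs_meet_near_A:
  assumes "dist c x = 1" "dist d x = 1" "Re x \<le> 0" "0 \<le> Im x"
    "0 < Re c + Re d" "Im c + Im d < 0" "c \<noteq> d"
  shows "arcs_meet_near corner_A c d = x"
proof (rule arcs_meet_near_eq[OF assms(7,1,2)])
  define y where "y = c + d - x"
  have "(y - corner_A) \<bullet> (y - corner_A) - (x - corner_A) \<bullet> (x - corner_A)
    = (y - x) \<bullet> (c + d - 2 *\<^sub>R corner_A)"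
    by (simp add: y_def inner_complex_def algebra_simps)
  moreover have "0 < Re (y - x) * Re (c + d - 2 *\<^sub>R corner_A)"
    using assms sqrt3_bounds by (intro mult_pos_pos) (simp_all add: y_def hex_corners)
  moreover have "0 < Im (y - x) * Im (c + d - 2 *\<^sub>R corner_A)"
    using assms by (intro mult_neg_neg) (simp_all add: y_def hex_corners)
  ultimately show "dist corner_A x < dist corner_A (c + d - x)"
    unfolding y_def[symmetric] dist_less_iff_sq by (simp add: inner_complex_def)
qed

lemma unit_circles_meet_left:
  fixes c d :: complex
  assumes "c \<noteq> d" "(c - d) \<bullet> (c - d) \<le> 4"
  defines "k \<equiv> sqrt (1 / ((c - d) \<bullet> (c - d)) - 1/4)"
  defines "x \<equiv> (1/2) *\<^sub>R (c + d) + k *\<^sub>R (\<i> * (c - d))"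
  shows "dist c x = 1" "dist d x = 1"
proof -
  define e where "e = c - d"
  have e0: "e \<bullet> e > 0" using assms(1) by (simp add: e_def)
  have "1 / (e \<bullet> e) \<ge> 1/4" using assms(2) e0 by (simp add: e_def field_simps)
  then have "k\<^sup>2 = 1 / (e \<bullet> e) - 1/4" by (simp add: k_def e_def)
  then have "k\<^sup>2 * (e \<bullet> e) = 1 - (e \<bullet> e) / 4" using e0 by (simp add: left_diff_distrib)
  moreover have o: "(\<i> * e) \<bullet> e = 0" "(\<i> * e) \<bullet> (\<i> * e) = e \<bullet> e" by (simp_all add: inner_complex_def algebra_simps)
  ultimately have kk: "(r *\<^sub>R e + k *\<^sub>R (\<i> * e)) \<bullet> (r *\<^sub>R e + k *\<^sub>R (\<i> * e)) = 1" if "r * r = 1/4" for r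
    using that by (simp add: inner_add_left inner_add_right inner_commute[of e "\<i> * e"] power2_eq_square mult.assoc[symmetric])
  have x: "x - c = (-1/2) *\<^sub>R e + k *\<^sub>R (\<i> * e)" "x - d = (1/2) *\<^sub>R e + k *\<^sub>R (\<i> * e)"
    by (simp_all add: x_def e_def complex_eq_iff field_simps)
  show "dist c x = 1" "dist d x = 1" unfolding dist_eq_1_iff x
    by (rule kk, simp)+
qed

context slant begin

abbreviation "\<theta> \<equiv> ang_theta \<sigma>"
abbreviation "u60 \<equiv> Complex (1/2) (sqrt 3/2)"

lemma cis_theta: "cis \<theta> = F3G"
proof -
  have e: "(pt_G \<sigma> - pt_F3 \<sigma>) / (corner_D - corner_E) = of_real (sqrt 3) * F3G"
  proof -
    have 1: "pt_G \<sigma> - pt_F3 \<sigma> = F3G" unfolding pt_G_eq cut_points by (simp add: complex_eq_iff field_simps)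
    have 2: "corner_D - corner_E = of_real (1 / sqrt 3)" unfolding hex_corners
      by (simp add: complex_eq_iff real_div_sqrt field_simps)
    show ?thesis unfolding 1 2 by simp
  qed
  have n: "norm F3G = 1" using norm_F3G by (simp add: norm_eq_1)
  have "of_real (sqrt 3) * F3G \<noteq> 0" using n by auto
  then have "cis \<theta> = sgn (of_real (sqrt 3) * F3G)" unfolding ang_theta_def e by (rule cis_Arg)
  also have "\<dots> = sgn F3G" by (simp add: sgn_div_norm norm_mult scaleR_conv_of_real field_simps)
  also have "\<dots> = F3G" using n by (simp add: sgn_div_norm)
  finally show ?thesis .
qed

lemma theta: "cos \<theta> = sqrt 3/2 + (g+p)/2" "sin \<theta> = sqrt 3/2 * (g - p)" "0 \<le> \<theta>" "\<theta> \<le> pi/6"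
proof -
  show c: "cos \<theta> = sqrt 3/2 + (g+p)/2" and s: "sin \<theta> = sqrt 3/2 * (g - p)"
    using cis_theta by (simp_all add: complex_eq_iff)
  have b: "- pi < \<theta>" "\<theta> \<le> pi" unfolding ang_theta_def using mpi_less_Arg Arg_le_pi by auto
  have s0: "0 \<le> sin \<theta>" unfolding s using g by simp
  show t0: "0 \<le> \<theta>"
  proof (rule ccontr)
    assume "\<not> 0 \<le> \<theta>"
    then have "0 < sin (- \<theta>)" using b by (intro sin_gt_zero) auto
    then show False using s0 by simp
  qed
  have "cos (pi/6) \<le> cos \<theta>" unfolding c cos_30 using p_bounds g by simp
  then show "\<theta> \<le> pi/6" using cos_mono_le_eq[of "pi/6" \<theta>] t0 b by auto
qed

lemma lam_theta: "lam \<theta> = p" "lam (-\<theta>) = g"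
  by (simp_all add: lam_def theta field_simps sqrt3_sq)

lemma lam_range: assumes "-\<theta> \<le> s" "s \<le> \<theta>" shows "p \<le> lam s" "lam s \<le> g"
proof -
  show "p \<le> lam s" using lam_less[of s \<theta>] assms theta lam_theta by (cases "s = \<theta>") auto
  show "lam s \<le> g" using lam_less[of "-\<theta>" s] assms theta lam_theta by (cases "s = -\<theta>") auto
qed

lemma lam_strict: "-\<theta> \<le> a \<Longrightarrow> a < b \<Longrightarrow> b \<le> \<theta> \<Longrightarrow> lam b < lam a"
  using lam_less theta by auto

lemma pt_L_eq': assumes "-\<theta> \<le> s" "s \<le> \<theta>" shows "pt_L s = CDpt (lam s)"
proof (rule pt_L_eq)
  show "\<bar>lam s\<bar> \<le> sqrt 3/6" using lam_range[OF assms] g_bounds p_bounds sqrt3_bounds by (simp add: abs_le_iff)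
  show "\<bar>lam (-s)\<bar> \<le> sqrt 3/6" using lam_range[of "-s"] assms g_bounds p_bounds sqrt3_bounds by (simp add: abs_le_iff)
qed

lemma len_tau_eq: "len_tau \<sigma> = p"
proof -
  have "sgn (corner_E - corner_D) = -1"
    unfolding hex_corners by (simp add: complex_eq_iff sgn_div_norm cmod_def)
  then show ?thesis unfolding len_tau_def cut_points by (simp add: hex_corners midpoint_def inner_complex_def)
qed

text \<open>A convex set that contains \<open>\<R>\<close>. The perpendiculars from its points to the lines \<open>CD\<close> and
  \<open>DE\<close> end beyond \<open>G\<close> and \<open>E\<^sub>3\<close>; so the distance to a point of these sides decreases in its
  coordinate, up to \<open>G\<close> and \<open>E\<^sub>3\<close>.\<close>

definition Q :: "complex set" where
  "Q = {x. Re x \<le> -p \<and> 0 \<le> Im x \<and> (x - CDpt g) \<bullet> u60 \<ge> 0}"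

lemma CDpt_less: assumes "x \<in> Q" "l' < l" "l \<le> g" shows "dist (CDpt l) x < dist (CDpt l') x"
proof -
  have e: "(x - CDpt l) \<bullet> (x - CDpt l) = (x - CDpt g) \<bullet> (x - CDpt g) + 2 * (g - l) * ((x - CDpt g) \<bullet> u60) + (g - l)\<^sup>2" for l
  proof -
    define w where "w = x - CDpt g"
    have "x - CDpt l = w + (g - l) *\<^sub>R u60" using CDpt_diff[of g l] by (simp add: w_def algebra_simps)
    moreover have "u60 \<bullet> u60 = 1" by (simp add: inner_complex_def)
    ultimately show ?thesis unfolding w_def[symmetric]
      by (simp add: inner_add_left inner_add_right inner_commute[of u60 w] power2_eq_square)
        (simp add: algebra_simps)
  qed
  have "(g - l) * ((x - CDpt g) \<bullet> u60) \<le> (g - l') * ((x - CDpt g) \<bullet> u60)"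
    using assms by (intro mult_right_mono) (auto simp: Q_def)
  moreover have "(g - l)\<^sup>2 < (g - l')\<^sup>2" using assms by (intro power_strict_mono) auto
  ultimately show ?thesis unfolding dist_less_iff_sq e[of l] e[of l'] by linarith
qed

lemma DEpt_less: assumes "x \<in> Q" "t < t'" "t' \<le> p" shows "dist (DEpt t') x < dist (DEpt t) x"
proof -
  have "(x - DEpt t) \<bullet> (x - DEpt t) = (- Re x - t)\<^sup>2 + (Im x + 1/2)\<^sup>2" for t
    by (simp add: DEpt_def inner_complex_def power2_eq_square algebra_simps)
  moreover have "(- Re x - t')\<^sup>2 < (- Re x - t)\<^sup>2" using assms by (intro power_strict_mono) (auto simp: Q_def)
  ultimately show ?thesis unfolding dist_less_iff_sq by simp
qed

lemma CDpt_le: assumes "x \<in> Q" "l' \<le> l" "l \<le> g" shows "dist (CDpt l) x \<le> dist (CDpt l') x"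
  using CDpt_less[OF assms(1), of l' l] assms by (cases "l' = l") auto

lemma DEpt_le: assumes "x \<in> Q" "t \<le> t'" "t' \<le> p" shows "dist (DEpt t') x \<le> dist (DEpt t) x"
  using DEpt_less[OF assms(1), of t t'] assms by (cases "t = t'") auto

lemma Q_convex: "convex Q"
proof -
  have "Q = {x. 1 \<bullet> x \<le> -p} \<inter> {x. \<i> \<bullet> x \<ge> 0} \<inter> {x. u60 \<bullet> x \<ge> u60 \<bullet> CDpt g}"
  proof -
    have "1 \<bullet> x = Re x" "\<i> \<bullet> x = Im x" "(x - CDpt g) \<bullet> u60 = u60 \<bullet> x - u60 \<bullet> CDpt g" for x
      by (simp_all add: inner_complex_def[of 1] inner_complex_def[of \<i>] inner_diff_left inner_commute[of u60])
    then show ?thesis unfolding Q_def by auto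
  qed
  then show ?thesis by (simp only:) (intro convex_Int convex_halfspace_le convex_halfspace_ge)
qed

lemma centres:
  assumes "p \<le> l" "l \<le> g" "-p \<le> t" "t \<le> p"
  shows "0 < Re (CDpt l) + Re (DEpt t)" "Im (CDpt l) + Im (DEpt t) < 0" "CDpt l \<noteq> DEpt t"
    "476/1000 \<le> Re (CDpt l)" "Re (CDpt l) \<le> 5252/10000" "- 1747/10000 \<le> Im (CDpt l)" "Im (CDpt l) \<le> - 90/1000"
proof -
  have "1732/1000 * l \<le> sqrt 3 * l" "sqrt 3 * l \<le> 17321/10000 * l" using assms p_bounds sqrt3_mult[of l] by linarith+
  then show a: "476/1000 \<le> Re (CDpt l)" "Re (CDpt l) \<le> 5252/10000" "- 1747/10000 \<le> Im (CDpt l)" "Im (CDpt l) \<le> - 90/1000"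
    using assms p_bounds g_bounds sqrt3_bounds unfolding CDpt_def complex.sel by linarith+
  show "0 < Re (CDpt l) + Re (DEpt t)" "Im (CDpt l) + Im (DEpt t) < 0"
    using a assms p_bounds by (simp_all add: DEpt_def)
  show "CDpt l \<noteq> DEpt t" using a(1) assms p_bounds by (auto simp: DEpt_def complex_eq_iff)
qed

text \<open>The line \<open>GP\<close> is perpendicular to \<open>CD\<close>, and \<open>P\<close> has distance one from \<open>N(-\<tau>)\<close> as well as from
  \<open>G\<close>. In terms of the depth \<open>a\<close> below the line \<open>GP\<close> and the distance \<open>b\<close> from the line \<open>FA\<close>, a point
  below \<open>GP\<close> satisfies \<open>\<bar>x - N(-\<tau>)\<bar>\<^sup>2 - 1 = a (a - 2 P\<^sub>1) + b (b - 2 P\<^sub>2)\<close>, where \<open>P\<^sub>1\<close> and \<open>P\<^sub>2\<close> are the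
  components of \<open>P - N(-\<tau>)\<close>; so it lies in the unit disc about \<open>N(-\<tau>)\<close>.\<close>

lemma foot_above_G:
  assumes x: "Re x \<le> -p" "0 \<le> Im x" and d: "dist (CDpt l) x = 1" and N: "1 \<le> dist (DEpt (-p)) x"
    and l: "p \<le> l" "l \<le> g"
  shows "(x - CDpt g) \<bullet> u60 \<ge> 0"
proof (rule ccontr)
  define a where "a = - ((x - CDpt g) \<bullet> u60)"
  define b where "b = 1 - (x - CDpt g) \<bullet> Complex (- sqrt 3/2) (1/2)"
  assume "\<not> ?thesis"
  then have a0: "0 < a" by (simp add: a_def)
  define P1 where "P1 = g - p/2 + sqrt 3/4"
  define P2 where "P2 = 3/4 + sqrt 3/2 * p"
  have b0: "0 \<le> b"
  proof -
    have "(x - CDpt g) \<bullet> Complex (- sqrt 3/2) (1/2) = (x - CDpt l) \<bullet> Complex (- sqrt 3/2) (1/2)"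
      by (simp add: CDpt_def inner_complex_def field_simps)
    also have "\<dots> \<le> norm (x - CDpt l) * norm (Complex (- sqrt 3/2) (1/2))" by (rule norm_cauchy_schwarz)
    also have "norm (x - CDpt l) = 1" using d by (simp add: dist_norm norm_minus_commute)
    also have "norm (Complex (- sqrt 3/2) (1/2)) = 1" by (simp add: cmod_def power2_eq_square)
    finally show ?thesis by (simp add: b_def)
  qed
  have b1: "b \<le> 1/2"
  proof -
    have "0 \<le> sqrt 3 * (- Re x)" using x p_bounds by (intro mult_nonneg_nonneg) auto
    then show ?thesis using x by (simp add: b_def CDpt_def inner_complex_def field_simps)
  qed
  have a1: "a < 1/2"
  proof -
    have "\<bar>Re (x - CDpt l)\<bar> \<le> 1" using d abs_Re_le_cmod[of "x - CDpt l"] by (simp add: dist_norm norm_minus_commute)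
    then have "- Re x \<le> 1 - 476/1000" using centres[OF l, of 0] p_bounds by (simp add: abs_le_iff)
    moreover have "0 \<le> sqrt 3 * Im x" using x by simp
    moreover have "2 * a = - Re x - sqrt 3 * Im x + 2 * g" by (simp add: a_def CDpt_def inner_complex_def field_simps)
    ultimately show ?thesis using g_bounds by linarith
  qed
  have "(x - DEpt (-p)) \<bullet> (x - DEpt (-p)) - 1 = a * (a - 2 * P1) + b * (b - 2 * P2)"
  proof -
    have "Re x = - sqrt 3/4 + g/2 - a/2 + sqrt 3/2 * b" "Im x = 1/4 + sqrt 3/2 * g - sqrt 3/2 * a - b/2"
      by (simp_all add: a_def b_def CDpt_def inner_complex_def field_simps)
    note x = this
    have "4 * g * g - 4 * g * p + 4 * p * p + 2 * sqrt 3 * (g + p) = 1"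
      using g(3) by (simp add: power2_eq_square field_simps)
    then show ?thesis unfolding P1_def P2_def
      by (simp add: DEpt_def inner_complex_def x field_simps) (use sqrt3_sq(1) in algebra)?
  qed
  moreover have "a * (a - 2 * P1) < 0" using a0 a1 g_bounds p_bounds sqrt3_bounds by (intro mult_pos_neg) (auto simp: P1_def)
  moreover have "0 \<le> sqrt 3 * p" using p_bounds by simp
  then have "b * (b - 2 * P2) \<le> 0" using b0 b1 by (intro mult_nonneg_nonpos) (auto simp: P2_def)
  ultimately have "(x - DEpt (-p)) \<bullet> (x - DEpt (-p)) < 1" by linarith
  then show False using N dist_less_1_iff[of "DEpt (-p)" x] by linarith
qed

text \<open>Of the two intersection points take the one on the left of the line of centres. Rough bounds
  for the distance of the centres place it in the second quadrant. If its real part exceeded \<open>- p\<close>,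
  it would have to be high up to have distance one from \<open>N(t)\<close>, and be too close to \<open>L(s)\<close>.\<close>

lemma X_exists:
  assumes l: "p \<le> l" "l \<le> g" and t: "-p \<le> t" "t \<le> p"
  obtains x where "x \<in> Q" "dist (CDpt l) x = 1" "dist (DEpt t) x = 1" "arcs_meet_near corner_A (CDpt l) (DEpt t) = x"
proof -
  note c = centres[OF l t]
  define e where "e = CDpt l - DEpt t"
  have er: "341/1000 \<le> Re e" "Re e \<le> 6602/10000" "3253/10000 \<le> Im e" "Im e \<le> 41/100"
  proof -
    have "Re e = Re (CDpt l) + t" "Im e = Im (CDpt l) + 1/2" by (simp_all add: e_def DEpt_def)
    then show "341/1000 \<le> Re e" "Re e \<le> 6602/10000" "3253/10000 \<le> Im e" "Im e \<le> 41/100"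
      using c t p_bounds l by linarith+
  qed
  have n: "e \<bullet> e \<le> 604/1000" "0 < e \<bullet> e"
  proof -
    have "Re e * Re e \<le> 6602/10000 * (6602/10000)" using er by (intro mult_mono) auto
    moreover have "Im e * Im e \<le> 41/100 * (41/100)" using er by (intro mult_mono) auto
    ultimately show "e \<bullet> e \<le> 604/1000" by (simp add: inner_complex_def)
    show "0 < e \<bullet> e" using c(3) by (simp add: e_def)
  qed
  define k where "k = sqrt (1 / (e \<bullet> e) - 1/4)"
  define x where "x = (1/2) *\<^sub>R (CDpt l + DEpt t) + k *\<^sub>R (\<i> * e)"
  have d: "dist (CDpt l) x = 1" "dist (DEpt t) x = 1"
    unfolding x_def k_def e_def using n(1) c(3) by (intro unit_circles_meet_left; simp add: e_def)+
  have "1 / (604/1000) \<le> 1 / (e \<bullet> e)" using n by (intro divide_left_mono) auto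
  then have "(118/100)\<^sup>2 \<le> 1 / (e \<bullet> e) - 1/4" by (simp add: power2_eq_square)
  then have k: "118/100 \<le> k" unfolding k_def by (rule real_le_rsqrt)
  have ke: "118/100 * (3253/10000) \<le> k * Im e" "118/100 * (341/1000) \<le> k * Re e"
    using k er by (intro mult_mono; simp)+
  have x1: "Re x < - 5/100" and x2: "0 \<le> Im x"
    using ke c t p_bounds by (simp_all add: x_def DEpt_def field_simps)
  have x3: "Re x \<le> -p"
  proof (rule ccontr)
    assume "\<not> Re x \<le> -p"
    then have lt: "-135/1000 < Re x" using p_bounds by simp
    have dN: "(Re x + t) * (Re x + t) + (Im x + 1/2) * (Im x + 1/2) = 1"
      using d(2) unfolding dist_eq_1_iff by (simp add: DEpt_def inner_complex_def)
    have "(Re x + t) * (Re x + t) \<le> 27/100 * (27/100)"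
    proof -
      have "\<bar>Re x + t\<bar> \<le> 27/100" using lt x1 t p_bounds by (intro abs_leI) linarith+
      then have "\<bar>Re x + t\<bar> * \<bar>Re x + t\<bar> \<le> 27/100 * (27/100)" by (intro mult_mono) auto
      then show ?thesis by simp
    qed
    then have sq: "(Im x + 1/2) * (Im x + 1/2) \<ge> 9271/10000" using dN by simp
    have i1: "46/100 \<le> Im x"
    proof (rule ccontr)
      assume "\<not> 46/100 \<le> Im x"
      then have "(Im x + 1/2) * (Im x + 1/2) \<le> 96/100 * (96/100)" using x2 by (intro mult_mono) auto
      then show False using sq by simp
    qed
    have i2: "Im x \<le> 1/2"
    proof (rule ccontr)
      assume "\<not> Im x \<le> 1/2"
      then have "1 * 1 < (Im x + 1/2) * (Im x + 1/2)" by (intro mult_strict_mono) auto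
      then show False using dN zero_le_square[of "Re x + t"] by linarith
    qed
    have "(Re (CDpt l) - Re x) * (Re (CDpt l) - Re x) \<le> 6602/10000 * (6602/10000)"
      using c lt x1 by (intro mult_mono) auto
    moreover have "(Im x - Im (CDpt l)) * (Im x - Im (CDpt l)) \<le> 6747/10000 * (6747/10000)"
      using c i1 i2 by (intro mult_mono) auto
    moreover have "(Re (CDpt l) - Re x) * (Re (CDpt l) - Re x) + (Im x - Im (CDpt l)) * (Im x - Im (CDpt l)) = 1"
      using d(1) unfolding dist_eq_1_iff by (simp add: inner_complex_def algebra_simps)
    ultimately show False by simp
  qed
  have N: "1 \<le> dist (DEpt (-p)) x"
  proof -
    have "(- Re x - t)\<^sup>2 \<le> (- Re x - (-p))\<^sup>2" using x3 t by (intro power_mono) auto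
    then have "\<not> dist (DEpt (-p)) x < dist (DEpt t) x"
      unfolding dist_less_iff_sq by (simp add: DEpt_def inner_complex_def power2_eq_square algebra_simps)
    then show ?thesis using d by simp
  qed
  have "x \<in> Q" unfolding Q_def using x2 x3 foot_above_G[OF x3 x2 d(1) N l] by simp
  moreover have "arcs_meet_near corner_A (CDpt l) (DEpt t) = x"
    using arcs_meet_near_A[OF d _ x2 c(1-3)] x1 by simp
  ultimately show ?thesis using that d by blast
qed

lemma X_unique:
  assumes "p \<le> l" "l \<le> g" "-p \<le> t" "t \<le> p" "x \<in> Q" "dist (CDpt l) x = 1" "dist (DEpt t) x = 1"
  shows "arcs_meet_near corner_A (CDpt l) (DEpt t) = x"
  using arcs_meet_near_A[OF assms(6,7) _ _ centres(1-3)[OF assms(1-4)]] assms(5) p_bounds by (auto simp: Q_def)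

lemma param_box_iff: "(s, t) \<in> param_box \<sigma> \<longleftrightarrow> -\<theta> \<le> s \<and> s \<le> \<theta> \<and> -p \<le> t \<and> t \<le> p"
  by (auto simp: param_box_def len_tau_eq)

lemma X_map:
  assumes "(s, t) \<in> param_box \<sigma>"
  shows "X_map s t \<in> Q" "dist (CDpt (lam s)) (X_map s t) = 1" "dist (DEpt t) (X_map s t) = 1"
proof -
  have b: "-\<theta> \<le> s" "s \<le> \<theta>" "-p \<le> t" "t \<le> p" using assms by (auto simp: param_box_iff)
  obtain x where "x \<in> Q" "dist (CDpt (lam s)) x = 1" "dist (DEpt t) x = 1"
    "arcs_meet_near corner_A (CDpt (lam s)) (DEpt t) = x"
    using X_exists[OF lam_range[OF b(1,2)] b(3,4)] .
  then show "X_map s t \<in> Q" "dist (CDpt (lam s)) (X_map s t) = 1" "dist (DEpt t) (X_map s t) = 1"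
    by (simp_all add: X_map_def pt_L_eq'[OF b(1,2)] pt_N_eq)
qed

lemma X_map_eqI:
  assumes "(s, t) \<in> param_box \<sigma>" "x \<in> Q" "dist (CDpt (lam s)) x = 1" "dist (DEpt t) x = 1"
  shows "X_map s t = x"
proof -
  have b: "-\<theta> \<le> s" "s \<le> \<theta>" "-p \<le> t" "t \<le> p" using assms by (auto simp: param_box_iff)
  show ?thesis unfolding X_map_def pt_L_eq'[OF b(1,2)] pt_N_eq
    by (rule X_unique[OF lam_range[OF b(1,2)] b(3,4) assms(2-4)])
qed

text \<open>On \<open>Q\<close> the distances to the centres are monotone, so comparing parameters amounts to comparing
  distances with one. This is how parameters are estimated from here on.\<close>

lemma X_map_dist_CD:
  assumes "(s, t) \<in> param_box \<sigma>" "-\<theta> \<le> s'" "s' \<le> \<theta>"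
  shows "dist (CDpt (lam s')) (X_map s t) < 1 \<longleftrightarrow> s' < s" "dist (CDpt (lam s')) (X_map s t) \<le> 1 \<longleftrightarrow> s' \<le> s"
proof -
  note x = X_map[OF assms(1)]
  have b: "-\<theta> \<le> s" "s \<le> \<theta>" using assms(1) by (auto simp: param_box_iff)
  have 1: "dist (CDpt (lam s')) (X_map s t) < 1" if "s' < s"
    using CDpt_less[OF x(1) lam_strict[of s' s]] lam_range(2)[of s'] that b assms x(2) by auto
  have 2: "dist (CDpt (lam s')) (X_map s t) > 1" if "s < s'"
    using CDpt_less[OF x(1) lam_strict[of s s']] lam_range(2)[of s] that b assms x(2) by auto
  show "dist (CDpt (lam s')) (X_map s t) < 1 \<longleftrightarrow> s' < s" "dist (CDpt (lam s')) (X_map s t) \<le> 1 \<longleftrightarrow> s' \<le> s"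
    using 1 2 x(2) by (cases s s' rule: linorder_cases; force)+
qed

lemma X_map_dist_DE:
  assumes "(s, t) \<in> param_box \<sigma>" "t' \<le> p"
  shows "dist (DEpt t') (X_map s t) < 1 \<longleftrightarrow> t < t'" "dist (DEpt t') (X_map s t) \<le> 1 \<longleftrightarrow> t \<le> t'"
proof -
  note x = X_map[OF assms(1)]
  have b: "t \<le> p" using assms(1) by (auto simp: param_box_iff)
  have 1: "dist (DEpt t') (X_map s t) < 1" if "t < t'" using DEpt_less[OF x(1) that] assms x(3) by auto
  have 2: "dist (DEpt t') (X_map s t) > 1" if "t' < t" using DEpt_less[OF x(1) that] b x(3) by auto
  show "dist (DEpt t') (X_map s t) < 1 \<longleftrightarrow> t < t'" "dist (DEpt t') (X_map s t) \<le> 1 \<longleftrightarrow> t \<le> t'"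
    using 1 2 x(3) by (cases t t' rule: linorder_cases; force)+
qed

lemma X_map_inj:
  assumes "(s, t) \<in> param_box \<sigma>" "(s', t') \<in> param_box \<sigma>" "X_map s t = X_map s' t'"
  shows "s = s'" "t = t'"
proof -
  have b: "-\<theta> \<le> s" "s \<le> \<theta>" "-\<theta> \<le> s'" "s' \<le> \<theta>" "t \<le> p" "t' \<le> p" using assms by (auto simp: param_box_iff)
  show "s = s'" using X_map_dist_CD(2)[OF assms(1) b(3,4)] X_map_dist_CD(2)[OF assms(2) b(1,2)] assms(3)
      X_map(2)[OF assms(1)] X_map(2)[OF assms(2)] by auto
  show "t = t'" using X_map_dist_DE(2)[OF assms(1) b(6)] X_map_dist_DE(2)[OF assms(2) b(5)] assms(3)
      X_map(3)[OF assms(1)] X_map(3)[OF assms(2)] by auto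
qed

text \<open>The region \<open>\<R>\<close> is a quadrilateral bounded by unit circles about the extreme centres. The parameters of a
  point of it exist by the intermediate value theorem.\<close>

lemma region_R_iff:
  "x \<in> region_R \<sigma> \<longleftrightarrow> x \<in> Q \<and> dist (CDpt g) x \<le> 1 \<and> 1 \<le> dist (CDpt p) x \<and> dist (DEpt p) x \<le> 1 \<and> 1 \<le> dist (DEpt (-p)) x"
  (is "_ \<longleftrightarrow> ?B x")
proof
  assume "x \<in> region_R \<sigma>"
  then obtain s t where st: "(s, t) \<in> param_box \<sigma>" "x = X_map s t" by (auto simp: region_R_def)
  have b: "-\<theta> \<le> s" "s \<le> \<theta>" "-p \<le> t" "t \<le> p" using st(1) by (auto simp: param_box_iff)
  show "?B x" unfolding st(2)
    using X_map[OF st(1)] X_map_dist_CD[OF st(1), of \<theta>] X_map_dist_CD[OF st(1), of "-\<theta>"]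
      X_map_dist_DE[OF st(1), of p] X_map_dist_DE[OF st(1), of "-p"] b theta p_bounds lam_theta by auto
next
  assume B: "?B x"
  have "\<exists>s. -\<theta> \<le> s \<and> s \<le> \<theta> \<and> dist (CDpt (lam s)) x = 1"
  proof (rule IVT)
    show "\<forall>s. - \<theta> \<le> s \<and> s \<le> \<theta> \<longrightarrow> isCont (\<lambda>s. dist (CDpt (lam s)) x) s"
    proof -
      have "(\<lambda>s. dist (CDpt (lam s)) x) = (\<lambda>s. dist (CDpt 0 + lam s *\<^sub>R u60) x)"
        by (rule ext, rule arg_cong2[of _ _ _ _ dist, OF _ refl]) (simp add: CDpt_def complex_eq_iff)
      then show ?thesis unfolding lam_def by (simp only:) (intro allI impI continuous_intros)
    qed
  qed (use B theta lam_theta in auto)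
  then obtain s where s: "-\<theta> \<le> s" "s \<le> \<theta>" "dist (CDpt (lam s)) x = 1" by blast
  have "\<exists>t. -p \<le> t \<and> t \<le> p \<and> dist (DEpt t) x = 1"
  proof (rule IVT2)
    show "\<forall>t. - p \<le> t \<and> t \<le> p \<longrightarrow> isCont (\<lambda>t. dist (DEpt t) x) t"
    proof -
      have "(\<lambda>t. dist (DEpt t) x) = (\<lambda>t. dist (Complex 0 (-1/2) - t *\<^sub>R 1) x)"
        by (intro ext arg_cong2[of _ _ _ _ dist]) (simp_all add: DEpt_def complex_eq_iff)
      then show ?thesis by (simp only:) (intro allI impI continuous_intros)
    qed
  qed (use B p_bounds in auto)
  then obtain t where t: "-p \<le> t" "t \<le> p" "dist (DEpt t) x = 1" by blast
  have st: "(s, t) \<in> param_box \<sigma>" using s t by (simp add: param_box_iff)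
  have "X_map s t = x" using X_map_eqI[OF st _ s(3) t(3)] B by blast
  then show "x \<in> region_R \<sigma>" using st unfolding region_R_def by blast
qed

end

section \<open>Shortest paths around a disc\<close>

definition polygon_length :: "(real \<Rightarrow> complex) \<Rightarrow> real list \<Rightarrow> real" where
  "polygon_length g ts = (\<Sum>i<length ts - 1. dist (g (ts ! i)) (g (ts ! Suc i)))"

lemma polygon_length_simps [simp]:
  "polygon_length g [] = 0" "polygon_length g [x] = 0"
  "polygon_length g (x # y # ts) = dist (g x) (g y) + polygon_length g (y # ts)"
  by (simp_all add: polygon_length_def sum.lessThan_Suc_shift del: sum.lessThan_Suc)

lemma polygon_length_join:
  "ts \<noteq> [] \<Longrightarrow> us \<noteq> [] \<Longrightarrow> last ts = hd us \<Longrightarrow>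
    polygon_length g (ts @ tl us) = polygon_length g ts + polygon_length g us"
proof (induction ts rule: induct_list012)
  case (2 x)
  then show ?case by (cases us) auto
qed auto

text \<open>A lower bound for the length of the piece of \<open>g\<close> over \<open>[a, b]\<close>, in a form that adds up over
  consecutive pieces.\<close>

definition length_ge :: "(real \<Rightarrow> complex) \<Rightarrow> real \<Rightarrow> real \<Rightarrow> real \<Rightarrow> bool" where
  "length_ge g a b l \<longleftrightarrow>
     (\<forall>\<epsilon>>0. \<exists>ts. sorted ts \<and> ts \<noteq> [] \<and> hd ts = a \<and> last ts = b \<and> l - \<epsilon> \<le> polygon_length g ts)"

lemma length_ge_chord: "a \<le> b \<Longrightarrow> length_ge g a b (dist (g a) (g b))"
  unfolding length_ge_def by (intro allI impI exI[of _ "[a, b]"]) auto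

lemma sorted_le_last: "sorted ts \<Longrightarrow> x \<in> set ts \<Longrightarrow> x \<le> last ts" for x :: real
  by (induction ts) (auto split: if_splits)

lemma sorted_hd_le: "sorted ts \<Longrightarrow> x \<in> set ts \<Longrightarrow> hd ts \<le> x" for x :: real
  by (cases ts) auto

lemma length_ge_add:
  assumes "length_ge g a b l" "length_ge g b c m"
  shows "length_ge g a c (l + m)"
  unfolding length_ge_def
proof (intro allI impI)
  fix \<epsilon> :: real assume "0 < \<epsilon>"
  then have e: "0 < \<epsilon> / 2" by simp
  obtain ts where ts: "sorted ts" "ts \<noteq> []" "hd ts = a" "last ts = b" "l - \<epsilon>/2 \<le> polygon_length g ts"
    using assms(1) e unfolding length_ge_def by blast
  obtain us where us: "sorted us" "us \<noteq> []" "hd us = b" "last us = c" "m - \<epsilon>/2 \<le> polygon_length g us"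
    using assms(2) e unfolding length_ge_def by blast
  show "\<exists>ts. sorted ts \<and> ts \<noteq> [] \<and> hd ts = a \<and> last ts = c \<and> l + m - \<epsilon> \<le> polygon_length g ts"
  proof (intro exI[of _ "ts @ tl us"] conjI)
    have "x \<le> y" if "x \<in> set ts" "y \<in> set (tl us)" for x y
      using sorted_le_last[OF ts(1) that(1)] sorted_hd_le[OF us(1), of y] that(2) ts us
      by (metis list.set_sel(2) order_trans)
    then show "sorted (ts @ tl us)" using ts(1) us(1) by (auto simp: sorted_append sorted_tl)
    show "hd (ts @ tl us) = a" using ts by simp
    show "last (ts @ tl us) = c" using ts us by (cases us) auto
    show "l + m - \<epsilon> \<le> polygon_length g (ts @ tl us)"
      using polygon_length_join[OF ts(2) us(2)] ts us by simp
  qed (use ts in simp)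
qed

lemma length_ge_curve_length:
  assumes "length_ge g 0 1 l" "curve_length g \<le> ennreal m" "0 \<le> m"
  shows "l \<le> m"
proof (rule ccontr)
  assume "\<not> l \<le> m"
  then obtain ts where ts: "sorted ts" "ts \<noteq> []" "hd ts = 0" "last ts = 1" "l - (l - m)/2 \<le> polygon_length g ts"
    using assms(1) unfolding length_ge_def by (metis diff_gt_0_iff_gt half_gt_zero not_le)
  have "set ts \<subseteq> {0..1}" using sorted_le_last[OF ts(1)] sorted_hd_le[OF ts(1)] ts by auto
  then have "ennreal (polygon_length g ts) \<le> curve_length g"
    unfolding curve_length_def polygon_length_def using ts(1) by (intro SUP_upper) auto
  then have "ennreal (polygon_length g ts) \<le> ennreal m" using assms(2) by (rule order_trans)
  then have "polygon_length g ts \<le> m" using assms(3) by (simp add: ennreal_le_iff)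
  then show False using ts(5) \<open>\<not> l \<le> m\<close> by (simp add: field_simps)
qed

lemma curve_length_ge:
  assumes "length_ge g 0 1 l" shows "ennreal l \<le> curve_length g"
proof (cases "curve_length g")
  case (real m)
  then have "l \<le> m" using length_ge_curve_length[OF assms, of m] by simp
  then show ?thesis using real by (simp add: ennreal_leI)
qed simp

lemma curve_length_lipschitz:
  assumes lip: "\<And>u v. u \<in> {0..1} \<Longrightarrow> v \<in> {0..1} \<Longrightarrow> dist (g u) (g v) \<le> L * \<bar>u - v\<bar>" and "0 \<le> L"
  shows "curve_length g \<le> ennreal L"
proof -
  have pl: "polygon_length g (x # ts) \<le> L * (last (x # ts) - x)" if "sorted (x # ts)" "set (x # ts) \<subseteq> {0..1}" for x ts
    using that
  proof (induction ts arbitrary: x)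
    case (Cons y ts)
    have "dist (g x) (g y) \<le> L * (y - x)" using lip[of x y] Cons.prems by auto
    moreover have "polygon_length g (y # ts) \<le> L * (last (y # ts) - y)" using Cons by auto
    ultimately show ?case by (simp add: algebra_simps)
  qed simp
  have "polygon_length g ts \<le> L" if "sorted ts" "set ts \<subseteq> {0..1}" for ts
  proof (cases ts)
    case (Cons x us)
    have "last (x # us) \<in> set (x # us)" by (rule last_in_set) simp
    then have "L * (last (x # us) - x) \<le> L * 1" using that Cons \<open>0 \<le> L\<close> by (intro mult_left_mono) auto
    then show ?thesis using pl[of x us] that Cons by simp
  qed (use \<open>0 \<le> L\<close> in simp)
  then show ?thesis unfolding curve_length_def polygon_length_def[symmetric]
    by (intro SUP_least) (auto intro: ennreal_leI)
qed

text \<open>If \<open>f\<close> is \<open>1\<close>-Lipschitz along \<open>g\<close> up to a factor that tends to one for small increments, then a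
  fine subdivision of the parameter interval yields a polygon of at least the length of the increment
  of \<open>f\<close>, up to a small error.\<close>

lemma length_ge_calibration:
  fixes f :: "complex \<Rightarrow> real"
  assumes ab: "a \<le> b" and cont: "continuous_on {a..b} (\<lambda>u. f (g u))"
    and loc: "\<And>\<epsilon>. \<epsilon> > 0 \<Longrightarrow> \<exists>\<delta>>0. \<forall>u\<in>{a..b}. \<forall>v\<in>{a..b}. \<bar>f (g u) - f (g v)\<bar> < \<delta> \<longrightarrow>
        \<bar>f (g u) - f (g v)\<bar> \<le> (1 + \<epsilon>) * dist (g u) (g v)"
  shows "length_ge g a b \<bar>f (g b) - f (g a)\<bar>"
  unfolding length_ge_def
proof (intro allI impI)
  fix \<epsilon> :: real assume e: "0 < \<epsilon>"
  define D where "D = \<bar>f (g b) - f (g a)\<bar>"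
  \<comment> \<open>the relative error that keeps the absolute error of the increment below \<open>\<epsilon>\<close>\<close>
  define \<eta> where "\<eta> = \<epsilon> / (D + 1)"
  have D0: "0 \<le> D" by (simp add: D_def)
  have eta: "0 < \<eta>" using e D0 by (simp add: \<eta>_def)
  obtain \<delta> where d: "0 < \<delta>" "\<And>u v. u \<in> {a..b} \<Longrightarrow> v \<in> {a..b} \<Longrightarrow> \<bar>f (g u) - f (g v)\<bar> < \<delta> \<Longrightarrow>
        \<bar>f (g u) - f (g v)\<bar> \<le> (1 + \<eta>) * dist (g u) (g v)"
    using loc[OF eta] by blast
  have "uniformly_continuous_on {a..b} (\<lambda>u. f (g u))" using cont by (intro compact_uniformly_continuous) auto
  then obtain \<mu> where mu: "0 < \<mu>" "\<And>u v. u \<in> {a..b} \<Longrightarrow> v \<in> {a..b} \<Longrightarrow> dist v u < \<mu> \<Longrightarrow> dist (f (g v)) (f (g u)) < \<delta>"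
    unfolding uniformly_continuous_on_def using d(1) by metis
  obtain n :: nat where n: "(b - a) / \<mu> < real n" using reals_Archimedean2 by blast
  have n0: "0 < n"
  proof (rule ccontr)
    assume "\<not> 0 < n"
    then have "(b - a) / \<mu> < 0" using n by simp
    then show False using ab mu(1) by (simp add: divide_less_0_iff)
  qed
  define t where "t i = a + (b - a) * real i / real n" for i :: nat
  have tin: "t i \<in> {a..b}" if "i \<le> n" for i
  proof -
    have "(b - a) * (real i / real n) \<le> (b - a) * 1" using ab that n0 by (intro mult_left_mono) auto
    moreover have "0 \<le> (b - a) * (real i / real n)" using ab by simp
    ultimately show ?thesis by (simp add: t_def)
  qed
  have step: "\<bar>f (g (t (Suc i))) - f (g (t i))\<bar> \<le> (1 + \<eta>) * dist (g (t i)) (g (t (Suc i)))" if "i < n" for i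
  proof -
    have "t (Suc i) - t i = (b - a) / real n" by (simp add: t_def add_divide_distrib diff_divide_distrib algebra_simps)
    moreover have "(b - a) / real n < \<mu>" using n n0 mu(1) by (simp add: field_simps)
    ultimately have "dist (t (Suc i)) (t i) < \<mu>" using ab by (simp add: dist_real_def)
    then have "\<bar>f (g (t (Suc i))) - f (g (t i))\<bar> < \<delta>"
      using mu(2)[OF tin tin, of i "Suc i"] that by (simp add: dist_real_def)
    then show ?thesis using d(2)[OF tin tin, of "Suc i" i] that by (simp add: dist_commute)
  qed
  define ts where "ts = map t [0..<Suc n]"
  have len: "length ts = Suc n" by (simp add: ts_def)
  have nth: "ts ! i = t i" if "i \<le> n" for i unfolding ts_def using that by (subst nth_map) (auto simp del: upt_Suc)
  have pl: "polygon_length g ts = (\<Sum>i<n. dist (g (t i)) (g (t (Suc i))))"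
    unfolding polygon_length_def len using nth by (intro sum.cong) auto
  have "f (g (t n)) - f (g (t 0)) = (\<Sum>i<n. f (g (t (Suc i))) - f (g (t i)))"
    by (rule sum_lessThan_telescope[symmetric])
  then have "\<bar>f (g (t n)) - f (g (t 0))\<bar> \<le> (\<Sum>i<n. \<bar>f (g (t (Suc i))) - f (g (t i))\<bar>)" by simp
  also have "\<dots> \<le> (\<Sum>i<n. (1 + \<eta>) * dist (g (t i)) (g (t (Suc i))))" using step by (intro sum_mono) auto
  also have "\<dots> = (1 + \<eta>) * polygon_length g ts" unfolding pl by (simp add: sum_distrib_left)
  finally have le: "D \<le> (1 + \<eta>) * polygon_length g ts" using n0 by (simp add: D_def t_def)
  have "D - \<epsilon> \<le> polygon_length g ts"
  proof (rule ccontr)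
    assume "\<not> ?thesis"
    then have "(1 + \<eta>) * polygon_length g ts < (1 + \<eta>) * (D - \<epsilon>)" using eta by (intro mult_strict_left_mono) auto
    then have "D < (1 + \<eta>) * (D - \<epsilon>)" using le by linarith
    then have "\<epsilon> + \<eta> * \<epsilon> < \<eta> * D" by (simp add: algebra_simps)
    moreover have "\<eta> * D \<le> \<eta> * (D + 1)" using eta by simp
    moreover have "\<eta> * (D + 1) = \<epsilon>" using D0 by (simp add: \<eta>_def)
    moreover have "0 < \<eta> * \<epsilon>" using eta e by simp
    ultimately show False by linarith
  qed
  moreover have "sorted ts" unfolding ts_def sorted_map
  proof (rule sorted_wrt_mono_rel[OF _ sorted_upt])
    fix i j :: nat assume "i \<le> j"
    then show "t i \<le> t j" using ab unfolding t_def by (intro add_left_mono divide_right_mono mult_left_mono) auto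
  qed
  moreover have "hd ts = a" using nth[of 0] len by (simp add: hd_conv_nth t_def ts_def del: upt_Suc)
  moreover have "last ts = b" using nth[of n] len n0 by (simp add: last_conv_nth t_def ts_def del: upt_Suc)
  ultimately show "\<exists>ts. sorted ts \<and> ts \<noteq> [] \<and> hd ts = a \<and> last ts = b \<and> \<bar>f (g b) - f (g a)\<bar> - \<epsilon> \<le> polygon_length g ts"
    unfolding D_def using len by (intro exI[of _ ts]) auto
qed

text \<open>Polar coordinates about the centre \<open>c\<close> of a unit disc, in the second quadrant and outside
  the disc: arc length is at least the increment of the angle.\<close>

definition outside_quadrant :: "complex \<Rightarrow> complex set" where
  "outside_quadrant c = {x. dist c x \<ge> 1 \<and> Re (x - c) < 0 \<and> Im (x - c) > 0}"

lemma norm_diff_rcis: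
  "(norm (of_real r * cis a - of_real s * cis b))\<^sup>2 = r\<^sup>2 + s\<^sup>2 - 2 * r * s * cos (a - b)"
  by (simp add: cmod_power2 cos_diff) (use sin_cos_squared_add[of a] sin_cos_squared_add[of b] in algebra)

lemma outside_quadrant_polar:
  assumes "x \<in> outside_quadrant c"
  shows "x = c + of_real (dist c x) * cis (Arg (x - c))" "pi/2 < Arg (x - c)" "Arg (x - c) < pi" "1 \<le> dist c x"
proof -
  have nz: "x - c \<noteq> 0" and im: "Im (x - c) > 0" and re: "Re (x - c) < 0" using assms by (auto simp: outside_quadrant_def)
  have x: "x - c = of_real (norm (x - c)) * cis (Arg (x - c))" using rcis_cmod_Arg[of "x - c"] by (simp add: rcis_def)
  then show "x = c + of_real (dist c x) * cis (Arg (x - c))" by (simp add: dist_norm norm_minus_commute algebra_simps)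
  have lt: "0 < Arg (x - c)" "Arg (x - c) < pi" using Arg_lt_pi[of "x - c"] im by auto
  then show "Arg (x - c) < pi" by simp
  have "Re (x - c) = norm (x - c) * cos (Arg (x - c))" by (subst x) simp
  then have "norm (x - c) * cos (Arg (x - c)) < 0" using re by simp
  then have "cos (Arg (x - c)) < 0" by (simp add: mult_less_0_iff)
  then have "\<not> Arg (x - c) \<le> pi/2" using cos_ge_zero[of "Arg (x - c)"] lt by auto
  then show "pi/2 < Arg (x - c)" by simp
  show "1 \<le> dist c x" using assms by (auto simp: outside_quadrant_def)
qed

lemma outside_quadrant_dist_sq:
  assumes "x \<in> outside_quadrant c" "y \<in> outside_quadrant c"
  shows "(dist x y)\<^sup>2 = (dist c x)\<^sup>2 + (dist c y)\<^sup>2 - 2 * dist c x * dist c y * cos (Arg (x - c) - Arg (y - c))"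
proof -
  have "x - y = of_real (dist c x) * cis (Arg (x - c)) - of_real (dist c y) * cis (Arg (y - c))"
    using outside_quadrant_polar(1)[OF assms(1)] outside_quadrant_polar(1)[OF assms(2)] by (metis add_diff_cancel_left)
  then show ?thesis unfolding dist_norm[of x y] by (simp only: norm_diff_rcis)
qed

lemma sin_ge_mult_cos: assumes "0 \<le> x" "x < pi/2" shows "x * cos x \<le> sin x"
proof (cases "x = 0")
  case False
  then have "x < tan x" using assms by (intro less_tan) auto
  moreover have "0 < cos x" using assms by (intro cos_gt_zero_pi) auto
  ultimately show ?thesis by (simp add: tan_def pos_less_divide_eq less_imp_le)
qed simp

text \<open>The chord of the angle \<open>d\<close> in the unit circle has length \<open>2 sin (d/2)\<close>, and moving its ends
  outwards makes it longer.\<close>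

lemma outside_quadrant_angle_le:
  assumes x: "x \<in> outside_quadrant c" and y: "y \<in> outside_quadrant c"
  shows "\<bar>Arg (x - c) - Arg (y - c)\<bar> * cos ((Arg (x - c) - Arg (y - c)) / 2) \<le> dist x y"
proof -
  define d where "d = \<bar>Arg (x - c) - Arg (y - c)\<bar>"
  have "d < pi/2" using outside_quadrant_polar(2,3)[OF x] outside_quadrant_polar(2,3)[OF y]
    unfolding d_def abs_less_iff by (intro conjI; linarith)
  then have d: "0 \<le> d" "d < pi/2" by (simp_all add: d_def)
  have ge: "1 \<le> dist c x" "1 \<le> dist c y" using outside_quadrant_polar(4) x y by auto
  have cd: "cos (Arg (x - c) - Arg (y - c)) = cos d" by (simp add: d_def abs_if cos_diff)
  have "(2 * sin (d/2))\<^sup>2 = 2 - 2 * cos d" using cos_double_sin[of "d/2"] by (simp add: power_mult_distrib)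
  also have "\<dots> \<le> 2 - 2 * cos d + (dist c x - dist c y)\<^sup>2 + 2 * (dist c x * dist c y - 1) * (1 - cos d)"
  proof -
    have "1 \<le> dist c x * dist c y" using ge mult_mono[of 1 "dist c x" 1 "dist c y"] by simp
    then have "0 \<le> (dist c x * dist c y - 1) * (1 - cos d)" by (intro mult_nonneg_nonneg) auto
    then show ?thesis using zero_le_power2[of "dist c x - dist c y"] by (simp only: mult.assoc)
  qed
  also have "\<dots> = (dist x y)\<^sup>2" unfolding outside_quadrant_dist_sq[OF x y] cd by (simp add: power2_eq_square algebra_simps)
  finally have "2 * sin (d/2) \<le> dist x y" by (rule power2_le_imp_le) simp
  moreover have "d/2 * cos (d/2) \<le> sin (d/2)" using d by (intro sin_ge_mult_cos) auto
  moreover have "cos ((Arg (x - c) - Arg (y - c)) / 2) = cos (d/2)"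
    by (simp add: d_def abs_if) (metis cos_minus minus_diff_eq minus_divide_left)?
  ultimately show ?thesis unfolding d_def[symmetric] by simp
qed

text \<open>The distance from \<open>x\<close> to the ray of \<open>y\<close> is \<open>dist c x * sin d\<close>, which is at least \<open>tan d\<close>.\<close>

lemma outside_quadrant_strict:
  assumes x: "x \<in> outside_quadrant c" and y: "y \<in> outside_quadrant c"
    and d: "0 < d" "d = \<bar>Arg (x - c) - Arg (y - c)\<bar>" "1 \<le> dist c x * cos d"
  shows "d < dist x y"
proof -
  have dp: "d < pi/2" using outside_quadrant_polar(2,3)[OF x] outside_quadrant_polar(2,3)[OF y]
    unfolding d(2) abs_less_iff by (intro conjI; linarith)
  have cd: "cos (Arg (x - c) - Arg (y - c)) = cos d" by (simp add: d abs_if cos_diff)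
  have cp: "0 < cos d" "0 < sin d" using d(1) dp by (auto intro!: cos_gt_zero_pi sin_gt_zero)
  have "tan d \<le> dist c x * sin d"
  proof -
    have "1 * sin d \<le> dist c x * cos d * sin d" using cp d(3) by (intro mult_right_mono) auto
    then show ?thesis using cp by (simp add: tan_def pos_divide_le_eq algebra_simps)
  qed
  then have lt: "d < dist c x * sin d" using less_tan[OF d(1) dp] by linarith
  have "(dist c x * sin d)\<^sup>2 \<le> (dist c x * sin d)\<^sup>2 + (dist c y - dist c x * cos d)\<^sup>2" by simp
  also have "\<dots> = (dist c x)\<^sup>2 * ((sin d)\<^sup>2 + (cos d)\<^sup>2) + (dist c y)\<^sup>2 - 2 * dist c x * dist c y * cos d"
    by algebra
  also have "\<dots> = (dist x y)\<^sup>2" unfolding outside_quadrant_dist_sq[OF x y] cd by simp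
  finally have "dist c x * sin d \<le> dist x y" by (rule power2_le_imp_le) simp
  then show ?thesis using lt by linarith
qed

lemma continuous_on_Arg_outside:
  assumes "continuous_on S g" "g ` S \<subseteq> outside_quadrant c"
  shows "continuous_on S (\<lambda>u. Arg (g u - c))"
proof (rule continuous_on_compose2[of "- \<real>\<^sub>\<le>\<^sub>0" Arg S "\<lambda>u. g u - c"])
  show "continuous_on (- \<real>\<^sub>\<le>\<^sub>0) Arg" by (rule continuous_on_Arg)
  show "continuous_on S (\<lambda>u. g u - c)" using assms by (intro continuous_intros)
  show "(\<lambda>u. g u - c) ` S \<subseteq> - \<real>\<^sub>\<le>\<^sub>0"
    using assms(2) by (fastforce simp: outside_quadrant_def complex_nonpos_Reals_iff)
qed

lemma length_ge_angle:
  assumes "a \<le> b" "continuous_on {a..b} g" "g ` {a..b} \<subseteq> outside_quadrant c"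
  shows "length_ge g a b \<bar>Arg (g b - c) - Arg (g a - c)\<bar>"
proof (rule length_ge_calibration[where f="\<lambda>x. Arg (x - c)"])
  show "continuous_on {a..b} (\<lambda>u. Arg (g u - c))" using assms by (intro continuous_on_Arg_outside)
  fix \<epsilon> :: real assume e: "0 < \<epsilon>"
  have "isCont cos (0::real)" by simp
  moreover have "1 / (1 + \<epsilon>) < cos 0" using e by simp
  ultimately have "\<forall>\<^sub>F x in at 0. 1 / (1 + \<epsilon>) < cos x" by (metis isCont_def order_tendstoD(1))
  then obtain \<delta> where d: "0 < \<delta>" "\<And>x::real. x \<noteq> 0 \<Longrightarrow> \<bar>x\<bar> < \<delta> \<Longrightarrow> 1 / (1 + \<epsilon>) < cos x"
    unfolding eventually_at by (auto simp: dist_real_def)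
  show "\<exists>\<delta>>0. \<forall>u\<in>{a..b}. \<forall>v\<in>{a..b}. \<bar>Arg (g u - c) - Arg (g v - c)\<bar> < \<delta> \<longrightarrow>
        \<bar>Arg (g u - c) - Arg (g v - c)\<bar> \<le> (1 + \<epsilon>) * dist (g u) (g v)"
  proof (intro exI[of _ \<delta>] conjI ballI impI d(1))
    fix u v assume uv: "u \<in> {a..b}" "v \<in> {a..b}" "\<bar>Arg (g u - c) - Arg (g v - c)\<bar> < \<delta>"
    let ?d = "Arg (g u - c) - Arg (g v - c)"
    have ge: "\<bar>?d\<bar> * cos (?d / 2) \<le> dist (g u) (g v)" using assms(3) uv by (intro outside_quadrant_angle_le) auto
    show "\<bar>?d\<bar> \<le> (1 + \<epsilon>) * dist (g u) (g v)"
    proof (cases "?d = 0")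
      case False
      then have "1 / (1 + \<epsilon>) < cos (?d / 2)" using uv(3) by (intro d(2)) auto
      then have "\<bar>?d\<bar> * (1 / (1 + \<epsilon>)) \<le> \<bar>?d\<bar> * cos (?d / 2)" by (intro mult_left_mono) auto
      then have "\<bar>?d\<bar> / (1 + \<epsilon>) \<le> dist (g u) (g v)" using ge by simp
      then show ?thesis using e by (simp add: pos_divide_le_eq mult.commute)
    qed (use e in simp)
  qed
qed (rule assms)

lemma dist_cis_le: "dist (c + cis a) (c + cis b) \<le> \<bar>a - b\<bar>"
proof -
  define y where "y = (a - b)/2"
  have y: "a - b = 2 * y" by (simp add: y_def)
  have "(dist (c + cis a) (c + cis b))\<^sup>2 = 2 - 2 * cos (2 * y)"
    using norm_diff_rcis[of 1 a 1 b] by (simp add: dist_norm y)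
  also have "\<dots> = (2 * \<bar>sin y\<bar>)\<^sup>2" by (simp add: cos_double_sin power_mult_distrib)
  finally have "dist (c + cis a) (c + cis b) = 2 * \<bar>sin y\<bar>" by (rule power2_eq_imp_eq) auto
  then show ?thesis using abs_sin_x_le_abs_x[of y] y by simp
qed

lemma in_segment_if_dist_le:
  fixes a b x :: complex
  assumes "dist a x + dist x b \<le> dist a b" shows "x \<in> closed_segment a b"
proof -
  have "dist a b = dist a x + dist x b" using assms dist_triangle[of a b x] by linarith
  then show ?thesis using between_mem_segment[of a b x] by (simp add: between)
qed

text \<open>The shortest path around a disc. A path that avoids the unit disc about \<open>c\<close> and leads from
  \<open>c + cis \<phi>\<^sub>1\<close> to \<open>x\<^sub>0\<close> must cross the ray through the point \<open>Z\<close> whose tangent passes through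
  \<open>x\<^sub>0\<close>. Up to there its length is at least the increment of the angle, and the point of that ray
  closest to \<open>x\<^sub>0\<close> is \<open>Z\<close>. So the arc to \<open>Z\<close> followed by the tangent segment is shortest, and
  tracing the cases of equality shows that it is the only shortest path.\<close>

definition arc_then_segment :: "complex \<Rightarrow> real \<Rightarrow> real \<Rightarrow> complex \<Rightarrow> complex set" where
  "arc_then_segment c \<phi>1 \<phi>Z x0 = (\<lambda>\<phi>. c + cis \<phi>) ` {\<phi>1..\<phi>Z} \<union> closed_segment (c + cis \<phi>Z) x0"

lemma arc_then_segment_path:
  assumes "\<phi>1 \<le> \<phi>Z"
  obtains g where "path g" "path_image g \<subseteq> arc_then_segment c \<phi>1 \<phi>Z x0" "pathstart g = c + cis \<phi>1" "pathfinish g = x0"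
    "curve_length g \<le> ennreal ((\<phi>Z - \<phi>1) + dist (c + cis \<phi>Z) x0)"
proof -
  define A D Z where "A = \<phi>Z - \<phi>1" and "D = dist (c + cis \<phi>Z) x0" and "Z = c + cis \<phi>Z"
  have AD: "0 \<le> A" "0 \<le> D" using assms by (auto simp: A_def D_def)
  define G where "G a = (if a \<le> A then c + cis (\<phi>1 + a) else Z + ((a - A) / D) *\<^sub>R (x0 - Z))" for a
  have GA: "G A = Z" by (simp add: G_def A_def Z_def)
  have nD: "norm (x0 - Z) = D" by (simp add: D_def Z_def dist_norm norm_minus_commute)
  have seg: "dist (G a) (G b) \<le> \<bar>a - b\<bar>" if "A \<le> a" "A \<le> b" for a b
  proof -
    have Gs: "G a = Z + ((a - A) / D) *\<^sub>R (x0 - Z)" if "A \<le> a" for a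
      using that GA by (cases "a = A") (auto simp: G_def)
    have "G a - G b = ((a - A) / D - (b - A) / D) *\<^sub>R (x0 - Z)"
      unfolding Gs[OF that(1)] Gs[OF that(2)] by (simp add: scaleR_left_diff_distrib)
    then have "G a - G b = ((a - b) / D) *\<^sub>R (x0 - Z)" by (simp add: diff_divide_distrib)
    then have "dist (G a) (G b) = \<bar>(a - b) / D\<bar> * D" using nD by (simp add: dist_norm)
    also have "\<dots> \<le> \<bar>a - b\<bar>" using AD by (cases "D = 0") auto
    finally show ?thesis .
  qed
  have arc: "dist (G a) (G b) \<le> \<bar>a - b\<bar>" if "a \<le> A" "b \<le> A" for a b
    using that dist_cis_le[of c "\<phi>1 + a" "\<phi>1 + b"] by (simp add: G_def)
  have mix: "dist (G a) (G b) \<le> \<bar>a - b\<bar>" if "a \<le> A" "A \<le> b" for a b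
    using dist_triangle[of "G a" "G b" "G A"] arc[of a A] seg[of A b] that by simp
  have lip: "dist (G a) (G b) \<le> \<bar>a - b\<bar>" for a b
    using arc[of a b] seg[of a b] mix[of a b] mix[of b a] by (cases "a \<le> A"; cases "b \<le> A") (auto simp: dist_commute abs_minus_commute)
  define g where "g u = G ((A + D) * u)" for u
  have lipg: "dist (g u) (g v) \<le> (A + D) * \<bar>u - v\<bar>" for u v
  proof -
    have "\<bar>(A + D) * u - (A + D) * v\<bar> = (A + D) * \<bar>u - v\<bar>"
      using AD by (simp add: right_diff_distrib[symmetric] abs_mult)
    then show ?thesis using lip unfolding g_def by metis
  qed
  show ?thesis
  proof
    have "continuous_on {0..1} g"
    proof (rule continuous_onI)
      fix x \<epsilon> :: real assume "x \<in> {0..1}" "0 < \<epsilon>"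
      show "\<exists>d>0. \<forall>x'\<in>{0..1}. dist x' x < d \<longrightarrow> dist (g x') (g x) \<le> \<epsilon>"
      proof (intro exI[of _ "\<epsilon> / (A + D + 1)"] conjI ballI impI)
        show "0 < \<epsilon> / (A + D + 1)" using AD \<open>0 < \<epsilon>\<close> by simp
        fix x' assume "dist x' x < \<epsilon> / (A + D + 1)"
        then have "(A + D + 1) * \<bar>x' - x\<bar> < \<epsilon>" using AD by (simp add: dist_real_def pos_less_divide_eq mult.commute)
        moreover have "(A + D) * \<bar>x' - x\<bar> \<le> (A + D + 1) * \<bar>x' - x\<bar>" by (intro mult_right_mono) auto
        ultimately show "dist (g x') (g x) \<le> \<epsilon>" using lipg[of x' x] by linarith
      qed
    qed
    then show "path g" by (simp add: path_def)
    show "pathstart g = c + cis \<phi>1" using AD by (simp add: pathstart_def g_def G_def)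
    show "pathfinish g = x0"
    proof (cases "D = 0")
      case True
      then have "Z = x0" by (simp add: D_def Z_def)
      then show ?thesis using GA True by (simp add: pathfinish_def g_def)
    next
      case False
      then show ?thesis using AD by (simp add: pathfinish_def g_def G_def)
    qed
    show "path_image g \<subseteq> arc_then_segment c \<phi>1 \<phi>Z x0"
    proof
      fix x assume "x \<in> path_image g"
      then obtain u where u: "0 \<le> u" "u \<le> 1" "x = G ((A + D) * u)" by (auto simp: path_image_def g_def)
      define a where "a = (A + D) * u"
      have a: "0 \<le> a" "a \<le> A + D" using u AD by (auto simp: a_def mult_left_le)
      have xa: "x = G a" using u by (simp add: a_def)
      show "x \<in> arc_then_segment c \<phi>1 \<phi>Z x0"
      proof (cases "a \<le> A")
        case True
        then have "x = c + cis (\<phi>1 + a)" "\<phi>1 + a \<in> {\<phi>1..\<phi>Z}" using xa a by (auto simp: G_def A_def)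
        then show ?thesis unfolding arc_then_segment_def by blast
      next
        case False
        then have x: "x = Z + ((a - A) / D) *\<^sub>R (x0 - Z)" "0 < D" using xa a by (auto simp: G_def)
        then have "x \<in> closed_segment Z x0" using False a by (intro in_closed_segmentI[OF x(1)]) auto
        then show ?thesis unfolding arc_then_segment_def Z_def by blast
      qed
    qed
    show "curve_length g \<le> ennreal ((\<phi>Z - \<phi>1) + dist (c + cis \<phi>Z) x0)"
      using curve_length_lipschitz[of g "A + D"] lipg AD by (simp add: A_def D_def)
  qed
qed

lemma Arg_crossing:
  fixes h :: "real \<Rightarrow> complex"
  assumes "a \<le> b" "continuous_on {a..b} h" "h ` {a..b} \<subseteq> outside_quadrant c"
    "Arg (h a - c) \<le> y" "y \<le> Arg (h b - c)"
  obtains v where "a \<le> v" "v \<le> b" "Arg (h v - c) = y"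
  using IVT'[of "\<lambda>u. Arg (h u - c)" a y b] continuous_on_Arg_outside[OF assms(2,3)] assms that by auto

lemma shortest_around_disc:
  assumes h: "path h" "path_image h \<subseteq> outside_quadrant c" "h 0 = c + cis \<phi>1" "h 1 = x0"
    and \<phi>: "pi/2 < \<phi>1" "\<phi>1 \<le> \<phi>Z" "\<phi>Z \<le> Arg (x0 - c)" "\<phi>Z < pi"
    and tangent: "(x0 - (c + cis \<phi>Z)) \<bullet> cis \<phi>Z = 0"
  shows "ennreal ((\<phi>Z - \<phi>1) + dist (c + cis \<phi>Z) x0) \<le> curve_length h"
    and "curve_length h \<le> ennreal ((\<phi>Z - \<phi>1) + dist (c + cis \<phi>Z) x0) \<Longrightarrow>
      path_image h \<subseteq> arc_then_segment c \<phi>1 \<phi>Z x0"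
proof -
  define Z where "Z = c + cis \<phi>Z"
  define f where "f u = Arg (h u - c)" for u
  have cont: "continuous_on {a..b} h" and img: "h ` {a..b} \<subseteq> outside_quadrant c" if "0 \<le> a" "b \<le> 1" for a b
  proof -
    have s: "{a..b} \<subseteq> {0..1}" using that by auto
    show "continuous_on {a..b} h" using h(1) s continuous_on_subset unfolding path_def by blast
    show "h ` {a..b} \<subseteq> outside_quadrant c" using h(2) s unfolding path_image_def by blast
  qed
  have out: "h u \<in> outside_quadrant c" if "0 \<le> u" "u \<le> 1" for u using h(2) that unfolding path_image_def by auto
  have f0: "f 0 = \<phi>1" using h(3) \<phi> by (simp add: f_def Arg_cis)
  have f1: "f 1 = Arg (x0 - c)" using h(4) by (simp add: f_def)
  obtain v where v: "0 \<le> v" "v \<le> 1" "f v = \<phi>Z"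
    using Arg_crossing[of 0 1 h c \<phi>Z] cont[of 0 1] img[of 0 1] f0 f1 \<phi> unfolding f_def by auto
  have ang: "length_ge h a b \<bar>f b - f a\<bar>" if "0 \<le> a" "a \<le> b" "b \<le> 1" for a b
    unfolding f_def using that by (intro length_ge_angle cont img) auto
  have polar: "h u = c + of_real (dist c (h u)) * cis (f u)" "1 \<le> dist c (h u)" if "0 \<le> u" "u \<le> 1" for u
    using outside_quadrant_polar[OF out[OF that]] by (simp_all add: f_def)
  define r where "r = dist c (h v)"
  have r: "h v = Z + (r - 1) *\<^sub>R cis \<phi>Z" "1 \<le> r"
    using polar[OF v(1,2)] v(3) by (simp_all add: r_def Z_def scaleR_conv_of_real algebra_simps)
  have hv: "(dist (h v) x0)\<^sup>2 = (dist Z x0)\<^sup>2 + (r - 1)\<^sup>2"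
  proof -
    define a b where "a = (r - 1) *\<^sub>R cis \<phi>Z" and "b = x0 - Z"
    have "a \<bullet> b = 0" "b \<bullet> a = 0" using tangent by (simp_all add: a_def b_def Z_def inner_commute)
    then have "(norm (a - b))\<^sup>2 = (norm b)\<^sup>2 + (norm a)\<^sup>2"
      by (simp add: power2_norm_eq_inner inner_diff_left inner_diff_right)
    moreover have "dist (h v) x0 = norm (a - b)" "dist Z x0 = norm b"
      unfolding r(1) by (simp_all add: a_def b_def dist_norm norm_minus_commute diff_diff_eq)
    moreover have "(norm a)\<^sup>2 = (r - 1)\<^sup>2" by (simp add: a_def)
    ultimately show ?thesis by simp
  qed
  have "(dist Z x0)\<^sup>2 \<le> (dist (h v) x0)\<^sup>2" using hv by simp
  then have Zle: "dist Z x0 \<le> dist (h v) x0" by (rule power2_le_imp_le) simp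
  have tail: "length_ge h v 1 (dist (h v) x0)" using length_ge_chord[of v 1 h] v h(4) by simp
  have whole: "length_ge h 0 1 (\<bar>\<phi>Z - \<phi>1\<bar> + dist (h v) x0)"
    using length_ge_add[OF ang[of 0 v] tail] v f0 by simp
  have "ennreal (\<bar>\<phi>Z - \<phi>1\<bar> + dist (h v) x0) \<le> curve_length h" by (rule curve_length_ge[OF whole])
  moreover have "ennreal ((\<phi>Z - \<phi>1) + dist Z x0) \<le> ennreal (\<bar>\<phi>Z - \<phi>1\<bar> + dist (h v) x0)"
    using Zle by (intro ennreal_leI) simp
  ultimately show "ennreal ((\<phi>Z - \<phi>1) + dist (c + cis \<phi>Z) x0) \<le> curve_length h"
    unfolding Z_def[symmetric] by (rule order_trans[rotated])
  assume "curve_length h \<le> ennreal ((\<phi>Z - \<phi>1) + dist (c + cis \<phi>Z) x0)"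
  then have le: "curve_length h \<le> ennreal ((\<phi>Z - \<phi>1) + dist Z x0)" by (simp add: Z_def)
  have bound: "l \<le> (\<phi>Z - \<phi>1) + dist Z x0" if "length_ge h 0 1 l" for l
    by (rule length_ge_curve_length[OF that le]) (use \<phi> in simp)
  have "dist (h v) x0 \<le> dist Z x0" using bound[OF whole] \<phi> by simp
  then have "(dist (h v) x0)\<^sup>2 \<le> (dist Z x0)\<^sup>2" by (intro power_mono) auto
  then have "(r - 1)\<^sup>2 = 0" using hv zero_le_power2[of "r - 1"] by linarith
  then have hvZ: "h v = Z" using r by simp
  have tailZ: "length_ge h v 1 (dist Z x0)" using tail hvZ by simp
  show "path_image h \<subseteq> arc_then_segment c \<phi>1 \<phi>Z x0"
  proof
    fix x assume "x \<in> path_image h"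
    then obtain u where u: "0 \<le> u" "u \<le> 1" "x = h u" by (auto simp: path_image_def)
    show "x \<in> arc_then_segment c \<phi>1 \<phi>Z x0"
    proof (cases "v \<le> u")
      case True
      have "length_ge h 0 1 (\<bar>\<phi>Z - \<phi>1\<bar> + (dist (h v) (h u) + dist (h u) (h 1)))"
        using length_ge_add[OF ang[of 0 v] length_ge_add[OF length_ge_chord[of v u h] length_ge_chord[of u 1 h]]] True u v f0 by simp
      from bound[OF this] have "dist Z x + dist x x0 \<le> dist Z x0" using \<phi> hvZ u h(4) by simp
      then show ?thesis unfolding arc_then_segment_def Z_def[symmetric] using in_segment_if_dist_le by blast
    next
      case False
      then have uv: "u \<le> v" by simp
      have "length_ge h 0 1 (\<bar>f u - \<phi>1\<bar> + (\<bar>\<phi>Z - f u\<bar> + dist Z x0))"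
        using length_ge_add[OF ang[of 0 u] length_ge_add[OF ang[of u v] tailZ]] uv u v f0 by simp
      from bound[OF this] have fu: "\<phi>1 \<le> f u" "f u \<le> \<phi>Z" by linarith+
      note pu = polar[OF u(1,2)]
      have "dist c (h u) = 1"
      proof (rule ccontr)
        assume "dist c (h u) \<noteq> 1"
        then have gt: "1 < dist c (h u)" using pu by simp
        show False
        proof (cases "f u = \<phi>Z")
          case True
          have "length_ge h 0 1 (\<bar>f u - \<phi>1\<bar> + (dist (h u) (h v) + dist Z x0))"
            using length_ge_add[OF ang[of 0 u] length_ge_add[OF length_ge_chord[of u v h] tailZ]] uv u v f0 by simp
          from bound[OF this] have "h u = Z" using True \<phi> hvZ by simp
          then show False using gt by (simp add: Z_def dist_norm)
        next
          case False
          have "-1 < 1 / dist c (h u)" by (rule less_le_trans[of _ 0]) simp_all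
          moreover have "1 / dist c (h u) < 1" using gt by (subst pos_divide_less_eq) linarith+
          ultimately have ar: "0 < arccos (1 / dist c (h u))" using arccos_lt_bounded[of "1 / dist c (h u)"] by blast
          \<comment> \<open>turning by this angle from \<open>h u\<close> is strictly longer than the angle, which makes the path too long\<close>
          define \<delta> where "\<delta> = min (\<phi>Z - f u) (arccos (1 / dist c (h u)))"
          have d: "0 < \<delta>" "f u + \<delta> \<le> \<phi>Z" "\<delta> \<le> arccos (1 / dist c (h u))"
            using ar False fu by (auto simp: \<delta>_def)
          have c1: "-1 \<le> 1 / dist c (h u)" "1 / dist c (h u) \<le> 1" using gt by (auto simp: divide_le_eq_1 intro: order_trans[of _ 0])
          have "cos (arccos (1 / dist c (h u))) \<le> cos \<delta>"
            using d arccos_ubound[OF c1] by (intro cos_monotone_0_pi_le) auto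
          then have "1 / dist c (h u) \<le> cos \<delta>" using cos_arccos[OF c1] by simp
          then have ge: "1 \<le> dist c (h u) * cos \<delta>" using gt
            mult_right_mono[of "1 / dist c (h u)" "cos \<delta>" "dist c (h u)"] by (cases "c = h u") (simp_all add: mult.commute[of "cos \<delta>"])
          obtain w where w: "u \<le> w" "w \<le> v" "f w = f u + \<delta>"
            using Arg_crossing[of u v h c "f u + \<delta>"] cont[of u v] img[of u v] uv u v d unfolding f_def by auto
          have w01: "0 \<le> w" "w \<le> 1" using w u v by auto
          have "\<delta> < dist (h u) (h w)"
            using outside_quadrant_strict[OF out[OF u(1,2)] out[OF w01] d(1) _ ge] w(3) d(1) by (simp add: f_def)
          moreover have "length_ge h 0 1 (\<bar>f u - \<phi>1\<bar> + (dist (h u) (h w) + (\<bar>\<phi>Z - f w\<bar> + dist Z x0)))"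
            using length_ge_add[OF ang[of 0 u] length_ge_add[OF length_ge_chord[of u w h] length_ge_add[OF ang[of w v] tailZ]]]
              uv u v w f0 by simp
          ultimately show False using bound w d fu by force
        qed
      qed
      then have "x = c + cis (f u)" using pu u by simp
      then show ?thesis unfolding arc_then_segment_def using fu by auto
    qed
  qed
qed

text \<open>The path of \<open>arc_then_segment_path\<close> shows that a shortest path exists, and its length forces
  every shortest path into the image of this one.\<close>

lemma shortest_path_around_disc:
  assumes R: "R \<subseteq> outside_quadrant c" "arc_then_segment c \<phi>1 \<phi>Z x0 \<subseteq> R"
    and \<phi>: "pi/2 < \<phi>1" "\<phi>1 \<le> \<phi>Z" "\<phi>Z \<le> Arg (x0 - c)" "\<phi>Z < pi" "(x0 - (c + cis \<phi>Z)) \<bullet> cis \<phi>Z = 0"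
  shows "path_image (SOME g. shortest_path R (c + cis \<phi>1) x0 g) \<subseteq> arc_then_segment c \<phi>1 \<phi>Z x0"
proof -
  obtain g where g: "path g" "path_image g \<subseteq> arc_then_segment c \<phi>1 \<phi>Z x0" "pathstart g = c + cis \<phi>1" "pathfinish g = x0"
    "curve_length g \<le> ennreal ((\<phi>Z - \<phi>1) + dist (c + cis \<phi>Z) x0)"
    using arc_then_segment_path[OF \<phi>(2)] .
  have hd: "path h" "path_image h \<subseteq> outside_quadrant c" "h 0 = c + cis \<phi>1" "h 1 = x0"
    if "path_within R (c + cis \<phi>1) x0 h" for h
    using that R(1) by (auto simp: path_within_def pathstart_def pathfinish_def)
  have "path_within R (c + cis \<phi>1) x0 g" using g R(2) by (auto simp: path_within_def)
  moreover have "curve_length g \<le> curve_length h" if "path_within R (c + cis \<phi>1) x0 h" for h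
    by (rule order_trans[OF g(5) shortest_around_disc(1)[OF hd[OF that] \<phi>]])
  ultimately have "\<exists>g. shortest_path R (c + cis \<phi>1) x0 g" unfolding shortest_path_def by blast
  then have s: "shortest_path R (c + cis \<phi>1) x0 (SOME g. shortest_path R (c + cis \<phi>1) x0 g)" by (rule someI_ex)
  then have "curve_length (SOME g. shortest_path R (c + cis \<phi>1) x0 g) \<le> curve_length g"
    using \<open>path_within R (c + cis \<phi>1) x0 g\<close> unfolding shortest_path_def by blast
  then have le: "curve_length (SOME g. shortest_path R (c + cis \<phi>1) x0 g) \<le> ennreal ((\<phi>Z - \<phi>1) + dist (c + cis \<phi>Z) x0)"
    using g(5) by (rule order_trans)
  have w: "path_within R (c + cis \<phi>1) x0 (SOME g. shortest_path R (c + cis \<phi>1) x0 g)"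
    using s unfolding shortest_path_def by blast
  show ?thesis by (rule shortest_around_disc(2)[OF hd[OF w] \<phi> le])
qed

lemma shortest_path_segment:
  assumes R: "closed_segment z1 x0 \<subseteq> R"
  shows "path_image (SOME g. shortest_path R z1 x0 g) \<subseteq> closed_segment z1 x0"
proof -
  have w: "path_within R z1 x0 (linepath z1 x0)" using R by (simp add: path_within_def)
  have ll: "curve_length (linepath z1 x0) \<le> ennreal (dist z1 x0)"
  proof (rule curve_length_lipschitz)
    fix u v :: real
    have "linepath z1 x0 u - linepath z1 x0 v = (v - u) *\<^sub>R (z1 - x0)" by (simp add: linepath_def algebra_simps)
    then show "dist (linepath z1 x0 u) (linepath z1 x0 v) \<le> dist z1 x0 * \<bar>u - v\<bar>"
      by (simp add: dist_norm abs_minus_commute mult.commute)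
  qed simp
  have ends: "h 0 = z1" "h 1 = x0" if "path_within R z1 x0 h" for h
    using that by (auto simp: path_within_def pathstart_def pathfinish_def)
  have "ennreal (dist z1 x0) \<le> curve_length h" if "path_within R z1 x0 h" for h
    using curve_length_ge[OF length_ge_chord[of 0 1 h]] ends[OF that] by simp
  then have "\<exists>g. shortest_path R z1 x0 g" using w ll unfolding shortest_path_def by (meson order_trans)
  then have s: "shortest_path R z1 x0 (SOME g. shortest_path R z1 x0 g)" by (rule someI_ex)
  let ?h = "SOME g. shortest_path R z1 x0 g"
  from s have "curve_length ?h \<le> curve_length (linepath z1 x0)" using w unfolding shortest_path_def by blast
  then have le: "curve_length ?h \<le> ennreal (dist z1 x0)" using ll by (rule order_trans)
  have wh: "path_within R z1 x0 ?h" using s unfolding shortest_path_def by blast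
  show ?thesis
  proof
    fix x assume "x \<in> path_image ?h"
    then obtain u where u: "0 \<le> u" "u \<le> 1" "x = ?h u" by (auto simp: path_image_def)
    have "length_ge ?h 0 1 (dist z1 x + dist x x0)"
      using length_ge_add[OF length_ge_chord[of 0 u ?h] length_ge_chord[of u 1 ?h]] ends[OF wh] u by simp
    then have "dist z1 x + dist x x0 \<le> dist z1 x0" using length_ge_curve_length[OF _ le] by simp
    then show "x \<in> closed_segment z1 x0" by (rule in_segment_if_dist_le)
  qed
qed

section \<open>The shortest path in the parametrised region\<close>

lemma dist_diff_sq: "dist c (x + d) \<ge> 1" if "dist c x \<ge> 1" "(x - c) \<bullet> d \<ge> 0" for c x d :: complex
proof -
  have "(x + d - c) \<bullet> (x + d - c) = (x - c) \<bullet> (x - c) + 2 * ((x - c) \<bullet> d) + d \<bullet> d"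
    by (simp add: inner_add_left inner_add_right inner_diff_left inner_diff_right inner_commute)
  moreover have "(x - c) \<bullet> (x - c) \<ge> 1" using that(1) dist_less_1_iff[of c x] by linarith
  ultimately have "\<not> (x + d - c) \<bullet> (x + d - c) < 1" using that(2) inner_ge_zero[of d] by linarith
  then show ?thesis using dist_less_1_iff[of c "x + d"] by linarith
qed

context slant begin

abbreviation "x0 \<equiv> X_map 0 0"
abbreviation "z1 \<equiv> X_map \<theta> p"

lemma box_0: "(0, 0) \<in> param_box \<sigma>" and box_z1: "(\<theta>, p) \<in> param_box \<sigma>"
  and box_theta: "-p \<le> t \<Longrightarrow> t \<le> p \<Longrightarrow> (\<theta>, t) \<in> param_box \<sigma>"
  using theta p_bounds by (auto simp: param_box_iff)

lemma box_in_R: "(s, t) \<in> param_box \<sigma> \<Longrightarrow> X_map s t \<in> region_R \<sigma>"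
  by (auto simp: region_R_def)

lemma region_R_E:
  assumes "x \<in> region_R \<sigma>" obtains s t where "(s, t) \<in> param_box \<sigma>" "x = X_map s t"
  using assms by (auto simp: region_R_def)

lemma lam_0: "lam 0 = 1 - sqrt 3/2" by (simp add: lam_def)

text \<open>The points \<open>X(0,0)\<close> and \<open>X(\<theta>,\<tau>)\<close> are less than \<open>1/10\<close> apart, so the signs of the components of
  their difference take precise bounds.\<close>

lemma x0_bounds: "- 312/1000 \<le> Re x0" "Re x0 \<le> - 311/1000" "450/1000 \<le> Im x0" "Im x0 \<le> 4505/10000"
proof -
  have L: "CDpt (lam 0) = Complex (1/2) (sqrt 3/2 - 1)"
    by (simp add: lam_0 CDpt_def complex_eq_iff field_simps)
  have e: "CDpt (lam 0) - DEpt 0 = Complex (1/2) (sqrt 3/2 - 1/2)" unfolding L by (simp add: DEpt_def complex_eq_iff)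
  define n where "n = (CDpt (lam 0) - DEpt 0) \<bullet> (CDpt (lam 0) - DEpt 0)"
  have n: "n = (5 - 2 * sqrt 3)/4" unfolding n_def e by (simp add: inner_complex_def field_simps)
  have n0: "n > 0" "n \<le> 4" using sqrt3_bounds unfolding n by simp_all
  define k where "k = sqrt (1 / n - 1/4)"
  have "n * (4 * (5 + 2 * sqrt 3)/13) = 1" unfolding n by (simp add: field_simps)
  then have "1 / n = 4 * (5 + 2 * sqrt 3)/13" using n0 by (simp add: field_simps)
  then have k2: "1 / n - 1/4 = 20/13 + 8/13 * sqrt 3 - 1/4" by simp
  have "(15343/10000)\<^sup>2 \<le> 1 / n - 1/4" unfolding k2 using sqrt3_bounds by (simp add: power2_eq_square)
  then have k1: "15343/10000 \<le> k" unfolding k_def by (rule real_le_rsqrt)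
  have "1 / n - 1/4 \<le> (15344/10000)\<^sup>2" unfolding k2 using sqrt3_bounds by (simp add: power2_eq_square)
  then have k2: "k \<le> 15344/10000" unfolding k_def by (intro real_le_lsqrt) auto
  define x where "x = (1/2) *\<^sub>R (CDpt (lam 0) + DEpt 0) + k *\<^sub>R (\<i> * (CDpt (lam 0) - DEpt 0))"
  have ne: "CDpt (lam 0) \<noteq> DEpt 0" using e by (auto simp: complex_eq_iff)
  have d: "dist (CDpt (lam 0)) x = 1" "dist (DEpt 0) x = 1"
    unfolding x_def k_def n_def using n0(2)[unfolded n_def] ne by (intro unit_circles_meet_left; simp)+
  have x: "Re x = 1/4 - k * (sqrt 3/2 - 1/2)" "Im x = sqrt 3/4 - 3/4 + k/2"
    unfolding x_def e by (simp_all add: L DEpt_def field_simps)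
  have "15343/10000 * (366/1000) \<le> k * (sqrt 3/2 - 1/2)" "k * (sqrt 3/2 - 1/2) \<le> 15344/10000 * (36605/100000)"
    using k1 k2 sqrt3_bounds by (intro mult_mono; simp)+
  then have b: "- 312/1000 \<le> Re x" "Re x \<le> - 311/1000" "450/1000 \<le> Im x" "Im x \<le> 4505/10000"
    unfolding x using k1 k2 sqrt3_bounds by simp_all
  have "x0 = x \<or> x0 = CDpt (lam 0) + DEpt 0 - x"
    by (rule unit_circles_meet[OF ne d X_map(2,3)[OF box_0]])
  moreover have "x0 \<noteq> CDpt (lam 0) + DEpt 0 - x"
  proof
    assume "x0 = CDpt (lam 0) + DEpt 0 - x"
    then have "Re x0 = 1/2 - Re x" by (simp add: L DEpt_def)
    then show False using b X_map(1)[OF box_0] p_bounds unfolding Q_def by simp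
  qed
  ultimately show "- 312/1000 \<le> Re x0" "Re x0 \<le> - 311/1000" "450/1000 \<le> Im x0" "Im x0 \<le> 4505/10000"
    using b by simp_all
qed

lemma z1_bounds: "- 2905/10000 \<le> Re z1" "Re z1 \<le> - 27/100" "468/1000 \<le> Im z1"
proof -
  define m where "m = 1/4 + sqrt 3 * p/2"
  define k where "k = sqrt (1 - m\<^sup>2)"
  have "1732/1000 * p \<le> sqrt 3 * p" "sqrt 3 * p \<le> 17321/10000 * p" using p_bounds sqrt3_mult[of p] by linarith+
  then have sp: "1506/10000 \<le> sqrt 3 * p" and m: "325/1000 \<le> m" "m \<le> 367/1000" using p_bounds unfolding m_def by linarith+
  have "(325/1000)\<^sup>2 \<le> m\<^sup>2" "m\<^sup>2 \<le> (367/1000)\<^sup>2" using m by (intro power_mono; simp)+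
  then have m2: "1056/10000 \<le> m\<^sup>2" "m\<^sup>2 \<le> 1347/10000" by (simp_all add: power2_eq_square)
  have "(93/100)\<^sup>2 \<le> 1 - m\<^sup>2" using m2 by (simp add: power2_eq_square)
  then have k1: "93/100 \<le> k" unfolding k_def by (rule real_le_rsqrt)
  have "1 - m\<^sup>2 \<le> (9458/10000)\<^sup>2" using m2 by (simp add: power2_eq_square)
  then have k2: "k \<le> 9458/10000" unfolding k_def by (intro real_le_lsqrt) auto
  have kk: "k * k = 1 - m * m" unfolding k_def using m2 by (simp add: power2_eq_square)
  define x where "x = Complex (sqrt 3/8 - p/4 - k/2) (- 3/8 + sqrt 3*p/4 + sqrt 3 * k/2)"
  have xe: "x - CDpt p = Complex (- (sqrt 3/2) * m - k/2) (- m/2 + sqrt 3/2 * k)"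
    "x - DEpt p = Complex (sqrt 3/2 * m - k/2) (m/2 + sqrt 3/2 * k)"
    by (simp_all add: x_def m_def CDpt_def DEpt_def complex_eq_iff field_simps)
  have d: "dist (CDpt p) x = 1" "dist (DEpt p) x = 1"
    unfolding dist_eq_1_iff xe by (simp_all add: inner_complex_def field_simps) (use kk in algebra)+
  have ks: "1732/1000 * (93/100) \<le> sqrt 3 * k" using k1 sqrt3_bounds by (intro mult_mono) auto
  then have b: "- 2905/10000 \<le> Re x" "Re x \<le> - 27/100" "468/1000 \<le> Im x"
    unfolding x_def complex.sel using k1 k2 sp ks sqrt3_bounds p_bounds by linarith+
  have g: "p \<le> p" "p \<le> g" "-p \<le> p" "p \<le> p" using g p_bounds by auto
  have "z1 = x \<or> z1 = CDpt p + DEpt p - x"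
    by (rule unit_circles_meet[OF centres(3)[OF g] d]) (use X_map(2,3)[OF box_z1] lam_theta in auto)
  moreover have "z1 \<noteq> CDpt p + DEpt p - x"
  proof
    assume "z1 = CDpt p + DEpt p - x"
    then have "Re z1 = Re (CDpt p) - p - Re x" by (simp add: DEpt_def)
    then show False using b X_map(1)[OF box_z1] p_bounds centres(4)[OF g] unfolding Q_def by simp
  qed
  ultimately show "- 2905/10000 \<le> Re z1" "Re z1 \<le> - 27/100" "468/1000 \<le> Im z1" using b by simp_all
qed

lemma region_R_outside: "region_R \<sigma> \<subseteq> outside_quadrant (CDpt p)"
proof
  fix x assume "x \<in> region_R \<sigma>"
  then have x: "Re x \<le> -p" "0 \<le> Im x" "1 \<le> dist (CDpt p) x" by (auto simp: region_R_iff Q_def)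
  then show "x \<in> outside_quadrant (CDpt p)"
    using centres[of p 0] g p_bounds by (auto simp: outside_quadrant_def)
qed

text \<open>Going from \<open>X(0,0)\<close> in the direction \<open>d\<close>, the path moves away from the centres \<open>N(t)\<close> with \<open>t \<ge> 0\<close>,
  by \<open>(x\<^sub>0 - N(0)) \<bullet> d \<ge> 0\<close>, and towards the centres on \<open>CD\<close>, by \<open>(Z - L(\<theta>)) \<bullet> d \<le> 0\<close> at the end
  \<open>Z\<close>; the signs of the components of \<open>d\<close> transfer both conditions to the other centres. So
  both parameters grow along the segment.\<close>

lemma chain_segment:
  assumes Z: "(\<theta>, tZ) \<in> param_box \<sigma>" "d = X_map \<theta> tZ - x0" "0 \<le> tZ"
    and d: "0 \<le> Re d" "0 \<le> Im d" "(x0 - DEpt 0) \<bullet> d \<ge> 0" "(X_map \<theta> tZ - CDpt p) \<bullet> d \<le> 0"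
  shows "0 \<le> u \<Longrightarrow> u \<le> 1 \<Longrightarrow> x0 + u *\<^sub>R d \<in> region_R \<sigma>"
    and "0 \<le> u \<Longrightarrow> u \<le> 1 \<Longrightarrow> (s, t) \<in> param_box \<sigma> \<Longrightarrow> X_map s t = x0 + u *\<^sub>R d \<Longrightarrow> 0 \<le> s \<and> 0 \<le> t \<and> t \<le> tZ"
    and "0 \<le> u \<Longrightarrow> u \<le> u' \<Longrightarrow> u' \<le> 1 \<Longrightarrow> (s, t) \<in> param_box \<sigma> \<Longrightarrow> X_map s t = x0 + u *\<^sub>R d \<Longrightarrow>
      (s', t') \<in> param_box \<sigma> \<Longrightarrow> X_map s' t' = x0 + u' *\<^sub>R d \<Longrightarrow> s \<le> s' \<and> t \<le> t'"
proof -
  let ?Z = "X_map \<theta> tZ"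
  have Zx: "?Z = x0 + d" using Z by simp
  have y_seg: "x0 + u *\<^sub>R d \<in> closed_segment x0 ?Z" if "0 \<le> u" "u \<le> 1" for u
    using that Z(2) by (intro in_closed_segmentI[where u=u]) auto
  have ball: "dist c (x0 + u *\<^sub>R d) \<le> 1" if "0 \<le> u" "u \<le> 1" "dist c x0 \<le> 1" "dist c ?Z \<le> 1" for c u
  proof -
    have "closed_segment x0 ?Z \<subseteq> cball c 1" using that by (intro closed_segment_subset) auto
    then show ?thesis using y_seg[OF that(1,2)] by auto
  qed
  have dd: "0 \<le> d \<bullet> d" by simp
  have zb: "0 \<le> \<theta>" "tZ \<le> p" using theta Z(1) by (auto simp: param_box_iff)
  have yQ: "x0 + u *\<^sub>R d \<in> Q" if "0 \<le> u" "u \<le> 1" for u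
    using closed_segment_subset[OF X_map(1)[OF box_0] X_map(1)[OF Z(1)] Q_convex] y_seg[OF that] by blast
  have cd: "dist (CDpt l) (x0 + u *\<^sub>R d) \<ge> 1" if "0 \<le> u" "u \<le> 1" "dist (CDpt l) (x0 + u' *\<^sub>R d) = 1" "u \<le> u'" "u' \<le> 1" "p \<le> l" for u u' l
  proof -
    have "x0 + u' *\<^sub>R d - CDpt l = (?Z - CDpt p) - (1 - u') *\<^sub>R d - (l - p) *\<^sub>R u60"
      unfolding Zx using CDpt_diff[of l p] by (simp add: algebra_simps)
    moreover have "(1 - u') * (d \<bullet> d) \<ge> 0" using that by simp
    moreover have "0 \<le> sqrt 3 * Im d" using d by simp
    then have "(l - p) * (u60 \<bullet> d) \<ge> 0" using that d by (intro mult_nonneg_nonneg) (auto simp: inner_complex_def)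
    ultimately have "(x0 + u' *\<^sub>R d - CDpt l) \<bullet> d \<le> 0" using d(4) by (simp add: inner_diff_left)
    then have *: "(x0 + u' *\<^sub>R d - CDpt l) \<bullet> ((u - u') *\<^sub>R d) \<ge> 0" using that by (simp add: mult_nonpos_nonpos)
    have "dist (CDpt l) (x0 + u' *\<^sub>R d + (u - u') *\<^sub>R d) \<ge> 1" by (rule dist_diff_sq[OF _ *]) (use that in simp)
    then show ?thesis by (simp add: algebra_simps)
  qed
  have de: "dist (DEpt t) (x0 + u' *\<^sub>R d) \<ge> 1" if "0 \<le> u" "dist (DEpt t) (x0 + u *\<^sub>R d) = 1" "u \<le> u'" "0 \<le> t" for u u' t
  proof -
    have e: "x0 + u *\<^sub>R d - DEpt t = (x0 - DEpt 0) + u *\<^sub>R d + t *\<^sub>R 1" by (simp add: DEpt_def complex_eq_iff)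
    moreover have "u * (d \<bullet> d) \<ge> 0" "t * Re d \<ge> 0" using that d by auto
    ultimately have "(x0 + u *\<^sub>R d - DEpt t) \<bullet> d \<ge> 0" using d(3) unfolding e inner_add_left by (simp add: inner_complex_def distrib_left mult.assoc)
    then have *: "(x0 + u *\<^sub>R d - DEpt t) \<bullet> ((u' - u) *\<^sub>R d) \<ge> 0" using that by simp
    have "dist (DEpt t) (x0 + u *\<^sub>R d + (u' - u) *\<^sub>R d) \<ge> 1" by (rule dist_diff_sq[OF _ *]) (use that in simp)
    then show ?thesis by (simp add: algebra_simps)
  qed
  have de0: "dist (DEpt 0) (x0 + u *\<^sub>R d) \<ge> 1" if "0 \<le> u" for u
    using de[of 0 0 u] that X_map(3)[OF box_0] by simp
  show R: "x0 + u *\<^sub>R d \<in> region_R \<sigma>" if "0 \<le> u" "u \<le> 1" for u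
    unfolding region_R_iff
  proof (intro conjI)
    show "dist (CDpt g) (x0 + u *\<^sub>R d) \<le> 1"
      using ball[OF that] box_in_R[OF box_0] box_in_R[OF Z(1)] by (auto simp: region_R_iff)
    show "dist (DEpt p) (x0 + u *\<^sub>R d) \<le> 1"
      using ball[OF that] box_in_R[OF box_0] box_in_R[OF Z(1)] by (auto simp: region_R_iff)
    show "1 \<le> dist (CDpt p) (x0 + u *\<^sub>R d)" using cd[of u p 1] that X_map(2)[OF Z(1)] Zx lam_theta by simp
    show "1 \<le> dist (DEpt (-p)) (x0 + u *\<^sub>R d)"
      using de0[OF that(1)] DEpt_le[OF yQ[OF that], of "-p" 0] p_bounds by simp
  qed (rule yQ[OF that])
  show nn: "0 \<le> s \<and> 0 \<le> t \<and> t \<le> tZ" if u: "0 \<le> u" "u \<le> 1" and st: "(s, t) \<in> param_box \<sigma>" "X_map s t = x0 + u *\<^sub>R d" for u s t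
  proof -
    have t0: "0 \<le> t" using X_map_dist_DE(1)[OF st(1), of 0] de0[OF u(1)] p_bounds st(2) by auto
    have "dist (DEpt tZ) x0 \<le> 1" using X_map_dist_DE(2)[OF box_0, of tZ] Z(3) zb by auto
    then have "dist (DEpt tZ) (x0 + u *\<^sub>R d) \<le> 1" using ball[OF u] X_map(3)[OF Z(1)] by simp
    then have tz: "t \<le> tZ" using X_map_dist_DE(2)[OF st(1), of tZ] st(2) zb by simp
    have "dist (CDpt (lam 0)) ?Z \<le> 1" using X_map_dist_CD(2)[OF Z(1), of 0] zb by simp
    then have "dist (CDpt (lam 0)) (x0 + u *\<^sub>R d) \<le> 1" using ball[OF u] X_map(2)[OF box_0] by simp
    then have "0 \<le> s" using X_map_dist_CD(2)[OF st(1), of 0] zb st(2) by simp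
    then show ?thesis using t0 tz by simp
  qed
  show "s \<le> s' \<and> t \<le> t'" if u: "0 \<le> u" "u \<le> u'" "u' \<le> 1" and st: "(s, t) \<in> param_box \<sigma>" "X_map s t = x0 + u *\<^sub>R d"
    and st': "(s', t') \<in> param_box \<sigma>" "X_map s' t' = x0 + u' *\<^sub>R d" for u u' s t s' t'
  proof
    have b: "-\<theta> \<le> s'" "s' \<le> \<theta>" "t \<le> p" using st st' by (auto simp: param_box_iff)
    have "dist (CDpt (lam s')) (x0 + u *\<^sub>R d) \<ge> 1"
      using cd[of u "lam s'" u'] u X_map(2)[OF st'(1)] st'(2) lam_range[OF b(1,2)] by auto
    then show "s \<le> s'" using X_map_dist_CD(1)[OF st(1) b(1,2)] st(2) by auto
    have "dist (DEpt t) (x0 + u' *\<^sub>R d) \<ge> 1"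
      using de[of u t u'] u X_map(3)[OF st(1)] st(2) nn[OF u(1) _ st] by auto
    then show "t \<le> t'" using X_map_dist_DE(1)[OF st'(1) b(3)] st'(2) by auto
  qed
qed

text \<open>The image under \<open>(s, t) \<mapsto> (- s, - t)\<close> completes the path to the boundary curve of \<open>A\<^sub>H\<close>. What matters about the
  path is that its parameters are nonnegative and that no two of its points have parameters that are
  strictly ordered in opposite ways.\<close>

definition chain :: "complex set \<Rightarrow> bool" where
  "chain W \<longleftrightarrow> W \<subseteq> region_R \<sigma> \<and>
     (\<forall>s t. (s, t) \<in> param_box \<sigma> \<and> X_map s t \<in> W \<longrightarrow> 0 \<le> s \<and> 0 \<le> t) \<and>
     (\<forall>s t s' t'. (s, t) \<in> param_box \<sigma> \<and> X_map s t \<in> W \<and> (s', t') \<in> param_box \<sigma> \<and> X_map s' t' \<in> W \<longrightarrow>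
        \<not> (s' < s \<and> t < t'))"

lemma chain_subset: "chain W \<Longrightarrow> V \<subseteq> W \<Longrightarrow> chain V"
  unfolding chain_def by blast

text \<open>On the arc about \<open>L(\<theta>)\<close> the parameter \<open>s\<close> has its largest value \<open>\<theta>\<close>, and \<open>t\<close> is at least as large as
  on the segment.\<close>

lemma chain_arc_segment:
  assumes Z: "(\<theta>, tZ) \<in> param_box \<sigma>" "d = X_map \<theta> tZ - x0" "0 \<le> tZ"
    and d: "0 \<le> Re d" "0 \<le> Im d" "(x0 - DEpt 0) \<bullet> d \<ge> 0" "(X_map \<theta> tZ - CDpt p) \<bullet> d \<le> 0"
  shows "chain ({X_map \<theta> t | t. tZ \<le> t \<and> t \<le> p} \<union> closed_segment (X_map \<theta> tZ) x0)"
proof -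
  note cs = chain_segment[OF assms]
  let ?A = "{X_map \<theta> t | t. tZ \<le> t \<and> t \<le> p}" and ?S = "closed_segment (X_map \<theta> tZ) x0"
  have S: "\<exists>u. 0 \<le> u \<and> u \<le> 1 \<and> x = x0 + u *\<^sub>R d" if "x \<in> ?S" for x
  proof -
    have "x \<in> closed_segment x0 (X_map \<theta> tZ)" using that by (simp add: closed_segment_commute)
    then show ?thesis unfolding in_segment_from Z(2) by blast
  qed
  have A: "s = \<theta> \<and> tZ \<le> t" if st: "(s, t) \<in> param_box \<sigma>" "X_map s t \<in> ?A" for s t
  proof -
    obtain t' where t': "tZ \<le> t'" "t' \<le> p" "X_map s t = X_map \<theta> t'" using st(2) by blast
    have "(\<theta>, t') \<in> param_box \<sigma>" using box_theta t' Z p_bounds by auto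
    from X_map_inj[OF st(1) this t'(3)] show ?thesis using t' by simp
  qed
  have sl: "s \<le> \<theta>" if "(s, t) \<in> param_box \<sigma>" for s t using that by (auto simp: param_box_iff)
  show ?thesis unfolding chain_def
  proof (intro conjI allI impI)
    show "?A \<union> ?S \<subseteq> region_R \<sigma>" using S cs(1) box_in_R[OF box_theta] Z(3) p_bounds by fastforce
  next
    fix s t assume st: "(s, t) \<in> param_box \<sigma> \<and> X_map s t \<in> ?A \<union> ?S"
    have "0 \<le> s \<and> 0 \<le> t"
    proof (cases "X_map s t \<in> ?A")
      case True then show ?thesis using A st theta Z(3) by fastforce
    next
      case False
      then obtain u where "0 \<le> u" "u \<le> 1" "X_map s t = x0 + u *\<^sub>R d" using S st by blast
      then show ?thesis using cs(2) st by blast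
    qed
    then show "0 \<le> s" "0 \<le> t" by auto
  next
    fix s t s' t'
    assume *: "(s, t) \<in> param_box \<sigma> \<and> X_map s t \<in> ?A \<union> ?S \<and> (s', t') \<in> param_box \<sigma> \<and> X_map s' t' \<in> ?A \<union> ?S"
    show "\<not> (s' < s \<and> t < t')"
    proof (cases "X_map s' t' \<in> ?A")
      case True then show ?thesis using A[of s' t'] * sl[of s t] by auto
    next
      case False
      then obtain u' where u': "0 \<le> u'" "u' \<le> 1" "X_map s' t' = x0 + u' *\<^sub>R d" using S * by blast
      show ?thesis
      proof (cases "X_map s t \<in> ?A")
        case True then show ?thesis using A[of s t] cs(2)[OF u'(1,2) _ u'(3)] * by auto
      next
        case False
        then obtain u where u: "0 \<le> u" "u \<le> 1" "X_map s t = x0 + u *\<^sub>R d" using S * by blast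
        show ?thesis
        proof (cases "u \<le> u'")
          case True then show ?thesis using cs(3)[OF u(1) True u'(2) _ u(3) _ u'(3)] * by auto
        next
          case False then show ?thesis using cs(3)[OF u'(1) _ u(2) _ u'(3) _ u(3)] * by auto
        qed
      qed
    qed
  qed
qed

lemma displacement_signs: "0 < Re (z1 - x0)" "0 < Im (z1 - x0)" "(x0 - DEpt 0) \<bullet> (z1 - x0) \<ge> 0"
proof -
  show d: "0 < Re (z1 - x0)" "0 < Im (z1 - x0)" using x0_bounds z1_bounds by simp_all
  have "95/100 * Im (z1 - x0) \<le> (Im x0 + 1/2) * Im (z1 - x0)" using d x0_bounds by (intro mult_right_mono) auto
  moreover have "- 312/1000 * Re (z1 - x0) \<le> Re x0 * Re (z1 - x0)" using d x0_bounds by (intro mult_right_mono) auto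
  moreover have "(x0 - DEpt 0) \<bullet> (z1 - x0) = Re x0 * Re (z1 - x0) + (Im x0 + 1/2) * Im (z1 - x0)"
    by (simp add: DEpt_def inner_complex_def)
  moreover have "0 \<le> - 312/1000 * Re (z1 - x0) + 95/100 * Im (z1 - x0)"
    using x0_bounds z1_bounds by simp
  ultimately show "(x0 - DEpt 0) \<bullet> (z1 - x0) \<ge> 0" by linarith
qed

text \<open>If the segment from \<open>X(0,0)\<close> to \<open>X(\<theta>,\<tau>)\<close> does not enter the open unit disc about \<open>L(\<theta>)\<close>, it is the
  shortest path. Otherwise the shortest path runs along the boundary of this disc from \<open>X(\<theta>,\<tau>)\<close> to the
  point \<open>Z\<close> at which the tangent through \<open>X(0,0)\<close> touches.\<close>

lemma chain_A_path: "chain (A_path \<sigma>)"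
proof (cases "(z1 - CDpt p) \<bullet> (z1 - x0) \<le> 0")
  case True
  have c: "chain ({X_map \<theta> t | t. p \<le> t \<and> t \<le> p} \<union> closed_segment z1 x0)"
    by (rule chain_arc_segment[OF box_z1 refl _ _ _ _ True]) (use displacement_signs p_bounds in auto)
  have "A_path \<sigma> \<subseteq> closed_segment z1 x0" unfolding A_path_def len_tau_eq
    by (rule shortest_path_segment) (use c in \<open>auto simp: chain_def\<close>)
  then show ?thesis using chain_subset[OF c] by blast
next
  case False
  define c where "c = CDpt p"
  define \<phi>1 where "\<phi>1 = Arg (z1 - c)"
  define \<phi>0 where "\<phi>0 = Arg (x0 - c)"
  define r where "r = dist c x0"
  have x0o: "x0 \<in> outside_quadrant c" and z1o: "z1 \<in> outside_quadrant c"
    using region_R_outside box_in_R[OF box_0] box_in_R[OF box_z1] unfolding c_def by blast+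
  have cz: "dist c z1 = 1" using X_map(2)[OF box_z1] by (simp add: c_def lam_theta)
  have z1: "z1 = c + cis \<phi>1" "pi/2 < \<phi>1" "\<phi>1 < pi" using outside_quadrant_polar[OF z1o] cz by (simp_all add: \<phi>1_def)
  have x0: "x0 = c + of_real r * cis \<phi>0" "pi/2 < \<phi>0" "\<phi>0 < pi" "1 \<le> r"
    using outside_quadrant_polar[OF x0o] by (simp_all add: \<phi>0_def r_def)
  \<comment> \<open>the angle at \<open>c\<close> between \<open>x0\<close> and the point of contact of the tangent from \<open>x0\<close>\<close>
  define \<delta> where "\<delta> = arccos (1 / r)"
  have r1: "-1 \<le> 1/r" "1/r \<le> 1" "0 < 1/r" using x0(4) less_imp_le[of "-1" "1/r"] less_trans[of "-1" 0 "1/r"] by auto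
  have \<delta>: "cos \<delta> = 1/r" "0 \<le> \<delta>" "\<delta> \<le> pi" "r * cos \<delta> = 1"
    using arccos_bounded[OF r1(1,2)] cos_arccos[OF r1(1,2)] x0(4) by (auto simp: \<delta>_def)
  define \<phi>Z where "\<phi>Z = \<phi>0 - \<delta>"
  define Z where "Z = c + cis \<phi>Z"
  have "(z1 - c) \<bullet> (z1 - x0) = 1 - r * cos (\<phi>0 - \<phi>1)"
    unfolding x0(1) z1(1) by (simp add: inner_complex_def cos_diff algebra_simps)
  then have lt: "r * cos (\<phi>0 - \<phi>1) < 1" using False by (simp add: c_def)
  have "r * sin (\<phi>0 - \<phi>1) = - Re (z1 - c) * Im (z1 - x0) + Im (z1 - c) * Re (z1 - x0)"
    unfolding x0(1) z1(1) by (simp add: sin_diff algebra_simps)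
  moreover have "0 < - Re (z1 - c) * Im (z1 - x0)" "0 < Im (z1 - c) * Re (z1 - x0)"
    using z1o displacement_signs by (auto simp: outside_quadrant_def intro: mult_neg_pos mult_pos_pos simp del: complex.sel)
  ultimately have "0 < r * sin (\<phi>0 - \<phi>1)" by linarith
  then have s: "0 < sin (\<phi>0 - \<phi>1)" using x0(4) by (simp add: zero_less_mult_iff)
  have "\<phi>1 < \<phi>0"
  proof (rule ccontr)
    assume "\<not> \<phi>1 < \<phi>0"
    then have "0 \<le> sin (\<phi>1 - \<phi>0)" using z1 x0 by (intro sin_ge_zero) auto
    then show False using s sin_minus[of "\<phi>1 - \<phi>0"] by simp
  qed
  have "cos (\<phi>0 - \<phi>1) < cos \<delta>"
  proof -
    have "r * cos (\<phi>0 - \<phi>1) < r * cos \<delta>" using lt \<delta>(4) by simp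
    then show ?thesis using x0(4) by simp
  qed
  then have "\<delta> < \<phi>0 - \<phi>1" using cos_mono_less_eq[of "\<phi>0 - \<phi>1" \<delta>] \<delta> \<open>\<phi>1 < \<phi>0\<close> z1 x0 by simp
  then have \<phi>Z: "\<phi>1 < \<phi>Z" "\<phi>Z \<le> \<phi>0" "\<phi>Z < pi" using \<delta> x0 by (auto simp: \<phi>Z_def)
  \<comment> \<open>the length of the tangent from \<open>x0\<close>\<close>
  define \<mu> where "\<mu> = r * sin \<delta>"
  have mu0: "0 \<le> \<mu>" using \<delta> x0(4) sin_ge_zero[of \<delta>] by (simp add: \<mu>_def)
  have x0Z: "x0 - Z = of_real \<mu> * (\<i> * cis \<phi>Z)"
  proof -
    have "of_real r * cis \<phi>0 = of_real r * (cis \<delta> * cis \<phi>Z)" by (simp add: cis_mult \<phi>Z_def)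
    also have "\<dots> = (of_real r * cis \<delta>) * cis \<phi>Z" by simp
    also have "of_real r * cis \<delta> = 1 + of_real \<mu> * \<i>" using \<delta>(4) by (simp add: complex_eq_iff \<mu>_def)
    finally show ?thesis unfolding x0(1) Z_def by (simp add: algebra_simps)
  qed
  have tangent: "(x0 - (c + cis \<phi>Z)) \<bullet> cis \<phi>Z = 0" unfolding Z_def[symmetric] x0Z
    by (simp add: inner_complex_def algebra_simps)
  define d where "d = Z - x0"
  have d: "d = of_real \<mu> * Complex (sin \<phi>Z) (- cos \<phi>Z)" using x0Z by (simp add: d_def complex_eq_iff algebra_simps)
  have cosdec: "cos b \<le> cos a" "sin b \<le> sin a" if "\<phi>1 \<le> a" "a \<le> b" "b \<le> pi" for a b
  proof -
    show "cos b \<le> cos a" using that z1 by (intro cos_monotone_0_pi_le) auto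
    have "sin (pi - b) \<le> sin (pi - a)" using that z1 by (intro sin_monotone_2pi_le) auto
    then show "sin b \<le> sin a" by simp
  qed
  have sZ: "0 \<le> sin \<phi>Z" "sin \<phi>Z \<le> 1" using \<phi>Z z1 by (auto intro!: sin_ge_zero)
  have cZ: "cos \<phi>Z \<le> cos \<phi>1" "cos \<phi>1 \<le> - 56/100"
  proof -
    show "cos \<phi>Z \<le> cos \<phi>1" using cosdec \<phi>Z by simp
    have "cos \<phi>1 = Re z1 - Re c" using z1(1) by simp
    then show "cos \<phi>1 \<le> - 56/100" using z1_bounds centres(4)[of p 0] g p_bounds by (simp add: c_def)
  qed
  have dpos: "0 \<le> Re d" "0 \<le> Im d" using mu0 sZ cZ by (simp_all add: d mult_nonneg_nonpos)
  have dM: "(x0 - DEpt 0) \<bullet> d \<ge> 0"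
  proof -
    have "- 312/1000 \<le> Re x0 * sin \<phi>Z"
    proof -
      have "- Re x0 * sin \<phi>Z \<le> 312/1000 * 1" using x0_bounds sZ by (intro mult_mono) auto
      then show ?thesis by simp
    qed
    moreover have "95/100 * (56/100) \<le> (Im x0 + 1/2) * (- cos \<phi>Z)" using x0_bounds cZ by (intro mult_mono) auto
    ultimately have "0 \<le> Re x0 * sin \<phi>Z + (Im x0 + 1/2) * (- cos \<phi>Z)" by simp
    then have "0 \<le> \<mu> * (Re x0 * sin \<phi>Z + (Im x0 + 1/2) * (- cos \<phi>Z))" using mu0 by simp
    then show ?thesis unfolding d by (simp add: DEpt_def inner_complex_def algebra_simps)
  qed
  have dc: "(Z - c) \<bullet> d = 0" using tangent by (simp add: Z_def d_def inner_diff_right inner_commute)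
  have arc_dist: "dist (DEpt t) (c + cis b) \<le> dist (DEpt t) (c + cis a)" if "\<phi>1 \<le> a" "a \<le> b" "b \<le> \<phi>Z" "-p \<le> t" "t \<le> p" for a b t
  proof -
    define e where "e = c - DEpt t"
    have e0: "0 \<le> Re e" "0 \<le> Im e" using centres[of p t] g p_bounds that by (auto simp: e_def c_def DEpt_def)
    have "(c + cis \<phi> - DEpt t) \<bullet> (c + cis \<phi> - DEpt t) = e \<bullet> e + 1 + 2 * (Re e * cos \<phi> + Im e * sin \<phi>)" for \<phi>
      unfolding e_def by (simp add: inner_complex_def) (use sin_cos_squared_add[of \<phi>] in algebra)
    moreover have "Re e * cos b \<le> Re e * cos a" "Im e * sin b \<le> Im e * sin a"
      using e0 cosdec[of a b] that \<phi>Z by (auto intro!: mult_left_mono)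
    ultimately have "\<not> dist (DEpt t) (c + cis a) < dist (DEpt t) (c + cis b)" unfolding dist_less_iff_sq by simp
    then show ?thesis by simp
  qed
  have ZM: "dist (DEpt 0) Z \<ge> 1"
    using dist_diff_sq[OF _ dM] X_map(3)[OF box_0] by (simp add: d_def)
  have arcR: "c + cis \<phi> \<in> region_R \<sigma>" if "\<phi>1 \<le> \<phi>" "\<phi> \<le> \<phi>Z" for \<phi>
  proof -
    let ?y = "c + cis \<phi>"
    have M: "dist (DEpt 0) ?y \<ge> 1" using arc_dist[of \<phi> \<phi>Z 0] that ZM p_bounds by (simp add: Z_def)
    have z1Q: "Re z1 \<le> -p" using X_map(1)[OF box_z1] by (simp add: Q_def)
    have re: "Re ?y \<le> -p" using cosdec(1)[of \<phi>1 \<phi>] that \<phi>Z z1(1) z1Q by simp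
    have "Im x0 \<le> Im Z" using dpos(2) by (simp add: d_def)
    then have im: "0 \<le> Im ?y" using cosdec(2)[of \<phi> \<phi>Z] that \<phi>Z x0_bounds by (simp add: Z_def)
    have c1: "dist (CDpt p) ?y = 1" by (simp add: c_def dist_norm)
    have N: "1 \<le> dist (DEpt (-p)) ?y"
    proof -
      have "(- Re ?y - 0)\<^sup>2 \<le> (- Re ?y - (-p))\<^sup>2" using re p_bounds by (intro power_mono) auto
      then have "\<not> dist (DEpt (-p)) ?y < dist (DEpt 0) ?y"
        unfolding dist_less_iff_sq by (simp add: DEpt_def inner_complex_def power2_eq_square algebra_simps)
      then show ?thesis using M by simp
    qed
    have yQ: "?y \<in> Q" unfolding Q_def using re im foot_above_G[OF re im c1 N] g by simp
    have "dist (DEpt p) ?y \<le> 1" using arc_dist[of \<phi>1 \<phi> p] that z1(1) X_map(3)[OF box_z1] p_bounds by simp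
    moreover have "dist (CDpt g) ?y \<le> 1" using CDpt_le[OF yQ, of p g] g c1 by simp
    ultimately show ?thesis unfolding region_R_iff using yQ N c1 by simp
  qed
  have arcX: "\<exists>t. -p \<le> t \<and> t \<le> p \<and> c + cis \<phi> = X_map \<theta> t" if ph: "\<phi>1 \<le> \<phi>" "\<phi> \<le> \<phi>Z" for \<phi>
  proof -
    obtain s t where st: "(s, t) \<in> param_box \<sigma>" "c + cis \<phi> = X_map s t" by (rule region_R_E[OF arcR[OF ph]])
    have b: "-\<theta> \<le> s" "s \<le> \<theta>" "-p \<le> t" "t \<le> p" using st(1) by (auto simp: param_box_iff)
    have "dist (CDpt (lam \<theta>)) (X_map s t) = 1" unfolding st(2)[symmetric] by (simp add: lam_theta c_def dist_norm)
    then have "\<theta> \<le> s" using X_map_dist_CD(2)[OF st(1), of \<theta>] theta by simp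
    then have "s = \<theta>" using b by simp
    then show ?thesis using st b by auto
  qed
  obtain tZ where tZ: "-p \<le> tZ" "tZ \<le> p" "Z = X_map \<theta> tZ" using arcX[of \<phi>Z] \<phi>Z unfolding Z_def by auto
  have bZ: "(\<theta>, tZ) \<in> param_box \<sigma>" using box_theta tZ by simp
  have tZ0: "0 \<le> tZ" using X_map_dist_DE(1)[OF bZ, of 0] ZM tZ(3) p_bounds by auto
  have W: "chain ({X_map \<theta> t | t. tZ \<le> t \<and> t \<le> p} \<union> closed_segment Z x0)"
    using chain_arc_segment[OF bZ _ tZ0 dpos dM] dc unfolding tZ(3)[symmetric] by (simp add: d_def c_def)
  have sub: "arc_then_segment c \<phi>1 \<phi>Z x0 \<subseteq> {X_map \<theta> t | t. tZ \<le> t \<and> t \<le> p} \<union> closed_segment Z x0"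
  proof
    fix x assume "x \<in> arc_then_segment c \<phi>1 \<phi>Z x0"
    then consider \<phi> where "\<phi>1 \<le> \<phi>" "\<phi> \<le> \<phi>Z" "x = c + cis \<phi>" | "x \<in> closed_segment Z x0"
      unfolding arc_then_segment_def Z_def by auto
    then show "x \<in> {X_map \<theta> t | t. tZ \<le> t \<and> t \<le> p} \<union> closed_segment Z x0"
    proof cases
      case 1
      obtain t where t: "-p \<le> t" "t \<le> p" "x = X_map \<theta> t" using arcX[OF 1(1,2)] 1(3) by auto
      have "dist (DEpt tZ) x \<ge> 1" using arc_dist[OF 1(1,2) order_refl tZ(1,2)] X_map(3)[OF bZ] tZ(3) 1(3) by (simp add: Z_def)
      then have "tZ \<le> t" using X_map_dist_DE(1)[OF box_theta[OF t(1,2)] tZ(2)] t(3) by auto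
      then show ?thesis using t by auto
    qed simp
  qed
  have "A_path \<sigma> \<subseteq> arc_then_segment c \<phi>1 \<phi>Z x0"
    unfolding A_path_def len_tau_eq z1(1)
  proof (rule shortest_path_around_disc)
    show "region_R \<sigma> \<subseteq> outside_quadrant c" using region_R_outside by (simp add: c_def)
    show "arc_then_segment c \<phi>1 \<phi>Z x0 \<subseteq> region_R \<sigma>" using sub W by (auto simp: chain_def)
  qed (use z1 \<phi>Z tangent in \<open>auto simp: \<phi>0_def\<close>)
  then show ?thesis using chain_subset[OF W] sub by blast
qed

end

section \<open>The regions removed at corner A\<close>

context slant begin

lemma pt_X_eq: "pt_X \<sigma> = X_map (-\<theta>) p"
proof -
  have "pt_L (-\<theta>) = pt_G \<sigma>" using pt_L_eq'[of "-\<theta>"] theta lam_theta pt_G_CD by simp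
  then show ?thesis unfolding pt_X_def X_map_def pt_N_eq by (simp add: pt_E3_DE)
qed

lemma pt_X_facts: "pt_X \<sigma> \<in> Q" "dist (pt_G \<sigma>) (pt_X \<sigma>) = 1" "dist (pt_E3 \<sigma>) (pt_X \<sigma>) = 1"
proof -
  have b: "(-\<theta>, p) \<in> param_box \<sigma>" using theta p_bounds by (simp add: param_box_iff)
  show "pt_X \<sigma> \<in> Q" "dist (pt_G \<sigma>) (pt_X \<sigma>) = 1" "dist (pt_E3 \<sigma>) (pt_X \<sigma>) = 1"
    unfolding pt_X_eq using X_map[OF b] lam_theta by (simp_all add: pt_G_CD pt_E3_DE)
qed

text \<open>By definition of \<open>G\<close> the points of \<open>CD\<close> between \<open>G\<close> and \<open>C\<^sub>2\<close> have distance more than one from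
  \<open>F\<^sub>3\<close>, and therefore also from the point of \<open>K\<close> in corner \<open>F\<close>.\<close>

lemma placed_CD_le_g:
  assumes K: "placed K" "CDpt l \<in> K" shows "l \<le> g"
proof (rule ccontr)
  assume "\<not> l \<le> g"
  then have gl: "g < l" by simp
  have lq: "l \<le> q" using placed_CD_le_q[OF K] .
  obtain f where f: "f \<in> K" "f \<bullet> Complex cs sn \<le> -1/2" "inHex f" using placed_reaches_F[OF K(1)] .
  define v where "v = Complex (sqrt 3/2 + (l+p)/2) (sqrt 3/2 * (l - p))"
  have neg: "v \<bullet> (f - pt_F3 \<sigma>) \<le> 0" unfolding v_def using F_corner_polar(2)[OF f(2,3)] gl g lq by simp
  have "v \<bullet> v = 1 + (l - g) * (l + g - p + sqrt 3/2)"
    using g(3) by (simp add: v_def inner_complex_def power2_eq_square field_simps)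
  moreover have "0 < (l - g) * (l + g - p + sqrt 3/2)" using gl g p_bounds sqrt3_bounds by (intro mult_pos_pos) auto
  ultimately have "1 < v \<bullet> v" by simp
  have "CDpt l - pt_F3 \<sigma> = v" unfolding pt_F3_EF v_def by (simp add: CDpt_def EFpt_def complex_eq_iff field_simps)
  then have e: "CDpt l - f = v - (f - pt_F3 \<sigma>)" by (simp add: algebra_simps)
  have "(CDpt l - f) \<bullet> (CDpt l - f) = v \<bullet> v - 2 * (v \<bullet> (f - pt_F3 \<sigma>)) + (f - pt_F3 \<sigma>) \<bullet> (f - pt_F3 \<sigma>)"
    unfolding e by (simp add: inner_diff_left[of v] inner_diff_right[of _ v] inner_commute)
  moreover have "0 \<le> (f - pt_F3 \<sigma>) \<bullet> (f - pt_F3 \<sigma>)" by simp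
  ultimately have "1 < (CDpt l - f) \<bullet> (CDpt l - f)" using neg \<open>1 < v \<bullet> v\<close> by linarith
  then have "\<not> dist f (CDpt l) \<le> 1" unfolding dist_le_1_iff by simp
  then show False using inscribed_diam[OF placedD(1)[OF K(1)] f(1) K(2)] by simp
qed

lemma disjoint_G_arc:
  assumes K: "placed K" and x: "(x - pt_G \<sigma>) \<bullet> u60 \<ge> 0" "(y - pt_G \<sigma>) \<bullet> u60 \<ge> 0"
  shows "interior K \<inter> unit_arc (pt_G \<sigma>) x y = {}"
proof -
  note ins = placedD(1)[OF K]
  obtain l where l: "CDpt l \<in> K" using inscribed_touches[OF ins] by blast
  have lg: "l \<le> g" using placed_CD_le_g[OF K l] .
  have e: "CDpt l - pt_G \<sigma> = (l - g) *\<^sub>R u60" unfolding pt_G_CD by (rule CDpt_diff)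
  show ?thesis
    by (rule interior_disjoint_unit_arc[OF ins l]) (use x lg in \<open>auto simp: e mult_nonpos_nonneg\<close>)
qed

lemma disjoint_E3_arc:
  assumes K: "placed K" and x: "Re x \<le> -p" "Re y \<le> -p"
  shows "interior K \<inter> unit_arc (pt_E3 \<sigma>) x y = {}"
proof -
  note ins = placedD(1)[OF K]
  obtain t where t: "DEpt t \<in> K" using inscribed_touches[OF ins] by blast
  have tp: "t \<le> p" using placed_DE_le_p[OF K t] .
  have e: "DEpt t - pt_E3 \<sigma> = Complex (p - t) 0" unfolding pt_E3_DE by (simp add: DEpt_def complex_eq_iff)
  show ?thesis
    by (rule interior_disjoint_unit_arc[OF ins t])
      (use x tp in \<open>auto simp: e inner_complex_def pt_E3_DE DEpt_def mult_nonpos_nonneg\<close>)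
qed

lemma interior_point_below_A:
  assumes K: "placed K" obtains v where "v \<in> interior K" "v \<bullet> Complex (-1/2) (sqrt 3/2) < 0"
proof -
  obtain l where l: "CDpt l \<in> K" using inscribed_touches[OF placedD(1)[OF K]] by blast
  have "l \<le> g" using placed_CD_le_g[OF K l] .
  then have "CDpt l \<bullet> Complex (-1/2) (sqrt 3/2) < 0"
    using g_bounds sqrt3_bounds by (simp add: CDpt_def inner_complex_def field_simps)
  then show ?thesis using constant_width_interior_point[OF placedD(2)[OF K] l] that by blast
qed

lemma A_side: "x \<in> Q \<Longrightarrow> x \<bullet> Complex (-1/2) (sqrt 3/2) \<ge> 0"
proof -
  assume "x \<in> Q"
  then have "Re x \<le> 0" "0 \<le> sqrt 3 * Im x" using p_bounds by (auto simp: Q_def)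
  then show ?thesis by (simp add: inner_complex_def mult.commute)
qed

lemma pt_P_facts: "dist (pt_G \<sigma>) (pt_P \<sigma>) = 1" "(pt_P \<sigma> - pt_G \<sigma>) \<bullet> u60 = 0" "pt_P \<sigma> \<bullet> Complex (-1/2) (sqrt 3/2) \<ge> 0"
proof -
  have e: "pt_P \<sigma> - pt_G \<sigma> = Complex (- sqrt 3/2) (1/2)" unfolding pt_P_eq pt_G_eq by (simp add: complex_eq_iff field_simps)
  show "dist (pt_G \<sigma>) (pt_P \<sigma>) = 1" "(pt_P \<sigma> - pt_G \<sigma>) \<bullet> u60 = 0"
    unfolding dist_eq_1_iff e by (simp_all add: inner_complex_def)
  show "pt_P \<sigma> \<bullet> Complex (-1/2) (sqrt 3/2) \<ge> 0" using g_bounds unfolding pt_P_eq by (simp add: inner_complex_def field_simps)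
qed

lemma A_centres_side: "pt_G \<sigma> \<bullet> Complex (-1/2) (sqrt 3/2) \<le> 0" "pt_E3 \<sigma> \<bullet> Complex (-1/2) (sqrt 3/2) \<le> 0"
  using g_bounds p_bounds sqrt3_bounds unfolding pt_G_eq pt_E3_DE by (simp_all add: DEpt_def inner_complex_def field_simps)

text \<open>The arc about \<open>G\<close> is far from the point where \<open>K\<close> touches \<open>CD\<close>, and the arc about \<open>E\<^sub>3\<close> from the
  one where it touches \<open>DE\<close>.\<close>

lemma placed_disjoint_A_S:
  assumes K: "placed K" shows "interior K \<inter> region_A_S \<sigma> = {}"
proof -
  note ins = placedD(1)[OF K]
  let ?\<Gamma> = "unit_arc (pt_E3 \<sigma>) (pt_Q \<sigma>) (pt_X \<sigma>) \<union> unit_arc (pt_G \<sigma>) (pt_X \<sigma>) (pt_P \<sigma>) \<union>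
      closed_segment (pt_P \<sigma>) corner_A \<union> closed_segment corner_A (pt_Q \<sigma>)"
  let ?a = "Complex (-1/2) (sqrt 3/2)"
  obtain v where v: "v \<in> interior K" "v \<bullet> ?a < 0" using interior_point_below_A[OF K] .
  have X: "Re (pt_X \<sigma>) \<le> -p" "(pt_X \<sigma> - pt_G \<sigma>) \<bullet> u60 \<ge> 0" using pt_X_facts(1) by (auto simp: Q_def pt_G_CD)
  have "interior K \<inter> bounded_region ?\<Gamma> = {}"
  proof (rule convex_disjoint_bounded_region[OF _ _ _ v])
    show "convex (interior K)" using placedD(2)[OF K] by (simp add: constant_width_def)
    have "interior K \<inter> unit_arc (pt_E3 \<sigma>) (pt_Q \<sigma>) (pt_X \<sigma>) = {}"
      by (rule disjoint_E3_arc[OF K]) (use X in \<open>simp_all add: pt_Q_eq\<close>)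
    moreover have "interior K \<inter> unit_arc (pt_G \<sigma>) (pt_X \<sigma>) (pt_P \<sigma>) = {}"
      by (rule disjoint_G_arc[OF K]) (use X pt_P_facts in auto)
    moreover have "interior K \<inter> closed_segment (pt_P \<sigma>) corner_A = {}"
      by (rule segment_disjoint_halfplane[where n="Complex (- sqrt 3/2) (1/2)" and t="1/2"])
        (use inscribed_interior(3)[OF ins] in \<open>auto simp: pt_P_eq hex_corners inner_complex_def field_simps\<close>)
    moreover have "interior K \<inter> closed_segment corner_A (pt_Q \<sigma>) = {}"
      by (rule segment_disjoint_halfplane[where n="Complex 0 1" and t="1/2"])
        (use inscribed_interior(2)[OF ins] in \<open>auto simp: pt_Q_eq hex_corners inner_complex_def\<close>)
    ultimately show "interior K \<inter> ?\<Gamma> = {}" by blast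
    have h: "pt_Q \<sigma> \<bullet> ?a \<ge> 0" "pt_X \<sigma> \<bullet> ?a \<ge> 0" "corner_A \<bullet> ?a \<ge> 0"
      using p_bounds A_side[OF pt_X_facts(1)] unfolding pt_Q_eq hex_corners by (simp_all add: inner_complex_def)
    have dQ: "dist (pt_E3 \<sigma>) (pt_Q \<sigma>) = 1" unfolding dist_eq_1_iff pt_E3_DE pt_Q_eq by (simp add: DEpt_def inner_complex_def)
    show "x \<bullet> ?a \<ge> 0" if "x \<in> ?\<Gamma>" for x
    proof -
      from that consider "x \<in> unit_arc (pt_E3 \<sigma>) (pt_Q \<sigma>) (pt_X \<sigma>)" | "x \<in> unit_arc (pt_G \<sigma>) (pt_X \<sigma>) (pt_P \<sigma>)"
        | "x \<in> closed_segment (pt_P \<sigma>) corner_A" | "x \<in> closed_segment corner_A (pt_Q \<sigma>)" by blast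
      then show ?thesis
      proof cases
        case 1 show ?thesis by (rule unit_arc_halfplane[OF 1 dQ pt_X_facts(3) h(1,2) A_centres_side(2)])
      next
        case 2 show ?thesis by (rule unit_arc_halfplane[OF 2 pt_X_facts(2) pt_P_facts(1) h(2) pt_P_facts(3) A_centres_side(1)])
      next
        case 3 show ?thesis by (rule segment_halfplane[OF 3 pt_P_facts(3) h(3)])
      next
        case 4 show ?thesis by (rule segment_halfplane[OF 4 h(3,1)])
      qed
    qed
  qed (simp add: complex_eq_iff)
  then show ?thesis by (simp add: region_A_S_def)
qed

lemma mirror_in_box: "(s, t) \<in> param_box \<sigma> \<Longrightarrow> (- s, - t) \<in> param_box \<sigma>"
  by (auto simp: param_box_iff)

lemma A_curve_in_R: "A_path \<sigma> \<union> A_path_mirror \<sigma> \<subseteq> region_R \<sigma>"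
  using chain_A_path box_in_R mirror_in_box by (auto simp: chain_def A_path_mirror_def)

lemma disjoint_A_H:
  assumes K: "placed K" and path: "interior K \<inter> (A_path \<sigma> \<union> A_path_mirror \<sigma>) = {}"
  shows "interior K \<inter> region_A_H \<sigma> = {}"
proof -
  let ?arcs = "unit_arc (pt_G \<sigma>) (pt_P \<sigma>) (pt_X \<sigma>) \<union> unit_arc (pt_E3 \<sigma>) (pt_X \<sigma>) z1"
  let ?\<Gamma> = "A_path \<sigma> \<union> A_path_mirror \<sigma> \<union> unit_arc (pt_G \<sigma>) (pt_P \<sigma>) (pt_X \<sigma>) \<union> unit_arc (pt_E3 \<sigma>) (pt_X \<sigma>) z1"
  let ?a = "Complex (-1/2) (sqrt 3/2)"
  obtain v where v: "v \<in> interior K" "v \<bullet> ?a < 0" using interior_point_below_A[OF K] .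
  have X: "Re (pt_X \<sigma>) \<le> -p" "(pt_X \<sigma> - pt_G \<sigma>) \<bullet> u60 \<ge> 0" using pt_X_facts(1) by (auto simp: Q_def pt_G_CD)
  have z1Q: "z1 \<in> Q" using X_map(1)[OF box_z1] .
  have "interior K \<inter> bounded_region ?\<Gamma> = {}"
  proof (rule convex_disjoint_bounded_region[OF _ _ _ v])
    show "convex (interior K)" using placedD(2)[OF K] by (simp add: constant_width_def)
    have "interior K \<inter> unit_arc (pt_G \<sigma>) (pt_P \<sigma>) (pt_X \<sigma>) = {}"
      by (rule disjoint_G_arc[OF K]) (use X pt_P_facts in auto)
    moreover have "interior K \<inter> unit_arc (pt_E3 \<sigma>) (pt_X \<sigma>) z1 = {}"
      by (rule disjoint_E3_arc[OF K]) (use X z1Q in \<open>auto simp: Q_def\<close>)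
    ultimately show "interior K \<inter> ?\<Gamma> = {}" using path by blast
    have dz: "dist (pt_E3 \<sigma>) z1 = 1" using X_map(3)[OF box_z1] by (simp add: pt_E3_DE)
    show "x \<bullet> ?a \<ge> 0" if "x \<in> ?\<Gamma>" for x
    proof -
      from that consider "x \<in> A_path \<sigma> \<union> A_path_mirror \<sigma>" | "x \<in> unit_arc (pt_G \<sigma>) (pt_P \<sigma>) (pt_X \<sigma>)"
        | "x \<in> unit_arc (pt_E3 \<sigma>) (pt_X \<sigma>) z1" by blast
      then show ?thesis
      proof cases
        case 1 then show ?thesis using A_curve_in_R A_side unfolding region_R_iff subset_iff by blast
      next
        case 2 show ?thesis
          by (rule unit_arc_halfplane[OF 2 pt_P_facts(1) pt_X_facts(2) pt_P_facts(3) A_side[OF pt_X_facts(1)] A_centres_side(1)])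
      next
        case 3 show ?thesis
          by (rule unit_arc_halfplane[OF 3 pt_X_facts(3) dz A_side[OF pt_X_facts(1)] A_side[OF z1Q] A_centres_side(2)])
      qed
    qed
  qed (simp add: complex_eq_iff)
  then show ?thesis unfolding region_A_H_def len_tau_eq .
qed

lemma interior_not_far:
  assumes "placed K" "x \<in> interior K" "y \<in> K" shows "dist y x < 1"
  using interior_dist_less[OF _ assms(2,3)] inscribed_diam[OF placedD(1)[OF assms(1)]] by (simp add: dist_commute)

lemma CD_le_p_if_below_C:
  assumes K: "below K (-\<sigma>)" "CDpt l \<in> K" shows "l \<le> p"
proof -
  have "CDpt p = Complex (cs/2 - p * sn) (- sn/2 - p * cs)"
    using p_eqs by (simp add: CDpt_def complex_eq_iff)
  then have "CDpt p \<bullet> Complex cs (-sn) = 1/2 * (cs * cs + sn * sn)" by (simp add: inner_complex_def algebra_simps)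
  then have 1: "CDpt p \<bullet> Complex cs (-sn) = 1/2" by (simp add: cos_sin_sq)
  have "CDpt l \<bullet> Complex cs (-sn) \<le> 1/2" using K by (auto simp: below_def cis.ctr)
  then have "(CDpt l - CDpt p) \<bullet> Complex cs (-sn) \<le> 0" using 1 by (simp add: inner_diff_left)
  then have "(l - p) * (cs - sqrt 3 * sn) \<le> 0" unfolding CDpt_diff by (simp add: inner_complex_def algebra_simps)
  then show ?thesis using C_cut_slope by (simp add: mult_le_0_iff)
qed

text \<open>The touching point on \<open>CD\<close> is not beyond \<open>L(\<theta>)\<close>, whose open unit disc is disjoint from \<open>\<R>\<close>.\<close>

lemma disjoint_A_H_if_below_C:
  assumes K: "placed K" "below K (-\<sigma>)" shows "interior K \<inter> region_A_H \<sigma> = {}"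
proof (rule disjoint_A_H[OF K(1)])
  obtain l where l: "CDpt l \<in> K" using inscribed_touches[OF placedD(1)[OF K(1)]] by blast
  have lp: "l \<le> p" using CD_le_p_if_below_C[OF K(2) l] .
  have "x \<notin> interior K" if x: "x \<in> region_R \<sigma>" for x
  proof
    assume xi: "x \<in> interior K"
    have e: "x - CDpt p = (x - CDpt g) + (g - p) *\<^sub>R u60" using CDpt_diff[of g p] by (simp add: algebra_simps)
    have "u60 \<bullet> u60 = 1" by (simp add: inner_complex_def)
    moreover have "(x - CDpt g) \<bullet> u60 \<ge> 0" using x by (simp add: region_R_iff Q_def)
    ultimately have "(x - CDpt p) \<bullet> u60 \<ge> 0" unfolding e inner_add_left using g(1) by simp
    then have "(x - CDpt p) \<bullet> (CDpt l - CDpt p) \<le> 0" unfolding CDpt_diff using lp by (simp add: mult_nonpos_nonneg)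
    moreover have "1 \<le> dist (CDpt p) x" using x by (simp add: region_R_iff)
    ultimately have "dist (CDpt l) x \<ge> 1" by (rule dist_ge_1_if_obtuse[rotated])
    then show False using interior_not_far[OF K(1) xi l] by simp
  qed
  then show "interior K \<inter> (A_path \<sigma> \<union> A_path_mirror \<sigma>) = {}" using A_curve_in_R by blast
qed

text \<open>\<open>K\<close> reaches a point \<open>f\<close> in corner \<open>D\<close>, beyond a line with normal \<open>v\<close> that passes through
  \<open>N = N(-\<tau>)\<close>. Let \<open>x\<close> be a point of \<open>\<R>\<close> in the interior of \<open>K\<close>; it has distance at least one from
  \<open>N\<close>. If \<open>x\<close> is on the left of the line through \<open>N\<close> in the direction \<open>v\<close>, then the angle \<open>x N f\<close> is
  not acute, and \<open>f\<close> is too far from \<open>x\<close>. If \<open>x\<close> is on the right, then \<open>x - N\<close> has coordinates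
  \<open>0 < \<alpha> < 1\<close> along \<open>v\<close> and \<open>\<beta> > 0\<close> to the right, where \<open>\<beta>\<close> is small. The open unit disc about \<open>L(\<theta>)\<close>
  contains all such points, because \<open>N + v\<close> has distance at most one from \<open>L(\<theta>)\<close>.\<close>

lemma disjoint_A_H_if_below_A:
  assumes K: "placed K" "below K (2*pi/3 - \<sigma>)" shows "interior K \<inter> region_A_H \<sigma> = {}"
proof (rule disjoint_A_H[OF K(1)])
  define v w where "v = Complex ex (-ey)" and "w = Complex (-ey) (-ex)"
  define N where "N = DEpt (-p)"
  have v: "cis (2*pi/3 - \<sigma>) = v"
  proof -
    have "cis (2*pi/3 - \<sigma>) = cnj (cis (\<sigma> - 2*pi/3))" by (simp add: cis_cnj)
    then show ?thesis unfolding cis_cut_E v_def by (simp add: complex_eq_iff)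
  qed
  have signs: "ex < 0" "ey < 0" using integral_eqs(5,6) C_cut_slope sin_slant_nonneg cos_slant_pos
    by (smt (verit) mult_nonneg_nonneg real_sqrt_ge_zero mult_pos_pos real_sqrt_gt_zero zero_less_numeral mult_minus_left)+
  obtain f where f: "f \<in> K" "f \<bullet> v \<le> -1/2" using below_imp_reaches_opposite[OF placedD(2)[OF K(1)] K(2)] unfolding v by blast
  have "N \<bullet> v = -1/2 * (ex * ex + ey * ey)" unfolding N_def v_def
    by (simp add: DEpt_def inner_complex_def field_simps) (use E_integral in algebra)
  then have Nv: "N \<bullet> v = -1/2" by (simp add: ex_ey_sq)
  have fv: "v \<bullet> (f - N) \<le> 0" using f(2) Nv by (simp add: inner_diff_right inner_commute)
  have fi: "Complex 0 (-1) \<bullet> (f - N) \<le> 0"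
    using placedD(3)[OF K(1) f(1)] abs_ge_minus_self[of "Im f"] unfolding inHex_def N_def DEpt_def by (simp add: inner_complex_def)
  have far: "x \<notin> interior K" if x: "x \<in> region_R \<sigma>" for x
  proof
    assume xi: "x \<in> interior K"
    define \<alpha> \<beta> where "\<alpha> = (x - N) \<bullet> v" and "\<beta> = (x - N) \<bullet> w"
    have xN: "x - N = \<alpha> *\<^sub>R v + \<beta> *\<^sub>R w"
    proof -
      have "Re (x - N) = Re (x - N) * (ex * ex + ey * ey)" "Im (x - N) = Im (x - N) * (ex * ex + ey * ey)"
        using ex_ey_sq by simp_all
      then show ?thesis by (simp add: \<alpha>_def \<beta>_def v_def w_def complex_eq_iff inner_complex_def algebra_simps)
    qed
    have xR: "Re x \<le> -p" "dist N x \<ge> 1" "dist (CDpt p) x \<ge> 1" using x by (auto simp: region_R_iff Q_def N_def)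
    have "x \<bullet> v < 1/2" using interior_below_less[OF K(2) xi] v by simp
    then have a1: "\<alpha> < 1" using Nv by (simp add: \<alpha>_def inner_diff_left)
    have b0: "\<beta> \<le> 0"
    proof (rule ccontr)
      assume "\<not> \<beta> \<le> 0"
      then have b: "0 < \<beta>" by simp
      have "Re (x - N) \<le> - 2 * p" using xR(1) by (simp add: N_def DEpt_def)
      then have re: "\<alpha> * ex - \<beta> * ey \<le> - 2 * p" unfolding xN by (simp add: v_def w_def)
      have bey: "\<beta> * (- ey) > 0" using b signs by (intro mult_pos_pos) auto
      have a0: "0 < \<alpha>"
      proof (rule ccontr)
        assume "\<not> 0 < \<alpha>"
        then have "0 \<le> \<alpha> * ex" using signs by (simp add: mult_nonpos_nonpos)
        then show False using re bey p_bounds by simp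
      qed
      have "0 \<le> sqrt 3 * sn" using sin_slant_nonneg by simp
      then have "- ex \<le> 1/2" using integral_eqs(5) cos_le_one[of \<sigma>] by linarith
      then have "\<alpha> * (- ex) \<le> 1 * (1/2)" using a1 a0 signs by (intro mult_mono) auto
      then have 1: "\<beta> * (- ey) \<le> 1/2" using re p_bounds by simp
      have "sqrt 3 * cs \<ge> 1732/1000 * (965/1000)" using sqrt3_bounds cs_gt by (intro mult_mono) auto
      then have "- ey \<ge> 8/10" using integral_eqs(6) sin_slant_nonneg by simp
      then have "\<beta> * (8/10) \<le> \<beta> * (- ey)" using b by (intro mult_left_mono) auto
      then have b1: "\<beta> \<le> 63/100" using 1 by simp
      define e where "e = CDpt p - N"
      have ev: "e \<bullet> v = sn/2 + p * cs" "e \<bullet> w = cs/2 - p * sn"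
        unfolding e_def N_def v_def w_def
        by (simp_all add: CDpt_def DEpt_def inner_complex_def ex_def ey_def field_simps sqrt3_sq)
      have pc: "p * cs \<le> 135/1000 * 1"
        using p_bounds cos_le_one[of \<sigma>] cos_slant_pos by (intro mult_mono) auto
      have ps: "p * sn \<le> 135/1000 * (27/100)"
        using p_bounds sn_less sin_slant_nonneg by (intro mult_mono) auto
      have pc0: "0 \<le> p * cs" using p_bounds cos_slant_pos by simp
      have k1: "\<bar>\<alpha> - e \<bullet> v\<bar> < 1 - e \<bullet> v" using a0 a1 pc pc0 sn_less sin_slant_nonneg by (simp add: ev abs_less_iff)
      have k2: "\<bar>\<beta> - e \<bullet> w\<bar> \<le> e \<bullet> w" using b b1 ps cs_gt by (simp add: ev abs_le_iff)
      have "(\<alpha> - e \<bullet> v)\<^sup>2 < (1 - e \<bullet> v)\<^sup>2" using k1 power_strict_mono[OF k1, of 2] by simp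
      moreover have "(\<beta> - e \<bullet> w)\<^sup>2 \<le> (e \<bullet> w)\<^sup>2" using k2 power_mono[OF k2, of 2] by simp
      moreover have "(1 - e \<bullet> v)\<^sup>2 + (e \<bullet> w)\<^sup>2 \<le> 1"
      proof -
        have "(e \<bullet> v)\<^sup>2 + (e \<bullet> w)\<^sup>2 = (cs * cs + sn * sn) * (1/4 + p\<^sup>2)"
          unfolding ev by (simp add: power2_eq_square field_simps) (use cos_sin_sq in algebra)
        then have sq: "(e \<bullet> v)\<^sup>2 + (e \<bullet> w)\<^sup>2 = 1/4 + p\<^sup>2" by (simp add: cos_sin_sq)
        have "2 * (e \<bullet> v) = 1/2 - sqrt 3 * p" unfolding ev using integral_eqs(2) by simp
        moreover have "(p + sqrt 3/2)\<^sup>2 \<le> 1\<^sup>2" using p_bounds sqrt3_bounds by (intro power_mono) auto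
        then have "p\<^sup>2 + sqrt 3 * p \<le> 1/4" by (simp add: power2_eq_square algebra_simps)
        moreover have "(1 - e \<bullet> v)\<^sup>2 = 1 - 2 * (e \<bullet> v) + (e \<bullet> v)\<^sup>2" by (simp add: power2_eq_square algebra_simps)
        ultimately show ?thesis using sq by linarith
      qed
      moreover have "(x - CDpt p) \<bullet> (x - CDpt p) = (\<alpha> - e \<bullet> v)\<^sup>2 + (\<beta> - e \<bullet> w)\<^sup>2"
      proof -
        have "x - CDpt p = (x - N) - e" by (simp add: e_def)
        then have *: "(x - CDpt p) \<bullet> v = \<alpha> - e \<bullet> v" "(x - CDpt p) \<bullet> w = \<beta> - e \<bullet> w"
          by (simp_all only: inner_diff_left \<alpha>_def \<beta>_def)
        have "((x - CDpt p) \<bullet> v)\<^sup>2 + ((x - CDpt p) \<bullet> w)\<^sup>2 = (ex * ex + ey * ey) * ((x - CDpt p) \<bullet> (x - CDpt p))"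
          unfolding v_def w_def inner_complex_def complex.sel by algebra
        then show ?thesis unfolding * by (simp add: ex_ey_sq)
      qed
      ultimately have "(x - CDpt p) \<bullet> (x - CDpt p) < 1" by linarith
      then show False using xR(3) dist_less_1_iff[of "CDpt p" x] by linarith
    qed
    have "(x - N) \<bullet> (f - N) \<le> 0"
    proof (rule cone_inner_nonpos[OF _ _ _ fv fi])
      show "0 < det2 v (Complex 0 (-1))" using signs by (simp add: det2_def v_def)
      have "det2 v (x - N) = - \<beta>" by (simp add: det2_def \<beta>_def v_def w_def inner_complex_def algebra_simps)
      then show "0 \<le> det2 v (x - N)" using b0 by simp
      show "0 \<le> det2 (x - N) (Complex 0 (-1))" using xR(1) p_bounds by (simp add: det2_def N_def DEpt_def)
    qed
    then have "dist f x \<ge> 1" by (rule dist_ge_1_if_obtuse[OF xR(2)])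
    then show False using interior_not_far[OF K(1) xi f(1)] by simp
  qed
  show "interior K \<inter> (A_path \<sigma> \<union> A_path_mirror \<sigma>) = {}" using A_curve_in_R far by blast
qed

text \<open>For fixed \<open>l = lam s\<close> the distance to the point of \<open>EF\<close> with coordinate \<open>y\<close> increases in
  \<open>y\<close> and is one at \<open>y = lam (- s)\<close>.\<close>

lemma strut_parameter:
  assumes "l \<le> g" "l' \<le> g" "dist (CDpt l) (EFpt l') \<le> 1"
  obtains s where "-\<theta> \<le> s" "s \<le> \<theta>" "l \<le> lam s" "l' \<le> lam (-s)"
proof (cases "l \<le> p")
  case True
  then show ?thesis using that[of \<theta>] lam_theta theta assms by simp
next
  case False
  have "\<exists>s. -\<theta> \<le> s \<and> s \<le> \<theta> \<and> lam s = l"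
  proof (rule IVT2)
    show "\<forall>s. - \<theta> \<le> s \<and> s \<le> \<theta> \<longrightarrow> isCont lam s"
      unfolding lam_def[abs_def] by (intro allI impI continuous_intros)
  qed (use False assms lam_theta theta in auto)
  then obtain s where s: "-\<theta> \<le> s" "s \<le> \<theta>" "lam s = l" by blast
  define b where "b = lam (-s)"
  have b: "p \<le> b" "b \<le> g" using lam_range[of "-s"] s by (auto simp: b_def)
  have "l' \<le> b"
  proof (rule ccontr)
    assume "\<not> l' \<le> b"
    then have lb: "b < l'" by simp
    define F where "F y = (sqrt 3/2 + (l + y)/2)\<^sup>2 + 3/4 * (l - y)\<^sup>2" for y
    have "sqrt 3/2 + (l + b)/2 = cos s" "l - b = - (2 * sqrt 3/3) * sin s" unfolding s(3)[symmetric] b_def lam_def by (simp_all add: field_simps)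
    then have "F b = cos s * cos s + sin s * sin s" by (simp add: F_def power2_eq_square)
    then have Fb: "F b = 1" using sin_cos_squared_add[of s] by (simp add: power2_eq_square)
    have "F l' - F b = (l' - b) * (sqrt 3/2 - l + (l' + b))"
      by (simp add: F_def power2_eq_square field_simps)
    moreover have "0 < (l' - b) * (sqrt 3/2 - l + (l' + b))"
      using lb b p_bounds g_bounds sqrt3_bounds assms by (intro mult_pos_pos) auto
    ultimately have "1 < F l'" using Fb by simp
    moreover have "(EFpt l' - CDpt l) \<bullet> (EFpt l' - CDpt l) = F l'"
      by (simp add: EFpt_def CDpt_def F_def inner_complex_def power2_eq_square field_simps)
    ultimately show False using assms(3) unfolding dist_le_1_iff by simp
  qed
  then show ?thesis using that[of s] s b_def by simp
qed

text \<open>Let \<open>K\<close> touch \<open>CD\<close>, \<open>EF\<close> and \<open>DE\<close> at \<open>l\<close>, \<open>l'\<close> and \<open>t\<close>. The touching points of the reflection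
  have the coordinates \<open>l'\<close>, \<open>l\<close> and \<open>- t\<close>. With \<open>s\<close> from \<open>strut_parameter\<close>, a point \<open>X(s\<^sub>1, t\<^sub>1)\<close> in the
  interior of \<open>K\<close> satisfies \<open>s < s\<^sub>1\<close> and \<open>t\<^sub>1 < t\<close>, and a point \<open>X(s\<^sub>2, t\<^sub>2)\<close> in the interior of the
  reflection satisfies \<open>- s < s\<^sub>2\<close> and \<open>t\<^sub>2 < - t\<close>. If both are on the curve, this contradicts the
  monotonicity of the path or the signs of its parameters.\<close>

lemma disjoint_A_H_or_mirror:
  assumes K: "placed K" and K': "placed ((\<lambda>z. - cnj z) ` K)" (is "placed ?K'")
  shows "interior K \<inter> region_A_H \<sigma> = {} \<or> interior ?K' \<inter> region_A_H \<sigma> = {}"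
proof (rule ccontr)
  assume neg: "\<not> ?thesis"
  obtain x where x: "x \<in> interior K" "x \<in> A_path \<sigma> \<union> A_path_mirror \<sigma>" using disjoint_A_H[OF K] neg by blast
  obtain x' where x': "x' \<in> interior ?K'" "x' \<in> A_path \<sigma> \<union> A_path_mirror \<sigma>" using disjoint_A_H[OF K'] neg by blast
  obtain l where l: "CDpt l \<in> K" using inscribed_touches[OF placedD(1)[OF K]] by blast
  obtain l' where l': "EFpt l' \<in> K" using inscribed_touches[OF placedD(1)[OF K]] by blast
  obtain t where t: "DEpt t \<in> K" using inscribed_touches[OF placedD(1)[OF K]] by blast
  have "- cnj (EFpt l') = CDpt l'" "- cnj (DEpt t) = DEpt (-t)"
    by (simp_all add: EFpt_def CDpt_def DEpt_def complex_eq_iff)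
  then have m: "CDpt l' \<in> ?K'" "DEpt (-t) \<in> ?K'" using l' t by (metis imageI)+
  have lg: "l \<le> g" "l' \<le> g" using placed_CD_le_g K l K' m by blast+
  have tp: "t \<le> p" "- t \<le> p" using placed_DE_le_p K t K' m by blast+
  obtain s where s: "-\<theta> \<le> s" "s \<le> \<theta>" "l \<le> lam s" "l' \<le> lam (-s)"
    using strut_parameter[OF lg inscribed_diam[OF placedD(1)[OF K] l l']] .
  have xR: "x \<in> region_R \<sigma>" "x' \<in> region_R \<sigma>" using x x' A_curve_in_R by blast+
  obtain s1 t1 where b1: "(s1, t1) \<in> param_box \<sigma>" "x = X_map s1 t1" using region_R_E[OF xR(1)] .
  obtain s2 t2 where b2: "(s2, t2) \<in> param_box \<sigma>" "x' = X_map s2 t2" using region_R_E[OF xR(2)] .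
  have xQ: "x \<in> Q" "x' \<in> Q" using xR by (auto simp: region_R_iff)
  have ms: "-\<theta> \<le> -s" "-s \<le> \<theta>" using s by auto
  have "dist (CDpt (lam s)) x < 1"
    using CDpt_le[OF xQ(1) s(3) lam_range(2)[OF s(1,2)]] interior_not_far[OF K x(1) l] by simp
  then have s1: "s < s1" using X_map_dist_CD(1)[OF b1(1) s(1,2)] b1(2) by simp
  have "dist (CDpt (lam (-s))) x' < 1"
    using CDpt_le[OF xQ(2) s(4) lam_range(2)[OF ms]] interior_not_far[OF K' x'(1) m(1)] by simp
  then have s2: "-s < s2" using X_map_dist_CD(1)[OF b2(1) ms] b2(2) by simp
  have t1: "t1 < t" using X_map_dist_DE(1)[OF b1(1) tp(1)] b1(2) interior_not_far[OF K x(1) t] by simp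
  have t2: "t2 < -t" using X_map_dist_DE(1)[OF b2(1) tp(2)] b2(2) interior_not_far[OF K' x'(1) m(2)] by simp
  note ch = chain_A_path[unfolded chain_def, THEN conjunct2]
  have nn: "0 \<le> a \<and> 0 \<le> b" if "(a, b) \<in> param_box \<sigma>" "X_map a b \<in> A_path \<sigma>" for a b using ch that by blast
  have no: "\<not> (c < a \<and> b < d)" if "(a, b) \<in> param_box \<sigma>" "X_map a b \<in> A_path \<sigma>" "(c, d) \<in> param_box \<sigma>" "X_map c d \<in> A_path \<sigma>" for a b c d
    using ch that by blast
  have mir: "X_map (-a) (-b) \<in> A_path \<sigma>" if ab: "(a, b) \<in> param_box \<sigma>" "X_map a b \<in> A_path_mirror \<sigma>" for a b
  proof -
    obtain c d where cd: "X_map a b = X_map (-c) (-d)" "(c, d) \<in> param_box \<sigma>" "X_map c d \<in> A_path \<sigma>"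
      using ab(2) by (auto simp: A_path_mirror_def)
    from X_map_inj[OF ab(1) mirror_in_box[OF cd(2)] cd(1)] show ?thesis using cd by simp
  qed
  consider "x \<in> A_path \<sigma>" "x' \<in> A_path \<sigma>" | "x \<in> A_path \<sigma>" "x' \<in> A_path_mirror \<sigma>"
    | "x \<in> A_path_mirror \<sigma>" "x' \<in> A_path \<sigma>" | "x \<in> A_path_mirror \<sigma>" "x' \<in> A_path_mirror \<sigma>"
    using x(2) x'(2) by blast
  then show False
  proof cases
    case 1 then show False using nn[OF b1(1)] nn[OF b2(1)] b1(2) b2(2) t1 t2 by simp
  next
    case 2
    have "X_map (-s2) (-t2) \<in> A_path \<sigma>" using mir[OF b2(1)] 2(2) b2(2) by simp
    then show False using no[OF b1(1) _ mirror_in_box[OF b2(1)]] 2(1) b1(2) s1 s2 t1 t2 by simp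
  next
    case 3
    have "X_map (-s1) (-t1) \<in> A_path \<sigma>" using mir[OF b1(1)] 3(1) b1(2) by simp
    then show False using no[OF b2(1) _ mirror_in_box[OF b1(1)]] 3(2) b2(2) s1 s2 t1 t2 by simp
  next
    case 4
    have "X_map (-s1) (-t1) \<in> A_path \<sigma>" "X_map (-s2) (-t2) \<in> A_path \<sigma>" using mir b1 b2 4 by simp_all
    then show False using nn[OF mirror_in_box[OF b1(1)]] nn[OF mirror_in_box[OF b2(1)]] s1 s2 by simp
  qed
qed

end

section \<open>The convex hull of an arc and a point\<close>

lemma convex_hull_halfplane:
  fixes n :: complex
  assumes "\<And>x. x \<in> A \<Longrightarrow> x \<bullet> n \<ge> c" "x \<in> convex hull A"
  shows "x \<bullet> n \<ge> c"
proof -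
  have "convex hull A \<subseteq> {x. n \<bullet> x \<ge> c}"
    using assms(1) by (intro hull_minimal convex_halfspace_ge) (auto simp: inner_commute)
  then show ?thesis using assms(2) by (auto simp: inner_commute)
qed

text \<open>The part of the line \<open>TU\<close> beyond \<open>U\<close> lies outside the disc, because the disc is convex and contains
  \<open>T\<close> but not \<open>U\<close>. So this part does not separate the points of the disc with \<open>x \<bullet> e < h\<close>, and all
  of them are on the side of \<open>S\<close>.\<close>

lemma beyond_exit:
  fixes S T U z e :: complex
  assumes "dist S T \<le> 1" "1 < dist S U" "U \<bullet> e = h" "h < T \<bullet> e" "S \<bullet> e < h"
    and S: "det2 (U - T) (S - T) < 0" and z: "dist S z \<le> 1" "z \<bullet> e < h"
  shows "det2 (U - T) (z - T) < 0"
proof (rule ccontr)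
  define l where "l x = det2 (U - T) (x - T)" for x
  assume "\<not> ?thesis"
  then have lz: "0 \<le> l z" and lS: "l S < 0" using S by (simp_all add: l_def)
  define u where "u = - l S / (l z - l S)"
  have u: "0 \<le> u" "u \<le> 1" "u * (l z - l S) = - l S"
  proof -
    have pos: "0 < l z - l S" using lz lS by simp
    show "0 \<le> u" unfolding u_def by (rule divide_nonneg_pos) (use lS pos in auto)
    show "u \<le> 1" unfolding u_def pos_divide_le_eq[OF pos] using lz by simp
    show "u * (l z - l S) = - l S" using pos by (simp add: u_def)
  qed
  define y where "y = S + u *\<^sub>R (z - S)"
  have "l y = l S + u * (l z - l S)" by (simp add: l_def y_def det2_def algebra_simps)
  then have ly: "l y = 0" using u by simp
  have yS: "dist S y \<le> 1"
  proof -
    have "dist S y = u * dist S z" using u(1) by (simp add: y_def dist_norm norm_minus_commute[of S])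
    also have "\<dots> \<le> 1 * 1" using u z by (intro mult_mono) auto
    finally show ?thesis by simp
  qed
  have "y \<bullet> e = (1 - u) * (S \<bullet> e) + u * (z \<bullet> e)" by (simp add: y_def inner_add_left inner_diff_left algebra_simps)
  moreover have "(1 - u) * (S \<bullet> e) + u * (z \<bullet> e) < h"
  proof (cases "u = 0")
    case False
    have "(1 - u) * (S \<bullet> e) \<le> (1 - u) * h" "u * (z \<bullet> e) < u * h" using assms u False by (auto intro!: mult_left_mono)
    then show ?thesis by (simp add: algebra_simps)
  qed (use assms in simp)
  ultimately have ye: "y \<bullet> e < h" by simp
  \<comment> \<open>\<open>U\<close> lies on the segment from \<open>T\<close> to \<open>y\<close>\<close>
  define w where "w = (T \<bullet> e - h) / (T \<bullet> e - y \<bullet> e)"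
  have w: "0 \<le> w" "w \<le> 1" "w * (T \<bullet> e - y \<bullet> e) = T \<bullet> e - h"
  proof -
    have pos: "0 < T \<bullet> e - y \<bullet> e" using assms(4) ye by simp
    show "0 \<le> w" unfolding w_def by (rule divide_nonneg_pos) (use assms(4) pos in auto)
    show "w \<le> 1" unfolding w_def pos_divide_le_eq[OF pos] using ye by simp
    show "w * (T \<bullet> e - y \<bullet> e) = T \<bullet> e - h" using pos by (simp add: w_def)
  qed
  have "(T \<bullet> e - h) *\<^sub>R (y - T) = (T \<bullet> e - y \<bullet> e) *\<^sub>R (U - T)"
  proof -
    have z: "(Re U - Re T) * (Im y - Im T) - (Im U - Im T) * (Re y - Re T) = 0" using ly by (simp add: l_def det2_def)
    have "((T - U) \<bullet> e) *\<^sub>R (y - T) = ((T - y) \<bullet> e) *\<^sub>R (U - T)"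
      by (rule complex_eqI; simp add: inner_complex_def; use z in algebra)
    then show ?thesis using assms(3) by (simp add: inner_diff_left)
  qed
  then have "w *\<^sub>R ((T \<bullet> e - y \<bullet> e) *\<^sub>R (y - T)) = (T \<bullet> e - y \<bullet> e) *\<^sub>R (U - T)"
    using w(3) by simp
  then have "(T \<bullet> e - y \<bullet> e) *\<^sub>R (w *\<^sub>R (y - T)) = (T \<bullet> e - y \<bullet> e) *\<^sub>R (U - T)"
    by (simp only: scaleR_left_commute)
  moreover have "T \<bullet> e - y \<bullet> e \<noteq> 0" using assms(4) ye by simp
  ultimately have "w *\<^sub>R (y - T) = U - T" by (simp only: scaleR_cancel_left) simp
  then have "U = T + w *\<^sub>R (y - T)" by simp
  then have "U \<in> closed_segment T y" using w by (intro in_closed_segmentI[where u=w]) auto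
  moreover have "closed_segment T y \<subseteq> cball S 1" using assms(1) yS by (intro closed_segment_subset) auto
  ultimately show False using assms(2) by auto
qed

lemma in_segment_of_scalings:
  fixes y c :: complex
  assumes "a < 1" "1 < b"
  shows "y \<in> closed_segment (c + a *\<^sub>R (y - c)) (c + b *\<^sub>R (y - c))"
proof -
  define w where "w = (1 - a) / (b - a)"
  have pos: "0 < b - a" using assms by simp
  have w: "w * (b - a) = 1 - a" using pos by (simp add: w_def)
  show ?thesis
  proof (rule in_closed_segmentI[where u=w])
    show "0 \<le> w" unfolding w_def by (rule divide_nonneg_pos[OF _ pos]) (use assms in linarith)
    show "w \<le> 1" unfolding w_def pos_divide_le_eq[OF pos] using assms by simp
    have "c + a *\<^sub>R (y - c) + w *\<^sub>R (c + b *\<^sub>R (y - c) - (c + a *\<^sub>R (y - c))) = c + (a + w * (b - a)) *\<^sub>R (y - c)"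
      by (simp add: algebra_simps)
    then show "y = c + a *\<^sub>R (y - c) + w *\<^sub>R (c + b *\<^sub>R (y - c) - (c + a *\<^sub>R (y - c)))"
      unfolding w by simp
  qed
qed

text \<open>In the coordinates \<open>al\<close> and \<open>be\<close> with respect to \<open>T - S\<close> and \<open>V - S\<close>, the hull contains all
  points of the open disc with \<open>al > 0\<close>, \<open>be > 0\<close> and \<open>al + be > 1\<close>: such a point lies between the
  arc and its chord. A point of the hull in the open disc that violates one of these conditions is on
  the chord and therefore on the other side of the line \<open>TU\<close>. So on the side under consideration a
  point of the hull in the open disc is an interior point.\<close>

lemma hull_frontier_outside_disc:
  fixes S T U V x :: complex
  defines "H \<equiv> convex hull (insert U (unit_arc S T V))"
  assumes TV: "dist S T = 1" "dist S V = 1" "0 < det2 (V - S) (T - S)"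
    and U: "0 \<le> det2 (V - S) (U - S)" "0 \<le> det2 (U - S) (T - S)" "1 < dist S U"
    and V: "det2 (U - T) (V - T) < 0"
    and x: "x \<in> frontier H" "0 \<le> det2 (U - T) (x - T)"
  shows "x \<in> H" "1 \<le> dist S x"
proof -
  let ?A = "unit_arc S T V"
  define t v where "t = T - S" and "v = V - S"
  define D where "D = det2 v t"
  have D: "0 < D" using TV by (simp add: D_def t_def v_def)
  define al be where "al y = det2 v (y - S) / D" and "be y = det2 (y - S) t / D" for y
  have co: "y - S = al y *\<^sub>R t + be y *\<^sub>R v" for y
  proof -
    have "D *\<^sub>R (y - S) = det2 v (y - S) *\<^sub>R t + det2 (y - S) t *\<^sub>R v"
      unfolding D_def det2_def complex_eq_iff by (simp, algebra)
    then have "(1/D) *\<^sub>R (D *\<^sub>R (y - S)) = (1/D) *\<^sub>R (det2 v (y - S) *\<^sub>R t + det2 (y - S) t *\<^sub>R v)" by simp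
    then show ?thesis using D by (simp add: al_def be_def scaleR_add_right)
  qed
  have coI: "al y = a \<and> be y = b" if "y - S = a *\<^sub>R t + b *\<^sub>R v" for a b y
  proof -
    have "det2 v (y - S) = a * D" "det2 (y - S) t = b * D" unfolding that D_def by (simp_all add: det2_def algebra_simps)
    then show ?thesis using D by (simp add: al_def be_def)
  qed
  have nt: "norm t = 1" "norm v = 1" using TV by (simp_all add: t_def v_def dist_norm norm_minus_commute)
  have A: "y \<in> ?A \<longleftrightarrow> dist S y = 1 \<and> 0 \<le> al y \<and> 0 \<le> be y" for y
  proof -
    have "y \<in> ?A \<longleftrightarrow> dist S y = 1 \<and> (\<exists>a\<ge>0. \<exists>b\<ge>0. y - S = a *\<^sub>R t + b *\<^sub>R v)"
      by (simp add: unit_arc_def t_def v_def)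
    moreover have "(\<exists>a\<ge>0. \<exists>b\<ge>0. y - S = a *\<^sub>R t + b *\<^sub>R v) \<longleftrightarrow> 0 \<le> al y \<and> 0 \<le> be y"
    proof
      assume "\<exists>a\<ge>0. \<exists>b\<ge>0. y - S = a *\<^sub>R t + b *\<^sub>R v"
      then show "0 \<le> al y \<and> 0 \<le> be y" using coI by metis
    next
      assume "0 \<le> al y \<and> 0 \<le> be y"
      then show "\<exists>a\<ge>0. \<exists>b\<ge>0. y - S = a *\<^sub>R t + b *\<^sub>R v" using co[of y] by metis
    qed
    ultimately show ?thesis by simp
  qed
  have nle: "norm (y - S) \<le> \<bar>al y\<bar> + \<bar>be y\<bar>" for y
    using norm_triangle_ineq[of "al y *\<^sub>R t" "be y *\<^sub>R v"] unfolding co[of y, symmetric] by (simp add: nt)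
  have A1: "1 \<le> al y + be y" if "y \<in> ?A" for y
    using nle[of y] that unfolding A by (simp add: dist_norm norm_minus_commute)
  have inner: "al y = y \<bullet> ((1/D) *\<^sub>R (\<i> * v)) - S \<bullet> ((1/D) *\<^sub>R (\<i> * v))"
    "be y = y \<bullet> ((1/D) *\<^sub>R (- \<i> * t)) - S \<bullet> ((1/D) *\<^sub>R (- \<i> * t))" for y
    by (simp_all add: al_def be_def det2_def inner_complex_def diff_divide_distrib add_divide_distrib algebra_simps)
  define B where "B = insert U ?A"
  have HB: "H = convex hull B" by (simp add: H_def B_def)
  have B: "0 \<le> al y" "0 \<le> be y" "1 \<le> al y + be y" if "y \<in> B" for y
  proof -
    have "0 \<le> al U" "0 \<le> be U" using U D by (simp_all add: al_def be_def t_def v_def)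
    moreover have "1 \<le> al U + be U" using nle[of U] calculation U(3) by (simp add: dist_norm norm_minus_commute)
    ultimately show "0 \<le> al y" "0 \<le> be y" "1 \<le> al y + be y" using that A A1 by (auto simp: B_def)
  qed
  have hull: "0 \<le> al y" "0 \<le> be y" "1 \<le> al y + be y" if y: "y \<in> H" for y
  proof -
    let ?n = "(1/D) *\<^sub>R (\<i> * v)" and ?m = "(1/D) *\<^sub>R (- \<i> * t)"
    have "y \<bullet> ?n \<ge> S \<bullet> ?n" by (rule convex_hull_halfplane[of B]) (use B(1) inner(1) y HB in fastforce)+
    then show "0 \<le> al y" using inner(1)[of y] by simp
    have "y \<bullet> ?m \<ge> S \<bullet> ?m" by (rule convex_hull_halfplane[of B]) (use B(2) inner(2) y HB in fastforce)+
    then show "0 \<le> be y" using inner(2)[of y] by simp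
    have "y \<bullet> (?n + ?m) \<ge> 1 + S \<bullet> (?n + ?m)"
    proof (rule convex_hull_halfplane[of B])
      fix z assume "z \<in> B"
      then show "1 + S \<bullet> (?n + ?m) \<le> z \<bullet> (?n + ?m)" using B(3)[of z] inner[of z] unfolding inner_add_right by linarith
    qed (use y HB in simp)
    then show "1 \<le> al y + be y" using inner[of y] unfolding inner_add_right by linarith
  qed
  have "compact ?A"
  proof -
    have "?A = sphere S 1 \<inter> ({y. ((1/D) *\<^sub>R (\<i> * v)) \<bullet> y \<ge> S \<bullet> ((1/D) *\<^sub>R (\<i> * v))}
      \<inter> {y. ((1/D) *\<^sub>R (- \<i> * t)) \<bullet> y \<ge> S \<bullet> ((1/D) *\<^sub>R (- \<i> * t))})"
    proof (intro set_eqI)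
      fix y
      have "0 \<le> al y \<longleftrightarrow> S \<bullet> ((1/D) *\<^sub>R (\<i> * v)) \<le> ((1/D) *\<^sub>R (\<i> * v)) \<bullet> y"
        "0 \<le> be y \<longleftrightarrow> S \<bullet> ((1/D) *\<^sub>R (- \<i> * t)) \<le> ((1/D) *\<^sub>R (- \<i> * t)) \<bullet> y"
        using inner[of y] by (auto simp only: inner_commute[of y])
      then show "y \<in> ?A \<longleftrightarrow> y \<in> sphere S 1 \<inter> ({y. ((1/D) *\<^sub>R (\<i> * v)) \<bullet> y \<ge> S \<bullet> ((1/D) *\<^sub>R (\<i> * v))}
      \<inter> {y. ((1/D) *\<^sub>R (- \<i> * t)) \<bullet> y \<ge> S \<bullet> ((1/D) *\<^sub>R (- \<i> * t))})" unfolding A by simp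
    qed
    then show ?thesis by (simp only:) (intro compact_Int_closed compact_sphere closed_Int closed_halfspace_ge)
  qed
  then have "closed H" unfolding H_def by (intro compact_imp_closed compact_convex_hull compact_insert)
  then show xH: "x \<in> H" using x(1) frontier_subset_closed by blast
  show "1 \<le> dist S x"
  proof (rule ccontr)
    assume "\<not> 1 \<le> dist S x"
    then have n: "norm (x - S) < 1" by (simp add: dist_norm norm_minus_commute)
    have pos: "0 < al x"
    proof (rule ccontr)
      assume "\<not> 0 < al x"
      then have "al x = 0" using hull[OF xH] by simp
      then show False using hull[OF xH] co[of x] n nt by simp
    qed
    have pos': "0 < be x"
    proof (rule ccontr)
      assume "\<not> 0 < be x"
      then have "be x = 0" using hull[OF xH] by simp
      then show False using hull[OF xH] co[of x] n nt by simp
    qed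
    have gt: "1 < al x + be x"
    proof (rule ccontr)
      assume "\<not> 1 < al x + be x"
      then have a: "al x = 1 - be x" using hull[OF xH] by simp
      have e: "x - T = be x *\<^sub>R (V - T)" using co[of x] a by (simp add: t_def v_def algebra_simps)
      have "det2 (U - T) (x - T) = be x * det2 (U - T) (V - T)" unfolding e by (simp add: det2_def algebra_simps)
      then show False using x(2) V pos' mult_pos_neg[OF pos' V] by simp
    qed
    let ?O = "{y. 0 < al y} \<inter> {y. 0 < be y} \<inter> {y. 1 < al y + be y} \<inter> ball S 1"
    have cont: "continuous_on UNIV al" "continuous_on UNIV be"
      unfolding inner[abs_def] by (intro continuous_intros)+
    then have "open ?O" by (intro open_Int open_ball open_Collect_less continuous_intros)
    moreover have "?O \<subseteq> H"
    proof
      fix y assume y: "y \<in> ?O"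
      define s where "s = al y + be y"
      have s: "1 < s" using y by (simp add: s_def)
      have ny: "norm (y - S) < 1" using y by (simp add: dist_norm norm_minus_commute)
      have n0: "0 < norm (y - S)"
      proof -
        have "y \<noteq> S" using y coI[of S 0 0] by auto
        then show ?thesis by simp
      qed
      have TH: "T \<in> H" "V \<in> H"
        using A[of T] A[of V] coI[of T 1 0] coI[of V 0 1] TV by (auto simp: t_def v_def H_def intro!: hull_inc)
      define c where "c = S + (1/s) *\<^sub>R (y - S)"
      have "c = (al y/s) *\<^sub>R T + (be y/s) *\<^sub>R V"
      proof -
        have "c = S + (1/s) *\<^sub>R (al y *\<^sub>R t + be y *\<^sub>R v)" unfolding c_def co[of y, symmetric] ..
        moreover have "(al y/s + be y/s) *\<^sub>R S = S" using s by (simp add: s_def flip: add_divide_distrib)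
        ultimately show ?thesis by (simp add: t_def v_def algebra_simps)
      qed
      moreover have "al y/s + be y/s = 1" using s by (simp add: s_def flip: add_divide_distrib)
      moreover have "0 \<le> al y/s" "0 \<le> be y/s" using y s by auto
      ultimately have cH: "c \<in> H" using TH convexD[OF convex_convex_hull, of T "insert U ?A" V] by (simp add: H_def)
      define r where "r = norm (y - S)"
      define d where "d = S + (1/r) *\<^sub>R (y - S)"
      have "d - S = (al y/r) *\<^sub>R t + (be y/r) *\<^sub>R v"
      proof -
        have "d - S = (1/r) *\<^sub>R (al y *\<^sub>R t + be y *\<^sub>R v)" unfolding d_def co[of y, symmetric] by simp
        then show ?thesis by (simp add: scaleR_add_right)
      qed
      then have "al d = al y/r" "be d = be y/r" using coI by blast+
      moreover have "dist S d = 1" using n0 by (simp add: d_def r_def dist_norm)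
      ultimately have "d \<in> ?A" unfolding A using y n0 by (simp add: r_def)
      then have dH: "d \<in> H" by (simp add: H_def hull_inc)
      have "1/s < 1" "1 < 1/r" using s ny n0 by (auto simp: r_def divide_simps)
      then have "y \<in> closed_segment c d" unfolding c_def d_def by (rule in_segment_of_scalings)
      moreover have "closed_segment c d \<subseteq> H" using cH dH by (intro closed_segment_subset) (auto simp: H_def)
      ultimately show "y \<in> H" by blast
    qed
    moreover have "x \<in> ?O" using pos pos' gt n by (simp add: dist_norm norm_minus_commute)
    ultimately have "x \<in> interior H" by (meson interiorI)
    then show False using x(1) by (simp add: frontier_def)
  qed
qed

text \<open>A point of the hull is a combination of \<open>U\<close> and a point of the disc; if it is on the far side of
  the line \<open>TU\<close>, so is the point of the disc, to which \<open>beyond_exit\<close> applies.\<close>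

lemma hull_far_side:
  fixes S T U e :: complex
  assumes "dist S T \<le> 1" "1 < dist S U" "U \<bullet> e = h" "h < T \<bullet> e" "S \<bullet> e < h" "det2 (U - T) (S - T) < 0"
    and A: "A \<subseteq> cball S 1" "A \<noteq> {}" and x: "x \<in> convex hull (insert U A)" "0 \<le> det2 (U - T) (x - T)"
  shows "h \<le> x \<bullet> e"
proof -
  obtain u v z where z: "0 \<le> u" "0 \<le> v" "u + v = 1" "z \<in> convex hull A" "x = u *\<^sub>R U + v *\<^sub>R z"
    using x(1) unfolding convex_hull_insert[OF A(2)] by blast
  have u: "u = 1 - v" using z by simp
  have "convex hull A \<subseteq> cball S 1" using A(1) by (intro hull_minimal) auto
  then have zS: "dist S z \<le> 1" using z(4) by auto
  have "det2 (U - T) (x - T) = v * det2 (U - T) (z - T)" unfolding z(5) u by (simp add: det2_def algebra_simps)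
  then have "v = 0 \<or> 0 \<le> det2 (U - T) (z - T)" using x(2) z(2) by (auto simp: zero_le_mult_iff)
  then have "v = 0 \<or> h \<le> z \<bullet> e" using beyond_exit[OF assms(1-6) zS] by force
  then have "v * h \<le> v * (z \<bullet> e)" using z(2) by (auto intro: mult_left_mono)
  then show ?thesis unfolding z(5) u using assms(3) by (simp add: inner_add_left algebra_simps)
qed

section \<open>The points R, S and U\<close>

text \<open>Orthonormal coordinates in which the second axis points from the centre to corner \<open>E\<close>.\<close>

definition xi :: "complex \<Rightarrow> real" where "xi x = x \<bullet> Complex (- sqrt 3/2) (1/2)"
definition et :: "complex \<Rightarrow> real" where "et x = x \<bullet> Complex (-1/2) (- sqrt 3/2)"

lemma frame_sq: "(x - y) \<bullet> (x - y) = (xi x - xi y) * (xi x - xi y) + (et x - et y) * (et x - et y)"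
  by (simp add: xi_def et_def inner_complex_def field_simps)

lemma frame_det: "det2 (a - b) (c - d) = (xi a - xi b) * (et c - et d) - (et a - et b) * (xi c - xi d)"
  by (simp add: xi_def et_def det2_def inner_complex_def field_simps)

lemma frame_cis120: "(x - y) \<bullet> Complex (-1/2) (sqrt 3/2) = sqrt 3/2 * (xi x - xi y) - (et x - et y)/2"
  by (simp add: xi_def et_def inner_complex_def field_simps)

lemma frame_eqI: "xi x = xi y \<Longrightarrow> et x = et y \<Longrightarrow> x = y"
  using frame_sq[of x y] by simp

lemma frame_point: "xi (a *\<^sub>R Complex (- sqrt 3/2) (1/2) + b *\<^sub>R Complex (-1/2) (- sqrt 3/2)) = a"
  "et (a *\<^sub>R Complex (- sqrt 3/2) (1/2) + b *\<^sub>R Complex (-1/2) (- sqrt 3/2)) = b"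
  by (simp_all add: xi_def et_def inner_complex_def field_simps)

lemma frame_combination:
  assumes "x - c = a *\<^sub>R (u - c) + b *\<^sub>R (v - c)"
  shows "xi x - xi c = a * (xi u - xi c) + b * (xi v - xi c)" "et x - et c = a * (et u - et c) + b * (et v - et c)"
proof -
  have x: "x = c + a *\<^sub>R (u - c) + b *\<^sub>R (v - c)" using assms by (simp add: algebra_simps)
  show "xi x - xi c = a * (xi u - xi c) + b * (xi v - xi c)" "et x - et c = a * (et u - et c) + b * (et v - et c)"
    unfolding x xi_def et_def by (simp_all add: inner_add_left inner_diff_left)
qed

lemma frame_values:
  "xi (BCpt l) = - 1/4 - sqrt 3 * l/2" "et (BCpt l) = - sqrt 3/4 + l/2"
  "xi (EFpt l) = 1/4 + sqrt 3 * l/2" "et (EFpt l) = sqrt 3/4 - l/2"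
  by (simp_all add: xi_def et_def BCpt_def EFpt_def inner_complex_def field_simps)

lemma unit_arcI:
  assumes "dist c x = 1" "0 < det2 (u - c) (v - c)" "0 \<le> det2 (u - c) (x - c)" "0 \<le> det2 (x - c) (v - c)"
  shows "x \<in> unit_arc c u v"
proof -
  define D where "D = det2 (u - c) (v - c)"
  have "D *\<^sub>R (x - c) = det2 (x - c) (v - c) *\<^sub>R (u - c) + det2 (u - c) (x - c) *\<^sub>R (v - c)"
    unfolding D_def det2_def complex_eq_iff by (simp, algebra)
  then have "(1/D) *\<^sub>R (D *\<^sub>R (x - c)) = (1/D) *\<^sub>R (det2 (x - c) (v - c) *\<^sub>R (u - c) + det2 (u - c) (x - c) *\<^sub>R (v - c))" by simp
  moreover have "0 < D" using assms by (simp add: D_def)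
  ultimately have "x - c = (det2 (x - c) (v - c)/D) *\<^sub>R (u - c) + (det2 (u - c) (x - c)/D) *\<^sub>R (v - c)"
    by (simp add: scaleR_add_right)
  moreover have "0 \<le> det2 (x - c) (v - c)/D" "0 \<le> det2 (u - c) (x - c)/D" using assms by (simp_all add: D_def)
  ultimately show ?thesis using assms(1) unfolding unit_arc_def by blast
qed

lemma quadrant_mono:
  fixes x y x' y' :: real
  assumes "0 \<le> x" "0 \<le> y" "0 \<le> x'" "x * x + y * y = 1" "x' * x' + y' * y' = 1" "y \<le> y'"
  shows "x' \<le> x" "0 \<le> x * y' - y * x'"
proof -
  have "y * y \<le> y' * y'" using assms by (intro mult_mono) auto
  then have "x'\<^sup>2 \<le> x\<^sup>2" using assms by (simp add: power2_eq_square)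
  then show le: "x' \<le> x" using assms power2_le_imp_le by blast
  have "x' * y \<le> x * y'" using assms le by (intro mult_mono) auto
  then show "0 \<le> x * y' - y * x'" by (simp add: mult.commute)
qed

lemma det2_add_scaleR: "det2 a (b + c *\<^sub>R d) = det2 a b + c * det2 a d"
  by (simp add: det2_def algebra_simps)

lemma inner_diff_self: "(v - w) \<bullet> (v - w) = v \<bullet> v - 2 * (v \<bullet> w) + w \<bullet> w" for v w :: complex
  by (simp add: inner_diff_left inner_diff_right inner_commute[of w v])

lemma inner_diff_unit: "n \<bullet> n = 1 \<Longrightarrow> (w - k *\<^sub>R n) \<bullet> (w - k *\<^sub>R n) = w \<bullet> w - 2 * k * (w \<bullet> n) + k * k"
  for n w :: complex
  by (simp add: inner_diff_left inner_diff_right inner_commute[of n w] algebra_simps)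

lemma Im_cnj_det2: "Im (cnj z * w) = det2 z w" by (simp add: det2_def)

context slant begin

lemma sn_le: "sn \<le> 17454/100000" and cs_ge: "9847/10000 \<le> cs"
proof -
  have s: "\<sigma> \<le> 17454/100000" using slant_less pi_approx by simp
  show "sn \<le> 17454/100000" using sin_x_le_x[OF slant_nonneg] s by simp
  have h: "0 \<le> sin (\<sigma>/2)" using slant_nonneg s pi_gt3 by (intro sin_ge_zero) auto
  have "sin (\<sigma>/2) \<le> 8727/100000" using sin_x_le_x[of "\<sigma>/2"] slant_nonneg s by simp
  then have "sin (\<sigma>/2) * sin (\<sigma>/2) \<le> 8727/100000 * (8727/100000)" using h by (intro mult_mono) auto
  moreover have "cs = 1 - 2 * (sin (\<sigma>/2))\<^sup>2" using cos_double_sin[of "\<sigma>/2"] by simp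
  ultimately show "9847/10000 \<le> cs" by (simp add: power2_eq_square)
qed

text \<open>The point \<open>R\<close> is at distance \<open>r\<close> to the left of the centre.\<close>

definition r :: real where "r = 1 / (2 * cs)"

lemma r: "2 * r * cs = 1" "1/2 \<le> r" "r \<le> 5078/10000" "r * r \<le> 5078/10000 * (5078/10000)" "sqrt 3 * r \<le> 17321/10000 * (5078/10000)"
proof -
  show "2 * r * cs = 1" using cos_slant_pos by (simp add: r_def)
  show "1/2 \<le> r" using cos_slant_pos cos_le_one[of \<sigma>] by (simp add: r_def divide_simps)
  have "r \<le> 1 / (2 * (9847/10000))" unfolding r_def using cs_ge by (intro divide_left_mono) auto
  then show r1: "r \<le> 5078/10000" by simp
  have r0: "0 \<le> r" using cos_slant_pos by (simp add: r_def)
  show "r * r \<le> 5078/10000 * (5078/10000)" by (rule mult_mono[OF r1 r1 _ r0]) simp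
  show "sqrt 3 * r \<le> 17321/10000 * (5078/10000)" by (rule mult_mono[OF _ r1 _ r0]) (use sqrt3_bounds in auto)
qed

text \<open>Measured on the line \<open>F\<^sub>2F\<^sub>3\<close> from the point where it touches the circle of radius \<open>1/2\<close>, \<open>R\<close>
  is at \<open>r sin \<sigma>\<close> and the foot of the perpendicular from \<open>C\<^sub>3\<close> at \<open>p\<close>.\<close>

lemma rsn_less_p: "r * sn < p"
proof -
  have "r * sn < r * (2 * p * cs)" using p_gt r by (intro mult_strict_left_mono) auto
  also have "r * (2 * p * cs) = p * (2 * r * cs)" by simp
  finally show ?thesis unfolding r(1) by simp
qed

lemma pt_R_eq: "pt_R \<sigma> = Complex (-r) 0"
  unfolding pt_R_def
proof (rule the_equality)
  have F2: "pt_F2 \<sigma> = Complex (- cs/2 - q * sn) (- sn/2 + q * cs)"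
    unfolding cut_points using C2_alt[unfolded cut_points] by (simp add: complex_eq_iff)
  have "Complex (-r) 0 \<in> closed_segment (pt_F2 \<sigma>) (pt_F3 \<sigma>)"
  proof (rule in_closed_segment_ratioI[of "q - r * sn" "p + q"])
    show "0 \<le> q - r * sn" "q - r * sn \<le> p + q" "0 < p + q"
      using rsn_less_p p_le_q p_bounds r sin_slant_nonneg mult_nonneg_nonneg[of r sn] by linarith+
    show "(p + q) * (Re (Complex (- r) 0) - Re (pt_F2 \<sigma>)) = (q - r * sn) * (Re (pt_F3 \<sigma>) - Re (pt_F2 \<sigma>))"
      "(p + q) * (Im (Complex (- r) 0) - Im (pt_F2 \<sigma>)) = (q - r * sn) * (Im (pt_F3 \<sigma>) - Im (pt_F2 \<sigma>))"
      unfolding F2 F3_alt by (simp_all add: field_simps) (use r(1) cos_sin_sq in algebra)+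
  qed
  moreover have "Complex (-r) 0 \<in> affine hull {corner_F, corner_C}"
    unfolding affine_hull_2
    by (intro CollectI exI[of _ "(1 + sqrt 3 * r)/2"] exI[of _ "(1 - sqrt 3 * r)/2"])
      (simp add: hex_corners complex_eq_iff field_simps)
  ultimately show "Complex (-r) 0 \<in> closed_segment (pt_F2 \<sigma>) (pt_F3 \<sigma>) \<and> Complex (-r) 0 \<in> affine hull {corner_F, corner_C}" ..
  then obtain u where u: "Complex (-r) 0 = pt_F2 \<sigma> + u *\<^sub>R (pt_F3 \<sigma> - pt_F2 \<sigma>)" unfolding in_segment_from by blast
  fix x assume x: "x \<in> closed_segment (pt_F2 \<sigma>) (pt_F3 \<sigma>) \<and> x \<in> affine hull {corner_F, corner_C}"
  then have ix: "Im x = 0" unfolding affine_hull_2 by (auto simp: hex_corners)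
  obtain w where w: "x = pt_F2 \<sigma> + w *\<^sub>R (pt_F3 \<sigma> - pt_F2 \<sigma>)" using x unfolding in_segment_from by blast
  have "Im (pt_F3 \<sigma> - pt_F2 \<sigma>) = - (p + q) * cs" unfolding F2 F3_alt by (simp add: algebra_simps)
  then have nz: "Im (pt_F3 \<sigma> - pt_F2 \<sigma>) \<noteq> 0" using p_bounds p_le_q cos_slant_pos by simp
  have "u * Im (pt_F3 \<sigma> - pt_F2 \<sigma>) = w * Im (pt_F3 \<sigma> - pt_F2 \<sigma>)"
  proof -
    have "Im (pt_F2 \<sigma>) + u * Im (pt_F3 \<sigma> - pt_F2 \<sigma>) = 0" "Im (pt_F2 \<sigma>) + w * Im (pt_F3 \<sigma> - pt_F2 \<sigma>) = 0"
      using arg_cong[OF u, of Im] arg_cong[OF w, of Im] ix by simp_all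
    then show ?thesis by linarith
  qed
  then have "u = w" using nz by simp
  then show "x = Complex (-r) 0" using u w by simp
qed

lemma BC_R_sq: "(BCpt l - Complex (-r) 0) \<bullet> (BCpt l - Complex (-r) 0) = 1/4 + sqrt 3 * r/2 + r * r + l * r + l * l"
  by (simp add: BCpt_def inner_complex_def field_simps)

text \<open>The equation says that the point of \<open>BC\<close> with coordinate \<open>l\<close> has distance one from \<open>R\<close>; so \<open>sg\<close> is the
  coordinate of \<open>S\<close>.\<close>

definition sg :: real where
  "sg = (SOME l. 8/100 \<le> l \<and> l \<le> p \<and> 1/4 + sqrt 3 * r/2 + r * r + l * r + l * l = 1)"

text \<open>The square of the distance from \<open>R\<close> to \<open>C\<^sub>3\<close> is \<open>1 + (p - r sin \<sigma>)\<^sup>2\<close>, so \<open>S\<close> lies outside the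
  corner region \<open>C\<close>.\<close>

lemma sg: "8/100 \<le> sg" "sg < p" "1/4 + sqrt 3 * r/2 + r * r + sg * r + sg * sg = 1"
proof -
  let ?f = "\<lambda>l. 1/4 + sqrt 3 * r/2 + r * r + l * r + l * l"
  have fp: "1 < ?f p"
  proof -
    have "?f p = (pt_C3 \<sigma> - Complex (-r) 0) \<bullet> (pt_C3 \<sigma> - Complex (-r) 0)" unfolding pt_C3_BC BC_R_sq ..
    also have "\<dots> = 1 + (p - r * sn) * (p - r * sn)"
      unfolding C3_alt by (simp add: inner_complex_def field_simps) (use r(1) cos_sin_sq in algebra)
    also have "1 < \<dots>" using rsn_less_p by (simp add: zero_less_mult_iff)
    finally show ?thesis .
  qed
  have f0: "?f (8/100) \<le> 1" using r by simp
  have "\<forall>l. 8/100 \<le> l \<and> l \<le> p \<longrightarrow> isCont ?f l" by (intro allI impI continuous_intros)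
  then have "\<exists>l. 8/100 \<le> l \<and> l \<le> p \<and> ?f l = 1" using IVT[of ?f "8/100" 1 p] f0 fp p_bounds by auto
  from someI_ex[OF this] have s: "8/100 \<le> sg" "sg \<le> p" "?f sg = 1" unfolding sg_def by blast+
  then show "8/100 \<le> sg" "?f sg = 1" by blast+
  show "sg < p" using s fp by (cases "sg = p") auto
qed

lemma pt_S_eq: "pt_S \<sigma> = BCpt sg"
proof -
  have "arc_meets (pt_R \<sigma>) corner_B corner_C = BCpt sg"
  proof (rule arc_meets_crossing)
    have "sqrt 3 * sg \<le> 17321/10000 * (135/1000)" using sg p_bounds sqrt3_bounds by (intro mult_mono) auto
    moreover have "0 \<le> sqrt 3 * sg" using sg by simp
    ultimately show "BCpt sg \<in> closed_segment corner_B corner_C" unfolding hex_corners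
      by (intro in_closed_segmentI[where u="1/2 + sqrt 3 * sg"])
        (simp_all add: BCpt_def complex_eq_iff field_simps)
    show "dist (pt_R \<sigma>) (BCpt sg) = 1" unfolding dist_eq_1_iff pt_R_eq BC_R_sq by (rule sg(3))
    have "corner_B = BCpt (- sqrt 3/6)" unfolding hex_corners by (simp add: BCpt_def complex_eq_iff field_simps)
    then have "(corner_B - Complex (-r) 0) \<bullet> (corner_B - Complex (-r) 0) = 1/3 + sqrt 3 * r/3 + r * r"
      by (simp only: BC_R_sq) (simp add: field_simps)
    then show "dist (pt_R \<sigma>) corner_B < 1" unfolding dist_less_1_iff pt_R_eq using r by simp
  qed
  then show ?thesis unfolding pt_S_def arc_meets_def by (simp add: closed_segment_commute)
qed

text \<open>Below \<open>FC\<close> the part of corner \<open>F\<close> beyond the cut lies in a cone with apex \<open>R\<close>, and the directions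
  from \<open>R\<close> to the points of \<open>BC\<close> between \<open>S\<close> and \<open>C\<^sub>3\<close> are in the polar cone. These points
  have distance more than one from \<open>R\<close>, hence also from \<open>f\<close>.\<close>

lemma BC_touch_beyond_S:
  assumes K: "placed K" "f \<in> K" "f \<bullet> Complex cs sn \<le> -1/2" "Im f \<le> 0" "BCpt l \<in> K"
  shows "l \<le> sg"
proof (rule ccontr)
  assume "\<not> l \<le> sg"
  then have ls: "sg < l" by simp
  have lp: "l \<le> p" using placed_BC_le_p[OF K(1,5)] .
  define R where "R = Complex (-r) 0"
  have "R \<bullet> Complex cs sn = -1/2" using r(1) by (simp add: R_def inner_complex_def)
  then have 1: "Complex cs sn \<bullet> (f - R) \<le> 0" using K(3) by (simp add: inner_diff_right inner_commute[of "Complex cs sn"])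
  have 2: "Complex 0 1 \<bullet> (f - R) \<le> 0" using K(4) by (simp add: R_def inner_complex_def)
  have neg: "(BCpt l - R) \<bullet> (f - R) \<le> 0"
  proof (rule cone_inner_nonpos[OF _ _ _ 1 2])
    show "0 < det2 (Complex cs sn) (Complex 0 1)" using cos_slant_pos by (simp add: det2_def)
    have e: "BCpt l - R = (pt_C3 \<sigma> - R) + (p - l) *\<^sub>R Complex (-1/2) (sqrt 3/2)"
      unfolding pt_C3_BC by (simp add: BCpt_def complex_eq_iff field_simps)
    have d1: "det2 (Complex cs sn) (pt_C3 \<sigma> - R) = p - r * sn"
      unfolding C3_alt R_def by (simp add: det2_def field_simps) (use cos_sin_sq in algebra)
    have d2: "det2 (Complex cs sn) (Complex (-1/2) (sqrt 3/2)) = (sqrt 3 * cs + sn)/2" by (simp add: det2_def field_simps)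
    have d3: "det2 (Complex cs sn) (BCpt l - R) = det2 (Complex cs sn) (pt_C3 \<sigma> - R) + (p - l) * det2 (Complex cs sn) (Complex (-1/2) (sqrt 3/2))"
      unfolding e by (rule det2_add_scaleR)
    have "0 \<le> (p - l) * ((sqrt 3 * cs + sn)/2)" using lp cos_slant_pos sin_slant_nonneg by simp
    then show "0 \<le> det2 (Complex cs sn) (BCpt l - R)" unfolding d3 d1 d2 using rsn_less_p by linarith
    show "0 \<le> det2 (BCpt l - R) (Complex 0 1)" using ls sg r by (simp add: det2_def R_def BCpt_def)
  qed
  have "1 = 1/4 + sqrt 3 * r/2 + r * r + sg * r + sg * sg" using sg(3) by simp
  also have "\<dots> < 1/4 + sqrt 3 * r/2 + r * r + l * r + l * l"
  proof -
    have "sg * r < l * r" using ls r by (intro mult_strict_right_mono) auto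
    moreover have "sg * sg < l * l" using ls sg by (intro mult_strict_mono) auto
    ultimately show ?thesis by simp
  qed
  also have "\<dots> = (BCpt l - R) \<bullet> (BCpt l - R)" unfolding R_def BC_R_sq ..
  finally have "1 < (BCpt l - R) \<bullet> (BCpt l - R)" .
  moreover have "(BCpt l - f) \<bullet> (BCpt l - f) = (BCpt l - R) \<bullet> (BCpt l - R) - 2 * ((BCpt l - R) \<bullet> (f - R)) + (f - R) \<bullet> (f - R)"
    using inner_diff_self[of "BCpt l - R" "f - R"] by simp
  moreover have "0 \<le> (f - R) \<bullet> (f - R)" by simp
  ultimately have "1 < (BCpt l - f) \<bullet> (BCpt l - f)" using neg by linarith
  then have "\<not> dist f (BCpt l) \<le> 1" unfolding dist_le_1_iff by simp
  then show False using inscribed_diam[OF placedD(1)[OF K(1)] K(2,5)] by simp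
qed

lemma arc_meets_S_EF: "arc_meets (pt_S \<sigma>) corner_E corner_F = EFpt (-sg)"
proof (rule arc_meets_tangent)
  show "EFpt (-sg) \<in> closed_segment corner_E corner_F"
    using sg p_bounds sqrt3_bounds by (intro EFpt_in_segment) simp
  show "dist (pt_S \<sigma>) (EFpt (-sg)) = 1" "(EFpt (-sg) - pt_S \<sigma>) \<bullet> (corner_F - corner_E) = 0"
    unfolding dist_eq_1_iff pt_S_eq hex_corners by (simp_all add: EFpt_def BCpt_def inner_complex_def field_simps)
qed

lemma frame_cut_points:
  "xi (pt_B3 \<sigma>) = 1/4 - sqrt 3 * p/2" "et (pt_B3 \<sigma>) = - sqrt 3/4 - p/2"
  "xi (pt_C3 \<sigma>) = - 1/4 - sqrt 3 * p/2" "et (pt_C3 \<sigma>) = - sqrt 3/4 + p/2"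
  "xi (pt_E2 \<sigma>) = 1/4 - sqrt 3 * q/2" "et (pt_E2 \<sigma>) = sqrt 3/4 + q/2"
  "xi (pt_H \<sigma>) = 1/4 - sqrt 3 * p/2" "et (pt_H \<sigma>) = sqrt 3/4 + p/2"
  "xi (pt_I \<sigma>) - xi (pt_B3 \<sigma>) = - sn" "et (pt_I \<sigma>) - et (pt_B3 \<sigma>) = cs"
proof -
  show "xi (pt_B3 \<sigma>) = 1/4 - sqrt 3 * p/2" "et (pt_B3 \<sigma>) = - sqrt 3/4 - p/2"
    "xi (pt_C3 \<sigma>) = - 1/4 - sqrt 3 * p/2" "et (pt_C3 \<sigma>) = - sqrt 3/4 + p/2"
    "xi (pt_E2 \<sigma>) = 1/4 - sqrt 3 * q/2" "et (pt_E2 \<sigma>) = sqrt 3/4 + q/2"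
    "xi (pt_H \<sigma>) = 1/4 - sqrt 3 * p/2" "et (pt_H \<sigma>) = sqrt 3/4 + p/2"
    unfolding cut_points pt_H_eq xi_def et_def by (simp_all add: inner_complex_def field_simps)
  have "xi (pt_I \<sigma>) - xi (pt_B3 \<sigma>) = Complex ex ey \<bullet> Complex (- sqrt 3/2) (1/2)"
    "et (pt_I \<sigma>) - et (pt_B3 \<sigma>) = Complex ex ey \<bullet> Complex (-1/2) (- sqrt 3/2)"
    unfolding xi_def et_def I_minus_B3[symmetric] by (simp_all only: inner_diff_left)
  then show "xi (pt_I \<sigma>) - xi (pt_B3 \<sigma>) = - sn" "et (pt_I \<sigma>) - et (pt_B3 \<sigma>) = cs"
    by (simp_all add: inner_complex_def ex_def ey_def field_simps)
qed

lemma et_pt_I: assumes "0 < \<sigma>" shows "1/2 < et (pt_I \<sigma>)"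
proof -
  have sp: "0 < sn" using assms sin_slant_pos by simp
  have "sn * sn < sn * (2 * p * cs)" using p_gt sp by simp
  moreover have "0 < sn * (2 * p)" using sp p_bounds by simp
  ultimately have "sn * sn < 2 * p * sn * (1 + cs)" by (simp add: algebra_simps)
  moreover have "sn * sn = (1 - cs) * (1 + cs)" using cos_sin_sq by (simp add: algebra_simps)
  ultimately have "(1 - cs) * (1 + cs) < 2 * p * sn * (1 + cs)" by simp
  then have "1 - cs < 2 * p * sn" using cos_slant_pos by (simp add: mult_less_cancel_right)
  moreover have "2 * et (pt_I \<sigma>) = cs + 2 * p * sn" using frame_cut_points(2,10) integral_eqs(1) by simp
  ultimately show ?thesis by simp
qed

text \<open>These follow from the position of \<open>E\<^sub>2\<close>. For the last one, \<open>E\<^sub>2\<close> exceeds the height \<open>1/2\<close> by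
  half of \<open>q - (1 - sqrt 3/2)\<close>, which is at least a quarter of \<open>q - p\<close>.\<close>

lemma frame_pt_J:
  "xi (pt_J \<sigma>) \<le> xi (pt_B3 \<sigma>)" "xi (pt_C3 \<sigma>) < xi (pt_J \<sigma>)"
  "0 < \<sigma> \<Longrightarrow> 1/2 < et (pt_J \<sigma>)"
proof -
  have n: "norm (Complex (- sqrt 3/2) (1/2)) = 1" "norm (Complex (-1/2) (- sqrt 3/2)) = 1"
    by (simp_all add: cmod_def power2_eq_square)
  note x = pt_J_inner[OF n(1), folded xi_def] and e = pt_J_inner[OF n(2), folded et_def]
  have "1732/1000 * (q - p) \<le> sqrt 3 * (q - p)" "sqrt 3 * (q - p) \<le> 17321/10000 * (q - p)"
    using sqrt3_mult[of "q - p"] p_le_q by auto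
  then have s: "1732/1000 * (q - p) \<le> sqrt 3 * q - sqrt 3 * p" "sqrt 3 * q - sqrt 3 * p \<le> 17321/10000 * (q - p)"
    by (simp_all add: right_diff_distrib)
  define a b where "a = sqrt 3 * q" and "b = sqrt 3 * p"
  define d e where "d = q - p" and "e = a - b"
  have s': "1732/1000 * d \<le> e" "0 \<le> d" "d \<le> 1/10" "a = b + e" "e \<le> 17321/10000 * d"
    using s p_le_q p_bounds q_bounds by (simp_all add: a_def b_def d_def e_def)
  have x1: "5 * xi (pt_J \<sigma>) - 5/4 + 5/2 * a \<le> d" "5/4 - 5/2 * a - 5 * xi (pt_J \<sigma>) \<le> d"
    using x unfolding frame_cut_points(5) a_def d_def by simp_all
  have xb: "xi (pt_B3 \<sigma>) = 1/4 - b/2" "xi (pt_C3 \<sigma>) = - 1/4 - b/2" unfolding frame_cut_points b_def by simp_all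
  show "xi (pt_J \<sigma>) \<le> xi (pt_B3 \<sigma>)" using x1(1) s' unfolding xb by linarith
  show "xi (pt_C3 \<sigma>) < xi (pt_J \<sigma>)" using x1(2) s' unfolding xb by linarith
  show "1/2 < et (pt_J \<sigma>)" if "0 < \<sigma>"
  proof -
    have m: "2 - sqrt 3 \<le> p + q"
    proof (rule ccontr)
      assume "\<not> 2 - sqrt 3 \<le> p + q"
      then have "(p + q + sqrt 3)\<^sup>2 < 2\<^sup>2" using p_bounds p_le_q sqrt3_bounds by (intro power_strict_mono) auto
      then have "(p + q) * (p + q) + 2 * sqrt 3 * (p + q) < 1" by (simp add: power2_eq_square algebra_simps)
      moreover have "4 * p * q \<le> (p + q) * (p + q)" using zero_le_square[of "p - q"] by (simp add: algebra_simps)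
      ultimately show False using p_q by linarith
    qed
    have "5/4 * sqrt 3 + 5/2 * q - 5 * et (pt_J \<sigma>) \<le> q - p" using e(2) unfolding frame_cut_points(6) by simp
    then show ?thesis using m p_less_q[OF that] by linarith
  qed
qed

text \<open>\<open>S\<close> is obtained from \<open>C\<^sub>3\<close> by a translation along \<open>BC\<close>, away from these points.\<close>

lemma outside_S_disc:
  assumes "dist (pt_C3 \<sigma>) x = 1" "(x - pt_C3 \<sigma>) \<bullet> Complex (-1/2) (sqrt 3/2) \<le> 0"
  shows "1 < dist (pt_S \<sigma>) x" "(x - pt_S \<sigma>) \<bullet> Complex (-1/2) (sqrt 3/2) \<le> 0"
proof -
  let ?n = "Complex (-1/2) (sqrt 3/2)"
  have e: "x - pt_S \<sigma> = (x - pt_C3 \<sigma>) - (p - sg) *\<^sub>R ?n"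
    unfolding pt_S_eq pt_C3_BC by (simp add: BCpt_def complex_eq_iff field_simps)
  have nn: "?n \<bullet> ?n = 1" by (simp add: inner_complex_def)
  have "(x - pt_S \<sigma>) \<bullet> ?n = (x - pt_C3 \<sigma>) \<bullet> ?n - (p - sg)" unfolding e inner_diff_left using nn by simp
  then show "(x - pt_S \<sigma>) \<bullet> ?n \<le> 0" using assms(2) sg(2) by simp
  have "(x - pt_S \<sigma>) \<bullet> (x - pt_S \<sigma>) = (x - pt_C3 \<sigma>) \<bullet> (x - pt_C3 \<sigma>)
    - 2 * (p - sg) * ((x - pt_C3 \<sigma>) \<bullet> ?n) + (p - sg) * (p - sg)"
    unfolding e by (rule inner_diff_unit[OF nn])
  moreover have "0 \<le> - (p - sg) * ((x - pt_C3 \<sigma>) \<bullet> ?n)" using assms(2) sg(2) by (intro mult_nonpos_nonpos) auto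
  moreover have "0 < (p - sg) * (p - sg)" using sg(2) by simp
  moreover have "(x - pt_C3 \<sigma>) \<bullet> (x - pt_C3 \<sigma>) = 1" using assms(1) dist_eq_1_iff by blast
  ultimately have "1 < (x - pt_S \<sigma>) \<bullet> (x - pt_S \<sigma>)" by linarith
  then show "1 < dist (pt_S \<sigma>) x" using dist_le_1_iff[of "pt_S \<sigma>" x] by linarith
qed

text \<open>On the circle about \<open>C\<^sub>3\<close>, from \<open>H\<close> to \<open>J\<close>, the height increases from at most \<open>1/2\<close> to more
  than \<open>1/2\<close>. So the point at height \<open>1/2\<close> is on the arc.\<close>

lemma pt_U_facts:
  assumes "0 < \<sigma>"
  shows "dist (pt_C3 \<sigma>) (pt_U \<sigma>) = 1" "et (pt_U \<sigma>) = 1/2" "xi (pt_J \<sigma>) \<le> xi (pt_U \<sigma>)"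
    "(pt_U \<sigma> - pt_C3 \<sigma>) \<bullet> Complex (-1/2) (sqrt 3/2) \<le> 0"
proof -
  let ?C = "pt_C3 \<sigma>"
  define y where "y = 1/2 - et ?C"
  have y: "sqrt 3/2 \<le> y" "y < 1" using p_bounds sqrt3_bounds unfolding y_def frame_cut_points by simp_all
  have yy: "y * y \<le> 1 * 1" using y sqrt3_bounds by (intro mult_mono) auto
  define x where "x = sqrt (1 - y * y)"
  have x: "0 \<le> x" "x * x + y * y = 1" using yy by (simp_all add: x_def)
  define U where "U = (xi ?C + x) *\<^sub>R Complex (- sqrt 3/2) (1/2) + (1/2) *\<^sub>R Complex (-1/2) (- sqrt 3/2)"
  have U: "xi U - xi ?C = x" "et U - et ?C = y" "et U = 1/2" unfolding U_def frame_point by (simp_all add: y_def)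
  have dU: "dist ?C U = 1" unfolding dist_eq_1_iff frame_sq U(1,2) using x by simp
  define jx jy where "jx = xi (pt_J \<sigma>) - xi ?C" and "jy = et (pt_J \<sigma>) - et ?C"
  have j: "0 < jx" "y < jy" using frame_pt_J(2) frame_pt_J(3)[OF assms] by (simp_all add: jx_def jy_def y_def)
  have jj: "jx * jx + jy * jy = 1" using pt_J_facts(2) unfolding dist_eq_1_iff frame_sq jx_def jy_def .
  have h: "xi (pt_H \<sigma>) - xi ?C = 1/2" "et (pt_H \<sigma>) - et ?C = sqrt 3/2" unfolding frame_cut_points by simp_all
  have hh: "1/2 * (1/2) + sqrt 3/2 * (sqrt 3/2) = (1::real)" by simp
  have y0: "0 \<le> y" "0 \<le> jy" "sqrt 3/2 \<le> jy" using y j sqrt3_bounds by auto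
  have jh: "jx \<le> 1/2" using quadrant_mono(1)[OF _ _ _ hh jj y0(3)] j by simp
  have xh: "0 \<le> 1/2 * y - sqrt 3/2 * x" using quadrant_mono(2)[OF _ _ _ hh x(2) y(1)] x by simp
  have xj: "jx \<le> x" "0 \<le> x * jy - y * jx" using quadrant_mono[OF x(1) y0(1) _ x(2) jj] j by simp_all
  have arc: "U \<in> unit_arc ?C (pt_H \<sigma>) (pt_J \<sigma>)"
  proof (rule unit_arcI[OF dU])
    have "sqrt 3 * jx \<le> sqrt 3 * (1/2)" using jh by (intro mult_left_mono) auto
    then have "sqrt 3 * jx < jy" using j y by linarith
    then show "0 < det2 (pt_H \<sigma> - ?C) (pt_J \<sigma> - ?C)"
      unfolding frame_det h jx_def[symmetric] jy_def[symmetric] by simp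
    show "0 \<le> det2 (pt_H \<sigma> - ?C) (U - ?C)" unfolding frame_det h U(1,2) using xh by simp
    show "0 \<le> det2 (U - ?C) (pt_J \<sigma> - ?C)" unfolding frame_det U(1,2) jx_def[symmetric] jy_def[symmetric] using xj by simp
  qed
  have sE: "sgn corner_E = Complex (-1/2) (- sqrt 3/2)"
    unfolding hex_corners by (simp add: sgn_div_norm cmod_def power2_eq_square complex_eq_iff real_sqrt_divide field_simps)
  have "pt_U \<sigma> = U" unfolding pt_U_def sE et_def[symmetric]
  proof (rule the_equality)
    show "U \<in> unit_arc ?C (pt_H \<sigma>) (pt_J \<sigma>) \<and> et U = 1/2" using arc U by simp
    fix z assume z: "z \<in> unit_arc ?C (pt_H \<sigma>) (pt_J \<sigma>) \<and> et z = 1/2"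
    then obtain a b where ab: "dist ?C z = 1" "0 \<le> a" "0 \<le> b" "z - ?C = a *\<^sub>R (pt_H \<sigma> - ?C) + b *\<^sub>R (pt_J \<sigma> - ?C)"
      by (auto simp: unit_arc_def)
    have "0 \<le> xi z - xi ?C" unfolding frame_combination(1)[OF ab(4)] h jx_def[symmetric] using ab j by simp
    moreover have "(xi z - xi ?C) * (xi z - xi ?C) + y * y = 1"
      using ab(1) z unfolding dist_eq_1_iff frame_sq by (simp add: y_def)
    then have "(xi z - xi ?C)\<^sup>2 = x\<^sup>2" using x by (simp add: power2_eq_square)
    ultimately have "xi z - xi ?C = x" using x by (simp add: power2_eq_iff_nonneg)
    then show "z = U" using U z by (intro frame_eqI) auto
  qed
  then show "dist ?C (pt_U \<sigma>) = 1" "et (pt_U \<sigma>) = 1/2" "xi (pt_J \<sigma>) \<le> xi (pt_U \<sigma>)"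
    "(pt_U \<sigma> - ?C) \<bullet> Complex (-1/2) (sqrt 3/2) \<le> 0"
    using dU U xj xh unfolding frame_cis120 jx_def by simp_all
qed

end

section \<open>The second region removed at corner E\<close>

context slant begin

lemma pt_J_I_det: "0 \<le> det2 (pt_J \<sigma> - pt_B3 \<sigma>) (pt_I \<sigma> - pt_B3 \<sigma>)"
  unfolding I_minus_B3 using pt_J_position(1) by (simp add: det2_def inner_complex_def algebra_simps)

text \<open>From \<open>J\<close> to \<open>I\<close> both coordinates decrease along the arc about \<open>B\<^sub>3\<close>, and the height of \<open>I\<close>
  exceeds \<open>1/2\<close>, too.\<close>

lemma T_frame:
  assumes sp: "0 < \<sigma>" and T: "T \<in> unit_arc (pt_B3 \<sigma>) (pt_J \<sigma>) (pt_I \<sigma>)"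
  shows "1/2 < et T" "et T \<le> et (pt_B3 \<sigma>) + 1" "- 9/100 \<le> xi T + 4/100" "xi T \<le> xi (pt_J \<sigma>)" "et T \<le> et (pt_J \<sigma>)"
    "T \<noteq> pt_J \<sigma> \<Longrightarrow> xi T < xi (pt_J \<sigma>)"
proof -
  let ?B = "pt_B3 \<sigma>" and ?J = "pt_J \<sigma>"
  obtain a b where ab: "a \<ge> 0" "b \<ge> 0" "a + b \<ge> 1" "T - ?B = a *\<^sub>R (?J - ?B) + b *\<^sub>R (pt_I \<sigma> - ?B)"
    using unit_arc_coefficients[OF T pt_J_facts(1)] unfolding dist_eq_1_iff I_minus_B3
    using ex_ey_sq by (auto simp: inner_complex_def)
  define jx jy x y where "jx = xi ?J - xi ?B" and "jy = et ?J - et ?B" and "x = xi T - xi ?B" and "y = et T - et ?B"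
  have T1: "dist ?B T = 1" using T by (simp add: unit_arc_def)
  have u: "jx * jx + jy * jy = 1" "x * x + y * y = 1"
    using pt_J_facts(1) T1 unfolding dist_eq_1_iff frame_sq jx_def jy_def x_def y_def by simp_all
  note xy = frame_combination[OF ab(4), unfolded frame_cut_points(9,10), folded jx_def jy_def x_def y_def]
  have B: "et ?B < 0" using p_bounds sqrt3_bounds unfolding frame_cut_points by simp
  have j: "jx \<le> 0" "1/2 - et ?B < jy" using frame_pt_J(1) frame_pt_J(3)[OF sp] by (simp_all add: jx_def jy_def)
  have i: "1/2 - et ?B < cs" using et_pt_I[OF sp] frame_cut_points(10) by simp
  have s0: "0 < sn" using sp sin_slant_pos by simp
  define m where "m = min jy cs"
  have m: "1/2 - et ?B < m" "m \<le> jy" "m \<le> cs" using i j by (auto simp: m_def)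
  have m0: "0 < m" using m(1) B by simp
  have "1 * m \<le> (a + b) * m" using ab m0 by (intro mult_right_mono) auto
  moreover have "a * m \<le> a * jy" "b * m \<le> b * cs" using ab m by (auto intro: mult_left_mono)
  ultimately have "m \<le> y" unfolding xy by (simp add: distrib_right)
  then show e: "1/2 < et T" using m(1) by (simp add: y_def)
  have y0: "0 < y" using \<open>m \<le> y\<close> m0 by simp
  have jy0: "0 < jy" using m m0 by simp
  have "0 \<le> a * (- jx)" "0 \<le> b * sn" using ab j s0 by (simp_all add: mult_nonneg_nonpos)
  then have x0: "x \<le> 0" unfolding xy by simp
  have "y\<^sup>2 \<le> 1\<^sup>2" using u(2) zero_le_square[of x] unfolding power2_eq_square by linarith
  then have y1: "y \<le> 1" using power2_le_imp_le[of y 1] by simp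
  then show "et T \<le> et ?B + 1" by (simp add: y_def)
  have ji: "0 \<le> jx * cs + jy * sn"
    using pt_J_I_det unfolding frame_det frame_cut_points(9,10) by (simp add: jx_def jy_def)
  have "0 \<le> x * cs + y * sn"
  proof -
    have "x * cs + y * sn = a * (jx * cs + jy * sn)" unfolding xy by (simp add: algebra_simps)
    then show ?thesis using ab ji by simp
  qed
  moreover have "y * sn \<le> 1 * (17454/100000)" using y1 y0 s0 sn_le by (intro mult_mono) auto
  moreover have "x * cs \<le> x * (98/100)" using x0 cs_ge by (intro mult_left_mono_neg) auto
  ultimately have "- 18/100 \<le> x" by linarith
  moreover have "sqrt 3 * p \<le> 17321/10000 * (135/1000)" using p_bounds sqrt3_bounds by (intro mult_mono) auto
  ultimately show "- 9/100 \<le> xi T + 4/100" unfolding x_def frame_cut_points by simp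
  have det: "0 \<le> jx * y - jy * x"
  proof -
    have "jx * y - jy * x = b * (jx * cs + jy * sn)" unfolding xy by (simp add: algebra_simps)
    then show ?thesis using ab ji by simp
  qed
  have xj: "x \<le> jx"
  proof (rule ccontr)
    assume "\<not> x \<le> jx"
    then have lt: "jx < x" by simp
    have "(- x) * (- x) \<le> (- jx) * (- jx)" using lt x0 by (intro mult_mono) auto
    then have "jy\<^sup>2 \<le> y\<^sup>2" using u by (simp add: power2_eq_square)
    then have "jy \<le> y" using y0 power2_le_imp_le[of jy y] by simp
    then have "(- x) * jy \<le> (- x) * y" using x0 by (intro mult_left_mono) auto
    moreover have "(- x) * y < (- jx) * y" using lt y0 by (intro mult_strict_right_mono) auto
    ultimately show False using det by (simp add: mult.commute)
  qed
  then show "xi T \<le> xi ?J" by (simp add: x_def jx_def)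
  have "y \<le> jy" by (rule quadrant_mono(1)[of jy "- jx" y "- x"]) (use jy0 y0 j x0 xj u in \<open>auto simp: add.commute\<close>)
  then show "et T \<le> et ?J" by (simp add: y_def jy_def)
  assume ne: "T \<noteq> ?J"
  have "x \<noteq> jx"
  proof
    assume "x = jx"
    then have "y\<^sup>2 = jy\<^sup>2" using u by (simp add: power2_eq_square)
    then have "y = jy" using y0 jy0 by (simp add: power2_eq_iff_nonneg)
    then show False using ne frame_eqI[of T ?J] \<open>x = jx\<close> by (simp add: x_def y_def jx_def jy_def)
  qed
  then show "xi T < xi ?J" using xj by (simp add: x_def jx_def)
qed

text \<open>This is half the tangent of \<open>\<sigma>/2\<close>: the abscissa at which the cutting line of corner \<open>E\<close> for the slant
  \<open>- \<sigma>\<close> meets the one for the slant \<open>0\<close>.\<close>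

abbreviation "half_tan \<equiv> sn / (2 * (1 + cs))"

text \<open>\<open>T\<close> is on the unit circle about \<open>S\<close>, and its height above \<open>S\<close> is at most \<open>1 - sg\<close>, because \<open>T\<close> has
  distance one from \<open>B\<^sub>3\<close>. So its abscissa relative to \<open>S\<close> is at least \<open>sqrt (2 sg - sg\<^sup>2)\<close>, which is
  large enough for the first claim.\<close>

lemma T_position:
  assumes sp: "0 < \<sigma>" and T: "T \<in> unit_arc (pt_B3 \<sigma>) (pt_J \<sigma>) (pt_I \<sigma>)" "dist (pt_S \<sigma>) T = 1"
  shows "half_tan \<le> xi T" "xi (pt_S \<sigma>) < xi T" "xi T < xi (pt_J \<sigma>)"
    "(T - pt_S \<sigma>) \<bullet> Complex (-1/2) (sqrt 3/2) < 0"
proof -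
  let ?S = "pt_S \<sigma>"
  have S: "xi ?S = - 1/4 - sqrt 3 * sg/2" "et ?S = - sqrt 3/4 + sg/2" unfolding pt_S_eq frame_values by simp_all
  define w y where "w = xi T - xi ?S" and "y = et T - et ?S"
  have u: "w * w + y * y = 1" using T(2) unfolding dist_eq_1_iff frame_sq w_def y_def .
  have sg3: "0 \<le> sqrt 3 * sg" "sqrt 3 * sg \<le> 17321/10000 * sg" using sg sqrt3_mult[of sg] by auto
  have w0: "0 < w" using T_frame(3)[OF sp T(1)] sg3 unfolding w_def S by simp
  then show "xi ?S < xi T" by (simp add: w_def)
  have y1: "sqrt 3/2 < y" using T_frame(1)[OF sp T(1)] sg p_bounds unfolding y_def S by simp
  have y2: "y \<le> 1 - sg" using T_frame(2)[OF sp T(1)] sg(2) unfolding y_def S frame_cut_points by simp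
  have yp: "0 < y" using y1 sqrt3_bounds by simp
  have "y * y \<le> (1 - sg) * (1 - sg)" using y2 yp by (intro mult_mono) auto
  then have w2: "2 * sg - sg * sg \<le> w\<^sup>2" using u by (simp add: power2_eq_square algebra_simps)
  define b where "b = 294/1000 + 86605/100000 * sg"
  have ssq: "sg * sg \<le> 135/1000 * sg" using sg p_bounds by (intro mult_right_mono) auto
  have "b\<^sup>2 = 86436/1000000 + 5092374/10000000 * sg + 7500426025/10000000000 * (sg * sg)"
    by (simp add: b_def power2_eq_square field_simps)
  then have "b\<^sup>2 \<le> w\<^sup>2" using w2 ssq sg(1) by linarith
  then have bw: "b \<le> w" using w0 power2_le_imp_le[of b w] by simp
  have ht: "half_tan \<le> 44/1000"
  proof -
    have "sn \<le> 44/1000 * (2 * (1 + cs))" using sn_le cs_ge by simp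
    then show ?thesis using cs_ge by (simp add: pos_divide_le_eq)
  qed
  show "half_tan \<le> xi T" using bw ht sg3 sg unfolding b_def w_def S by linarith
  have dJ: "1 < dist ?S (pt_J \<sigma>)" by (rule outside_S_disc(1)[OF pt_J_facts(2) pt_J_position(2)])
  then show "xi T < xi (pt_J \<sigma>)" using T_frame(6)[OF sp T(1)] T(2) by force
  have wl: "w \<le> 1/2" using quadrant_mono(1)[of "1/2" "sqrt 3/2" w y] w0 y1 u by simp
  have "(T - ?S) \<bullet> Complex (-1/2) (sqrt 3/2) = sqrt 3/2 * w - y/2" unfolding frame_cis120 w_def y_def ..
  moreover have "sqrt 3/2 * w \<le> sqrt 3/2 * (1/2)" using wl by (intro mult_left_mono) auto
  ultimately show "(T - ?S) \<bullet> Complex (-1/2) (sqrt 3/2) < 0" using y1 by linarith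
qed

lemma pt_T_eq:
  assumes sp: "0 < \<sigma>" and T: "T \<in> unit_arc (pt_B3 \<sigma>) (pt_J \<sigma>) (pt_I \<sigma>)" "dist (pt_S \<sigma>) T = 1"
  shows "pt_T \<sigma> = T"
  unfolding pt_T_def
proof (rule the_equality)
  show "T \<in> unit_arc (pt_B3 \<sigma>) (pt_J \<sigma>) (pt_I \<sigma>) \<and> dist (pt_S \<sigma>) T = 1" using T by simp
  fix y assume y: "y \<in> unit_arc (pt_B3 \<sigma>) (pt_J \<sigma>) (pt_I \<sigma>) \<and> dist (pt_S \<sigma>) y = 1"
  have S: "et (pt_S \<sigma>) < 0" using sg p_bounds sqrt3_bounds unfolding pt_S_eq frame_values by simp
  have B: "et (pt_B3 \<sigma>) < 0" using p_bounds sqrt3_bounds unfolding frame_cut_points by simp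
  have ne: "pt_B3 \<sigma> \<noteq> pt_S \<sigma>"
    using sg p_bounds sqrt3_bounds unfolding pt_S_eq cut_points by (simp add: BCpt_def complex_eq_iff)
  have "y = T \<or> y = pt_B3 \<sigma> + pt_S \<sigma> - T"
    by (rule unit_circles_meet[OF ne]) (use T y in \<open>auto simp: unit_arc_def\<close>)
  moreover have "y \<noteq> pt_B3 \<sigma> + pt_S \<sigma> - T"
  proof
    assume "y = pt_B3 \<sigma> + pt_S \<sigma> - T"
    then have "et y = et (pt_B3 \<sigma>) + et (pt_S \<sigma>) - et T" by (simp add: et_def inner_add_left inner_diff_left)
    then show False using T_frame(1)[OF sp T(1)] T_frame(1)[OF sp, of y] y S B by simp
  qed
  ultimately show "y = T" by simp
qed

text \<open>The curve is the boundary of the hull on the side of \<open>J\<close> of the line \<open>TU\<close>; on this side it stays above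
  the height \<open>1/2\<close> of \<open>U\<close>, and it avoids the open disc about \<open>S\<close>.\<close>

lemma curve_TU_facts:
  assumes sp: "0 < \<sigma>" and T: "T \<in> unit_arc (pt_B3 \<sigma>) (pt_J \<sigma>) (pt_I \<sigma>)" "dist (pt_S \<sigma>) T = 1"
    and x: "x \<in> curve_TU \<sigma>"
  shows "1/2 \<le> et x" "half_tan \<le> xi x" "(x - pt_S \<sigma>) \<bullet> Complex (-1/2) (sqrt 3/2) \<le> 0" "1 \<le> dist (pt_S \<sigma>) x"
proof -
  let ?S = "pt_S \<sigma>" and ?U = "pt_U \<sigma>" and ?J = "pt_J \<sigma>" and ?n = "Complex (-1/2) (sqrt 3/2)"
  let ?e = "Complex (-1/2) (- sqrt 3/2)"
  define V where "V = EFpt (-sg)"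
  let ?A = "unit_arc ?S T V"
  let ?H = "convex hull (insert ?U ?A)"
  note U = pt_U_facts[OF sp] and Tf = T_frame[OF sp T(1)] and Tp = T_position[OF sp T]
  have S: "xi ?S = - 1/4 - sqrt 3 * sg/2" "et ?S = - sqrt 3/4 + sg/2" unfolding pt_S_eq frame_values by simp_all
  have V: "xi V - xi ?S = 1/2" "et V - et ?S = sqrt 3/2" "et V < 1/2"
    using sg p_bounds sqrt3_bounds unfolding V_def pt_S_eq frame_values by simp_all
  have dV: "dist ?S V = 1" unfolding dist_eq_1_iff frame_sq V(1,2) by simp
  have dU: "1 < dist ?S ?U" "(?U - ?S) \<bullet> ?n \<le> 0" using outside_S_disc[OF U(1,4)] by simp_all
  have eS: "et ?S < 1/2" using sg p_bounds sqrt3_bounds unfolding S by simp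
  have rr: "xi T < xi ?U" using Tp(3) U(3) by simp
  have lJ: "0 < det2 (?U - T) (?J - T)"
  proof -
    have "0 \<le> (xi ?U - xi T) * (et ?J - et T)" using rr Tf(5) by simp
    moreover have "(et ?U - et T) * (xi ?J - xi T) < 0" using U(2) Tf(1) Tp(3) by (intro mult_neg_pos) auto
    ultimately show ?thesis unfolding frame_det by simp
  qed
  have lS: "det2 (?U - T) (?S - T) < 0"
  proof -
    have "(xi ?U - xi T) * (et ?S - et T) < 0" using rr Tf(1) eS by (intro mult_pos_neg) auto
    moreover have "0 < (et ?U - et T) * (xi ?S - xi T)" using U(2) Tf(1) Tp(2) by (intro mult_neg_neg) auto
    ultimately show ?thesis unfolding frame_det by simp
  qed
  have lV: "det2 (?U - T) (V - T) < 0"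
    by (rule beyond_exit[OF _ dU(1) _ _ _ lS, of ?e "1/2"])
      (use T(2) U(2) Tf(1) eS dV V(3) in \<open>auto simp: et_def\<close>)
  have x1: "x \<in> frontier ?H" "0 \<le> det2 (?U - T) (x - T)"
  proof -
    show "x \<in> frontier ?H" using x unfolding curve_TU_def pt_T_eq[OF sp T] arc_meets_S_EF V_def by simp
    have "x \<in> same_side T ?U ?J" using x unfolding curve_TU_def pt_T_eq[OF sp T] by simp
    then have "0 \<le> det2 (?U - T) (x - T) * det2 (?U - T) (?J - T)" unfolding same_side_def Im_cnj_det2 by simp
    then show "0 \<le> det2 (?U - T) (x - T)" using lJ by (simp add: zero_le_mult_iff)
  qed
  have VT: "0 < det2 (V - ?S) (T - ?S)" "0 \<le> det2 (V - ?S) (?U - ?S)"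
    using Tp(4) dU(2) unfolding frame_det V frame_cis120 by (simp_all add: field_simps)
  have UT: "0 \<le> det2 (?U - ?S) (T - ?S)"
  proof -
    have "(et ?U - et ?S) * (xi T - xi ?S) \<le> (et T - et ?S) * (xi ?U - xi ?S)"
      using U(2) Tf(1) Tp(2) rr eS by (intro mult_mono) auto
    then show ?thesis unfolding frame_det by (simp add: mult.commute)
  qed
  note hull = hull_frontier_outside_disc[OF T(2) dV VT(1) VT(2) UT dU(1) lV x1]
  show "1 \<le> dist ?S x" by (rule hull(2))
  have AS: "?A \<subseteq> cball ?S 1" by (auto simp: unit_arc_def)
  have "\<exists>a\<ge>0. \<exists>b\<ge>0. T - ?S = a *\<^sub>R (T - ?S) + b *\<^sub>R (V - ?S)"
    by (rule exI[of _ 1], rule conjI, simp, rule exI[of _ 0], simp)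
  then have "T \<in> ?A" unfolding unit_arc_def using T(2) by simp
  then have A0: "?A \<noteq> {}" by blast
  show "1/2 \<le> et x" unfolding et_def
    by (rule hull_far_side[OF _ dU(1) _ _ _ lS AS A0 hull(1) x1(2)]) (use T(2) U(2) Tf(1) eS in \<open>auto simp: et_def\<close>)
  have hp: "t \<le> x \<bullet> n" if "t \<le> ?U \<bullet> n" "t \<le> T \<bullet> n" "t \<le> V \<bullet> n" "?S \<bullet> n \<le> t" for t n
  proof (rule convex_hull_halfplane[OF _ hull(1)])
    fix y assume "y \<in> insert ?U ?A"
    then consider "y = ?U" | "y \<in> ?A" by blast
    then show "t \<le> y \<bullet> n"
    proof cases
      case 2 show ?thesis by (rule unit_arc_halfplane[OF 2 T(2) dV that(2,3,4)])
    qed (use that in simp)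
  qed
  have "xi T - xi ?S \<le> 1/2"
  proof -
    have "(xi T - xi ?S) * (xi T - xi ?S) + (et T - et ?S) * (et T - et ?S) = 1"
      using T(2) unfolding dist_eq_1_iff frame_sq .
    moreover have "sqrt 3/2 \<le> et T - et ?S" using Tf(1) V(2,3) by simp
    ultimately show ?thesis using quadrant_mono(1)[of "1/2" "sqrt 3/2" "xi T - xi ?S" "et T - et ?S"] Tp(2) by simp
  qed
  then have "xi T \<le> xi x" unfolding xi_def using hp[of "xi T" "Complex (- sqrt 3/2) (1/2)"] rr Tp(2) V(1)
    by (simp add: xi_def)
  then show "half_tan \<le> xi x" using Tp(1) by simp
  have "(V - ?S) \<bullet> ?n = 0" unfolding frame_cis120 V by simp
  then have "?U \<bullet> ?n \<le> ?S \<bullet> ?n" "T \<bullet> ?n \<le> ?S \<bullet> ?n" "V \<bullet> ?n \<le> ?S \<bullet> ?n"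
    using dU(2) Tp(4) by (simp_all add: inner_diff_left)
  then have "?S \<bullet> (- ?n) \<le> x \<bullet> (- ?n)" by (intro hp) (simp_all only: inner_minus_right neg_le_iff_le order_refl)
  then show "(x - ?S) \<bullet> ?n \<le> 0" by (simp only: inner_minus_right inner_diff_left)
qed

text \<open>At slant zero \<open>J\<close> and \<open>I\<close> both coincide with \<open>E\<^sub>2\<close>, so that the arc is a single point, whose
  distance from \<open>S\<close> is more than one.\<close>

lemma E_H_empty_if_upright:
  assumes "\<sigma> = 0" shows "sphere (pt_S \<sigma>) 1 \<inter> unit_arc (pt_B3 \<sigma>) (pt_J \<sigma>) (pt_I \<sigma>) = {}"
proof -
  have "p = q" unfolding p_def q_def using assms by simp
  then have "pt_J \<sigma> = pt_E2 \<sigma>" using pt_J_facts(3) by simp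
  moreover have "pt_I \<sigma> = pt_E2 \<sigma>" unfolding pt_I_eq cut_points E2_alt using \<open>p = q\<close> by simp
  ultimately have IJ: "pt_I \<sigma> = pt_J \<sigma>" by simp
  have dJ: "1 < dist (pt_S \<sigma>) (pt_J \<sigma>)" by (rule outside_S_disc(1)[OF pt_J_facts(2) pt_J_position(2)])
  have "x = pt_J \<sigma>" if x: "x \<in> unit_arc (pt_B3 \<sigma>) (pt_J \<sigma>) (pt_I \<sigma>)" for x
  proof -
    obtain a b where ab: "dist (pt_B3 \<sigma>) x = 1" "0 \<le> a" "0 \<le> b" "x - pt_B3 \<sigma> = a *\<^sub>R (pt_J \<sigma> - pt_B3 \<sigma>) + b *\<^sub>R (pt_J \<sigma> - pt_B3 \<sigma>)"
      using x unfolding IJ by (auto simp: unit_arc_def)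
    then have e: "x - pt_B3 \<sigma> = (a + b) *\<^sub>R (pt_J \<sigma> - pt_B3 \<sigma>)" by (simp add: scaleR_left_distrib)
    then have "a + b = 1" using ab pt_J_facts(1) arg_cong[OF e, of norm] by (simp add: dist_norm norm_minus_commute)
    then show ?thesis using e by simp
  qed
  then show ?thesis using dJ by fastforce
qed

lemma below_E_side: "x \<bullet> cis (-(2*pi/3)) = et x" "x \<bullet> cis (-(2*pi/3) - \<sigma>) = cs * et x + sn * xi x"
proof -
  show "x \<bullet> cis (-(2*pi/3)) = et x" unfolding cis_60s et_def ..
  have "cis (-(2*pi/3) - \<sigma>) = cis (-(2*pi/3)) * cis (-\<sigma>)" by (simp add: cis_mult)
  then show "x \<bullet> cis (-(2*pi/3) - \<sigma>) = cs * et x + sn * xi x"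
    unfolding cis_60s by (simp add: xi_def et_def inner_complex_def algebra_simps)
qed

text \<open>The curve \<open>TU\<close> is far from a touching point of \<open>BC\<close> between \<open>B\<close> and \<open>S\<close>, and it lies in both the
  corner regions \<open>E\<close> for the slants \<open>0\<close> and \<open>- \<sigma>\<close>. The two arcs are parts of the arcs that bound
  \<open>E\<^sub>S\<close>.\<close>

lemma disjoint_E_H:
  assumes K: "placed K"
    and far: "(\<exists>l. BCpt l \<in> K \<and> l \<le> sg) \<or> below K (-(2*pi/3)) \<or> below K (-(2*pi/3) - \<sigma>)"
  shows "interior K \<inter> region_E_H \<sigma> = {}"
proof (cases "sphere (pt_S \<sigma>) 1 \<inter> unit_arc (pt_B3 \<sigma>) (pt_J \<sigma>) (pt_I \<sigma>) = {}")
  case True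
  then show ?thesis by (simp add: region_E_H_def)
next
  case False
  then obtain T where T: "T \<in> unit_arc (pt_B3 \<sigma>) (pt_J \<sigma>) (pt_I \<sigma>)" "dist (pt_S \<sigma>) T = 1" by auto
  have "\<sigma> \<noteq> 0" using False E_H_empty_if_upright by blast
  then have sp: "0 < \<sigma>" using slant_nonneg by simp
  note U = pt_U_facts[OF sp] and Tf = T_frame[OF sp T(1)] and ins = placedD(1)[OF K]
  let ?e = "Complex (-1/2) (- sqrt 3/2)"
  let ?\<Gamma> = "curve_TU \<sigma> \<union> unit_arc (pt_C3 \<sigma>) (pt_U \<sigma>) (pt_J \<sigma>) \<union> unit_arc (pt_B3 \<sigma>) (pt_J \<sigma>) T"
  obtain l where l: "BCpt l \<in> K" using inscribed_touches[OF ins] by blast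
  have lp: "l \<le> p" using placed_BC_le_p[OF K l] .
  have "interior K \<inter> bounded_region ?\<Gamma> = {}"
  proof -
    have "BCpt l \<bullet> ?e < 0" using lp p_bounds sqrt3_bounds frame_values(2)[of l] by (simp add: et_def)
    then obtain v where v: "v \<in> interior K" "v \<bullet> ?e < 0"
      using constant_width_interior_point[OF placedD(2)[OF K] l] by blast
    have curve: "x \<notin> interior K" if x: "x \<in> curve_TU \<sigma>" for x
    proof
      assume xi: "x \<in> interior K"
      note c = curve_TU_facts[OF sp T x]
      from far show False
      proof (elim disjE exE conjE)
        fix m assume m: "BCpt m \<in> K" "m \<le> sg"
        have "BCpt m - pt_S \<sigma> = (sg - m) *\<^sub>R Complex (-1/2) (sqrt 3/2)"
          unfolding pt_S_eq by (simp add: BCpt_def complex_eq_iff field_simps)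
        then have "(x - pt_S \<sigma>) \<bullet> (BCpt m - pt_S \<sigma>) \<le> 0" using c(3) m(2) by (simp add: mult_nonneg_nonpos)
        then have "1 \<le> dist (BCpt m) x" by (rule dist_ge_1_if_obtuse[OF c(4)])
        then show False using interior_not_far[OF K xi m(1)] by simp
      next
        assume "below K (-(2*pi/3))"
        from interior_below_less[OF this xi] show False using c(1) unfolding below_E_side by simp
      next
        assume "below K (-(2*pi/3) - \<sigma>)"
        from interior_below_less[OF this xi] have lt: "cs * et x + sn * xi x < 1/2" unfolding below_E_side .
        have hc: "cs * (1/2) \<le> cs * et x" using c(1) cos_slant_pos by (intro mult_left_mono) auto
        have ht: "sn * half_tan = (1 - cs)/2"
        proof -
          have "sn * sn = (1 - cs) * (1 + cs)" using cos_sin_sq by (simp add: algebra_simps)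
          moreover have "half_tan * (2 * (1 + cs)) = sn" using cos_slant_pos by simp
          ultimately have "(sn * half_tan * 2) * (1 + cs) = (1 - cs) * (1 + cs)" by algebra
          then have "sn * half_tan * 2 = 1 - cs" using cos_slant_pos by (simp only: mult_cancel_right) simp
          then show ?thesis by simp
        qed
        have "1 - cs \<le> 2 * (sn * xi x)"
          using mult_left_mono[OF c(2) sin_slant_nonneg] unfolding ht by simp
        then show False using lt hc by linarith
      qed
    qed
    have bC: "(x - pt_C3 \<sigma>) \<bullet> (BCpt l - pt_C3 \<sigma>) \<le> 0" if "(x - pt_C3 \<sigma>) \<bullet> Complex (-1/2) (sqrt 3/2) \<le> 0" for x
    proof -
      have "BCpt l - pt_C3 \<sigma> = (p - l) *\<^sub>R Complex (-1/2) (sqrt 3/2)"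
        unfolding pt_C3_BC by (simp add: BCpt_def complex_eq_iff field_simps)
      then show ?thesis using that lp by (simp add: mult_nonneg_nonpos)
    qed
    have arcC: "interior K \<inter> unit_arc (pt_C3 \<sigma>) (pt_U \<sigma>) (pt_J \<sigma>) = {}"
      by (rule interior_disjoint_unit_arc[OF ins l]) (rule bC[OF U(4)], rule bC[OF pt_J_position(2)])
    obtain f where f: "f \<in> K" "f \<bullet> Complex ex ey \<le> -1/2" "inHex f" using placed_reaches_B[OF K] .
    note fJ = J_arc_polar[OF f(2,3)]
    have fT: "(T - pt_B3 \<sigma>) \<bullet> (f - pt_B3 \<sigma>) \<le> 0"
    proof -
      obtain a b where ab: "0 \<le> a" "0 \<le> b" "T - pt_B3 \<sigma> = a *\<^sub>R (pt_J \<sigma> - pt_B3 \<sigma>) + b *\<^sub>R (pt_I \<sigma> - pt_B3 \<sigma>)"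
        using T(1) by (auto simp: unit_arc_def)
      have "a * ((pt_J \<sigma> - pt_B3 \<sigma>) \<bullet> (f - pt_B3 \<sigma>)) \<le> 0" "b * ((pt_I \<sigma> - pt_B3 \<sigma>) \<bullet> (f - pt_B3 \<sigma>)) \<le> 0"
        using ab fJ by (auto intro: mult_nonneg_nonpos)
      then show ?thesis unfolding ab(3) inner_add_left by simp
    qed
    have arcB: "interior K \<inter> unit_arc (pt_B3 \<sigma>) (pt_J \<sigma>) T = {}"
      by (rule interior_disjoint_unit_arc[OF ins f(1) fJ(2) fT])
    show ?thesis
    proof (rule convex_disjoint_bounded_region[OF _ _ _ v])
      show "convex (interior K)" using placedD(2)[OF K] by (simp add: constant_width_def)
      show "interior K \<inter> ?\<Gamma> = {}" using curve arcC arcB by blast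
      have h: "pt_U \<sigma> \<bullet> ?e \<ge> 0" "pt_J \<sigma> \<bullet> ?e \<ge> 0" "T \<bullet> ?e \<ge> 0"
        using U(2) frame_pt_J(3)[OF sp] Tf(1) by (simp_all add: et_def)
      have c: "pt_C3 \<sigma> \<bullet> ?e \<le> 0" "pt_B3 \<sigma> \<bullet> ?e \<le> 0"
        using frame_cut_points(2,4) p_bounds sqrt3_bounds by (simp_all add: et_def)
      have dT: "dist (pt_B3 \<sigma>) T = 1" using T(1) by (simp add: unit_arc_def)
      show "x \<bullet> ?e \<ge> 0" if "x \<in> ?\<Gamma>" for x
      proof -
        from that consider "x \<in> curve_TU \<sigma>" | "x \<in> unit_arc (pt_C3 \<sigma>) (pt_U \<sigma>) (pt_J \<sigma>)"
          | "x \<in> unit_arc (pt_B3 \<sigma>) (pt_J \<sigma>) T" by blast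
        then show ?thesis
        proof cases
          case 1 show ?thesis using curve_TU_facts(1)[OF sp T 1] by (simp add: et_def)
        next
          case 2 show ?thesis by (rule unit_arc_halfplane[OF 2 U(1) pt_J_facts(2) h(1,2) c(1)])
        next
          case 3 show ?thesis by (rule unit_arc_halfplane[OF 3 pt_J_facts(1) dT h(2,3) c(2)])
        qed
      qed
    qed (simp add: complex_eq_iff)
  qed
  then show ?thesis using False unfolding region_E_H_def pt_T_eq[OF sp T] by simp
qed

end

section \<open>Choosing the position\<close>

lemma below_shift: "below K \<phi> \<Longrightarrow> \<phi> = \<psi> + of_int k * (2 * pi) \<Longrightarrow> below K \<psi>"
  using below_cong[OF cis_add_multiple] by blast

context slant begin

definition fits :: "complex set \<Rightarrow> bool" where
  "fits K \<longleftrightarrow> (\<exists>f. (\<forall>x y. dist (f x) (f y) = dist x y) \<and> f ` K \<subseteq> shape_H \<sigma>)"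

lemma fits_image:
  assumes "\<And>x y. dist (h x) (h y) = dist x y" "fits (h ` K)" shows "fits K"
proof -
  obtain f where "\<forall>x y. dist (f x) (f y) = dist x y" "f ` h ` K \<subseteq> shape_H \<sigma>" using assms(2) by (auto simp: fits_def)
  then have "(\<forall>x y. dist ((f \<circ> h) x) ((f \<circ> h) y) = dist x y) \<and> (f \<circ> h) ` K \<subseteq> shape_H \<sigma>"
    using assms(1) by (simp add: image_comp)
  then show ?thesis unfolding fits_def by blast
qed

lemma fits_rotation: "fits ((\<lambda>z. cis \<alpha> * z + d) ` K) \<Longrightarrow> fits K"
  by (rule fits_image) (simp_all add: dist_norm norm_mult flip: right_diff_distrib)

lemma fits_reflection: "fits ((\<lambda>z. cis \<alpha> * cnj z) ` K) \<Longrightarrow> fits K"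
proof (rule fits_image)
  fix x y
  have "cis \<alpha> * cnj x - cis \<alpha> * cnj y = cis \<alpha> * cnj (x - y)" by (simp add: right_diff_distrib)
  then show "dist (cis \<alpha> * cnj x) (cis \<alpha> * cnj y) = dist x y"
    unfolding dist_norm by (simp only: norm_mult complex_mod_cnj norm_cis mult_1_left)
qed

lemma cut_normals: "cut_normal \<sigma> 2 = cis \<sigma>" "cut_normal \<sigma> 4 = cis (\<sigma> - 2*pi/3)"
proof -
  have "sgn (hex_corner k) = cis (2*pi/3 - of_int k * (pi/3))" for k
    unfolding hex_corner_def by (simp add: sgn_scaleR sgn_div_norm)
  then have e: "cut_normal \<sigma> k = cis (\<sigma> + (2*pi/3 - of_int k * (pi/3)))" for k
    unfolding cut_normal_def by (simp add: cis_mult)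
  show "cut_normal \<sigma> 2 = cis \<sigma>" "cut_normal \<sigma> 4 = cis (\<sigma> - 2*pi/3)"
    unfolding e by (rule arg_cong[of _ _ cis], simp)+
qed

lemma fits_if_disjoint:
  assumes K: "placed K" "interior K \<inter> region_A_H \<sigma> = {}" "interior K \<inter> region_E_H \<sigma> = {}"
  shows "fits K"
proof -
  have Pal: "K \<subseteq> slanted_Pal \<sigma>"
    using K(1) inHex_subset_Hex placedD(3)[OF K(1)] by (auto simp: slanted_Pal_def cut_normals placed_def below_def)
  then have "interior K \<subseteq> slanted_Pal \<sigma> - (region_C_S \<sigma> \<union> region_E_S \<sigma> \<union> region_A_S \<sigma>)"
    using interior_subset[of K] placed_disjoint_C_S[OF K(1)] placed_disjoint_E_S[OF K(1)] placed_disjoint_A_S[OF K(1)] by blast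
  then have "interior K \<subseteq> shape_S \<sigma>" unfolding shape_S_def using closure_subset by blast
  then have "interior K \<subseteq> shape_S \<sigma> - (region_A_H \<sigma> \<union> region_E_H \<sigma>)" using K(2,3) by blast
  then have "closure (interior K) \<subseteq> shape_H \<sigma>" unfolding shape_H_def by (rule closure_mono)
  then have "K \<subseteq> shape_H \<sigma>" using constant_width_closure_interior(2)[OF placedD(2)[OF K(1)]] by simp
  then show ?thesis unfolding fits_def by (intro exI[of _ id]) simp
qed

lemma placed_reflection:
  assumes "inscribed K" "below K (of_int m * (pi/3) - \<sigma>)" "below K (of_int m * (pi/3) - (\<sigma> - 2*pi/3))"
  shows "placed ((\<lambda>z. cis (of_int m * (pi/3)) * cnj z) ` K)"
  unfolding placed_def below_reflection using assms inscribed_reflection by blast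

text \<open>\<open>K\<close> reaches beyond the cut of corner \<open>F\<close> below the line \<open>FC\<close>.\<close>

definition low_F :: "complex set \<Rightarrow> bool" where
  "low_F K \<longleftrightarrow> (\<exists>f\<in>K. f \<bullet> Complex cs sn \<le> -1/2 \<and> Im f \<le> 0)"

lemma disjoint_E_H_if_low_F:
  assumes "placed K" "low_F K" shows "interior K \<inter> region_E_H \<sigma> = {}"
proof -
  obtain f where f: "f \<in> K" "f \<bullet> Complex cs sn \<le> -1/2" "Im f \<le> 0" using assms(2) by (auto simp: low_F_def)
  obtain l where "BCpt l \<in> K" using inscribed_touches[OF placedD(1)[OF assms(1)]] by blast
  then show ?thesis using disjoint_E_H[OF assms(1)] BC_touch_beyond_S[OF assms(1) f] by blast
qed

text \<open>The line with normal \<open>cis (pi - \<sigma>)\<close> at corner \<open>F\<close> is the mirror image in \<open>FC\<close> of the line \<open>F\<^sub>2F\<^sub>3\<close>.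
  The points beyond \<open>F\<^sub>2F\<^sub>3\<close> that are above \<open>FC\<close> are beyond this line as well.\<close>

lemma low_F_if_below_mirror_F:
  assumes K: "placed K" "below K (pi - \<sigma>)" "0 < \<sigma>" shows "low_F K"
proof -
  obtain f where f: "f \<in> K" "f \<bullet> Complex cs sn \<le> -1/2" "inHex f" using placed_reaches_F[OF K(1)] .
  have "f \<bullet> cis (pi - \<sigma>) \<le> 1/2" using K(2) f(1) by (simp add: below_def)
  then have "- Re f * cs + Im f * sn \<le> 1/2" by (simp add: inner_complex_def)
  moreover have "Re f * cs + Im f * sn \<le> -1/2" using f(2) by (simp add: inner_complex_def)
  ultimately have "Im f * sn \<le> 0" by simp
  then have "Im f \<le> 0" using sin_slant_pos[OF K(3)] by (simp add: mult_le_0_iff)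
  then show ?thesis using f by (auto simp: low_F_def)
qed

lemma below_mirror_C_if_not_low_F:
  assumes K: "placed K" "\<not> low_F K" shows "below K (-\<sigma>)"
proof (cases "\<sigma> = 0")
  case True
  have "below K \<sigma>" using K(1) by (simp add: placed_def)
  then show ?thesis using True by simp
next
  case False
  then have "\<not> below K (pi - \<sigma>)" using low_F_if_below_mirror_F[OF K(1)] K(2) slant_nonneg by auto
  then show ?thesis using constant_width_below_or_opposite[OF placedD(2)[OF K(1)], of "-\<sigma>"] by simp
qed

text \<open>\<open>E\<^sub>H\<close> is avoided anyway. If neither of the two criteria for \<open>A\<^sub>H\<close> applies, \<open>K\<close> avoids the opposite
  corner regions, which places its reflection in the vertical axis; and this reflection reaches beyond the
  cut of corner \<open>F\<close> below \<open>FC\<close> as well, unless the slant is zero and \<open>E\<^sub>H\<close> is empty.\<close>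

lemma fits_if_low_F:
  assumes K: "placed K" "low_F K" shows "fits K"
proof -
  note cw = placedD(2)[OF K(1)] and E = disjoint_E_H_if_low_F[OF K]
  consider "below K (-\<sigma>)" | "below K (2*pi/3 - \<sigma>)" | "below K (-\<sigma> + pi)" "below K (2*pi/3 - \<sigma> + pi)"
    using constant_width_below_or_opposite[OF cw] by blast
  then show ?thesis
  proof cases
    case 1 show ?thesis by (rule fits_if_disjoint[OF K(1) disjoint_A_H_if_below_C[OF K(1) 1] E])
  next
    case 2 show ?thesis by (rule fits_if_disjoint[OF K(1) disjoint_A_H_if_below_A[OF K(1) 2] E])
  next
    case 3
    let ?K' = "(\<lambda>z. - cnj z) ` K"
    have e: "(\<lambda>z. cis (of_int 3 * (pi/3)) * cnj z) = (\<lambda>z. - cnj z)" by (simp add: fun_eq_iff)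
    have "below K (of_int 3 * (pi/3) - \<sigma>)" using 3(1) by (simp add: add.commute)
    moreover have "below K (of_int 3 * (pi/3) - (\<sigma> - 2*pi/3))" by (rule below_shift[OF 3(2), of _ 0]) simp
    ultimately have K': "placed ?K'" using placed_reflection[OF placedD(1)[OF K(1)], of 3] unfolding e by blast
    have E': "interior ?K' \<inter> region_E_H \<sigma> = {}"
    proof (cases "\<sigma> = 0")
      case True
      then show ?thesis using E_H_empty_if_upright by (simp add: region_E_H_def)
    next
      case False
      have "below ?K' (pi - \<sigma>)"
        unfolding e[symmetric] below_reflection using K(1) by (simp add: placed_def)
      then show ?thesis using disjoint_E_H_if_low_F[OF K'] low_F_if_below_mirror_F[OF K'] False slant_nonneg by simp
    qed
    from disjoint_A_H_or_mirror[OF K(1) K'] show ?thesis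
    proof
      assume "interior K \<inter> region_A_H \<sigma> = {}"
      then show ?thesis by (rule fits_if_disjoint[OF K(1) _ E])
    next
      assume "interior ?K' \<inter> region_A_H \<sigma> = {}"
      then have "fits ?K'" by (rule fits_if_disjoint[OF K' _ E'])
      then show ?thesis using fits_reflection unfolding e[symmetric] by blast
    qed
  qed
qed

text \<open>If \<open>K\<close> does not reach beyond the cut of corner \<open>F\<close> below \<open>FC\<close>, the criterion at \<open>C\<close> applies to \<open>A\<^sub>H\<close>.\<close>

lemma fits_if_below_E:
  assumes K: "placed K" and E: "below K (-(2*pi/3)) \<or> below K (-(2*pi/3) - \<sigma>)" shows "fits K"
proof (cases "low_F K")
  case False
  show ?thesis
    by (rule fits_if_disjoint[OF K disjoint_A_H_if_below_C[OF K below_mirror_C_if_not_low_F[OF K False]]])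
      (use disjoint_E_H[OF K] E in blast)
qed (rule fits_if_low_F[OF K])

text \<open>In the remaining case \<open>K\<close> reaches corner \<open>F\<close> only above \<open>FC\<close> and avoids the two corner regions
  opposite to \<open>E\<close>, for the slants \<open>0\<close> and \<open>- \<sigma>\<close>. Depending on which of the corner regions \<open>A\<close> and \<open>D\<close> for the slant \<open>- \<sigma>\<close>
  it avoids, the reflection in \<open>FC\<close>, which lets it reach below \<open>FC\<close>, or the one that interchanges
  \<open>B\<close> and \<open>E\<close> yields a placed set that has been treated.\<close>

lemma placed_fits:
  assumes K: "placed K" shows "fits K"
proof (rule ccontr)
  assume no: "\<not> fits K"
  note cw = placedD(2)[OF K] and ins = placedD(1)[OF K]
  have nl: "\<not> low_F K" using fits_if_low_F[OF K] no by blast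
  have "below K (-(2*pi/3) + pi)" "below K (-(2*pi/3) - \<sigma> + pi)"
    using constant_width_below_or_opposite[OF cw] fits_if_below_E[OF K] no by blast+
  moreover have "-(2*pi/3) + pi = pi/3" "-(2*pi/3) - \<sigma> + pi = pi/3 - \<sigma>" by simp_all
  ultimately have E: "below K (pi/3)" "below K (pi/3 - \<sigma>)" by simp_all
  consider "below K (2*pi/3 - \<sigma>)" | "below K (2*pi/3 - \<sigma> + pi)"
    using constant_width_below_or_opposite[OF cw] by blast
  then show False
  proof cases
    case 1
    let ?K1 = "(\<lambda>z. cis (of_int 0 * (pi/3)) * cnj z) ` K"
    have "below K (of_int 0 * (pi/3) - \<sigma>)" using below_mirror_C_if_not_low_F[OF K nl] by simp
    moreover have "below K (of_int 0 * (pi/3) - (\<sigma> - 2*pi/3))" using 1 by simp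
    ultimately have K1: "placed ?K1" by (rule placed_reflection[OF ins])
    obtain f where f: "f \<in> ?K1" "f \<bullet> Complex cs sn \<le> -1/2" "inHex f" using placed_reaches_F[OF K1] .
    have "low_F ?K1"
    proof (rule ccontr)
      assume "\<not> low_F ?K1"
      then have im: "0 < Im f" using f by (auto simp: low_F_def)
      have "cnj f \<in> K" using f(1) by auto
      moreover have "cnj f \<bullet> Complex cs sn \<le> f \<bullet> Complex cs sn" using mult_nonneg_nonneg[of "Im f" sn] im sin_slant_nonneg by (simp add: inner_complex_def)
      ultimately have "low_F K" unfolding low_F_def using f(2) im by (intro bexI[of _ "cnj f"]) auto
      then show False using nl by simp
    qed
    then have "fits ?K1" by (rule fits_if_low_F[OF K1])
    then show False using fits_reflection no by blast
  next
    case 2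
    let ?K2 = "(\<lambda>z. cis (of_int 5 * (pi/3)) * cnj z) ` K"
    have "below K (of_int 5 * (pi/3) - \<sigma>)" by (rule below_shift[OF 2, of _ 0]) simp
    moreover have "below K (of_int 5 * (pi/3) - (\<sigma> - 2*pi/3))" by (rule below_shift[OF E(2), of _ "-1"]) simp
    ultimately have K2: "placed ?K2" by (rule placed_reflection[OF ins])
    have "below ?K2 (-(2*pi/3))" unfolding below_reflection by (rule below_shift[OF E(1), of _ "-1"]) simp
    then have "fits ?K2" using fits_if_below_E[OF K2] by blast
    then show False using fits_reflection no by blast
  qed
qed

lemma constant_width_fits:
  assumes "constant_width K" shows "fits K"
proof -
  obtain \<alpha> d where ins: "inscribed ((\<lambda>z. cis \<alpha> * z + d) ` K)" (is "inscribed ?K1")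
    using constant_width_circumscribed_hexagon[OF assms] .
  obtain m :: int where m: "below ((\<lambda>z. cis (of_int m * (pi/3)) * z) ` ?K1) \<sigma>"
    "below ((\<lambda>z. cis (of_int m * (pi/3)) * z) ` ?K1) (\<sigma> - 2*pi/3)"
    using inscribed_rotate_to_avoid_C_E[OF ins] .
  then have "placed ((\<lambda>z. cis (of_int m * (pi/3)) * z) ` ?K1)"
    using inscribed_rotation[OF ins] by (simp add: placed_def)
  then have "fits ((\<lambda>z. cis (of_int m * (pi/3)) * z) ` ?K1)" by (rule placed_fits)
  then have "fits ?K1" using fits_rotation[of "of_int m * (pi/3)" 0 ?K1] by simp
  then show ?thesis by (rule fits_rotation)
qed

lemma covering: "is_covering (shape_H \<sigma>) unit_diameter_sets"
  unfolding is_covering_def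
proof
  fix S assume "S \<in> unit_diameter_sets"
  then have "dist x y \<le> 1" if "x \<in> S" "y \<in> S" for x y
    using that diameter_bounded_bound[of S x y] by (auto simp: unit_diameter_sets_def)
  then obtain K where K: "S \<subseteq> K" "constant_width K" by (rule constant_width_superset)
  obtain f where f: "\<forall>x y. dist (f x) (f y) = dist x y" "f ` K \<subseteq> shape_H \<sigma>"
    using constant_width_fits[OF K(2)] by (auto simp: fits_def)
  then show "\<exists>T\<subseteq>shape_H \<sigma>. congruent_sets S T"
    using K(1) unfolding congruent_sets_def by (intro exI[of _ "f ` S"]) blast
qed

end

theorem theorem1:
  fixes \<sigma> :: real
  assumes "0 \<le> \<sigma>" and "\<sigma> < 10 * (pi / 180)"
  shows "is_covering (shape_H \<sigma>) unit_diameter_sets"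
proof -
  interpret slant \<sigma> using assms by unfold_locales simp_all
  show ?thesis by (rule covering)
qed

end
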